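(* Let $K$ be an algebraic number field, $A$ a central simple algebra over $K$, $\sigma$ an orthogonal involution on $A$, and $\mathcal{O}$ a maximal $\sigma$-order of $A$. Then $SL^\sigma(2,\mathcal{O})$ is a maximal arithmetic subgroup of $SL^\sigma(2,A)$, in the sense that it is not contained in any strictly larger arithmetic subgroup of $SL^\sigma(2,A)$.
   Context: An involution on $A$ is an additive map $\sigma$ with $\sigma(\sigma(x))=x$, $\sigma(xy)=\sigma(y)\sigma(x)$; it is of the first kind if it fixes $K$ pointwise, and then orthogonal if the bilinear form $b$ on $\overline{K}^n$ (unique up to scalar) with $b(v,Mw)=b(\sigma(M)v,w)$ for $M\in A\otimes_K\overline{K}\cong\text{Mat}(n,\overline{K})$ is symmetric. An order of $A$ is a subring that is a finitely generated $\mathfrak{o}_K$-module ($\mathfrak{o}_K$ the ring of integers of $K$) spanning $A$ over $K$; a $\sigma$-order is an order $\mathcal{O}$ with $\sigma(\mathcal{O})=\mathcal{O}$, and it is a maximal $\sigma$-order if it is not contained in any strictly larger $\sigma$-order. Define $\hat{\sigma}\begin{pmatrix} a & b \\ c & d\end{pmatrix} = \begin{pmatrix} \sigma(d) & -\sigma(b) \\ -\sigma(c) & \sigma(a)\end{pmatrix}$ and $SL^\sigma(2,R)=\{M\in\text{Mat}(2,R): M\hat{\sigma}(M)=I\}$. *)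

theory Defs
  imports
    Jordan_Normal_Form.Matrix
    "HOL-Algebra.Algebraic_Closure_Type"
    "HOL-Algebra.QuotRing"
begin

section \<open>Number fields and central simple algebras\<close>

definition number_field :: "'k::field_char_0 itself \<Rightarrow> bool" where
  "number_field _ \<longleftrightarrow>
     (\<exists>B :: 'k set. finite B \<and> Modules.module.span (\<lambda>q x. of_rat q * x) B = UNIV)"

definition ring_of_integers :: "'k::field set" where
  "ring_of_integers = {x. algebraic_int x}"

text \<open>The HOL-Algebra notions of subring, ideal and ring homomorphism are applied to a type of
  class \<open>ring_1\<close> through the library's \<open>ring_of_type_algebra\<close>, which is shown there to be a ring
  only in the commutative case.\<close>

lemma ring_ring_of_type_algebra: "ring (ring_of_type_algebra :: 'a::ring_1 ring)"
proof -
  have "\<exists>y. y + x = 0" "\<exists>y. x + y = 0" for x :: 'a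
    using add.left_inverse add.right_inverse by blast+
  then show ?thesis
    unfolding ring_of_type_algebra_def
    by unfold_locales (auto simp: algebra_simps Units_def)
qed

locale central_simple_algebra = vector_space scale
  for scale :: "'k::field \<Rightarrow> 'a::ring_1 \<Rightarrow> 'a" +
  assumes scale_mult_left: "scale c (x * y) = scale c x * y"
    and scale_mult_right: "scale c (x * y) = x * scale c y"
    and finite_dimensional: "\<exists>B. finite B \<and> span B = UNIV"
    and simple: "ideal I (ring_of_type_algebra :: 'a ring) \<Longrightarrow> I = {0} \<or> I = UNIV"
    and central: "{z. \<forall>x. z * x = x * z} = range (\<lambda>c. scale c 1)"

section \<open>Orthogonal involutions\<close>

definition involution :: "('a::ring_1 \<Rightarrow> 'a) \<Rightarrow> bool" where
  "involution \<sigma> \<longleftrightarrow>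
     (\<forall>x y. \<sigma> (x + y) = \<sigma> x + \<sigma> y) \<and> (\<forall>x. \<sigma> (\<sigma> x) = x) \<and> (\<forall>x y. \<sigma> (x * y) = \<sigma> y * \<sigma> x)"

definition first_kind :: "('k::field \<Rightarrow> 'a::ring_1 \<Rightarrow> 'a) \<Rightarrow> ('a \<Rightarrow> 'a) \<Rightarrow> bool" where
  "first_kind scale \<sigma> \<longleftrightarrow> (\<forall>c. \<sigma> (scale c 1) = scale c 1)"

text \<open>An isomorphism \<open>A \<otimes> L \<cong> Mat(n, L)\<close> of \<open>L\<close>-algebras, \<open>L\<close> the algebraic closure of \<open>K\<close>, is given
  by its restriction \<open>\<phi>\<close> to \<open>A\<close>: a homomorphism of \<open>K\<close>-algebras whose \<open>L\<close>-linear extension is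
  bijective. For a \<open>K\<close>-basis \<open>B\<close> of \<open>A\<close>, the elements of \<open>A \<otimes> L\<close> are the sums of the \<open>e \<otimes> c e\<close> over
  \<open>e \<in> B\<close> with unique coefficients \<open>c\<close>, and the extension sends such a sum to the matrix below.\<close>

definition splitting ::
  "('k::field \<Rightarrow> 'a::ring_1 \<Rightarrow> 'a) \<Rightarrow> nat \<Rightarrow> ('a \<Rightarrow> 'k alg_closure mat) \<Rightarrow> bool" where
  "splitting scale n \<phi> \<longleftrightarrow>
     \<phi> \<in> ring_hom ring_of_type_algebra (ring_mat TYPE('k alg_closure) n ()) \<and>
     (\<forall>c x. \<phi> (scale c x) = to_ac c \<cdot>\<^sub>m \<phi> x) \<and>
     (\<exists>B. finite B \<and> \<not> Modules.module.dependent scale B \<and> Modules.module.span scale B = UNIV \<and>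
        (\<forall>M \<in> carrier_mat n n. \<exists>!c. c \<in> B \<rightarrow>\<^sub>E UNIV \<and>
           M = mat n n (\<lambda>(i, j). \<Sum>e\<in>B. c e * \<phi> e $$ (i, j))))"

definition bilinear_form :: "nat \<Rightarrow> ('l::field vec \<Rightarrow> 'l vec \<Rightarrow> 'l) \<Rightarrow> bool" where
  "bilinear_form n b \<longleftrightarrow>
     (\<forall>u \<in> carrier_vec n. \<forall>v \<in> carrier_vec n. \<forall>w \<in> carrier_vec n.
        b (u + v) w = b u w + b v w \<and> b u (v + w) = b u v + b u w) \<and>
     (\<forall>c. \<forall>v \<in> carrier_vec n. \<forall>w \<in> carrier_vec n.
        b (c \<cdot>\<^sub>v v) w = c * b v w \<and> b v (c \<cdot>\<^sub>v w) = c * b v w)"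

text \<open>\<open>\<tau>\<close> is the \<open>L\<close>-linear extension of \<open>\<sigma>\<close> to \<open>A \<otimes> L\<close>, transported to \<open>Mat(n, L)\<close>. The form \<open>b\<close> is
  unique up to a scalar only among nonzero forms.\<close>

definition orthogonal_involution ::
  "('k::field \<Rightarrow> 'a::ring_1 \<Rightarrow> 'a) \<Rightarrow> ('a \<Rightarrow> 'a) \<Rightarrow> bool" where
  "orthogonal_involution scale \<sigma> \<longleftrightarrow> involution \<sigma> \<and> first_kind scale \<sigma> \<and>
     (\<exists>n (\<phi> :: 'a \<Rightarrow> 'k alg_closure mat) \<tau> b.
        splitting scale n \<phi> \<and>
        \<tau> \<in> carrier_mat n n \<rightarrow> carrier_mat n n \<and>
        (\<forall>M \<in> carrier_mat n n. \<forall>N \<in> carrier_mat n n. \<tau> (M + N) = \<tau> M + \<tau> N) \<and>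
        (\<forall>c. \<forall>M \<in> carrier_mat n n. \<tau> (c \<cdot>\<^sub>m M) = c \<cdot>\<^sub>m \<tau> M) \<and>
        (\<forall>x. \<tau> (\<phi> x) = \<phi> (\<sigma> x)) \<and>
        bilinear_form n b \<and>
        (\<exists>v \<in> carrier_vec n. \<exists>w \<in> carrier_vec n. b v w \<noteq> 0) \<and>
        (\<forall>M \<in> carrier_mat n n. \<forall>v \<in> carrier_vec n. \<forall>w \<in> carrier_vec n.
           b v (M *\<^sub>v w) = b (\<tau> M *\<^sub>v v) w) \<and>
        (\<forall>v \<in> carrier_vec n. \<forall>w \<in> carrier_vec n. b v w = b w v))"

section \<open>Orders\<close>

definition algebra_order :: "('k::field \<Rightarrow> 'a::ring_1 \<Rightarrow> 'a) \<Rightarrow> 'a set \<Rightarrow> bool" where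
  "algebra_order scale R \<longleftrightarrow>
     subring R ring_of_type_algebra \<and>
     (\<exists>S. finite S \<and> R = {\<Sum>s\<in>S. scale (c s) s | c. c \<in> S \<rightarrow> ring_of_integers}) \<and>
     Modules.module.span scale R = UNIV"

definition involution_order ::
  "('k::field \<Rightarrow> 'a::ring_1 \<Rightarrow> 'a) \<Rightarrow> ('a \<Rightarrow> 'a) \<Rightarrow> 'a set \<Rightarrow> bool" where
  "involution_order scale \<sigma> R \<longleftrightarrow> algebra_order scale R \<and> \<sigma> ` R = R"

definition maximal_involution_order ::
  "('k::field \<Rightarrow> 'a::ring_1 \<Rightarrow> 'a) \<Rightarrow> ('a \<Rightarrow> 'a) \<Rightarrow> 'a set \<Rightarrow> bool" where
  "maximal_involution_order scale \<sigma> R \<longleftrightarrow>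
     involution_order scale \<sigma> R \<and> \<not> (\<exists>R'. involution_order scale \<sigma> R' \<and> R \<subset> R')"

section \<open>The groups\<close>

definition hat :: "('a::ring_1 \<Rightarrow> 'a) \<Rightarrow> 'a mat \<Rightarrow> 'a mat" where
  "hat \<sigma> M = mat_of_rows_list 2
     [[  \<sigma> (M $$ (1, 1)), - \<sigma> (M $$ (0, 1))],
      [- \<sigma> (M $$ (1, 0)),   \<sigma> (M $$ (0, 0))]]"

definition SL2 :: "('a::ring_1 \<Rightarrow> 'a) \<Rightarrow> 'a set \<Rightarrow> 'a mat set" where
  "SL2 \<sigma> R = {M \<in> carrier_mat 2 2. elements_mat M \<subseteq> R \<and> M * hat \<sigma> M = 1\<^sub>m 2}"

definition SL2_group :: "('a::ring_1 \<Rightarrow> 'a) \<Rightarrow> 'a mat monoid" where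
  "SL2_group \<sigma> = \<lparr>carrier = SL2 \<sigma> UNIV, mult = (*), one = 1\<^sub>m 2\<rparr>"

section \<open>Arithmetic subgroups\<close>

definition commensurable :: "('g, 'm) monoid_scheme \<Rightarrow> 'g set \<Rightarrow> 'g set \<Rightarrow> bool" where
  "commensurable G H H' \<longleftrightarrow>
     finite (rcosets\<^bsub>G\<lparr>carrier := H\<rparr>\<^esub> (H \<inter> H')) \<and>
     finite (rcosets\<^bsub>G\<lparr>carrier := H'\<rparr>\<^esub> (H \<inter> H'))"

definition GL_integers :: "nat \<Rightarrow> 'k::field mat set" where
  "GL_integers N = {M \<in> carrier_mat N N. elements_mat M \<subseteq> ring_of_integers \<and>
     (\<exists>M' \<in> carrier_mat N N. elements_mat M' \<subseteq> ring_of_integers \<and> M * M' = 1\<^sub>m N \<and> M' * M = 1\<^sub>m N)}"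

text \<open>An injective homomorphism \<open>Mat(2, A) \<rightarrow> Mat(N, K)\<close> of \<open>K\<close>-algebras, for instance a regular
  representation; it realises the group above as a linear algebraic group over \<open>K\<close> inside \<open>GL(N)\<close>.\<close>

definition matrix_embedding ::
  "('k::field \<Rightarrow> 'a::ring_1 \<Rightarrow> 'a) \<Rightarrow> nat \<Rightarrow> ('a mat \<Rightarrow> 'k mat) \<Rightarrow> bool" where
  "matrix_embedding scale N \<rho> \<longleftrightarrow>
     \<rho> \<in> ring_hom (ring_mat TYPE('a) 2 ()) (ring_mat TYPE('k) N ()) \<and>
     (\<forall>c. \<forall>M \<in> carrier_mat 2 2. \<rho> (map_mat (scale c) M) = c \<cdot>\<^sub>m \<rho> M) \<and>
     inj_on \<rho> (carrier_mat 2 2)"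

text \<open>A subgroup is arithmetic if it is commensurable with the group of integral points
  \<open>G \<inter> GL(N, ring_of_integers)\<close>; the commensurability class of the latter does not depend on the
  embedding.\<close>

definition arithmetic_subgroup ::
  "('k::field \<Rightarrow> 'a::ring_1 \<Rightarrow> 'a) \<Rightarrow> ('a \<Rightarrow> 'a) \<Rightarrow> 'a mat set \<Rightarrow> bool" where
  "arithmetic_subgroup scale \<sigma> \<Gamma> \<longleftrightarrow>
     subgroup \<Gamma> (SL2_group \<sigma>) \<and>
     (\<exists>N \<rho>. matrix_embedding scale N \<rho> \<and>
        commensurable (SL2_group \<sigma>) \<Gamma> {M \<in> SL2 \<sigma> UNIV. \<rho> M \<in> GL_integers N})"

definition maximal_arithmetic_subgroup ::
  "('k::field \<Rightarrow> 'a::ring_1 \<Rightarrow> 'a) \<Rightarrow> ('a \<Rightarrow> 'a) \<Rightarrow> 'a mat set \<Rightarrow> bool" where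
  "maximal_arithmetic_subgroup scale \<sigma> \<Gamma> \<longleftrightarrow>
     arithmetic_subgroup scale \<sigma> \<Gamma> \<and> \<not> (\<exists>\<Gamma>'. arithmetic_subgroup scale \<sigma> \<Gamma>' \<and> \<Gamma> \<subset> \<Gamma>')"

end

theory Submission
  imports Defs
    "Jordan_Normal_Form.Jordan_Normal_Form_Existence"
    "HOL-Library.Function_Algebras"
begin

text \<open>
  Let \<open>\<Gamma>\<close> be an arithmetic group containing \<open>SL\<^sup>\<sigma>(2, \<O>)\<close>. The upper left entries of \<open>\<Gamma>\<close> are, up to sign, all
  its entries, and they generate an additive group \<open>S\<close> that is closed under products: with the
  unipotent matrix \<open>U\<close> with rows \<open>(1, 1)\<close> and \<open>(0, 1)\<close>, the upper left entries of \<open>M U M'\<close> and \<open>M M'\<close>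
  differ by the product of that of \<open>M\<close> and the lower left entry of \<open>M'\<close>. Moreover \<open>S\<close> is \<open>\<sigma>\<close>-stable and has
  bounded denominators because \<open>\<Gamma>\<close> is arithmetic. If \<open>S\<close> contains \<open>\<O>\<close>, then \<open>S = \<O>\<close> by maximality and
  \<open>\<Gamma>\<close> is contained in \<open>SL\<^sup>\<sigma>(2, \<O>)\<close>.

  So it remains to see that the entries of \<open>SL\<^sup>\<sigma>(2, \<O>)\<close> generate \<open>\<O>\<close> as a ring. They contain the symmetric
  elements of \<open>\<O>\<close>. As \<open>\<sigma>\<close> is orthogonal, every \<open>x\<close> in \<open>A\<close> is a product of two symmetric elements, the first
  one invertible; hence the entries generate \<open>N \<O>\<close> for some \<open>N\<close>, and a unit of \<open>A\<close> is the upper left entry of a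
  product of elementary matrices, which can be approximated \<open>N\<close>-adically by elementary matrices
  over \<open>\<O>[1/N]\<close>. This gives all elements that are units modulo \<open>N\<close>. Finally \<open>\<O>\<close> is generated by
  \<open>N \<O>\<close>, its units modulo \<open>N\<close> and its symmetric elements: by maximality the prime ideals of \<open>\<O>\<close> over \<open>N\<close> are
  \<open>\<sigma>\<close>-stable, so symmetric elements separate the simple factors of \<open>\<O>/N\<O>\<close> modulo its radical, and a
  finite simple ring is generated by its units.
\<close>

section \<open>Orders and their prime ideals\<close>

text \<open>Stability of a prime \<open>P\<close> is therefore proved by comparison with a maximal
  order \<open>M\<close> above it. If \<open>\<sigma>\<close> moved \<open>P\<close>, the smallest
  ideal \<open>E\<close> that is, locally, outside \<open>P\<close> would have its image
  \<open>\<sigma> E\<close> inside \<open>P\<close>. From the lattice \<open>E M\<close> and its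
  dual one then builds an ideal \<open>W\<close> inside \<open>P\<close> with
  \<open>W E M = E M\<close>, against Nakayama's lemma. The factorization into symmetric elements is
  Frobenius' theorem in disguise. Over the algebraic closure \<open>\<sigma>\<close> is the adjoint
  for a symmetric form with Gram matrix \<open>G\<close>, and \<open>X\<close> is fixed if
  \<open>G X\<close> is symmetric. An invertible symmetric \<open>B\<close> with \<open>B X\<close>
  symmetric gives the fixed matrix \<open>G^-1 B\<close>. Specializing its coefficients to natural
  numbers brings it back into \<open>A\<close>. Elementary matrices have additive parameters;
  approximating their products reduces to approximating these one at a time, and multiplication by
  integers does so without losing symmetry.\<close>

definition is_addgroup :: "'a::ring_1 set \<Rightarrow> bool" where
  "is_addgroup S \<longleftrightarrow> 0 \<in> S \<and> (\<forall>x\<in>S. \<forall>y\<in>S. x - y \<in> S)"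

lemma addgroup_0: "is_addgroup S \<Longrightarrow> 0 \<in> S"
  by (simp add: is_addgroup_def)

lemma addgroup_diff: "is_addgroup S \<Longrightarrow> x \<in> S \<Longrightarrow> y \<in> S \<Longrightarrow> x - y \<in> S"
  by (simp add: is_addgroup_def)

lemma addgroup_minus: "is_addgroup S \<Longrightarrow> x \<in> S \<Longrightarrow> - x \<in> S"
  by (metis addgroup_0 addgroup_diff diff_0)

lemma addgroup_add: "is_addgroup S \<Longrightarrow> x \<in> S \<Longrightarrow> y \<in> S \<Longrightarrow> x + y \<in> S"
  by (metis addgroup_diff addgroup_minus diff_minus_eq_add)

lemma addgroup_sum: "is_addgroup S \<Longrightarrow> (\<And>i. i \<in> I \<Longrightarrow> f i \<in> S) \<Longrightarrow> sum f I \<in> S"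
  by (induction I rule: infinite_finite_induct) (auto simp: addgroup_0 addgroup_add)

lemma addgroup_of_nat: "is_addgroup S \<Longrightarrow> x \<in> S \<Longrightarrow> of_nat n * x \<in> S"
  by (induction n) (auto simp: addgroup_0 addgroup_add algebra_simps)

lemma addgroup_of_int: "is_addgroup S \<Longrightarrow> x \<in> S \<Longrightarrow> of_int n * x \<in> S"
  by (cases n rule: int_cases2) (auto simp: addgroup_of_nat addgroup_minus)

lemma addgroup_of_nat_image:
  assumes "is_addgroup S"
  shows "is_addgroup {of_nat n * y | y. y \<in> S}"
  unfolding is_addgroup_def
proof (intro conjI ballI)
  show "0 \<in> {of_nat n * y | y. y \<in> S}" using addgroup_0[OF assms] by force
next
  fix x y assume "x \<in> {of_nat n * y | y. y \<in> S}" "y \<in> {of_nat n * y | y. y \<in> S}"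
  then obtain u v where *: "x = of_nat n * u" "y = of_nat n * v" "u \<in> S" "v \<in> S" by blast
  then have "x - y = of_nat n * (u - v)" by (simp add: right_diff_distrib)
  with addgroup_diff[OF assms *(3,4)] show "x - y \<in> {of_nat n * y | y. y \<in> S}" by blast
qed

lemma addgroupI: "0 \<in> S \<Longrightarrow> (\<And>x y. x \<in> S \<Longrightarrow> y \<in> S \<Longrightarrow> x - y \<in> S) \<Longrightarrow> is_addgroup S"
  by (simp add: is_addgroup_def)

text \<open>Taken as an intersection, so that an inclusion of a generated group is proved by
  exhibiting the target, or its preimage under an additive map, as an additive group that contains
  the generators.\<close>

definition addhull :: "'a::ring_1 set \<Rightarrow> 'a set" where
  "addhull S = \<Inter>{Z. is_addgroup Z \<and> S \<subseteq> Z}"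

lemma addgroup_addhull: "is_addgroup (addhull S)"
  by (auto simp: addhull_def is_addgroup_def)

lemma addhull_superset: "S \<subseteq> addhull S"
  by (auto simp: addhull_def)

lemma addhull_least: "is_addgroup Z \<Longrightarrow> S \<subseteq> Z \<Longrightarrow> addhull S \<subseteq> Z"
  by (auto simp: addhull_def)

definition sprod :: "'a::ring_1 set \<Rightarrow> 'a set \<Rightarrow> 'a set" (infixl "\<star>" 70) where
  "S \<star> Y = addhull {x * y | x y. x \<in> S \<and> y \<in> Y}"

lemma addgroup_sprod: "is_addgroup (S \<star> Y)"
  by (simp add: sprod_def addgroup_addhull)

lemma sprodI: "x \<in> S \<Longrightarrow> y \<in> Y \<Longrightarrow> x * y \<in> S \<star> Y"
  unfolding sprod_def by (rule subsetD[OF addhull_superset]) auto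

lemma sprod_least:
  "is_addgroup Z \<Longrightarrow> (\<And>x y. x \<in> S \<Longrightarrow> y \<in> Y \<Longrightarrow> x * y \<in> Z) \<Longrightarrow> S \<star> Y \<subseteq> Z"
  unfolding sprod_def by (rule addhull_least) auto

lemma sprod_mono: "S \<subseteq> S' \<Longrightarrow> Y \<subseteq> Y' \<Longrightarrow> S \<star> Y \<subseteq> S' \<star> Y'"
  by (rule sprod_least[OF addgroup_sprod]) (auto intro: sprodI)

lemma addgroup_vimage_left: "is_addgroup Z \<Longrightarrow> is_addgroup {x. x * a \<in> Z}"
  by (auto simp: is_addgroup_def algebra_simps)

lemma addgroup_vimage_right: "is_addgroup Z \<Longrightarrow> is_addgroup {x. a * x \<in> Z}"
  by (auto simp: is_addgroup_def algebra_simps)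

text \<open>Multiplication by a fixed element is additive, so the elements that it sends into the
  target form a group; generators suffice in one factor at a time.\<close>

lemma sprod_assoc: "(S \<star> Y) \<star> Z = S \<star> (Y \<star> Z)"
proof
  show "(S \<star> Y) \<star> Z \<subseteq> S \<star> (Y \<star> Z)"
  proof (rule sprod_least[OF addgroup_sprod])
    fix w z assume w: "w \<in> S \<star> Y" and z: "z \<in> Z"
    have "S \<star> Y \<subseteq> {w. w * z \<in> S \<star> (Y \<star> Z)}"
      by (rule sprod_least[OF addgroup_vimage_left[OF addgroup_sprod]])
        (use z in \<open>auto intro!: sprodI simp: mult.assoc\<close>)
    with w show "w * z \<in> S \<star> (Y \<star> Z)" by auto
  qed
  show "S \<star> (Y \<star> Z) \<subseteq> (S \<star> Y) \<star> Z"
  proof (rule sprod_least[OF addgroup_sprod])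
    fix w x assume w: "w \<in> Y \<star> Z" and x: "x \<in> S"
    have "Y \<star> Z \<subseteq> {w. x * w \<in> (S \<star> Y) \<star> Z}"
      by (rule sprod_least[OF addgroup_vimage_right[OF addgroup_sprod]])
        (use x in \<open>auto intro!: sprodI simp: mult.assoc[symmetric]\<close>)
    with w show "x * w \<in> (S \<star> Y) \<star> Z" by auto
  qed
qed

section \<open>Subrings, ideals and prime ideals\<close>

definition is_subring :: "'a::ring_1 set \<Rightarrow> bool" where
  "is_subring R \<longleftrightarrow> is_addgroup R \<and> 1 \<in> R \<and> (\<forall>x\<in>R. \<forall>y\<in>R. x * y \<in> R)"

lemma subring_addgroup: "is_subring R \<Longrightarrow> is_addgroup R"
  and subring_1: "is_subring R \<Longrightarrow> 1 \<in> R"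
  and subring_mult: "is_subring R \<Longrightarrow> x \<in> R \<Longrightarrow> y \<in> R \<Longrightarrow> x * y \<in> R"
  by (auto simp: is_subring_def)

lemma subring_of_nat: "is_subring R \<Longrightarrow> of_nat n \<in> R"
  using addgroup_of_nat[of R 1 n] by (simp add: is_subring_def)

lemma subring_power: "is_subring R \<Longrightarrow> x \<in> R \<Longrightarrow> x ^ n \<in> R"
  by (induction n) (auto simp: subring_1 subring_mult)

definition is_ideal :: "'a::ring_1 set \<Rightarrow> 'a set \<Rightarrow> bool" where
  "is_ideal R I \<longleftrightarrow> is_addgroup I \<and> I \<subseteq> R \<and> (\<forall>r\<in>R. \<forall>x\<in>I. r * x \<in> I \<and> x * r \<in> I)"

lemma ideal_addgroup: "is_ideal R I \<Longrightarrow> is_addgroup I"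
  and ideal_subset: "is_ideal R I \<Longrightarrow> I \<subseteq> R"
  and ideal_left: "is_ideal R I \<Longrightarrow> r \<in> R \<Longrightarrow> x \<in> I \<Longrightarrow> r * x \<in> I"
  and ideal_right: "is_ideal R I \<Longrightarrow> r \<in> R \<Longrightarrow> x \<in> I \<Longrightarrow> x * r \<in> I"
  by (auto simp: is_ideal_def)

lemma ideal_one: "is_ideal R I \<Longrightarrow> is_subring R \<Longrightarrow> 1 \<in> I \<Longrightarrow> I = R"
  unfolding is_ideal_def by (metis mult.right_neutral subsetI subset_antisym)

lemma ideal_self: "is_subring R \<Longrightarrow> is_ideal R R"
  by (auto simp: is_ideal_def is_subring_def)

text \<open>The noncommutative notion: \<open>x R y \<subseteq> P\<close> in place of
  \<open>x * y \<in> P\<close>, which is what primality for products of ideals amounts to.\<close>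

definition is_prime_ideal :: "'a::ring_1 set \<Rightarrow> 'a set \<Rightarrow> bool" where
  "is_prime_ideal R P \<longleftrightarrow> is_ideal R P \<and> P \<noteq> R \<and>
     (\<forall>x\<in>R. \<forall>y\<in>R. (\<forall>r\<in>R. x * r * y \<in> P) \<longrightarrow> x \<in> P \<or> y \<in> P)"

lemma prime_ideal: "is_prime_ideal R P \<Longrightarrow> is_ideal R P"
  by (simp add: is_prime_ideal_def)

lemma prime_ideal_sprod:
  assumes "is_prime_ideal R P" "is_ideal R I" "is_ideal R J" "I \<star> J \<subseteq> P"
  shows "I \<subseteq> P \<or> J \<subseteq> P"
proof (rule ccontr)
  assume "\<not> ?thesis"
  then obtain x y where xy: "x \<in> I" "x \<notin> P" "y \<in> J" "y \<notin> P" by auto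
  then have "x * r * y \<in> P" if "r \<in> R" for r
    using assms(2,4) that sprodI[of "x * r" I y J] by (auto simp: ideal_right)
  with assms xy show False
    unfolding is_prime_ideal_def using ideal_subset by blast
qed

text \<open>A central \<open>s\<close> slides past \<open>r\<close>:
  \<open>s * r * x = r * (s * x)\<close>. Against central factors a prime ideal thus behaves as in a
  commutative ring.\<close>

lemma prime_ideal_central:
  assumes "is_prime_ideal R P" "s \<in> R" "x \<in> R" "\<And>r. s * r = r * s" "s * x \<in> P"
  shows "s \<in> P \<or> x \<in> P"
proof -
  have "s * r * x \<in> P" if "r \<in> R" for r
    using ideal_left[OF prime_ideal[OF assms(1)] that assms(5)] assms(4)
    by (simp add: mult.assoc)
  with assms show ?thesis unfolding is_prime_ideal_def by blast
qed

lemma ideal_sprod: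
  assumes "is_subring R" "is_ideal R I" "is_ideal R J"
  shows "is_ideal R (I \<star> J)"
proof -
  have "I \<star> J \<subseteq> R"
    by (rule sprod_least[OF subring_addgroup[OF assms(1)]])
      (use assms in \<open>meson ideal_subset subring_mult subsetD\<close>)
  moreover have "R \<star> (I \<star> J) \<subseteq> I \<star> J"
    unfolding sprod_assoc[symmetric]
    by (rule sprod_mono[OF sprod_least])
      (use assms in \<open>auto simp: ideal_addgroup ideal_left\<close>)
  moreover have "(I \<star> J) \<star> R \<subseteq> I \<star> J"
    unfolding sprod_assoc
    by (rule sprod_mono[OF _ sprod_least])
      (use assms in \<open>auto simp: ideal_addgroup ideal_right\<close>)
  ultimately show ?thesis
    unfolding is_ideal_def by (auto simp: addgroup_sprod intro: sprodI)
qed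

lemma idealI:
  "is_addgroup I \<Longrightarrow> I \<subseteq> R \<Longrightarrow> (\<And>r x. r \<in> R \<Longrightarrow> x \<in> I \<Longrightarrow> r * x \<in> I) \<Longrightarrow>
    (\<And>r x. r \<in> R \<Longrightarrow> x \<in> I \<Longrightarrow> x * r \<in> I) \<Longrightarrow> is_ideal R I"
  by (simp add: is_ideal_def)

text \<open>The free middle factor \<open>r\<close> is what makes this annihilator two-sided,
  although \<open>Y\<close> is a mere subset.\<close>

lemma ideal_left_annihilator:
  assumes R: "is_subring R" and I: "is_ideal R I" and "Y \<subseteq> R"
  shows "is_ideal R {z \<in> R. \<forall>y\<in>Y. \<forall>r\<in>R. z * r * y \<in> I}"
proof (rule idealI)
  show "is_addgroup {z \<in> R. \<forall>y\<in>Y. \<forall>r\<in>R. z * r * y \<in> I}"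
    using subring_addgroup[OF R] ideal_addgroup[OF I]
    by (auto simp: is_addgroup_def left_diff_distrib)
next
  fix r z assume "r \<in> R" and "z \<in> {z \<in> R. \<forall>y\<in>Y. \<forall>r\<in>R. z * r * y \<in> I}"
  then have *: "r \<in> R" "z \<in> R" "\<And>y t. y \<in> Y \<Longrightarrow> t \<in> R \<Longrightarrow> z * t * y \<in> I" by auto
  show "r * z \<in> {z \<in> R. \<forall>y\<in>Y. \<forall>r\<in>R. z * r * y \<in> I}"
    using subring_mult[OF R *(1,2)] ideal_left[OF I *(1) *(3)] by (auto simp: mult.assoc)
  show "z * r \<in> {z \<in> R. \<forall>y\<in>Y. \<forall>r\<in>R. z * r * y \<in> I}"
    using subring_mult[OF R *(2,1)] *(3)[OF _ subring_mult[OF R *(1)]] by (auto simp: mult.assoc)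
qed auto

lemma ideal_right_annihilator:
  assumes R: "is_subring R" and I: "is_ideal R I" and "Y \<subseteq> R"
  shows "is_ideal R {z \<in> R. \<forall>y\<in>Y. \<forall>r\<in>R. y * r * z \<in> I}"
proof (rule idealI)
  show "is_addgroup {z \<in> R. \<forall>y\<in>Y. \<forall>r\<in>R. y * r * z \<in> I}"
    using subring_addgroup[OF R] ideal_addgroup[OF I]
    by (auto simp: is_addgroup_def right_diff_distrib)
next
  fix r z assume "r \<in> R" and "z \<in> {z \<in> R. \<forall>y\<in>Y. \<forall>r\<in>R. y * r * z \<in> I}"
  then have *: "r \<in> R" "z \<in> R" "\<And>y t. y \<in> Y \<Longrightarrow> t \<in> R \<Longrightarrow> y * t * z \<in> I" by auto
  show "z * r \<in> {z \<in> R. \<forall>y\<in>Y. \<forall>r\<in>R. y * r * z \<in> I}"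
    using subring_mult[OF R *(2,1)] ideal_right[OF I *(1) *(3)] by (auto simp: mult.assoc)
  show "r * z \<in> {z \<in> R. \<forall>y\<in>Y. \<forall>r\<in>R. y * r * z \<in> I}"
    using subring_mult[OF R *(1,2)] *(3)[OF _ subring_mult[OF R _ *(1)]] by (auto simp: mult.assoc)
qed auto

definition ideal_prod :: "'a::ring_1 set \<Rightarrow> 'a set list \<Rightarrow> 'a set" where
  "ideal_prod R Ps = foldr (\<star>) Ps R"

lemma ideal_prod_Nil [simp]: "ideal_prod R [] = R"
  and ideal_prod_Cons [simp]: "ideal_prod R (P # Ps) = P \<star> ideal_prod R Ps"
  by (simp_all add: ideal_prod_def)

lemma ideal_prod_ideal:
  assumes "is_subring R" "\<And>P. P \<in> set Ps \<Longrightarrow> is_ideal R P"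
  shows "is_ideal R (ideal_prod R Ps)"
  using assms(2) by (induction Ps) (auto simp: ideal_self ideal_sprod assms(1))

lemma ideal_prod_append:
  assumes "is_subring R"
  shows "ideal_prod R (Ps @ Qs) \<subseteq> ideal_prod R Ps \<star> ideal_prod R Qs"
proof (induction Ps)
  case Nil
  show ?case using assms sprodI[of 1 R _ "ideal_prod R Qs"] by (auto simp: is_subring_def)
next
  case (Cons P Ps)
  then show ?case by (auto simp: sprod_assoc dest: subsetD[OF sprod_mono[OF order_refl]])
qed

lemma ideal_prod_prime:
  assumes "is_subring R" "\<And>P. P \<in> set Ps \<Longrightarrow> is_ideal R P"
    and "is_prime_ideal R Q" "ideal_prod R Ps \<subseteq> Q"
  shows "\<exists>P\<in>set Ps. P \<subseteq> Q"
  using assms(2,4)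
proof (induction Ps)
  case Nil
  then show ?case using assms(3) by (auto simp: is_prime_ideal_def is_ideal_def)
next
  case (Cons P Ps)
  then have "P \<subseteq> Q \<or> ideal_prod R Ps \<subseteq> Q"
    using prime_ideal_sprod[OF assms(3), of P "ideal_prod R Ps"] ideal_prod_ideal[OF assms(1), of Ps]
    by auto
  with Cons show ?case by auto
qed

section \<open>Bounded denominators, and orders as lattices over the integers\<close>

definition is_bounded :: "'a::ring_1 set \<Rightarrow> 'a set \<Rightarrow> bool" where
  "is_bounded R S \<longleftrightarrow> (\<exists>n>0. \<forall>x\<in>S. of_nat n * x \<in> R)"

lemma finite_maximal_set:
  "finite \<A> \<Longrightarrow> J \<in> \<A> \<Longrightarrow> \<exists>P\<in>\<A>. \<forall>J\<in>\<A>. P \<subseteq> J \<longrightarrow> J = P" for \<A> :: "'a set set"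
  using finite_has_maximal[of \<A>] by blast

text \<open>The properties of an order on which the ideal theory rests. They speak of ordinary
  integers, so the locale covers orders of the algebra and the ring of integers of the number field
  alike. Boundedness, a common denominator, takes the place of finite generation for
  overrings.\<close>

locale rational_order =
  fixes R :: "'a::ring_1 set"
  assumes subring: "is_subring R"
    and unit_of_nat: "n > 0 \<Longrightarrow> \<exists>y::'a. of_nat n * y = 1"
    and finite_quotient:
      "n > 0 \<Longrightarrow> \<exists>F. finite F \<and> F \<subseteq> R \<and> (\<forall>x\<in>R. \<exists>f\<in>F. \<exists>y\<in>R. x = f + of_nat n * y)"
    and full: "\<exists>n>0. of_nat n * x \<in> R"
begin

lemmas addgroup = subring_addgroup[OF subring]

lemma of_nat_cancel: "n > 0 \<Longrightarrow> of_nat n * x = of_nat n * y \<Longrightarrow> x = (y::'a)"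
proof -
  assume "n > 0" and eq: "of_nat n * x = of_nat n * y"
  then obtain z :: 'a where z: "of_nat n * z = 1" using unit_of_nat by blast
  have "z * (of_nat n * w) = w" for w
    using z by (metis mult.assoc mult_1 mult_of_nat_commute)
  then have "x = z * (of_nat n * x)" "y = z * (of_nat n * y)" by simp_all
  with eq show ?thesis by simp
qed

lemma of_nat_assoc: "of_nat m * (of_nat n * x) = of_nat (m * n) * (x :: 'a)"
  by (simp add: mult.assoc)

lemma of_nat_R: "x \<in> R \<Longrightarrow> of_nat n * x \<in> R"
  by (rule addgroup_of_nat[OF addgroup])

lemma common_denominator_exists: "finite F \<Longrightarrow> \<exists>n>0. \<forall>x\<in>F. of_nat n * x \<in> R"
proof (induction F rule: finite_induct)
  case (insert x F)
  then obtain n where n: "n > 0" "\<forall>x\<in>F. of_nat n * x \<in> R" by blast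
  obtain m where m: "m > 0" "of_nat m * x \<in> R" using full by blast
  have "of_nat (m * n) * y \<in> R" if y: "y \<in> insert x F" for y
  proof (cases "y = x")
    case True
    have "of_nat (m * n) * x = of_nat n * (of_nat m * x)" by (simp only: of_nat_assoc mult.commute)
    then show ?thesis using of_nat_R[OF m(2)] True by simp
  next
    case False
    then show ?thesis using n y of_nat_R[of "of_nat n * y" m] by (simp only: of_nat_assoc) auto
  qed
  then show ?case using m n by (intro exI[of _ "m * n"]) simp
qed (auto intro: exI[of _ 1])

text \<open>Such a group is a union of cosets of \<open>n R\<close>, hence determined by the
  representatives in the finite set \<open>F\<close> that it contains.\<close>

lemma finite_between:
  assumes "n > 0"
  shows "finite {J. is_addgroup J \<and> (\<forall>x\<in>R. of_nat n * x \<in> J) \<and> J \<subseteq> R}"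
proof -
  define \<A> where "\<A> = {J. is_addgroup J \<and> (\<forall>x\<in>R. of_nat n * x \<in> J) \<and> J \<subseteq> R}"
  obtain F where F: "finite F" "F \<subseteq> R" "\<And>x. x \<in> R \<Longrightarrow> \<exists>f\<in>F. \<exists>y\<in>R. x = f + of_nat n * y"
    using finite_quotient[OF assms] by blast
  have sub: "J \<subseteq> J'" if J: "J \<in> \<A>" "J' \<in> \<A>" "J \<inter> F = J' \<inter> F" for J J'
  proof
    fix x assume x: "x \<in> J"
    have J1: "is_addgroup J" "\<And>x. x \<in> R \<Longrightarrow> of_nat n * x \<in> J" "J \<subseteq> R"
      and J2: "is_addgroup J'" "\<And>x. x \<in> R \<Longrightarrow> of_nat n * x \<in> J'"
      using J(1,2) by (simp_all add: \<A>_def)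
    obtain f y where f: "f \<in> F" "y \<in> R" "x = f + of_nat n * y" using F(3) x J1(3) by blast
    have "x - of_nat n * y \<in> J" by (rule addgroup_diff[OF J1(1) x J1(2)[OF f(2)]])
    then have "f \<in> J" by (simp add: f(3))
    then have "f \<in> J'" using J(3) f(1) by blast
    then show "x \<in> J'" unfolding f(3) by (rule addgroup_add[OF J2(1) _ J2(2)[OF f(2)]])
  qed
  have "inj_on (\<lambda>J. J \<inter> F) \<A>"
  proof (rule inj_onI)
    fix J J' assume *: "J \<in> \<A>" "J' \<in> \<A>" "J \<inter> F = J' \<inter> F"
    show "J = J'" by (rule subset_antisym[OF sub[OF *] sub[OF *(2,1) *(3)[symmetric]]])
  qed
  moreover have "(\<lambda>J. J \<inter> F) ` \<A> \<subseteq> Pow F" by blast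
  moreover have "finite (Pow F)" using F(1) by simp
  ultimately have "finite \<A>" by (rule inj_on_finite)
  then show ?thesis by (simp only: \<A>_def)
qed

lemma finite_ideals:
  assumes "n > 0"
  shows "finite {I. is_ideal R I \<and> of_nat n \<in> I}"
  by (rule finite_subset[OF _ finite_between[OF assms]])
    (auto simp: is_ideal_def)

text \<open>Modulo \<open>P\<close> the left annihilator of \<open>y\<close> is an ideal containing
  \<open>x\<close>. By maximality it is \<open>P\<close>, which gives \<open>x \<in> P\<close>, or
  \<open>R\<close>, which gives \<open>y \<in> P\<close>.\<close>

lemma maximal_ideal_prime:
  assumes P: "is_ideal R P" "P \<noteq> R" and max: "\<And>I. is_ideal R I \<Longrightarrow> P \<subseteq> I \<Longrightarrow> I = P \<or> I = R"
  shows "is_prime_ideal R P"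
  unfolding is_prime_ideal_def
proof (intro conjI ballI impI P)
  fix x y assume xy: "x \<in> R" "y \<in> R" "\<forall>r\<in>R. x * r * y \<in> P"
  let ?W = "{z \<in> R. \<forall>y\<in>{y}. \<forall>r\<in>R. z * r * y \<in> P}"
  have W: "is_ideal R ?W"
    by (rule ideal_left_annihilator[OF subring P(1)]) (use xy(2) in simp)
  have "P \<subseteq> ?W" using ideal_right[OF P(1)] ideal_subset[OF P(1)] xy by auto
  then consider "?W = P" | "?W = R" using max[OF W] by blast
  then show "x \<in> P \<or> y \<in> P"
  proof cases
    case 1
    then show ?thesis using xy by blast
  next
    case 2
    then have "1 \<in> ?W" using subring_1[OF subring] by simp
    then show ?thesis by (auto dest: bspec[of _ _ 1])
  qed
qed

lemma prime_ideal_exists: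
  assumes I: "is_ideal R I" "I \<noteq> R" "of_nat n \<in> I" "n > 0"
  shows "\<exists>P. is_prime_ideal R P \<and> I \<subseteq> P"
proof -
  let ?S = "{J. is_ideal R J \<and> J \<noteq> R \<and> I \<subseteq> J}"
  have "finite ?S"
    by (rule finite_subset[OF _ finite_ideals[OF I(4)]]) (use I in auto)
  moreover have "I \<in> ?S" using I by auto
  ultimately obtain P where P: "P \<in> ?S" "\<And>J. J \<in> ?S \<Longrightarrow> P \<subseteq> J \<Longrightarrow> J = P"
    using finite_maximal_set by meson
  have "is_prime_ideal R P"
  proof (rule maximal_ideal_prime)
    fix J assume "is_ideal R J" "P \<subseteq> J"
    then show "J = P \<or> J = R" using P(2)[of J] P(1) by auto
  qed (use P(1) in auto)
  with P(1) show ?thesis by auto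
qed

text \<open>Noetherian induction, provided by the finiteness of the set of ideals over
  \<open>n\<close>: a maximal counterexample is not prime, and it contains a product of two strictly
  larger ideals.\<close>

lemma ideal_contains_prime_product:
  assumes n: "n > 0" and I: "is_ideal R I" "of_nat n \<in> I"
  shows "\<exists>Ps. (\<forall>P\<in>set Ps. is_prime_ideal R P \<and> of_nat n \<in> P) \<and> ideal_prod R Ps \<subseteq> I"
proof (rule ccontr)
  define good where "good I \<longleftrightarrow>
    (\<exists>Ps. (\<forall>P\<in>set Ps. is_prime_ideal R P \<and> of_nat n \<in> P) \<and> ideal_prod R Ps \<subseteq> I)" for I
  let ?S = "{I. is_ideal R I \<and> of_nat n \<in> I \<and> \<not> good I}"
  assume "\<nexists>Ps. (\<forall>P\<in>set Ps. is_prime_ideal R P \<and> of_nat n \<in> P) \<and> ideal_prod R Ps \<subseteq> I"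
  with I have "I \<in> ?S" by (simp add: good_def)
  moreover have "finite ?S"
    by (rule finite_subset[OF _ finite_ideals[OF n]]) auto
  ultimately obtain I where I: "I \<in> ?S" and max: "\<And>J. J \<in> ?S \<Longrightarrow> I \<subseteq> J \<Longrightarrow> J = I"
    using finite_maximal_set by meson
  have id: "is_ideal R I" and nI: "of_nat n \<in> I" and bad: "\<not> good I" using I by blast+
  have "I \<noteq> R" using bad by (auto simp: good_def dest: spec[of _ "[]"])
  moreover have "\<not> is_prime_ideal R I"
  proof
    assume pr: "is_prime_ideal R I"
    have "ideal_prod R [I] \<subseteq> I"
      by (simp, rule sprod_least) (use id in \<open>auto simp: ideal_addgroup ideal_right\<close>)
    with pr nI have "good I" by (auto simp: good_def intro!: exI[of _ "[I]"])
    with bad show False by blast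
  qed
  ultimately obtain x y where xy: "x \<in> R" "y \<in> R" "\<forall>r\<in>R. x * r * y \<in> I" "x \<notin> I" "y \<notin> I"
    using id unfolding is_prime_ideal_def by blast
  \<comment> \<open>For the two elements that violate primality, \<open>W\<close> is the left
    annihilator of \<open>y\<close> modulo \<open>I\<close> and \<open>V\<close> the right
    annihilator of \<open>W\<close>. They contain \<open>x\<close> and \<open>y\<close>, so both are
    strictly larger than \<open>I\<close>, and \<open>W \<star> V \<subseteq> I\<close>.\<close>
  define W where "W = {z \<in> R. \<forall>y\<in>{y}. \<forall>r\<in>R. z * r * y \<in> I}"
  define V where "V = {z \<in> R. \<forall>w\<in>W. \<forall>r\<in>R. w * r * z \<in> I}"
  have W: "is_ideal R W"
    unfolding W_def by (rule ideal_left_annihilator[OF subring id]) (use xy(2) in simp)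
  have V: "is_ideal R V"
    unfolding V_def using ideal_right_annihilator[OF subring id ideal_subset[OF W]] .
  have sub: "x \<in> W" "y \<in> V" using xy unfolding W_def V_def by auto
  have "z * r * t \<in> I" "t * r * z \<in> I" if "z \<in> I" "r \<in> R" "t \<in> R" for z r t
    using ideal_right[OF id that(3) ideal_right[OF id that(2,1)]]
      ideal_left[OF id subring_mult[OF subring that(3,2)] that(1)] .
  then have sub': "I \<subseteq> W" "I \<subseteq> V"
    using xy(2) ideal_subset[OF id] ideal_subset[OF W] unfolding W_def V_def by auto
  have "W \<noteq> I" "V \<noteq> I" using sub xy by auto
  then have "W \<notin> ?S" "V \<notin> ?S" using max sub' by blast+
  then have "good W" "good V" using W V sub' nI by auto
  then obtain Ps Qs where PQ: "\<forall>P\<in>set Ps. is_prime_ideal R P \<and> of_nat n \<in> P" "ideal_prod R Ps \<subseteq> W"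
    "\<forall>P\<in>set Qs. is_prime_ideal R P \<and> of_nat n \<in> P" "ideal_prod R Qs \<subseteq> V"
    unfolding good_def by blast
  have "W \<star> V \<subseteq> I"
  proof (rule sprod_least[OF ideal_addgroup[OF id]])
    fix w v assume "w \<in> W" "v \<in> V"
    then have "w * 1 * v \<in> I" unfolding V_def using subring_1[OF subring] by blast
    then show "w * v \<in> I" by simp
  qed
  then have "ideal_prod R (Ps @ Qs) \<subseteq> I"
    using ideal_prod_append[OF subring, of Ps Qs] sprod_mono[OF PQ(2,4)] by blast
  moreover have "\<forall>P\<in>set (Ps @ Qs). is_prime_ideal R P \<and> of_nat n \<in> P" using PQ by auto
  ultimately have "good I" unfolding good_def by blast
  with bad show False by simp
qed

end

section \<open>Idempotents in finite prime rings\<close>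

context rational_order
begin

lemma finite_left_ideals:
  assumes "n > 0" "\<And>x. x \<in> R \<Longrightarrow> of_nat n * x \<in> P"
  shows "finite {L. is_addgroup L \<and> L \<subseteq> R \<and> P \<subseteq> L \<and> \<Phi> L}"
  by (rule finite_subset[OF _ finite_between[OF assms(1)]]) (use assms(2) in auto)

lemma finite_minimal_set:
  "finite \<A> \<Longrightarrow> J \<in> \<A> \<Longrightarrow> \<exists>P\<in>\<A>. \<forall>J\<in>\<A>. J \<subseteq> P \<longrightarrow> J = P" for \<A> :: "'b set set"
  using finite_has_minimal[of \<A>] by blast

text \<open>Brauer's lemma, modulo \<open>P\<close>.\<close>

lemma left_ideal_idempotent:
  assumes n: "n > 0" "of_nat n \<in> P" and P: "is_prime_ideal R P"
    and L: "is_addgroup L" "L \<subseteq> R" "\<And>r x. r \<in> R \<Longrightarrow> x \<in> L \<Longrightarrow> r * x \<in> L" "P \<subseteq> L" "L \<noteq> P"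
  shows "\<exists>e\<in>L. e \<notin> P \<and> e * e - e \<in> P"
proof -
  note Pid = prime_ideal[OF P]
  note Padd = ideal_addgroup[OF Pid]
  define lid where "lid J \<longleftrightarrow> (\<forall>r\<in>R. \<forall>x\<in>J. r * x \<in> J) \<and> J \<noteq> P \<and> J \<subseteq> L" for J
  let ?S = "{J. is_addgroup J \<and> J \<subseteq> R \<and> P \<subseteq> J \<and> lid J}"
  have "finite ?S"
    by (rule finite_left_ideals[OF n(1)]) (use Pid n(2) in \<open>auto simp: is_ideal_def\<close>)
  moreover have "L \<in> ?S" using L by (simp add: lid_def)
  ultimately obtain J where "J \<in> ?S" and min: "\<And>J'. J' \<in> ?S \<Longrightarrow> J' \<subseteq> J \<Longrightarrow> J' = J"
    using finite_minimal_set by meson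
  then have J: "is_addgroup J" "J \<subseteq> R" "P \<subseteq> J" "J \<noteq> P" "J \<subseteq> L"
    and Jl: "\<And>r x. r \<in> R \<Longrightarrow> x \<in> J \<Longrightarrow> r * x \<in> J"
    by (auto simp: lid_def)
  obtain b where b: "b \<in> J" "b \<notin> P" using J by blast
  then obtain r where r: "r \<in> R" "b * r * b \<notin> P"
    using P J(2) unfolding is_prime_ideal_def by blast
  define a where "a = r * b"
  have a: "a \<in> J" "b * a \<notin> P" using r Jl b by (auto simp: a_def mult.assoc)
  have aP: "a \<notin> P" using ideal_left[OF Pid, of b a] b(1) J(2) a(2) by blast
  \<comment> \<open>\<open>?T\<close> is \<open>J a + P\<close>. It lies in the minimal
    \<open>J\<close> and is not \<open>P\<close>, since it contains \<open>b * a\<close>, so it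
    equals \<open>J\<close>; hence \<open>a\<close> has the form \<open>e * a + p\<close>.\<close>
  let ?T = "{y * a + p | y p. y \<in> J \<and> p \<in> P}"
  have Tsub: "?T \<subseteq> J"
    using Jl[OF _ a(1)] J(2,3) by (auto intro!: addgroup_add[OF J(1)])
  have PT: "P \<subseteq> ?T"
  proof
    fix p assume "p \<in> P"
    then have "p = 0 * a + p" "0 \<in> J" by (simp_all add: addgroup_0 J(1))
    with \<open>p \<in> P\<close> show "p \<in> ?T" by blast
  qed
  have baT: "b * a \<in> ?T"
  proof -
    have "b * a = b * a + 0" "0 \<in> P" by (simp_all add: addgroup_0[OF Padd])
    with b show ?thesis by blast
  qed
  have "is_addgroup ?T"
  proof (rule addgroupI)
    show "0 \<in> ?T" using PT addgroup_0[OF Padd] by blast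
  next
    fix x y assume "x \<in> ?T" "y \<in> ?T"
    then obtain u p v q where *: "x = u * a + p" "y = v * a + q" "u \<in> J" "v \<in> J" "p \<in> P" "q \<in> P"
      by blast
    then have "x - y = (u - v) * a + (p - q)" by (simp add: algebra_simps)
    with * addgroup_diff[OF J(1)] addgroup_diff[OF Padd] show "x - y \<in> ?T" by blast
  qed
  moreover have "r * x \<in> ?T" if "r \<in> R" "x \<in> ?T" for r x
  proof -
    from that(2) obtain u p where *: "x = u * a + p" "u \<in> J" "p \<in> P" by blast
    then have "r * x = (r * u) * a + r * p" by (simp add: algebra_simps)
    with * Jl[OF that(1)] ideal_left[OF Pid that(1)] show ?thesis by blast
  qed
  moreover have "?T \<noteq> P" using baT a(2) by auto
  moreover have "?T \<subseteq> R" "?T \<subseteq> L" using Tsub J by auto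
  ultimately have "?T \<in> ?S" using PT by (simp only: lid_def mem_Collect_eq) blast
  then have TJ: "?T = J" using min[OF _ Tsub] by simp
  have "a \<in> ?T" unfolding TJ by (rule a)
  then obtain e p where e: "e \<in> J" "p \<in> P" "a = e * a + p" by blast
  \<comment> \<open>The annihilator of \<open>a\<close> in \<open>J\<close> modulo \<open>P\<close>
    does not contain \<open>e\<close>, so minimality makes it \<open>P\<close>; it does contain
    \<open>e * e - e\<close>.\<close>
  let ?Z = "{x \<in> J. x * a \<in> P}"
  have eaP: "e * a - a \<in> P"
  proof -
    have "e * a - a = - p" using e(3) by (simp add: algebra_simps)
    then show ?thesis using addgroup_minus[OF Padd e(2)] by simp
  qed
  have eZ: "e * a \<notin> P"
    using aP eaP addgroup_diff[OF Padd, of "e * a" "e * a - a"] by auto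
  have "is_addgroup ?Z"
    using J(1) Padd by (auto simp: is_addgroup_def left_diff_distrib)
  moreover have "P \<subseteq> ?Z" using ideal_right[OF Pid] a(1) J by blast
  moreover have "r * x \<in> ?Z" if "r \<in> R" "x \<in> ?Z" for r x
    using that Jl ideal_left[OF Pid] by (auto simp: mult.assoc)
  moreover have "?Z \<noteq> J" using e(1) eZ by blast
  ultimately have "?Z = P"
    using min[of ?Z] J(2,5) unfolding lid_def by blast
  moreover have "(e * e - e) * a \<in> P"
    using ideal_left[OF Pid _ eaP, of e] e(1) J(2) by (auto simp: algebra_simps)
  moreover have "e * e - e \<in> J" using Jl[of e e] e(1) J addgroup_diff[OF J(1)] by blast
  ultimately have "e * e - e \<in> P" by blast
  moreover have "e \<notin> P" using eZ ideal_right[OF Pid, of a e] a(1) J(2) by blast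
  ultimately show ?thesis using e(1) J(5) by blast
qed

text \<open>A finite prime ring is simple.\<close>

lemma prime_ideal_maximal:
  assumes n: "n > 0" "of_nat n \<in> P" and P: "is_prime_ideal R P"
    and I: "is_ideal R I" "P \<subseteq> I" "I \<noteq> P"
  shows "I = R"
proof -
  note Pid = prime_ideal[OF P]
  note Padd = ideal_addgroup[OF Pid]
  note Iadd = ideal_addgroup[OF I(1)]
  note IR = ideal_subset[OF I(1)]
  note Pl = ideal_left[OF Pid] and Pr = ideal_right[OF Pid]
  \<comment> \<open>Among the idempotents modulo \<open>P\<close> in \<open>I\<close>, one with
    minimal left annihilator \<open>Z e\<close> is taken. Once \<open>Z e\<close> is known to be
    \<open>P\<close>, this \<open>e\<close> is a right identity of \<open>I\<close> modulo
    \<open>P\<close>.\<close>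
  define Z where "Z e = {x \<in> I. x * e \<in> P}" for e
  define E where "E = {e \<in> I. e * e - e \<in> P}"
  have Z: "is_addgroup (Z e)" "Z e \<subseteq> R" "\<And>r x. r \<in> R \<Longrightarrow> x \<in> Z e \<Longrightarrow> r * x \<in> Z e" "P \<subseteq> Z e"
    if "e \<in> I" for e
  proof -
    show "is_addgroup (Z e)"
      unfolding Z_def using Iadd Padd by (auto simp: is_addgroup_def left_diff_distrib)
    show "Z e \<subseteq> R" using IR by (auto simp: Z_def)
    show "\<And>r x. r \<in> R \<Longrightarrow> x \<in> Z e \<Longrightarrow> r * x \<in> Z e"
      using Pl ideal_left[OF I(1)] by (auto simp: Z_def mult.assoc)
    show "P \<subseteq> Z e" using Pr that I(2) IR by (auto simp: Z_def)
  qed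
  have "finite {L. is_addgroup L \<and> L \<subseteq> R \<and> P \<subseteq> L \<and> True}"
    by (rule finite_left_ideals[OF n(1)]) (use Pid n(2) in \<open>auto simp: is_ideal_def\<close>)
  then have "finite (Z ` E)"
    by (rule finite_subset[rotated], intro image_subsetI CollectI conjI TrueI Z) (auto simp: E_def)
  moreover have "Z 0 \<in> Z ` E" using addgroup_0[OF Iadd] addgroup_0[OF Padd] by (auto simp: E_def)
  ultimately obtain M where "M \<in> Z ` E" "\<forall>J\<in>Z ` E. J \<subseteq> M \<longrightarrow> J = M"
    using finite_minimal_set by meson
  then obtain e where "e \<in> E" and min: "\<And>e'. e' \<in> E \<Longrightarrow> Z e' \<subseteq> Z e \<Longrightarrow> Z e' = Z e"
    by (metis imageE imageI)
  then have eI: "e \<in> I" and ee: "e * e - e \<in> P" by (auto simp: E_def)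
  have eR: "e \<in> R" using eI IR by blast
  have "Z e = P"
  proof (rule ccontr)
    assume ne: "Z e \<noteq> P"
    then obtain f where f: "f \<in> Z e" "f \<notin> P" "f * f - f \<in> P"
      using left_ideal_idempotent[OF n P Z[OF eI]] by blast
    then have fI: "f \<in> I" and fe: "f * e \<in> P" by (auto simp: Z_def)
    have fR: "f \<in> R" using fI IR by blast
    \<comment> \<open>Since \<open>f * e \<in> P\<close>, this is an idempotent with
      \<open>g e = e\<close> and \<open>g f = f\<close> modulo \<open>P\<close>. Its annihilator is
      contained in \<open>Z e\<close> but cannot contain \<open>f\<close>.\<close>
    define g where "g = e + f - e * f"
    have gI: "g \<in> I"
      unfolding g_def using eI fI eR ideal_left[OF I(1)] addgroup_add[OF Iadd] addgroup_diff[OF Iadd]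
      by blast
    have gR: "g \<in> R" using gI IR by blast
    have ge: "g * e - e \<in> P"
    proof -
      have "g * e - e = (e * e - e) + f * e - e * (f * e)" by (simp add: g_def algebra_simps)
      then show ?thesis
        using addgroup_diff[OF Padd addgroup_add[OF Padd ee fe] Pl[OF eR fe]] by (simp only:)
    qed
    have gf: "g * f - f \<in> P"
    proof -
      have "g * f - f = (f * f - f) - e * (f * f - f)" by (simp add: g_def algebra_simps)
      then show ?thesis using addgroup_diff[OF Padd f(3) Pl[OF eR f(3)]] by (simp only:)
    qed
    have "g * g - g \<in> P"
    proof -
      have "g * g - g = (g * e - e) + (g * f - f) - (g * e - e) * f"
        unfolding g_def by (simp add: algebra_simps)
      then show ?thesis
        using addgroup_diff[OF Padd addgroup_add[OF Padd ge gf] Pr[OF fR ge]] by (simp only:)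
    qed
    then have gE: "g \<in> E" using gI by (simp add: E_def)
    have "Z g \<subseteq> Z e"
    proof
      fix x assume "x \<in> Z g"
      then have x: "x \<in> I" "x * g \<in> P" "x \<in> R" using IR by (auto simp: Z_def)
      have "x * e = (x * g) * e - x * (g * e - e)" by (simp add: algebra_simps)
      then have "x * e \<in> P"
        using addgroup_diff[OF Padd Pr[OF eR x(2)] Pl[OF x(3) ge]] by (simp only:)
      with x show "x \<in> Z e" by (simp add: Z_def)
    qed
    then have "f \<in> Z g" using min[OF gE] f(1) by simp
    then have fg: "f * g \<in> P" by (simp add: Z_def)
    have "f = f * g - f * e - (f * f - f) + (f * e) * f" by (simp add: g_def algebra_simps)
    then have "f \<in> P"
      using addgroup_add[OF Padd addgroup_diff[OF Padd addgroup_diff[OF Padd fg fe] f(3)] Pr[OF fR fe]]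
      by metis
    with f(2) show False by simp
  qed
  have right_unit: "x - x * e \<in> P" if x: "x \<in> I" for x
  proof -
    have xR: "x \<in> R" using x IR by blast
    have "(x - x * e) * e = - (x * (e * e - e))" by (simp add: algebra_simps)
    then have "(x - x * e) * e \<in> P" using addgroup_minus[OF Padd Pl[OF xR ee]] by (simp only:)
    moreover have "x - x * e \<in> I"
      using x ideal_left[OF I(1) xR eI] addgroup_diff[OF Iadd] by blast
    ultimately show ?thesis using \<open>Z e = P\<close> by (auto simp: Z_def)
  qed
  obtain x where x: "x \<in> I" "x \<notin> P" using I(2,3) by blast
  have oneR: "1 - e \<in> R" using subring_1[OF subring] eR addgroup_diff[OF addgroup] by blast
  \<comment> \<open>Every \<open>x * r\<close> lies in \<open>I\<close>, where \<open>e\<close> is a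
    right identity; primality turns this into \<open>1 - e \<in> P\<close>.\<close>
  have "x * r * (1 - e) \<in> P" if "r \<in> R" for r
    using right_unit[OF ideal_right[OF I(1) that x(1)]] by (simp add: algebra_simps)
  then have "1 - e \<in> P"
    using P x IR oneR unfolding is_prime_ideal_def by blast
  then have "(1 - e) + e \<in> I" using I(2) eI addgroup_add[OF Iadd] by blast
  then show ?thesis using ideal_one[OF I(1) subring] by simp
qed

lemma prime_ideal_eq:
  assumes "n > 0" "of_nat n \<in> P" "is_prime_ideal R P" "is_prime_ideal R Q" "P \<subseteq> Q"
  shows "P = Q"
  using prime_ideal_maximal[OF assms(1-3) prime_ideal[OF assms(4)] assms(5)] assms(4)
  by (auto simp: is_prime_ideal_def)

end

section \<open>Ideals and lattices of a maximal order\<close>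

lemma ideal_prod_append_superset:
  assumes "\<And>P. P \<in> set Qs \<Longrightarrow> is_ideal R P" "is_subring R"
  shows "ideal_prod R Ps \<star> ideal_prod R Qs \<subseteq> ideal_prod R (Ps @ Qs)"
proof (induction Ps)
  case Nil
  have "is_ideal R (ideal_prod R Qs)" using ideal_prod_ideal[OF assms(2)] assms(1) by blast
  then have "R \<star> ideal_prod R Qs \<subseteq> ideal_prod R Qs"
    by (intro sprod_least) (auto simp: ideal_addgroup ideal_left)
  then show ?case by simp
next
  case (Cons P Ps)
  then show ?case by (simp add: sprod_assoc sprod_mono)
qed

lemma ideal_prod_of_nat:
  assumes "is_subring R" "\<And>P. P \<in> set Ps \<Longrightarrow> of_nat n \<in> P"
  shows "of_nat (n ^ length Ps) \<in> ideal_prod R Ps"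
  using assms(2)
proof (induction Ps)
  case (Cons P Ps)
  then show ?case using sprodI[of "of_nat n" P "of_nat (n ^ length Ps)"] by simp
qed (simp add: subring_1 assms(1))

locale maximal_order = rational_order +
  assumes maximal: "is_subring S \<Longrightarrow> R \<subseteq> S \<Longrightarrow> is_bounded R S \<Longrightarrow> S = R"
begin

text \<open>The left stabilizer of \<open>D\<close> is an overring, and the denominator
  \<open>m\<close> of \<open>D\<close> together with \<open>of_nat n \<in> D\<close> gives it the
  denominator \<open>m * n\<close>.\<close>

lemma left_stabilizer:
  assumes D: "is_addgroup D" "is_bounded R D" "n > 0" "of_nat n \<in> D" "\<And>r d. r \<in> R \<Longrightarrow> d \<in> D \<Longrightarrow> r * d \<in> D"
    and x: "\<And>d. d \<in> D \<Longrightarrow> x * d \<in> D"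
  shows "x \<in> R"
proof -
  let ?S = "{x. \<forall>d\<in>D. x * d \<in> D}"
  obtain m where m: "m > 0" "\<And>d. d \<in> D \<Longrightarrow> of_nat m * d \<in> R" using D(2) by (auto simp: is_bounded_def)
  have "is_subring ?S"
    using D(1) by (auto simp: is_subring_def is_addgroup_def left_diff_distrib mult.assoc)
  moreover have "R \<subseteq> ?S" using D(5) by blast
  moreover have "is_bounded R ?S"
    unfolding is_bounded_def
  proof (intro exI[of _ "m * n"] conjI ballI)
    fix y assume "y \<in> ?S"
    then have "of_nat m * (y * of_nat n) \<in> R" using m(2) D(4) by blast
    then show "of_nat (m * n) * y \<in> R" by (simp add: mult.assoc mult_of_nat_commute[of n y])
  qed (use m D(3) in simp)
  ultimately have "?S = R" by (rule maximal)
  then show ?thesis using x by blast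
qed

lemma right_stabilizer:
  assumes D: "is_addgroup D" "is_bounded R D" "n > 0" "of_nat n \<in> D" "\<And>r d. r \<in> R \<Longrightarrow> d \<in> D \<Longrightarrow> d * r \<in> D"
    and x: "\<And>d. d \<in> D \<Longrightarrow> d * x \<in> D"
  shows "x \<in> R"
proof -
  let ?S = "{x. \<forall>d\<in>D. d * x \<in> D}"
  obtain m where m: "m > 0" "\<And>d. d \<in> D \<Longrightarrow> of_nat m * d \<in> R" using D(2) by (auto simp: is_bounded_def)
  have "is_subring ?S"
    using D(1) by (auto simp: is_subring_def is_addgroup_def right_diff_distrib simp flip: mult.assoc)
  moreover have "R \<subseteq> ?S" using D(5) by blast
  moreover have "is_bounded R ?S"
    unfolding is_bounded_def
  proof (intro exI[of _ "m * n"] conjI ballI)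
    fix y assume "y \<in> ?S"
    then have "of_nat m * (of_nat n * y) \<in> R" using m(2) D(4) by blast
    then show "of_nat (m * n) * y \<in> R" by (simp add: mult.assoc)
  qed (use m D(3) in simp)
  ultimately have "?S = R" by (rule maximal)
  then show ?thesis using x by blast
qed

text \<open>The argument for Dedekind rings that the inverse of a proper ideal is not integral. With
  a shortest product of primes \<open>A P D\<close> inside \<open>n R\<close>, where
  \<open>P\<close> contains \<open>B\<close>, an element \<open>y\<close> of \<open>D A\<close>
  outside \<open>n R\<close> gives \<open>x = y / n\<close>.\<close>

lemma left_quotient_proper:
  assumes B: "is_ideal R B" "B \<noteq> R" "n > 0" "of_nat n \<in> B"
  shows "\<exists>x. x \<notin> R \<and> (\<forall>b\<in>B. x * b \<in> R)"
proof -
  obtain P where P: "is_prime_ideal R P" "B \<subseteq> P" using prime_ideal_exists[OF B(1,2,4,3)] by blast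
  let ?N = "{of_nat n * y | y. y \<in> R}"
  have N: "is_ideal R ?N"
  proof (rule idealI)
    show "is_addgroup ?N" by (rule addgroup_of_nat_image[OF addgroup])
    show "?N \<subseteq> R" using addgroup_of_nat[OF addgroup] by blast
  next
    fix r x assume "r \<in> R" "x \<in> ?N"
    then obtain u where u: "x = of_nat n * u" "u \<in> R" by blast
    have "r * x = of_nat n * (r * u)" "x * r = of_nat n * (u * r)"
      using u by (metis mult.assoc mult_of_nat_commute, simp add: mult.assoc)
    then show "r * x \<in> ?N" "x * r \<in> ?N"
      using subring_mult[OF subring] \<open>r \<in> R\<close> u(2) by blast+
  qed
  have nN: "of_nat n \<in> ?N" using subring_1[OF subring] by force
  define ok where "ok k \<longleftrightarrow> (\<exists>Ps. length Ps = k \<and>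
    (\<forall>P\<in>set Ps. is_prime_ideal R P \<and> of_nat n \<in> P) \<and> ideal_prod R Ps \<subseteq> ?N)" for k
  have "\<exists>k. ok k" using ideal_contains_prime_product[OF B(3) N nN] unfolding ok_def by blast
  then have "ok (LEAST k. ok k)" by (rule LeastI_ex)
  then obtain Ps where Ps: "length Ps = (LEAST k. ok k)"
    "\<And>P. P \<in> set Ps \<Longrightarrow> is_prime_ideal R P \<and> of_nat n \<in> P" "ideal_prod R Ps \<subseteq> ?N"
    unfolding ok_def by blast
  have NP: "?N \<subseteq> P" using B(4) P ideal_right[OF prime_ideal[OF P(1)]] by blast
  then obtain Q where Q: "Q \<in> set Ps" "Q \<subseteq> P"
    using ideal_prod_prime[OF subring _ P(1) order_trans[OF Ps(3)]] Ps(2) prime_ideal by metis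
  have "Q = P" using prime_ideal_eq[OF B(3) _ _ P(1) Q(2)] Ps(2)[OF Q(1)] by blast
  with Q(1) obtain As Ds where split: "Ps = As @ P # Ds" by (metis split_list)
  let ?A = "ideal_prod R As" and ?D = "ideal_prod R Ds"
  have ids: "\<And>P. P \<in> set As \<Longrightarrow> is_ideal R P" "\<And>P. P \<in> set Ds \<Longrightarrow> is_ideal R P"
    and nat: "\<And>P. P \<in> set Ds \<Longrightarrow> of_nat n \<in> P"
    using Ps(2) split prime_ideal by auto
  have D: "is_ideal R ?D" using ideal_prod_ideal[OF subring] ids by blast
  have APD: "?A \<star> (P \<star> ?D) \<subseteq> ?N"
    using ideal_prod_append_superset[of "P # Ds" R As] ids(2) prime_ideal[OF P(1)] subring Ps(3) split
    by auto
  have "\<not> ok (length (Ds @ As))"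
  proof
    assume "ok (length (Ds @ As))"
    then have "length Ps \<le> length (Ds @ As)" unfolding Ps(1) by (rule Least_le)
    then show False by (simp add: split)
  qed
  moreover have all: "\<forall>P\<in>set (Ds @ As). is_prime_ideal R P \<and> of_nat n \<in> P"
    using Ps(2) split by auto
  have "ok (length (Ds @ As))" if "ideal_prod R (Ds @ As) \<subseteq> ?N"
    unfolding ok_def by (intro exI[of _ "Ds @ As"] conjI refl all that)
  ultimately have "\<not> ideal_prod R (Ds @ As) \<subseteq> ?N" by blast
  then have "\<not> ?D \<star> ?A \<subseteq> ?N" using ideal_prod_append[OF subring, of Ds As] by blast
  then obtain y where y: "y \<in> ?D \<star> ?A" "y \<notin> ?N" by blast
  obtain z :: 'a where z: "of_nat n * z = 1" using unit_of_nat[OF B(3)] by blast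
  define x where "x = z * y"
  have nx: "of_nat n * x = y" by (simp add: x_def z flip: mult.assoc)
  have "x \<notin> R" using y(2) nx by blast
  moreover have "x * b \<in> R" if b: "b \<in> B" for b
  proof (rule left_stabilizer[of ?D])
    show "is_addgroup ?D" using D ideal_addgroup by blast
    show "is_bounded R ?D" using ideal_subset[OF D] by (auto simp: is_bounded_def intro!: exI[of _ 1])
    show "of_nat (n ^ length Ds) \<in> ?D" by (rule ideal_prod_of_nat[OF subring nat])
    show "n ^ length Ds > 0" using B(3) by simp
    show "r * d \<in> ?D" if "r \<in> R" "d \<in> ?D" for r d using ideal_left[OF D] that by blast
  next
    \<comment> \<open>The order \<open>D A\<close> of the factors is chosen for this:
      \<open>y * b * d\<close> lies in \<open>D A P D\<close>, hence in \<open>n D\<close>, so that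
      \<open>x * b\<close> maps \<open>?D\<close> into itself.\<close>
    fix d assume d: "d \<in> ?D"
    have "y * (b * d) \<in> (?D \<star> ?A) \<star> (P \<star> ?D)"
      by (intro sprodI y d) (use b P(2) in blast)
    also have "\<dots> \<subseteq> ?D \<star> ?N"
      unfolding sprod_assoc by (rule sprod_mono[OF order_refl APD])
    also have "\<dots> \<subseteq> {of_nat n * d | d. d \<in> ?D}"
    proof (rule sprod_least)
      show "is_addgroup {of_nat n * d | d. d \<in> ?D}"
        by (rule addgroup_of_nat_image[OF ideal_addgroup[OF D]])
    next
      fix d w assume "d \<in> ?D" "w \<in> ?N"
      then obtain u where u: "w = of_nat n * u" "u \<in> R" by blast
      have "d * w = of_nat n * (d * u)" using u by (metis mult.assoc mult_of_nat_commute)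
      then show "d * w \<in> {of_nat n * d | d. d \<in> ?D}"
        using ideal_right[OF D u(2) \<open>d \<in> ?D\<close>] by blast
    qed
    finally obtain d' where d': "d' \<in> ?D" "y * (b * d) = of_nat n * d'" by blast
    then have "of_nat n * (x * b * d) = of_nat n * d'" by (simp add: nx flip: mult.assoc)
    then have "x * b * d = d'" by (rule of_nat_cancel[OF B(3)])
    with d'(1) show "x * b * d \<in> ?D" by simp
  qed
  ultimately show ?thesis by blast
qed

text \<open>If the ideal \<open>?P \<star> Q\<close> were proper, some \<open>x\<close> outside
  \<open>R\<close> would send it into \<open>R\<close>. Then \<open>x\<close> maps \<open>?P\<close>
  into itself, although the left stabilizer of \<open>?P\<close> is \<open>R\<close>.\<close>

lemma lattice_generates:
  assumes Q: "is_addgroup Q" "is_bounded R Q" "n > 0" "of_nat n \<in> Q"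
    "\<And>q r. q \<in> Q \<Longrightarrow> r \<in> R \<Longrightarrow> q * r \<in> Q"
  shows "{x. \<forall>q\<in>Q. x * q \<in> R} \<star> Q = R"
proof (rule ccontr)
  let ?P = "{x. \<forall>q\<in>Q. x * q \<in> R}"
  assume ne: "?P \<star> Q \<noteq> R"
  obtain m where m: "m > 0" "\<And>q. q \<in> Q \<Longrightarrow> of_nat m * q \<in> R" using Q(2) by (auto simp: is_bounded_def)
  have P: "is_addgroup ?P"
    using addgroup by (auto simp: is_addgroup_def left_diff_distrib)
  have "?P \<star> Q \<subseteq> R" by (rule sprod_least[OF addgroup]) auto
  moreover have "R \<star> ?P \<subseteq> ?P"
    by (rule sprod_least[OF P]) (auto simp: mult.assoc subring_mult[OF subring])
  then have "R \<star> (?P \<star> Q) \<subseteq> ?P \<star> Q"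
    unfolding sprod_assoc[symmetric] by (rule sprod_mono) simp
  moreover have "Q \<star> R \<subseteq> Q" by (rule sprod_least[OF Q(1)]) (rule Q(5))
  then have "(?P \<star> Q) \<star> R \<subseteq> ?P \<star> Q"
    unfolding sprod_assoc by (rule sprod_mono[OF order_refl])
  ultimately have id: "is_ideal R (?P \<star> Q)"
    by (intro idealI addgroup_sprod) (auto intro: sprodI)
  have "of_nat m \<in> ?P" using m(2) by simp
  then have "of_nat (m * n) \<in> ?P \<star> Q" using sprodI[of _ ?P _ Q] Q(4) by simp
  then obtain x where x: "x \<notin> R" "\<And>b. b \<in> ?P \<star> Q \<Longrightarrow> x * b \<in> R"
    using left_quotient_proper[OF id ne, of "m * n"] m(1) Q(3) by auto
  have "x \<in> R"
  proof (rule left_stabilizer[OF P])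
    show "is_bounded R ?P"
      unfolding is_bounded_def
      by (rule exI[of _ n]) (use Q(3,4) in \<open>auto simp: mult_of_nat_commute[of n]\<close>)
    show "m > 0" "of_nat m \<in> ?P" by fact+
    show "r * d \<in> ?P" if "r \<in> R" "d \<in> ?P" for r d
      using that by (auto simp: mult.assoc subring_mult[OF subring])
    show "x * d \<in> ?P" if "d \<in> ?P" for d
      using x(2)[OF sprodI[OF that]] by (auto simp: mult.assoc)
  qed
  with x(1) show False by simp
qed

end

section \<open>Maximal orders with involution\<close>

lemma sprod_bounded:
  assumes "is_subring R" "is_bounded R A" "is_bounded R B"
  shows "is_bounded R (A \<star> B)"
proof -
  obtain m n where m: "m > 0" "\<And>x. x \<in> A \<Longrightarrow> of_nat m * x \<in> R"
    and n: "n > 0" "\<And>x. x \<in> B \<Longrightarrow> of_nat n * x \<in> R"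
    using assms(2,3) unfolding is_bounded_def by auto
  have "A \<star> B \<subseteq> {x. of_nat (m * n) * x \<in> R}"
  proof (rule sprod_least[OF addgroup_vimage_right[OF subring_addgroup[OF assms(1)]]])
    fix x y assume "x \<in> A" "y \<in> B"
    then have "(of_nat m * x) * (of_nat n * y) \<in> R" using m n subring_mult[OF assms(1)] by blast
    also have "(of_nat m * x) * (of_nat n * y) = of_nat (m * n) * (x * y)"
      by (metis mult.assoc mult_of_nat_commute of_nat_mult)
    finally show "x * y \<in> {x. of_nat (m * n) * x \<in> R}" by simp
  qed
  with m(1) n(1) show ?thesis
    unfolding is_bounded_def by (intro exI[of _ "m * n"]) auto
qed

lemma bounded_mono: "is_bounded R B \<Longrightarrow> A \<subseteq> B \<Longrightarrow> R \<subseteq> R' \<Longrightarrow> is_bounded R' A"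
  unfolding is_bounded_def by blast

lemma bounded_self: "is_bounded R R"
  unfolding is_bounded_def by (intro exI[of _ 1]) auto

locale involution_ring =
  fixes \<sigma> :: "'a::ring_1 \<Rightarrow> 'a"
  assumes involution: "involution \<sigma>"
begin

lemma inv_add: "\<sigma> (x + y) = \<sigma> x + \<sigma> y"
  and inv_inv [simp]: "\<sigma> (\<sigma> x) = x"
  and inv_mult: "\<sigma> (x * y) = \<sigma> y * \<sigma> x"
  using involution by (auto simp: involution_def)

lemma inv_0 [simp]: "\<sigma> 0 = 0"
  using inv_add[of 0 0] by simp

lemma inv_minus: "\<sigma> (- x) = - \<sigma> x"
  using inv_add[of x "- x"] by (simp add: minus_unique)

lemma inv_diff: "\<sigma> (x - y) = \<sigma> x - \<sigma> y"
  using inv_add[of x "- y"] by (simp add: inv_minus)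

lemma inv_1 [simp]: "\<sigma> 1 = 1"
  by (metis inv_inv inv_mult mult_1)

lemma inv_of_nat [simp]: "\<sigma> (of_nat n) = of_nat n"
  by (induction n) (simp_all add: inv_add)

lemma inv_image_iff: "\<sigma> x \<in> \<sigma> ` S \<longleftrightarrow> x \<in> S"
  by (metis image_iff inv_inv)

lemma inv_mem_image: "x \<in> \<sigma> ` S \<longleftrightarrow> \<sigma> x \<in> S"
  by (metis inv_image_iff inv_inv)

lemma inv_image_image [simp]: "\<sigma> ` \<sigma> ` S = S"
  by (auto simp: image_image)

lemma inv_addgroup: "is_addgroup S \<Longrightarrow> is_addgroup (\<sigma> ` S)"
  by (auto simp: is_addgroup_def inv_mem_image inv_diff)

lemma inv_subring: "is_subring S \<Longrightarrow> is_subring (\<sigma> ` S)"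
  by (auto simp: is_subring_def inv_addgroup inv_mem_image inv_mult)

lemma inv_sprod_subset: "\<sigma> ` (A \<star> B) \<subseteq> \<sigma> ` B \<star> \<sigma> ` A"
proof -
  have "A \<star> B \<subseteq> {x. \<sigma> x \<in> \<sigma> ` B \<star> \<sigma> ` A}"
  proof (rule sprod_least)
    show "is_addgroup {x. \<sigma> x \<in> \<sigma> ` B \<star> \<sigma> ` A}"
      using addgroup_sprod[of "\<sigma> ` B" "\<sigma> ` A"] by (auto simp: is_addgroup_def inv_diff)
  qed (auto simp: inv_mult intro: sprodI)
  then show ?thesis by auto
qed

lemma inv_sprod: "\<sigma> ` (A \<star> B) = \<sigma> ` B \<star> \<sigma> ` A"
proof
  show "\<sigma> ` B \<star> \<sigma> ` A \<subseteq> \<sigma> ` (A \<star> B)"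
    using image_mono[OF inv_sprod_subset[of "\<sigma> ` B" "\<sigma> ` A"], of \<sigma>] by simp
qed (rule inv_sprod_subset)

end

text \<open>Maximality is required among \<open>\<sigma>\<close>-stable overrings; the maximal order
  in the last assumption may be larger than \<open>R\<close> and not stable. \<open>C\<close> stands
  for the integral scalars. The assumption \<open>ideal_meets_C\<close> replaces localization at the
  scalars outside \<open>P\<close>: up to one integer \<open>m\<close>, valid for all ideals at
  once, an ideal outside \<open>P\<close> contains such a scalar.\<close>

locale max_involution_order = rational_order R + involution_ring \<sigma>
  for R :: "'a::ring_1 set" and \<sigma> +
  fixes C :: "'a set"
  assumes inv_R: "\<sigma> ` R = R"
    and max_inv: "is_subring S \<Longrightarrow> R \<subseteq> S \<Longrightarrow> is_bounded R S \<Longrightarrow> \<sigma> ` S = S \<Longrightarrow> S = R"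
    and C_subset: "C \<subseteq> R"
    and C_central: "c \<in> C \<Longrightarrow> c * x = x * c"
    and C_inv: "c \<in> C \<Longrightarrow> \<sigma> c = c"
    and C_one: "1 \<in> C"
    and C_mult: "c \<in> C \<Longrightarrow> d \<in> C \<Longrightarrow> c * d \<in> C"
    and ideal_meets_C: "is_prime_ideal R P \<Longrightarrow> n > 0 \<Longrightarrow> of_nat n \<in> P \<Longrightarrow>
      \<exists>m>0. \<forall>I. is_ideal R I \<longrightarrow> \<not> I \<subseteq> P \<longrightarrow> (\<exists>s\<in>C. s \<notin> P \<and> s * of_nat m \<in> I)"
    and maximal_order_exists: "\<exists>M. maximal_order M \<and> R \<subseteq> M \<and> is_bounded R M"
begin

text \<open>Imposing the condition on \<open>\<sigma> x\<close> as well makes the ring of all such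
  \<open>x\<close> stable under \<open>\<sigma>\<close>, so that the weaker maximality of
  \<open>R\<close> applies.\<close>

lemma lattice_stabilizer:
  assumes L: "is_addgroup L" "is_bounded R L" "n > 0" "of_nat n \<in> L" "\<And>r l. r \<in> R \<Longrightarrow> l \<in> L \<Longrightarrow> r * l \<in> L"
    and x: "\<And>l. l \<in> L \<Longrightarrow> x * l \<in> L" "\<And>l. l \<in> L \<Longrightarrow> \<sigma> x * l \<in> L"
  shows "x \<in> R"
proof -
  let ?S = "{x. \<forall>l\<in>L. x * l \<in> L \<and> \<sigma> x * l \<in> L}"
  obtain m where m: "m > 0" "\<And>d. d \<in> L \<Longrightarrow> of_nat m * d \<in> R" using L(2) by (auto simp: is_bounded_def)
  have "is_subring ?S"
    using L(1) by (auto simp: is_subring_def is_addgroup_def left_diff_distrib mult.assoc inv_diff inv_mult)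
  moreover have "R \<subseteq> ?S" using L(5) inv_R by (auto simp flip: inv_mem_image)
  moreover have "is_bounded R ?S"
    unfolding is_bounded_def
  proof (intro exI[of _ "m * n"] conjI ballI)
    fix y assume "y \<in> ?S"
    then have "of_nat m * (y * of_nat n) \<in> R" using m(2) L(4) by blast
    then show "of_nat (m * n) * y \<in> R" by (simp add: mult.assoc mult_of_nat_commute[of n y])
  qed (use m L(3) in simp)
  moreover have "\<sigma> ` ?S = ?S" by (auto simp: inv_mem_image)
  ultimately have "?S = R" by (rule max_inv)
  then show ?thesis using x by blast
qed

lemma inv_ideal:
  assumes "is_ideal R I"
  shows "is_ideal R (\<sigma> ` I)"
proof (rule idealI)
  show "is_addgroup (\<sigma> ` I)" using assms inv_addgroup ideal_addgroup by blast
  show "\<sigma> ` I \<subseteq> R" using ideal_subset[OF assms] inv_R by blast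
next
  fix r x assume "r \<in> R" "x \<in> \<sigma> ` I"
  then have "\<sigma> r \<in> R" "\<sigma> x \<in> I" using inv_R by (auto simp: inv_mem_image)
  then show "r * x \<in> \<sigma> ` I" "x * r \<in> \<sigma> ` I"
    using ideal_left[OF assms] ideal_right[OF assms] by (auto simp: inv_mem_image inv_mult)
qed

lemma inv_prime:
  assumes P: "is_prime_ideal R P"
  shows "is_prime_ideal R (\<sigma> ` P)"
  unfolding is_prime_ideal_def
proof (intro conjI ballI impI)
  show "is_ideal R (\<sigma> ` P)" using inv_ideal prime_ideal[OF P] by blast
  show "\<sigma> ` P \<noteq> R"
  proof
    assume "\<sigma> ` P = R"
    then have "\<sigma> ` \<sigma> ` P = \<sigma> ` R" by simp
    then have "P = R" using inv_R by simp
    with P show False by (simp add: is_prime_ideal_def)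
  qed
  fix x y assume xy: "x \<in> R" "y \<in> R" and *: "\<forall>r\<in>R. x * r * y \<in> \<sigma> ` P"
  have "\<sigma> y * r * \<sigma> x \<in> P" if "r \<in> R" for r
  proof -
    have "\<sigma> r \<in> R" using that inv_R by (auto simp flip: inv_mem_image)
    with * have "x * \<sigma> r * y \<in> \<sigma> ` P" by blast
    then show ?thesis by (simp add: inv_mem_image inv_mult mult.assoc)
  qed
  moreover have "\<sigma> x \<in> R" "\<sigma> y \<in> R" using xy inv_R by (auto simp flip: inv_mem_image)
  ultimately have "\<sigma> y \<in> P \<or> \<sigma> x \<in> P" using P by (simp add: is_prime_ideal_def)
  then show "x \<in> \<sigma> ` P \<or> y \<in> \<sigma> ` P" by (auto simp: inv_mem_image)
qed

end

section \<open>Localization at a prime ideal and its stability under the involution\<close>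

locale max_involution_order_prime = max_involution_order R \<sigma> C
  for R :: "'a::ring_1 set" and \<sigma> and C +
  fixes P :: "'a set" and p :: nat
  assumes prime_P: "is_prime_ideal R P" and p: "Factorial_Ring.prime p" "of_nat p \<in> P"
begin

definition T :: "'a set" where "T = C - P"

lemma T_central: "s \<in> T \<Longrightarrow> s * x = x * s"
  and T_R: "s \<in> T \<Longrightarrow> s \<in> R"
  and T_inv: "s \<in> T \<Longrightarrow> \<sigma> s = s"
  using C_central C_subset C_inv by (auto simp: T_def)

lemma T_cancel:
  assumes "s \<in> T" "x \<in> R" "s * x \<in> P"
  shows "x \<in> P"
  using prime_ideal_central[OF prime_P T_R[OF assms(1)] assms(2) T_central[OF assms(1)] assms(3)] assms(1)
  by (auto simp: T_def)

lemma one_notin_prime: "is_prime_ideal R Q \<Longrightarrow> 1 \<notin> Q"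
  using ideal_one[OF _ subring] by (auto simp: is_prime_ideal_def)

lemma T_one: "1 \<in> T"
  using C_one one_notin_prime[OF prime_P] by (simp add: T_def)

lemma T_mult: "s \<in> T \<Longrightarrow> t \<in> T \<Longrightarrow> s * t \<in> T"
  using C_mult[of s t] T_cancel[of s t] C_subset by (auto simp: T_def)

lemma T_power: "s \<in> T \<Longrightarrow> s ^ n \<in> T"
  by (induction n) (auto simp: T_one T_mult)

text \<open>The contraction to \<open>R\<close> of the localization of \<open>I\<close> at the
  central elements outside \<open>P\<close>; it stands in for the ring of fractions.\<close>

definition loc :: "'a set \<Rightarrow> 'a set" where "loc I = {x \<in> R. \<exists>s\<in>T. s * x \<in> I}"

lemma loc_superset: "I \<subseteq> R \<Longrightarrow> I \<subseteq> loc I"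
  using T_one by (auto simp: loc_def intro!: bexI[of _ 1])

lemma loc_mono: "I \<subseteq> J \<Longrightarrow> loc I \<subseteq> loc J"
  by (auto simp: loc_def)

lemma loc_ideal:
  assumes "is_ideal R I"
  shows "is_ideal R (loc I)"
proof (rule idealI)
  show "is_addgroup (loc I)"
  proof (rule addgroupI)
    show "0 \<in> loc I"
      using T_one addgroup_0[OF addgroup] addgroup_0[OF ideal_addgroup[OF assms]] by (auto simp: loc_def)
  next
    fix x y assume "x \<in> loc I" "y \<in> loc I"
    then obtain s t where *: "x \<in> R" "y \<in> R" "s \<in> T" "t \<in> T" "s * x \<in> I" "t * y \<in> I"
      by (auto simp: loc_def)
    have "s * t * (x - y) = t * (s * x) - s * (t * y)"
      using T_central[OF *(3), of t] by (simp add: algebra_simps flip: mult.assoc)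
    also have "\<dots> \<in> I"
      by (rule addgroup_diff[OF ideal_addgroup[OF assms]
            ideal_left[OF assms T_R[OF *(4)] *(5)] ideal_left[OF assms T_R[OF *(3)] *(6)]])
    finally show "x - y \<in> loc I"
      unfolding loc_def using T_mult[OF *(3,4)] addgroup_diff[OF addgroup *(1,2)] by blast
  qed
  show "loc I \<subseteq> R" by (auto simp: loc_def)
next
  fix r x assume r: "r \<in> R" and "x \<in> loc I"
  then obtain s where *: "x \<in> R" "s \<in> T" "s * x \<in> I" by (auto simp: loc_def)
  have "s * (r * x) = r * (s * x)" using T_central[OF *(2), of r] by (simp flip: mult.assoc)
  then have "s * (r * x) \<in> I" using ideal_left[OF assms r *(3)] by simp
  with * r subring_mult[OF subring] show "r * x \<in> loc I" unfolding loc_def by blast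
  have "s * (x * r) \<in> I" using ideal_right[OF assms r *(3)] by (simp add: mult.assoc)
  with * r subring_mult[OF subring] show "x * r \<in> loc I" unfolding loc_def by blast
qed

lemma loc_loc: "loc (loc I) = loc I"
proof
  show "loc (loc I) \<subseteq> loc I"
  proof
    fix x assume "x \<in> loc (loc I)"
    then obtain s t where *: "x \<in> R" "s \<in> T" "t \<in> T" "t * (s * x) \<in> I" by (auto simp: loc_def)
    then have "t * s * x \<in> I" by (simp add: mult.assoc)
    then show "x \<in> loc I" unfolding loc_def using T_mult[OF *(3,2)] *(1) by blast
  qed
  show "loc I \<subseteq> loc (loc I)" by (rule loc_superset) (auto simp: loc_def)
qed

text \<open>Only the residues modulo \<open>k R\<close> matter, since \<open>k R\<close> lies in
  \<open>W\<close>. They are finitely many, and the product of their multipliers works for all of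
  \<open>I\<close>.\<close>

lemma uniform_multiplier:
  assumes k: "k > 0" and W: "is_addgroup W" "\<And>y. y \<in> R \<Longrightarrow> of_nat k * y \<in> W" "\<And>r x. r \<in> R \<Longrightarrow> x \<in> W \<Longrightarrow> r * x \<in> W"
    and I: "I \<subseteq> loc W"
  shows "\<exists>s\<in>T. \<forall>x\<in>I. s * x \<in> W"
proof -
  obtain F where F: "finite F" "F \<subseteq> R" "\<And>x. x \<in> R \<Longrightarrow> \<exists>f\<in>F. \<exists>y\<in>R. x = f + of_nat k * y"
    using finite_quotient[OF k] by blast
  have "\<exists>s\<in>T. \<forall>x\<in>I. \<forall>y\<in>R. \<forall>f\<in>G. x = f + of_nat k * y \<longrightarrow> s * x \<in> W" if "finite G" "G \<subseteq> F" for G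
    using that
  proof (induction G rule: finite_induct)
    case empty
    then show ?case using T_one by auto
  next
    case (insert f G)
    then obtain s where s: "s \<in> T" "\<And>x y f. x \<in> I \<Longrightarrow> y \<in> R \<Longrightarrow> f \<in> G \<Longrightarrow> x = f + of_nat k * y \<Longrightarrow> s * x \<in> W"
      by auto
    have "\<exists>t\<in>T. \<forall>x\<in>I. \<forall>y\<in>R. x = f + of_nat k * y \<longrightarrow> t * x \<in> W"
    proof (cases "\<exists>x\<in>I. \<exists>y\<in>R. x = f + of_nat k * y")
      case False
      then show ?thesis using T_one by blast
    next
      case True
      then obtain x y where x: "x \<in> I" "y \<in> R" "x = f + of_nat k * y" by blast
      then obtain t where t: "t \<in> T" "t * x \<in> W" using I by (auto simp: loc_def)
      have "t * x' \<in> W" if "y' \<in> R" "x' = f + of_nat k * y'" for x' y'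
      proof -
        have "x' = x + of_nat k * (y' - y)" using that x by (simp add: algebra_simps)
        then have "t * x' = t * x + of_nat k * (t * (y' - y))"
          by (simp add: distrib_left mult.assoc[symmetric] mult_of_nat_commute[of k t])
        moreover have "t * (y' - y) \<in> R"
          using T_R[OF t(1)] that x addgroup_diff[OF addgroup] subring_mult[OF subring] by simp
        ultimately show ?thesis using addgroup_add[OF W(1) t(2) W(2)] by simp
      qed
      with t show ?thesis by blast
    qed
    then obtain t where t: "t \<in> T" "\<And>x y. x \<in> I \<Longrightarrow> y \<in> R \<Longrightarrow> x = f + of_nat k * y \<Longrightarrow> t * x \<in> W"
      by blast
    show ?case
    proof (intro bexI[of _ "s * t"] ballI impI)
      fix x y f' assume *: "x \<in> I" "y \<in> R" "f' \<in> insert f G" "x = f' + of_nat k * y"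
      consider "f' = f" | "f' \<in> G" using *(3) by blast
      then show "s * t * x \<in> W"
      proof cases
        case 1
        then have "t * x \<in> W" using t(2) * by blast
        then show ?thesis using W(3)[OF T_R[OF s(1)]] by (simp add: mult.assoc)
      next
        case 2
        then have "s * x \<in> W" using s(2) * by blast
        then have "t * (s * x) \<in> W" using W(3)[OF T_R[OF t(1)]] by blast
        then show ?thesis using T_central[OF s(1), of t] by (simp flip: mult.assoc)
      qed
    qed (rule T_mult[OF s(1) t(1)])
  qed
  from this[OF F(1)] obtain s where s: "s \<in> T" "\<And>x y f. x \<in> I \<Longrightarrow> y \<in> R \<Longrightarrow> f \<in> F \<Longrightarrow> x = f + of_nat k * y \<Longrightarrow> s * x \<in> W"
    by blast
  have "I \<subseteq> R" using I by (auto simp: loc_def)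
  then show ?thesis using s F(3) by (metis subsetD)
qed

lemma p_pos: "p > 0"
  using p(1) prime_gt_0_nat by blast

text \<open>All saturated ideals outside \<open>P\<close> contain one integer \<open>m\<close>, so
  they are finitely many and a minimal one \<open>E\<close> exists. For \<open>I\<close> outside
  \<open>P\<close> the product \<open>E \<star> I\<close> is again outside \<open>P\<close>, so it
  saturates to \<open>E\<close>. Locally, \<open>E\<close> is thus idempotent and lies in every
  ideal outside \<open>P\<close>.\<close>

lemma minimal_ideal:
  "\<exists>E m. m > 0 \<and> is_ideal R E \<and> loc E = E \<and> \<not> E \<subseteq> P \<and> of_nat m \<in> E \<and>
     (\<forall>I. is_ideal R I \<longrightarrow> \<not> I \<subseteq> P \<longrightarrow> loc (E \<star> I) = E)"
proof -
  obtain m where m: "m > 0" "\<And>I. is_ideal R I \<Longrightarrow> \<not> I \<subseteq> P \<Longrightarrow> \<exists>s\<in>C. s \<notin> P \<and> s * of_nat m \<in> I"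
    using ideal_meets_C[OF prime_P p_pos p(2)] by blast
  have mI: "of_nat m \<in> loc I" if I: "is_ideal R I" "\<not> I \<subseteq> P" for I
    using m(2)[OF I] subring_of_nat[OF subring] by (auto simp: loc_def T_def)
  define \<A> where "\<A> = {I. is_ideal R I \<and> loc I = I \<and> \<not> I \<subseteq> P}"
  have "finite \<A>"
    by (rule finite_subset[OF _ finite_ideals[OF m(1)]]) (use mI in \<open>force simp: \<A>_def\<close>)
  moreover have "loc R = R" using loc_superset[of R] by (auto simp: loc_def)
  then have "R \<in> \<A>"
    using one_notin_prime[OF prime_P] subring_1[OF subring] by (auto simp: \<A>_def ideal_self[OF subring])
  ultimately obtain E where E: "E \<in> \<A>" and min: "\<And>I. I \<in> \<A> \<Longrightarrow> I \<subseteq> E \<Longrightarrow> I = E"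
    using finite_minimal_set by meson
  have E': "is_ideal R E" "loc E = E" "\<not> E \<subseteq> P" using E by (auto simp: \<A>_def)
  have "loc (E \<star> I) = E" if I: "is_ideal R I" "\<not> I \<subseteq> P" for I
  proof (rule min)
    have EI: "is_ideal R (E \<star> I)" by (rule ideal_sprod[OF subring E'(1) I(1)])
    have "\<not> E \<star> I \<subseteq> P" using prime_ideal_sprod[OF prime_P E'(1) I(1)] E'(3) I(2) by blast
    then have "\<not> loc (E \<star> I) \<subseteq> P" using loc_superset[OF ideal_subset[OF EI]] by blast
    then show "loc (E \<star> I) \<in> \<A>" by (simp add: \<A>_def loc_loc loc_ideal[OF EI])
    have "E \<star> I \<subseteq> E"
      by (rule sprod_least[OF ideal_addgroup[OF E'(1)]])
        (use ideal_right[OF E'(1)] ideal_subset[OF I(1)] in blast)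
    then show "loc (E \<star> I) \<subseteq> E" using loc_mono E'(2) by metis
  qed
  moreover have "of_nat m \<in> E" using mI[OF E'(1,3)] E'(2) by simp
  ultimately show ?thesis using m(1) E' by blast
qed

text \<open>Suppose the contrary. With \<open>E\<close> minimal outside \<open>P\<close> and
  \<open>F = \<sigma> E\<close>, which then lies in \<open>P\<close>, an ideal \<open>W\<close> of
  \<open>R\<close> is built from lattices over a maximal order; it lies in \<open>P\<close> but does
  not shrink the lattice \<open>L = E M\<close>. Nakayama's lemma makes \<open>L\<close>, and with
  it \<open>E\<close>, divisible by powers of \<open>p\<close> up to scalars outside
  \<open>P\<close>. This forces \<open>E\<close> into \<open>P\<close>, against its choice.\<close>

theorem inv_prime_subset: "\<sigma> ` P \<subseteq> P"
proof (rule ccontr)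
  assume nsub: "\<not> \<sigma> ` P \<subseteq> P"
  obtain E m where E: "m > 0" "is_ideal R E" "loc E = E" "\<not> E \<subseteq> P" "of_nat m \<in> E"
    and Emin: "\<And>I. is_ideal R I \<Longrightarrow> \<not> I \<subseteq> P \<Longrightarrow> loc (E \<star> I) = E"
    using minimal_ideal by blast
  note ER = ideal_subset[OF E(2)]
  have Eloc: "E \<subseteq> loc I" if I: "is_ideal R I" "\<not> I \<subseteq> P" for I
  proof -
    have "E \<star> I \<subseteq> I"
      by (rule sprod_least[OF ideal_addgroup[OF I(1)]]) (use ideal_left[OF I(1)] ER in blast)
    then show ?thesis using loc_mono Emin[OF I] by metis
  qed
  have P2: "is_ideal R (\<sigma> ` P)" "is_prime_ideal R (\<sigma> ` P)"
    using inv_prime[OF prime_P] prime_ideal by auto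
  \<comment> \<open>The scalars in \<open>T\<close> are fixed by \<open>\<sigma>\<close> and
    therefore outside the image of \<open>P\<close> too, so they cancel modulo that prime
    ideal.\<close>
  have "E \<subseteq> \<sigma> ` P"
  proof
    fix x assume "x \<in> E"
    then obtain s where s: "x \<in> R" "s \<in> T" "s * x \<in> \<sigma> ` P"
      using Eloc[OF P2(1) nsub] by (auto simp: loc_def)
    then have "s \<in> \<sigma> ` P \<or> x \<in> \<sigma> ` P"
      by (intro prime_ideal_central[OF P2(2)]) (use T_R T_central in auto)
    then show "x \<in> \<sigma> ` P" using s(2) by (auto simp: inv_mem_image T_inv) (simp add: T_def)
  qed
  define F where "F = \<sigma> ` E"
  have F: "is_ideal R F" "of_nat m \<in> F" "F \<subseteq> R"
    using inv_ideal[OF E(2)] E(5) ideal_subset by (auto simp: F_def inv_mem_image)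
  have FP: "F \<subseteq> P" using image_mono[OF \<open>E \<subseteq> \<sigma> ` P\<close>, of \<sigma>] by (simp add: F_def)
  \<comment> \<open>One scalar \<open>s0\<close> makes the local equality of \<open>E\<close> and
    \<open>E \<star> E\<close> uniform; by \<open>s0F\<close> it serves \<open>F\<close> as
    well.\<close>
  have "\<exists>s\<in>T. \<forall>x\<in>E. s * x \<in> E \<star> E"
  proof (rule uniform_multiplier)
    show "m * m > 0" using E(1) by simp
    show "E \<subseteq> loc (E \<star> E)" using Emin[OF E(2,4)] by simp
    show "of_nat (m * m) * y \<in> E \<star> E" if "y \<in> R" for y
      using sprodI[OF E(5) ideal_right[OF E(2) that E(5)]] by (simp add: mult.assoc)
    show "r * x \<in> E \<star> E" if "r \<in> R" "x \<in> E \<star> E" for r x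
      by (rule ideal_left[OF ideal_sprod[OF subring E(2,2)] that])
  qed (rule addgroup_sprod)
  then obtain s0 where s0: "s0 \<in> T" "\<And>x. x \<in> E \<Longrightarrow> s0 * x \<in> E \<star> E" by blast
  have s0F: "s0 * x \<in> F \<star> F" if "x \<in> F" for x
  proof -
    have "\<sigma> (s0 * \<sigma> x) \<in> \<sigma> ` (E \<star> E)" using s0(2)[of "\<sigma> x"] that by (simp add: F_def inv_mem_image)
    then show ?thesis by (simp add: inv_sprod F_def inv_mult T_inv[OF s0(1)] T_central[OF s0(1)])
  qed
  obtain M where "maximal_order M" and RM: "R \<subseteq> M" and MR: "is_bounded R M"
    using maximal_order_exists by blast
  then interpret M: maximal_order M by simp
  \<comment> \<open>\<open>L\<close> is a left \<open>R\<close>-module and a right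
    \<open>M\<close>-module. \<open>Q\<close> is the product \<open>N F E M\<close>, which
    \<open>\<sigma>\<close> maps to itself because it exchanges \<open>N\<close> with
    \<open>M\<close> and \<open>F\<close> with \<open>E\<close>; \<open>Pi\<close> is the left dual
    of \<open>Q\<close>. In \<open>W\<close> the dual is cut down to a two-sided
    \<open>R\<close>-module.\<close>
  define N where "N = \<sigma> ` M"
  define L where "L = E \<star> M"
  define Q where "Q = N \<star> (F \<star> L)"
  define Pi where "Pi = {x. \<forall>q\<in>Q. x * q \<in> M}"
  define W where "W = E \<star> Pi \<star> F"
  have N: "is_subring N" "1 \<in> N" using inv_subring[OF M.subring] by (auto simp: N_def subring_1)
  have M1: "1 \<in> M" by (rule subring_1[OF M.subring])
  have inv_Q: "\<sigma> ` Q = Q" by (simp add: Q_def L_def N_def F_def inv_sprod sprod_assoc)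
  have inv_L: "\<sigma> ` L = N \<star> F" by (simp add: L_def N_def F_def inv_sprod)
  have NR: "is_bounded R N"
  proof -
    obtain k where k: "k > 0" "\<And>x. x \<in> M \<Longrightarrow> of_nat k * x \<in> R" using MR by (auto simp: is_bounded_def)
    have "of_nat k * x \<in> R" if "x \<in> N" for x
    proof -
      have "\<sigma> (of_nat k * \<sigma> x) \<in> \<sigma> ` R" using k(2) that by (auto simp: N_def)
      then show ?thesis by (simp add: inv_R inv_mult mult_of_nat_commute[of k x])
    qed
    with k(1) show ?thesis by (auto simp: is_bounded_def)
  qed
  have bE: "is_bounded R E" "is_bounded R F"
    using bounded_mono[OF bounded_self ER order_refl] bounded_mono[OF bounded_self F(3) order_refl] by auto
  have bL: "is_bounded R L" unfolding L_def by (intro sprod_bounded[OF subring] bE MR)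
  have bQ: "is_bounded R Q" unfolding Q_def by (intro sprod_bounded[OF subring] bE NR bL)
  have mL: "of_nat m \<in> L" using sprodI[OF E(5) M1] by (simp add: L_def)
  have mQ: "of_nat (m * m) \<in> Q"
    using sprodI[OF N(2) sprodI[OF F(2) mL]] by (simp add: Q_def)
  have EL: "E \<subseteq> L" using sprodI[OF _ M1, of _ E] by (auto simp: L_def)
  have MM: "M \<star> M \<subseteq> M" by (rule sprod_least[OF M.addgroup]) (rule subring_mult[OF M.subring])
  have NN: "N \<star> N \<subseteq> N" by (rule sprod_least[OF subring_addgroup[OF N(1)]]) (rule subring_mult[OF N(1)])
  have RE: "R \<star> E \<subseteq> E"
    by (rule sprod_least[OF ideal_addgroup[OF E(2)]]) (rule ideal_left[OF E(2)])
  have FR: "F \<star> R \<subseteq> F"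
    by (rule sprod_least[OF ideal_addgroup[OF F(1)]]) (rule ideal_right[OF F(1)])
  have LM: "L \<star> M \<subseteq> L" unfolding L_def sprod_assoc by (rule sprod_mono[OF order_refl MM])
  have QM: "Q \<star> M \<subseteq> Q"
    unfolding Q_def sprod_assoc by (intro sprod_mono order_refl LM)
  have NQ: "N \<star> Q \<subseteq> Q"
    unfolding Q_def sprod_assoc[symmetric] by (intro sprod_mono order_refl NN)
  have addQ: "is_addgroup Q" unfolding Q_def by (rule addgroup_sprod)
  have gen: "Pi \<star> Q = M"
    unfolding Pi_def
    by (rule M.lattice_generates[OF addQ bounded_mono[OF bQ order_refl RM] _ mQ])
      (use E(1) subsetD[OF QM sprodI] in auto)
  \<comment> \<open>The duality theorem gives one side, \<open>Pi \<star> Q = M\<close>. The other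
    side comes from the involution: \<open>d * \<sigma> (q * x)\<close> is the image of
    \<open>q * (x * \<sigma> d)\<close>, so \<open>\<sigma> (q * x)\<close> lies in the right
    stabilizer \<open>M\<close> of \<open>Q\<close>.\<close>
  have QPi: "Q \<star> Pi \<subseteq> N"
  proof (rule sprod_least[OF subring_addgroup[OF N(1)]])
    fix q x assume q: "q \<in> Q" and x: "x \<in> Pi"
    have "\<sigma> (q * x) \<in> M"
    proof (rule M.right_stabilizer[OF addQ bounded_mono[OF bQ order_refl RM] _ mQ])
      fix r d assume "r \<in> M" "d \<in> Q"
      then show "d * r \<in> Q" using QM sprodI by blast
    next
      fix d assume "d \<in> Q"
      then have "\<sigma> d \<in> Q" using inv_Q by (metis inv_mem_image)
      then have "x * \<sigma> d \<in> M" using x by (simp add: Pi_def)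
      then have "q * (x * \<sigma> d) \<in> Q" using QM sprodI[OF q] by blast
      then have "\<sigma> (q * (x * \<sigma> d)) \<in> Q" using inv_Q by (metis inv_image_iff)
      then show "d * \<sigma> (q * x) \<in> Q" by (simp add: inv_mult mult.assoc)
    qed (use E(1) in simp)
    then show "q * x \<in> N" by (simp add: N_def inv_mem_image)
  qed
  have PiN: "Pi \<star> N \<subseteq> Pi"
  proof (rule sprod_least)
    show "is_addgroup Pi"
      unfolding Pi_def using M.addgroup by (auto simp: is_addgroup_def left_diff_distrib)
    fix x y assume x: "x \<in> Pi" and y: "y \<in> N"
    have "x * (y * q) \<in> M" if "q \<in> Q" for q
      using x NQ sprodI[OF y that] by (auto simp: Pi_def)
    then show "x * y \<in> Pi" by (simp add: Pi_def mult.assoc)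
  qed
  have FLQ: "F \<star> L \<subseteq> Q" unfolding Q_def using sprodI[OF N(2)] by (metis mult_1 subsetI)
  have NFEQ: "N \<star> (F \<star> E) \<subseteq> Q"
    unfolding Q_def by (intro sprod_mono order_refl EL)
  have WL: "W \<star> L \<subseteq> L"
  proof -
    have "W \<star> L = E \<star> (Pi \<star> (F \<star> L))" by (simp add: W_def sprod_assoc)
    also have "\<dots> \<subseteq> E \<star> (Pi \<star> Q)" by (intro sprod_mono order_refl FLQ)
    finally show ?thesis by (simp add: gen L_def)
  qed
  have NFW: "(N \<star> F) \<star> W \<subseteq> N \<star> F"
  proof -
    have "(N \<star> F) \<star> W = ((N \<star> (F \<star> E)) \<star> Pi) \<star> F" by (simp add: W_def sprod_assoc)
    also have "\<dots> \<subseteq> (Q \<star> Pi) \<star> F" by (intro sprod_mono order_refl NFEQ)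
    also have "\<dots> \<subseteq> N \<star> F" by (intro sprod_mono order_refl QPi)
    finally show ?thesis .
  qed
  \<comment> \<open>Here the maximality of \<open>R\<close> among \<open>\<sigma>\<close>-orders
    enters: \<open>W\<close> stabilizes \<open>L\<close> from the left and
    \<open>N \<star> F\<close>, the image of \<open>L\<close>, from the right.\<close>
  have WR: "W \<subseteq> R"
  proof
    fix x assume x: "x \<in> W"
    show "x \<in> R"
    proof (rule lattice_stabilizer[OF _ bL E(1) mL])
      show "is_addgroup L" unfolding L_def by (rule addgroup_sprod)
      show "r * l \<in> L" if "r \<in> R" "l \<in> L" for r l
      proof -
        have "R \<star> L \<subseteq> L" unfolding L_def sprod_assoc[symmetric] by (intro sprod_mono order_refl RE)
        with that sprodI show ?thesis by blast
      qed
      show "x * l \<in> L" if "l \<in> L" for l using WL sprodI[OF x that] by blast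
      show "\<sigma> x * l \<in> L" if "l \<in> L" for l
      proof -
        have "\<sigma> l \<in> N \<star> F" using that inv_L by (metis inv_image_iff)
        then have "\<sigma> l * x \<in> \<sigma> ` L" using NFW sprodI[OF _ x] inv_L by blast
        then show ?thesis by (simp add: inv_mem_image inv_mult)
      qed
    qed
  qed
  have W: "is_ideal R W"
  proof -
    have "R \<star> W \<subseteq> W" unfolding W_def sprod_assoc[symmetric] by (intro sprod_mono order_refl RE)
    moreover have "W \<star> R \<subseteq> W" unfolding W_def sprod_assoc by (intro sprod_mono order_refl FR)
    moreover have "is_addgroup W" unfolding W_def by (rule addgroup_sprod)
    ultimately show ?thesis using WR by (intro idealI) (use sprodI in blast)+
  qed
  \<comment> \<open>Up to \<open>s0\<close> the right factor \<open>F\<close> of \<open>W\<close>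
    may be doubled, so \<open>s0 W\<close> lies in \<open>W \<star> F\<close>, hence in
    \<open>F\<close> and in \<open>P\<close>.\<close>
  have WP: "W \<subseteq> P"
  proof
    fix w assume w: "w \<in> W"
    have "W \<subseteq> {w. s0 * w \<in> W \<star> F}"
      unfolding W_def
    proof (rule sprod_least[OF addgroup_vimage_right[OF addgroup_sprod]])
      fix a f assume a: "a \<in> E \<star> Pi" and f: "f \<in> F"
      have "a * (s0 * f) \<in> (E \<star> Pi) \<star> (F \<star> F)" by (rule sprodI[OF a s0F[OF f]])
      moreover have "a * (s0 * f) = s0 * (a * f)"
        using T_central[OF s0(1), of a] by (simp flip: mult.assoc)
      ultimately show "a * f \<in> {w. s0 * w \<in> E \<star> Pi \<star> F \<star> F}" by (simp add: sprod_assoc)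
    qed
    moreover have "W \<star> F \<subseteq> F"
      by (rule sprod_least[OF ideal_addgroup[OF F(1)]]) (use ideal_left[OF F(1)] WR in blast)
    ultimately have "s0 * w \<in> P" using w FP by blast
    then show "w \<in> P" using T_cancel[OF s0(1)] WR w by blast
  qed
  define r where "r = W \<star> E"
  \<comment> \<open>The factor \<open>N\<close> at the left of \<open>Q\<close> is absorbed by
    \<open>Pi\<close>, so \<open>L = E Pi Q\<close> is contained in
    \<open>E Pi F L = W L\<close>.\<close>
  have LWL: "L \<subseteq> W \<star> L"
  proof -
    have "L = E \<star> (Pi \<star> Q)" by (simp add: gen L_def)
    also have "\<dots> = E \<star> ((Pi \<star> N) \<star> (F \<star> L))" by (simp add: Q_def sprod_assoc)
    also have "\<dots> \<subseteq> E \<star> (Pi \<star> (F \<star> L))" by (intro sprod_mono order_refl PiN)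
    finally show ?thesis by (simp add: W_def sprod_assoc)
  qed
  \<comment> \<open>As \<open>E\<close> equals \<open>E \<star> E\<close> up to \<open>s0\<close>,
    the ideal \<open>W\<close> can be replaced by \<open>r = W \<star> E\<close>, which lies in both
    \<open>W\<close> and \<open>E\<close>.\<close>
  have s0L: "s0 * l \<in> r \<star> L" if "l \<in> L" for l
  proof -
    have 1: "s0 * l \<in> (E \<star> E) \<star> M" if "l \<in> L" for l
    proof -
      have "L \<subseteq> {l. s0 * l \<in> (E \<star> E) \<star> M}"
        unfolding L_def
        by (rule sprod_least[OF addgroup_vimage_right[OF addgroup_sprod]])
          (use sprodI[OF s0(2)] in \<open>auto simp flip: mult.assoc\<close>)
      with that show ?thesis by blast
    qed
    have "W \<star> L \<subseteq> {l. s0 * l \<in> W \<star> ((E \<star> E) \<star> M)}"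
    proof (rule sprod_least[OF addgroup_vimage_right[OF addgroup_sprod]])
      fix w l assume w: "w \<in> W" and l: "l \<in> L"
      have "w * (s0 * l) \<in> W \<star> ((E \<star> E) \<star> M)" by (rule sprodI[OF w 1[OF l]])
      moreover have "w * (s0 * l) = s0 * (w * l)"
        using T_central[OF s0(1), of w] by (simp flip: mult.assoc)
      ultimately show "w * l \<in> {l. s0 * l \<in> W \<star> ((E \<star> E) \<star> M)}" by simp
    qed
    with that LWL show ?thesis by (auto simp: r_def L_def sprod_assoc)
  qed
  have rE: "r \<subseteq> E" "r \<subseteq> W"
  proof -
    show "r \<subseteq> E" unfolding r_def
      by (rule sprod_least[OF ideal_addgroup[OF E(2)]]) (use ideal_left[OF E(2)] WR in blast)
    show "r \<subseteq> W" unfolding r_def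
      by (rule sprod_least[OF ideal_addgroup[OF W]]) (use ideal_right[OF W] ER in blast)
  qed
  let ?pR = "{of_nat p * y | y. y \<in> R}"
  have pR: "is_ideal R ?pR"
  proof (rule idealI[OF addgroup_of_nat_image[OF addgroup]])
    show "?pR \<subseteq> R" using addgroup_of_nat[OF addgroup] by blast
  next
    fix t x assume "t \<in> R" "x \<in> ?pR"
    then obtain u where u: "x = of_nat p * u" "u \<in> R" by blast
    have "t * x = of_nat p * (t * u)" "x * t = of_nat p * (u * t)"
      using u by (metis mult.assoc mult_of_nat_commute, simp add: mult.assoc)
    then show "t * x \<in> ?pR" "x * t \<in> ?pR"
      using subring_mult[OF subring] \<open>t \<in> R\<close> u(2) by blast+
  qed
  have "of_nat p \<in> ?pR" using subring_1[OF subring] by force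
  then obtain Qs where Qs: "\<And>Q. Q \<in> set Qs \<Longrightarrow> is_prime_ideal R Q \<and> of_nat p \<in> Q" "ideal_prod R Qs \<subseteq> ?pR"
    using ideal_contains_prime_product[OF p_pos pR] by blast
  \<comment> \<open>Locally \<open>r\<close> lies in every prime over \<open>p\<close>: in
    \<open>P\<close> through \<open>W\<close>, in the others through the minimality of
    \<open>E\<close>.\<close>
  have step: "\<exists>s\<in>T. \<forall>x\<in>r. s * x \<in> Q" if "Q \<in> set Qs" for Q
  proof (rule uniform_multiplier[OF p_pos])
    have Q: "is_ideal R Q" "is_prime_ideal R Q" "of_nat p \<in> Q" using Qs(1)[OF that] prime_ideal by auto
    show "is_addgroup Q" by (rule ideal_addgroup[OF Q(1)])
    show "of_nat p * y \<in> Q" if "y \<in> R" for y by (rule ideal_right[OF Q(1) that Q(3)])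
    show "t * x \<in> Q" if "t \<in> R" "x \<in> Q" for t x by (rule ideal_left[OF Q(1) that])
    show "r \<subseteq> loc Q"
    proof (cases "Q \<subseteq> P")
      case True
      then have "Q = P" by (rule prime_ideal_eq[OF p_pos Q(3,2) prime_P])
      then show ?thesis using rE WP loc_superset[OF ideal_subset[OF Q(1)]] by blast
    next
      case False
      then show ?thesis using rE Eloc[OF Q(1)] by blast
    qed
  qed
  \<comment> \<open>Nakayama's lemma in the form needed: passing from \<open>L\<close> to
    \<open>r L\<close> once for each factor of a product of primes inside \<open>p R\<close> leads
    to \<open>t L \<subseteq> p L\<close>.\<close>
  have "\<exists>t\<in>T. \<forall>l\<in>L. t * l \<in> ideal_prod R Qs' \<star> L" if "set Qs' \<subseteq> set Qs" for Qs'
    using that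
  proof (induction Qs')
    case Nil
    have "1 * l \<in> R \<star> L" if "l \<in> L" for l using sprodI[OF subring_1[OF subring] that] .
    then show ?case using T_one by (intro bexI[of _ 1]) auto
  next
    case (Cons Q Qs')
    then obtain t where t: "t \<in> T" "\<And>l. l \<in> L \<Longrightarrow> t * l \<in> ideal_prod R Qs' \<star> L" by auto
    obtain s where s: "s \<in> T" "\<And>x. x \<in> r \<Longrightarrow> s * x \<in> Q" using step[of Q] Cons.prems
      by (meson list.set_intros(1) subsetD)
    have "r \<star> L \<subseteq> {x. s * t * x \<in> Q \<star> (ideal_prod R Qs' \<star> L)}"
    proof (rule sprod_least[OF addgroup_vimage_right[OF addgroup_sprod]])
      fix x l assume "x \<in> r" "l \<in> L"
      then have "(s * x) * (t * l) \<in> Q \<star> (ideal_prod R Qs' \<star> L)" using s(2) t(2) sprodI by blast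
      moreover have "(s * x) * (t * l) = s * t * (x * l)"
        using T_central[OF t(1), of x] by (metis mult.assoc)
      ultimately show "x * l \<in> {x. s * t * x \<in> Q \<star> (ideal_prod R Qs' \<star> L)}" by simp
    qed
    then have "s * t * s0 * l \<in> ideal_prod R (Q # Qs') \<star> L" if "l \<in> L" for l
      using s0L[OF that] by (auto simp: sprod_assoc mult.assoc)
    then show ?case using T_mult[OF T_mult[OF s(1) t(1)] s0(1)] by blast
  qed
  then obtain t where t: "t \<in> T" "\<And>l. l \<in> L \<Longrightarrow> t * l \<in> ideal_prod R Qs \<star> L" by blast
  have pL: "\<exists>l'\<in>L. t * l = of_nat p * l'" if "l \<in> L" for l
  proof -
    have "?pR \<star> L \<subseteq> {of_nat p * y | y. y \<in> L}"
    proof (rule sprod_least[OF addgroup_of_nat_image])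
      show "is_addgroup L" by (simp add: L_def addgroup_sprod)
      fix x y assume "x \<in> ?pR" "y \<in> L"
      then obtain u where u: "x = of_nat p * u" "u \<in> R" by blast
      have "R \<star> L \<subseteq> L" unfolding L_def sprod_assoc[symmetric] by (intro sprod_mono order_refl RE)
      then have "u * y \<in> L" using sprodI[OF u(2) \<open>y \<in> L\<close>] by blast
      with u show "x * y \<in> {of_nat p * y | y. y \<in> L}" by (auto simp: mult.assoc)
    qed
    with t(2)[OF that] sprod_mono[OF Qs(2) order_refl, of L] show ?thesis by blast
  qed
  have pkL: "\<exists>l'\<in>L. t ^ k * l = of_nat (p ^ k) * l'" if "l \<in> L" for l k
  proof (induction k)
    case 0
    then show ?case using that by auto
  next
    case (Suc k)
    then obtain l' where l': "l' \<in> L" "t ^ k * l = of_nat (p ^ k) * l'" by blast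
    obtain l'' where l'': "l'' \<in> L" "t * l' = of_nat p * l''" using pL[OF l'(1)] by blast
    have "t ^ Suc k * l = t * (of_nat (p ^ k) * l')" using l'(2) by (simp add: mult.assoc)
    also have "\<dots> = of_nat (p ^ k) * (t * l')" using T_central[OF t(1)] by (metis mult.assoc)
    also have "\<dots> = of_nat (p ^ Suc k) * l''"
      using l''(2) by (metis mult.assoc of_nat_mult power_Suc2)
    finally show ?case using l''(1) by blast
  qed
  obtain n where n: "n > 0" "\<And>x. x \<in> M \<Longrightarrow> of_nat n * x \<in> R" using MR by (auto simp: is_bounded_def)
  \<comment> \<open>In the denominator \<open>n\<close> of \<open>M\<close> the
    \<open>p\<close>-part \<open>p ^ a\<close> is the obstacle, since \<open>n'\<close> is outside
    \<open>P\<close>; the exponent \<open>Suc a\<close> below leaves one factor \<open>p\<close>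
    over.\<close>
  obtain a n' where a: "n = n' * p ^ a" "\<not> p dvd n'"
    using n(1) multiplicity_decompose'[of n p] p(1) by (metis mult.commute not_prime_unit neq0_conv)
  have "L \<star> M \<subseteq> L" by (rule LM)
  have "L \<subseteq> M"
    unfolding L_def by (rule sprod_least[OF M.addgroup]) (use ER RM subring_mult[OF M.subring] in blast)
  have n'P: "of_nat n' \<notin> P"
  proof
    assume n'P: "of_nat n' \<in> P"
    have "coprime p n'" using p(1) a(2) by (simp add: prime_imp_coprime)
    then obtain u v :: int where "u * int p + v * int n' = 1"
      using bezout_int[of "int p" "int n'"] by auto
    then have "of_int u * of_nat p + of_int v * of_nat n' = (1::'a)"
      by (metis of_int_1 of_int_add of_int_mult of_int_of_nat_eq)
    moreover have "of_int u * of_nat p + of_int v * of_nat n' \<in> P"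
      using addgroup_add addgroup_of_int ideal_addgroup[OF prime_ideal[OF prime_P]] p(2) n'P by blast
    ultimately show False using one_notin_prime[OF prime_P] by simp
  qed
  have "E \<subseteq> P"
  proof
    fix e assume e: "e \<in> E"
    then obtain l where l: "l \<in> L" "t ^ (Suc a) * e = of_nat (p ^ Suc a) * l" using pkL EL by blast
    have "of_nat n' * (t ^ Suc a * e) = of_nat p * (of_nat n * l)"
    proof -
      have "n' * p ^ Suc a = p * n" by (simp add: a(1))
      then show ?thesis unfolding l(2) by (metis mult.assoc of_nat_mult)
    qed
    also have "\<dots> \<in> P"
      using ideal_right[OF prime_ideal[OF prime_P] n(2) p(2)] l(1) \<open>L \<subseteq> M\<close> by blast
    finally have *: "of_nat n' * (t ^ Suc a * e) \<in> P" .
    have eR: "e \<in> R" using e ER by blast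
    have "t ^ Suc a * e \<in> P"
      using prime_ideal_central[OF prime_P _ _ _ *] n'P subring_of_nat[OF subring]
        subring_mult[OF subring T_R[OF T_power[OF t(1)]] eR] mult_of_nat_commute[of n'] by blast
    then show "e \<in> P" by (rule T_cancel[OF T_power[OF t(1)] eR])
  qed
  with E(4) show False by simp
qed

end

section \<open>Units and idempotents modulo an integer\<close>

lemma one_minus_power:
  fixes y :: "'a::ring_1"
  shows "(1 - y) * (\<Sum>i<k. y ^ i) = 1 - y ^ k" "(\<Sum>i<k. y ^ i) * (1 - y) = 1 - y ^ k"
proof -
  show *: "(1 - y) * (\<Sum>i<k. y ^ i) = 1 - y ^ k"
  proof (induction k)
    case (Suc k)
    have "(1 - y) * (\<Sum>i<Suc k. y ^ i) = (1 - y) * (\<Sum>i<k. y ^ i) + (1 - y) * y ^ k"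
      by (simp add: distrib_left)
    then show ?case by (simp only: Suc.IH) (simp add: algebra_simps)
  qed simp
  have "(\<Sum>i<k. y ^ i) * y = y * (\<Sum>i<k. y ^ i)"
    by (simp add: sum_distrib_left sum_distrib_right power_commutes)
  then show "(\<Sum>i<k. y ^ i) * (1 - y) = 1 - y ^ k"
    using * by (simp add: algebra_simps)
qed

lemma ideal_prod_subset:
  assumes "is_subring R" "\<And>P. P \<in> set Ps \<Longrightarrow> is_ideal R P" "Q \<in> set Ps"
  shows "ideal_prod R Ps \<subseteq> Q"
  using assms(2,3)
proof (induction Ps)
  case (Cons P Ps)
  have P: "is_ideal R P" and PR: "is_ideal R (ideal_prod R Ps)"
    using Cons.prems ideal_prod_ideal[OF assms(1), of Ps] by auto
  have "P \<star> ideal_prod R Ps \<subseteq> P"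
    by (rule sprod_least[OF ideal_addgroup[OF P]]) (use ideal_right[OF P] ideal_subset[OF PR] in blast)
  moreover have "P \<star> ideal_prod R Ps \<subseteq> ideal_prod R Ps"
    by (rule sprod_least[OF ideal_addgroup[OF PR]]) (use ideal_left[OF PR] ideal_subset[OF P] in blast)
  ultimately show ?case using Cons by auto
qed simp

lemma ideal_generated:
  assumes R: "is_subring R" and P: "is_ideal R P" and f: "f \<in> R"
  shows "is_ideal R (addhull (P \<union> {a * f * b | a b. a \<in> R \<and> b \<in> R}))" (is "is_ideal R (addhull ?G)")
proof (rule idealI[OF addgroup_addhull])
  show "addhull ?G \<subseteq> R"
    by (rule addhull_least[OF subring_addgroup[OF R]])
      (use ideal_subset[OF P] f subring_mult[OF R] in auto)
next
  fix r x assume r: "r \<in> R" and x: "x \<in> addhull ?G"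
  have G: "r * g \<in> ?G" "g * r \<in> ?G" if g: "g \<in> ?G" for g
  proof -
    consider "g \<in> P" | a b where "g = a * f * b" "a \<in> R" "b \<in> R" using g by blast
    then have "r * g \<in> ?G \<and> g * r \<in> ?G"
    proof cases
      case 1
      then show ?thesis using ideal_left[OF P r] ideal_right[OF P r] by blast
    next
      case 2
      have "r * g = (r * a) * f * b" "g * r = a * f * (b * r)" by (simp_all add: 2 mult.assoc)
      with 2 subring_mult[OF R r] subring_mult[OF R _ r] show ?thesis by blast
    qed
    then show "r * g \<in> ?G" "g * r \<in> ?G" by auto
  qed
  have "addhull ?G \<subseteq> {x. r * x \<in> addhull ?G}"
    by (rule addhull_least[OF addgroup_vimage_right[OF addgroup_addhull]])
      (use G(1) addhull_superset[of ?G] in blast)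
  with x show "r * x \<in> addhull ?G" by blast
  have "addhull ?G \<subseteq> {x. x * r \<in> addhull ?G}"
    by (rule addhull_least[OF addgroup_vimage_left[OF addgroup_addhull]])
      (use G(2) addhull_superset[of ?G] in blast)
  with x show "x * r \<in> addhull ?G" by blast
qed

context rational_order
begin

lemma multiples_ideal: "is_ideal R {of_nat n * y | y. y \<in> R}" (is "is_ideal R ?N")
proof (rule idealI[OF addgroup_of_nat_image[OF addgroup]])
  show "?N \<subseteq> R" using addgroup_of_nat[OF addgroup] by blast
next
  fix t x assume "t \<in> R" "x \<in> ?N"
  then obtain u where u: "x = of_nat n * u" "u \<in> R" by blast
  have "t * x = of_nat n * (t * u)" "x * t = of_nat n * (u * t)"
    using u by (metis mult.assoc mult_of_nat_commute, simp add: mult.assoc)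
  then show "t * x \<in> ?N" "x * t \<in> ?N"
    using subring_mult[OF subring] \<open>t \<in> R\<close> u(2) by blast+
qed

text \<open>The powers of \<open>y\<close> modulo \<open>n R\<close> are eventually periodic, and an
  exponent that is a multiple of the period and lies beyond the preperiod gives an
  idempotent.\<close>

lemma power_idempotent:
  assumes "n > 0" "y \<in> R"
  shows "\<exists>k>0. y ^ k * y ^ k - y ^ k \<in> {of_nat n * y | y. y \<in> R}"
proof -
  let ?N = "{of_nat n * y | y. y \<in> R}"
  note N = multiples_ideal[of n]
  note Nadd = ideal_addgroup[OF N]
  obtain F where F: "finite F" "F \<subseteq> R" "\<And>x. x \<in> R \<Longrightarrow> \<exists>f\<in>F. \<exists>y\<in>R. x = f + of_nat n * y"
    using finite_quotient[OF assms(1)] by blast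
  obtain g where g: "\<And>x. x \<in> R \<Longrightarrow> g x \<in> F \<and> (\<exists>y\<in>R. x = g x + of_nat n * y)"
    using F(3) by metis
  have yR: "y ^ i \<in> R" for i by (rule subring_power[OF subring assms(2)])
  have "(\<lambda>i. g (y ^ i)) ` UNIV \<subseteq> F" using g yR by blast
  then have "\<not> inj (\<lambda>i::nat. g (y ^ i))" using F(1) finite_subset finite_imageD infinite_UNIV_nat by blast
  then obtain i j :: nat where ij: "i < j" "g (y ^ i) = g (y ^ j)"
    unfolding inj_def by (metis linorder_neqE_nat)
  obtain u v where uv: "u \<in> R" "v \<in> R" "y ^ i = g (y ^ i) + of_nat n * u" "y ^ j = g (y ^ j) + of_nat n * v"
    using g[OF yR[of i]] g[OF yR[of j]] by blast
  have "y ^ j - y ^ i = of_nat n * (v - u)"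
    using uv(3,4) ij(2) by (simp add: algebra_simps)
  then have base: "y ^ j - y ^ i \<in> ?N" using addgroup_diff[OF addgroup uv(2,1)] by blast
  define d where "d = j - i"
  have d: "d > 0" "j = i + d" using ij by (auto simp: d_def)
  have step: "y ^ (m + d) - y ^ m \<in> ?N" if "m \<ge> i" for m
  proof -
    have "y ^ (m + d) - y ^ m = y ^ (m - i) * (y ^ j - y ^ i)"
      using that by (simp add: d(2) right_diff_distrib flip: power_add)
    then show ?thesis using ideal_left[OF N yR base] by simp
  qed
  have multi: "y ^ (m + d * t) - y ^ m \<in> ?N" if "m \<ge> i" for m t
  proof (induction t)
    case 0
    then show ?case using addgroup_0[OF Nadd] by simp
  next
    case (Suc t)
    have "y ^ (m + d * Suc t) - y ^ m = (y ^ ((m + d * t) + d) - y ^ (m + d * t)) + (y ^ (m + d * t) - y ^ m)"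
      by (simp add: algebra_simps)
    then show ?case using addgroup_add[OF Nadd step[of "m + d * t"] Suc] that by simp
  qed
  \<comment> \<open>A multiple of the period \<open>d\<close> that is at least the preperiod
    \<open>i\<close>; \<open>Suc\<close> keeps it positive when \<open>i\<close> is 0.\<close>
  have "d * Suc i \<ge> i" using d(1) by (metis Suc_leD le_square mult_le_mono1 nat_mult_1 Suc_leI One_nat_def)
  then have "y ^ (d * Suc i + d * Suc i) - y ^ (d * Suc i) \<in> ?N" by (rule multi)
  then show ?thesis using d(1) by (intro exI[of _ "d * Suc i"]) (auto simp flip: power_add)
qed

end

context max_involution_order
begin

theorem prime_inv_stable:
  assumes P: "is_prime_ideal R P" and n: "n > 0" "of_nat n \<in> P"
  shows "\<sigma> ` P = P"
proof -
  \<comment> \<open>The least positive integer in \<open>P\<close> divides every natural number in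
    \<open>P\<close>, by division with remainder; it is a prime number because \<open>P\<close> is
    prime.\<close>
  define n0 where "n0 = (LEAST n. n > 0 \<and> of_nat n \<in> P)"
  have n0: "n0 > 0" "of_nat n0 \<in> P"
    using LeastI[of "\<lambda>n. n > 0 \<and> of_nat n \<in> P" n] n by (auto simp: n0_def)
  have min: "n0 \<le> k" if "k > 0" "of_nat k \<in> P" for k
    using Least_le[of "\<lambda>n. n > 0 \<and> of_nat n \<in> P" k] that by (simp add: n0_def)
  have one: "1 \<notin> P" using P ideal_one[OF _ subring] by (auto simp: is_prime_ideal_def)
  have "Factorial_Ring.prime n0"
  proof (rule prime_natI)
    show "n0 \<ge> 2" using n0 one by (cases "n0 = 1") auto
    fix a b assume ab: "n0 dvd a * b"
    show "n0 dvd a \<or> n0 dvd b"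
    proof (rule ccontr)
      assume "\<not> ?thesis"
      moreover have "n0 dvd k" if "of_nat k \<in> P" for k
      proof (rule ccontr)
        assume "\<not> n0 dvd k"
        then have "k mod n0 > 0" by (simp add: mod_greater_zero_iff_not_dvd)
        moreover have "of_nat (k mod n0) \<in> P"
        proof -
          have "of_nat (k mod n0) = (of_nat k - of_nat (k div n0) * of_nat n0 :: 'a)"
            by (metis add_diff_cancel_left' div_mult_mod_eq of_nat_add of_nat_mult)
          then show ?thesis
            using addgroup_diff[OF ideal_addgroup[OF prime_ideal[OF P]] that
              ideal_left[OF prime_ideal[OF P] subring_of_nat[OF subring] n0(2)]] by simp
        qed
        ultimately have "n0 \<le> k mod n0" by (rule min)
        then show False using n0(1) by (meson mod_less_divisor not_le)
      qed
      moreover obtain c where "a * b = n0 * c" using ab by blast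
      then have "of_nat a * of_nat b = (of_nat n0 * of_nat c :: 'a)" by (metis of_nat_mult)
      then have "of_nat a * of_nat b \<in> P"
        using ideal_right[OF prime_ideal[OF P] subring_of_nat[OF subring] n0(2)] by simp
      then have "of_nat a \<in> P \<or> of_nat b \<in> P"
        by (rule prime_ideal_central[OF P subring_of_nat[OF subring] subring_of_nat[OF subring]
              mult_of_nat_commute])
      ultimately show False by blast
    qed
  qed
  then interpret max_involution_order_prime R \<sigma> C P n0
    by unfold_locales (use P n0 in auto)
  show ?thesis using inv_prime_subset image_mono[OF inv_prime_subset, of \<sigma>] by simp
qed

text \<open>Over a residue field with two elements units need not generate \<open>R\<close> modulo \<open>N\<close>: they do not separate
  the factors of a product of several such fields. The symmetric elements do, as the
  factors are preserved by \<open>\<sigma>\<close>.\<close>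

theorem generated_by_units_and_symmetric:
  assumes N: "N > 0" and S: "is_subring S"
    and multiples: "\<And>x. x \<in> R \<Longrightarrow> of_nat N * x \<in> S"
    and symmetric: "\<And>x. x \<in> R \<Longrightarrow> \<sigma> x = x \<Longrightarrow> x \<in> S"
    and units: "\<And>u v. u \<in> R \<Longrightarrow> v \<in> R \<Longrightarrow> u * v - 1 \<in> {of_nat N * y | y. y \<in> R} \<Longrightarrow>
      v * u - 1 \<in> {of_nat N * y | y. y \<in> R} \<Longrightarrow> u \<in> S"
  shows "R \<subseteq> S"
proof -
  define J where "J = {of_nat N * y | y. y \<in> R}"
  have J: "is_ideal R J" unfolding J_def by (rule multiples_ideal)
  note Jadd = ideal_addgroup[OF J] and Sadd = subring_addgroup[OF S] and R1 = subring_1[OF subring]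
  note Rm = subring_mult[OF subring] and Rd = addgroup_diff[OF addgroup]
  have JS: "x \<in> S" if "x \<in> J" for x using that multiples by (auto simp: J_def)
  have NJ: "of_nat N \<in> J" using R1 by (force simp: J_def)
  \<comment> \<open>\<open>1 + x\<close> is a unit modulo \<open>J\<close> by the geometric series,
    so it belongs to \<open>S\<close>, and \<open>1\<close> can be subtracted.\<close>
  have nil: "x \<in> S" if x: "x \<in> R" "x ^ k \<in> J" for x k
  proof -
    define v where "v = (\<Sum>i<k. (- x) ^ i)"
    have mx: "- x \<in> R" by (rule addgroup_minus[OF addgroup x(1)])
    have "v \<in> R" unfolding v_def by (rule addgroup_sum[OF addgroup subring_power[OF subring mx]])
    moreover have "- ((- x) ^ k) \<in> J"
    proof -
      have "(- x) ^ k = x ^ k \<or> (- x) ^ k = - (x ^ k)" by (cases "even k") auto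
      then show ?thesis using x(2) addgroup_minus[OF Jadd] by auto
    qed
    then have "(1 - - x) * v - 1 \<in> J" "v * (1 - - x) - 1 \<in> J"
      unfolding v_def one_minus_power by simp_all
    ultimately have "1 - - x \<in> S" using units[of "1 - - x" v] Rd[OF R1 mx] by (simp add: J_def)
    then show ?thesis using addgroup_diff[OF Sadd _ subring_1[OF S]] by fastforce
  qed
  define Sp where "Sp = {Q. is_prime_ideal R Q \<and> of_nat N \<in> Q}"
  have rad: "x \<in> S" if x: "x \<in> R" "\<And>Q. Q \<in> Sp \<Longrightarrow> x \<in> Q" for x
  proof -
    obtain Ps where Ps: "\<And>Q. Q \<in> set Ps \<Longrightarrow> Q \<in> Sp" "ideal_prod R Ps \<subseteq> J"
      using ideal_contains_prime_product[OF N J NJ] by (auto simp: Sp_def)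
    have "x ^ length Qs \<in> ideal_prod R Qs" if "set Qs \<subseteq> set Ps" for Qs
      using that
    proof (induction Qs)
      case (Cons Q Qs)
      then show ?case using sprodI[of x Q "x ^ length Qs"] x(2)[OF Ps(1)] by auto
    qed (simp add: R1)
    then have "x ^ length Ps \<in> J" using Ps(2) by blast
    then show ?thesis by (rule nil[OF x(1)])
  qed
  \<comment> \<open>The elements of \<open>D P\<close> vanish in all simple factors of
    \<open>R\<close> modulo the radical except the one that belongs to \<open>P\<close>.\<close>
  define D where "D P = {y \<in> R. \<forall>Q\<in>Sp. Q \<noteq> P \<longrightarrow> y \<in> Q}" for P
  have DS: "y \<in> S" if P: "P \<in> Sp" and y: "y \<in> D P" for P y
  proof -
    have Pp: "is_prime_ideal R P" "of_nat N \<in> P" using P by (auto simp: Sp_def)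
    note Pid = prime_ideal[OF Pp(1)]
    have yR: "y \<in> R" using y by (simp add: D_def)
    obtain k where k: "k > 0" "y ^ k * y ^ k - y ^ k \<in> J"
      using power_idempotent[OF N yR] by (auto simp: J_def)
    \<comment> \<open>Fitting's decomposition: modulo \<open>J\<close>, \<open>y\<close> is
      invertible on the part cut out by the idempotent \<open>e\<close> and nilpotent on that of
      \<open>f\<close>.\<close>
    define e where "e = y ^ k"
    define f where "f = 1 - e"
    define y' where "y' = y ^ (k - 1)"
    have h: "e * e - e \<in> J" using k(2) by (simp add: e_def)
    have R: "e \<in> R" "f \<in> R" "y' \<in> R"
      using subring_power[OF subring yR] Rd[OF R1] by (auto simp: e_def f_def y'_def)
    have comm: "y * e = e * y" "y' * e = e * y'" "y * y' = e" "y' * y = e"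
    proof -
      show "y * e = e * y" unfolding e_def by (rule power_commutes[symmetric])
      show "y' * e = e * y'" by (simp only: e_def y'_def add.commute flip: power_add)
      show "y * y' = e" "y' * y = e"
        by (simp_all only: e_def y'_def Suc_diff_1[OF k(1)] flip: power_Suc power_Suc2)
    qed
    have fe: "f * e \<in> J" "e * f \<in> J" "f * f - f \<in> J"
    proof -
      have "f * e = - (e * e - e)" "e * f = - (e * e - e)" "f * f - f = e * e - e"
        by (simp_all add: f_def algebra_simps)
      then show "f * e \<in> J" "e * f \<in> J" "f * f - f \<in> J" using h addgroup_minus[OF Jadd h] by simp_all
    qed
    have eQ: "e \<in> Q" if "Q \<in> Sp" "Q \<noteq> P" for Q
    proof -
      have "y \<in> Q" "is_ideal R Q" using y that prime_ideal by (auto simp: D_def Sp_def)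
      then have "y' * y \<in> Q" using ideal_left R(3) by blast
      then show ?thesis by (simp add: comm)
    qed
    have in_S: "z \<in> S" if "z \<in> R" "z \<in> P" "\<And>Q. Q \<in> Sp \<Longrightarrow> Q \<noteq> P \<Longrightarrow> z \<in> Q" for z
      using rad[OF that(1)] that(2,3) by blast
    \<comment> \<open>If \<open>f \<in> P\<close>, then \<open>e\<close> is the identity in the
      factor of \<open>P\<close>, and it is symmetric up to the radical because \<open>P\<close> is
      \<open>\<sigma>\<close>-stable: \<open>e * \<sigma> e\<close> is symmetric and
      \<open>e * \<sigma> f\<close> lies in every prime over \<open>N\<close>.\<close>
    have eS: "e \<in> S"
    proof (cases "f \<in> P")
      case True
      have sR: "\<sigma> x \<in> R" if "x \<in> R" for x using that inv_R by blast
      have "\<sigma> f \<in> P" using True prime_inv_stable[OF Pp(1) N Pp(2)] by blast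
      then have "e * \<sigma> f \<in> P" by (rule ideal_left[OF Pid R(1)])
      moreover have "e * \<sigma> f \<in> Q" if "Q \<in> Sp" "Q \<noteq> P" for Q
      proof -
        have "is_ideal R Q" using that(1) prime_ideal by (auto simp: Sp_def)
        then show ?thesis by (rule ideal_right[OF _ sR[OF R(2)] eQ[OF that]])
      qed
      ultimately have "e * \<sigma> f \<in> S" using in_S Rm[OF R(1) sR[OF R(2)]] by blast
      moreover have "e * \<sigma> e \<in> S"
        by (rule symmetric) (use Rm[OF R(1) sR[OF R(1)]] in \<open>simp_all add: inv_mult\<close>)
      moreover have "e = e * \<sigma> f + e * \<sigma> e" by (simp add: f_def inv_diff algebra_simps)
      ultimately show ?thesis using addgroup_add[OF Sadd] by metis
    next
      case fP: False
      \<comment> \<open>In the Peirce decomposition the parts \<open>e a f\<close> and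
        \<open>f b e\<close> square to zero modulo \<open>J\<close>, so they belong to
        \<open>S\<close>. Their products give \<open>e R f R e\<close>, and the ideal generated by
        \<open>f\<close> and \<open>P\<close> is \<open>R\<close> because \<open>P\<close> is
        maximal; so \<open>e * e\<close> is reached, which is \<open>e\<close> modulo
        \<open>J\<close>.\<close>
      have square_zero: "x \<in> S" if "x \<in> R" "x * x \<in> J" for x
        using nil[OF that(1), of 2] that(2) by (simp add: power2_eq_square)
      have eaf: "e * a * f \<in> S" if "a \<in> R" for a
      proof (rule square_zero)
        have "(e * a) * (f * e) * (a * f) \<in> J"
          using ideal_right[OF J _ ideal_left[OF J _ fe(1)]] Rm R that by blast
        then show "e * a * f * (e * a * f) \<in> J" by (simp add: mult.assoc)
      qed (use Rm R that in blast)
      have fae: "f * a * e \<in> S" if "a \<in> R" for a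
      proof (rule square_zero)
        have "(f * a) * (e * f) * (a * e) \<in> J"
          using ideal_right[OF J _ ideal_left[OF J _ fe(2)]] Rm R that by blast
        then show "f * a * e * (f * a * e) \<in> J" by (simp add: mult.assoc)
      qed (use Rm R that in blast)
      let ?I = "addhull (P \<union> {a * f * b | a b. a \<in> R \<and> b \<in> R})"
      have "f = 1 * f * 1" by simp
      then have "f \<in> ?I" using addhull_superset[of "P \<union> {a * f * b | a b. a \<in> R \<and> b \<in> R}"] R1 by blast
      moreover have "P \<subseteq> ?I" using addhull_superset by blast
      ultimately have IR: "?I = R"
        using prime_ideal_maximal[OF N Pp(2,1) ideal_generated[OF subring Pid R(2)]] fP by blast
      have "?I \<subseteq> {z. e * z * e \<in> S}"
      proof (rule addhull_least)
        show "is_addgroup {z. e * z * e \<in> S}"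
          using Sadd by (auto simp: is_addgroup_def algebra_simps)
        have "e * z * e \<in> S" if z: "z \<in> P" for z
        proof (rule in_S)
          have zR: "z \<in> R" using z ideal_subset[OF Pid] by blast
          show "e * z * e \<in> R" using Rm R zR by blast
          show "e * z * e \<in> P" by (intro ideal_left[OF Pid R(1)] ideal_right[OF Pid R(1)] z)
          show "e * z * e \<in> Q" if "Q \<in> Sp" "Q \<noteq> P" for Q
          proof -
            have "is_ideal R Q" using that prime_ideal by (auto simp: Sp_def)
            then show ?thesis using ideal_left[OF _ Rm[OF R(1) zR] eQ[OF that]] by blast
          qed
        qed
        moreover have "e * (a * f * b) * e \<in> S" if ab: "a \<in> R" "b \<in> R" for a b
        proof -
          have "e * (a * f * b) * e = (e * a * f) * (f * b * e) - (e * a) * (f * f - f) * (b * e)"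
            by (simp add: algebra_simps)
          moreover have "(e * a) * (f * f - f) * (b * e) \<in> S"
            by (intro JS ideal_left[OF J] ideal_right[OF J] fe(3) Rm R ab)
          ultimately show ?thesis
            using addgroup_diff[OF Sadd subring_mult[OF S eaf[OF ab(1)] fae[OF ab(2)]]] by metis
        qed
        ultimately show "P \<union> {a * f * b | a b. a \<in> R \<and> b \<in> R} \<subseteq> {z. e * z * e \<in> S}" by blast
      qed
      then have "e * 1 * e \<in> S" using IR R1 by blast
      then show ?thesis using addgroup_diff[OF Sadd _ JS[OF h], of "e * e"] by simp
    qed
    \<comment> \<open>This is the nilpotent part: its \<open>k\<close>-th power contains the factor
      \<open>f * e\<close>.\<close>
    have "f * y \<in> S"
    proof (rule nil)
      have fy: "y * f = f * y" by (simp add: f_def algebra_simps comm)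
      have "(f * y) ^ j = f ^ j * y ^ j" for j
      proof (induction j)
        case (Suc j)
        have "f * y * (f ^ j * y ^ j) = f * (y * f ^ j) * y ^ j" by (simp add: mult.assoc)
        also have "y * f ^ j = f ^ j * y" using power_commuting_commutes[of f y j] fy by simp
        finally show ?case using Suc by (simp add: mult.assoc)
      qed simp
      then have "(f * y) ^ k = f ^ (k - 1) * (f * e)"
        using k(1) by (metis e_def mult.assoc power_minus_mult)
      then show "(f * y) ^ k \<in> J"
        using ideal_left[OF J subring_power[OF subring R(2)] fe(1)] by simp
    qed (use Rm R yR in blast)
    \<comment> \<open>Completing the invertible part by \<open>f\<close> gives a unit modulo
      \<open>J\<close> with inverse \<open>e * y' + f\<close>, because
      \<open>y * y' = e\<close>.\<close>
    moreover have "e * y + f \<in> S"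
    proof (rule units)
      have *: "(e * y + f) * (e * y' + f) - 1 = (e * e - e) * (e + 2 - y - y')"
        "(e * y' + f) * (e * y + f) - 1 = (e * e - e) * (e + 2 - y - y')"
      proof -
        have c2: "y * (e * z) = e * (y * z)" "y' * (e * z) = e * (y' * z)" for z
          using comm by (metis mult.assoc)+
        show "(e * y + f) * (e * y' + f) - 1 = (e * e - e) * (e + 2 - y - y')"
          "(e * y' + f) * (e * y + f) - 1 = (e * e - e) * (e + 2 - y - y')"
          by (simp_all add: f_def algebra_simps comm c2 mult_2 mult_2_right)
      qed
      have "e + 2 - y - y' \<in> R"
        using R yR subring_of_nat[OF subring, of 2] addgroup_add[OF addgroup] Rd by simp
      then have "(e * e - e) * (e + 2 - y - y') \<in> J" by (rule ideal_right[OF J _ h])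
      then show "(e * y + f) * (e * y' + f) - 1 \<in> {of_nat N * y | y. y \<in> R}"
        "(e * y' + f) * (e * y + f) - 1 \<in> {of_nat N * y | y. y \<in> R}"
        unfolding * by (simp_all add: J_def)
      show "e * y + f \<in> R" "e * y' + f \<in> R" by (intro addgroup_add[OF addgroup] Rm R yR)+
    qed
    moreover have "f \<in> S" unfolding f_def by (rule addgroup_diff[OF Sadd subring_1[OF S] eS])
    moreover have "y = (e * y + f - f) + f * y" by (simp add: f_def algebra_simps)
    ultimately show ?thesis using addgroup_add[OF Sadd addgroup_diff[OF Sadd]] by metis
  qed
  \<comment> \<open>It remains to see that \<open>J\<close> and the \<open>D P\<close> add up to
    \<open>R\<close>. Otherwise their sum lies in a prime \<open>P\<close>, which would then contain
    the product of all other primes over \<open>N\<close>.\<close>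
  let ?D = "addhull (J \<union> \<Union> (D ` Sp))"
  have Did: "is_ideal R (D P)" for P
    unfolding D_def
  proof (rule idealI)
    show "is_addgroup {y \<in> R. \<forall>Q\<in>Sp. Q \<noteq> P \<longrightarrow> y \<in> Q}"
      using addgroup by (auto simp: is_addgroup_def Sp_def is_prime_ideal_def is_ideal_def)
  next
    fix r x assume "r \<in> R" "x \<in> {y \<in> R. \<forall>Q\<in>Sp. Q \<noteq> P \<longrightarrow> y \<in> Q}"
    then show "r * x \<in> {y \<in> R. \<forall>Q\<in>Sp. Q \<noteq> P \<longrightarrow> y \<in> Q}" "x * r \<in> {y \<in> R. \<forall>Q\<in>Sp. Q \<noteq> P \<longrightarrow> y \<in> Q}"
      using Rm by (auto simp: Sp_def is_prime_ideal_def is_ideal_def)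
  qed auto
  have DR: "is_ideal R ?D"
  proof (rule idealI[OF addgroup_addhull])
    show "?D \<subseteq> R"
      by (rule addhull_least[OF addgroup]) (use ideal_subset[OF J] in \<open>auto simp: D_def\<close>)
  next
    fix r x assume r: "r \<in> R" and x: "x \<in> ?D"
    have *: "r * z \<in> J \<union> \<Union> (D ` Sp)" "z * r \<in> J \<union> \<Union> (D ` Sp)" if "z \<in> J \<union> \<Union> (D ` Sp)" for z
    proof -
      have "(\<exists>I. is_ideal R I \<and> z \<in> I \<and> I \<subseteq> J \<union> \<Union> (D ` Sp))"
        using that J Did by blast
      then obtain I where I: "is_ideal R I" "z \<in> I" "I \<subseteq> J \<union> \<Union> (D ` Sp)" by blast
      then show "r * z \<in> J \<union> \<Union> (D ` Sp)" "z * r \<in> J \<union> \<Union> (D ` Sp)"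
        using subsetD[OF I(3) ideal_left[OF I(1) r I(2)]] subsetD[OF I(3) ideal_right[OF I(1) r I(2)]]
        by auto
    qed
    have "?D \<subseteq> {x. r * x \<in> ?D}"
      by (rule addhull_least[OF addgroup_vimage_right[OF addgroup_addhull]])
        (use *(1) addhull_superset[of "J \<union> \<Union> (D ` Sp)"] in blast)
    with x show "r * x \<in> ?D" by blast
    have "?D \<subseteq> {x. x * r \<in> ?D}"
      by (rule addhull_least[OF addgroup_vimage_left[OF addgroup_addhull]])
        (use *(2) addhull_superset[of "J \<union> \<Union> (D ` Sp)"] in blast)
    with x show "x * r \<in> ?D" by blast
  qed
  have "?D \<subseteq> S"
    by (rule addhull_least[OF Sadd]) (use JS DS in blast)
  moreover have "?D = R"
  proof (rule ccontr)
    assume "?D \<noteq> R"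
    moreover have ND: "of_nat N \<in> ?D" using NJ addhull_superset by blast
    ultimately obtain P where P: "is_prime_ideal R P" "?D \<subseteq> P"
      using prime_ideal_exists[OF DR _ _ N] by blast
    have "finite (Sp - {P})"
      by (rule finite_subset[OF _ finite_ideals[OF N]]) (auto simp: Sp_def is_prime_ideal_def)
    then obtain Qs where Qs: "set Qs = Sp - {P}" using finite_list by blast
    have id: "is_ideal R Q" if "Q \<in> set Qs" for Q using that Qs prime_ideal by (auto simp: Sp_def)
    have "ideal_prod R Qs \<subseteq> D P"
    proof
      fix x assume x: "x \<in> ideal_prod R Qs"
      have "x \<in> R" using ideal_subset[OF ideal_prod_ideal[OF subring id]] x by blast
      moreover have "x \<in> Q" if "Q \<in> Sp" "Q \<noteq> P" for Q
        using ideal_prod_subset[OF subring id, of Qs Q] Qs that x by blast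
      ultimately show "x \<in> D P" by (simp add: D_def)
    qed
    moreover have "P \<in> Sp" using P(1) subsetD[OF P(2) ND] by (simp add: Sp_def)
    then have "D P \<subseteq> ?D" using addhull_superset[of "J \<union> \<Union> (D ` Sp)"] by blast
    ultimately have "ideal_prod R Qs \<subseteq> P" using P(2) by blast
    then obtain Q where Q: "Q \<in> set Qs" "Q \<subseteq> P" using ideal_prod_prime[OF subring id P(1)] by blast
    have "Q = P" using prime_ideal_eq[OF N _ _ P(1) Q(2)] Q(1) Qs by (auto simp: Sp_def)
    with Q(1) Qs show False by blast
  qed
  ultimately show ?thesis by simp
qed

end

section \<open>The ring of integers of a number field\<close>

definition zspan :: "'a::ring_1 set \<Rightarrow> 'a set" where
  "zspan B = range (\<lambda>c. \<Sum>b\<in>B. of_int (c b) * b)"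

lemma zspanI: "(\<Sum>b\<in>B. of_int (c b) * b) \<in> zspan B"
  by (simp add: zspan_def)

lemma zspanE:
  assumes "x \<in> zspan B"
  obtains c where "x = (\<Sum>b\<in>B. of_int (c b) * b)"
  using assms by (auto simp: zspan_def)

lemma addgroup_zspan: "is_addgroup (zspan B)"
proof (rule addgroupI)
  show "0 \<in> zspan B" using zspanI[where c = "\<lambda>_. 0"] by simp
next
  fix x y assume "x \<in> zspan B" "y \<in> zspan B"
  then obtain c d where "x = (\<Sum>b\<in>B. of_int (c b) * b)" "y = (\<Sum>b\<in>B. of_int (d b) * b)"
    by (elim zspanE)
  then have "x - y = (\<Sum>b\<in>B. of_int (c b - d b) * b)"
    by (simp add: algebra_simps flip: sum_subtractf)
  then show "x - y \<in> zspan B" by (simp only: zspanI)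
qed

lemma zspan_superset:
  assumes "finite B"
  shows "B \<subseteq> zspan B"
proof
  fix x assume "x \<in> B"
  then have "x = (\<Sum>b\<in>B. of_int (if b = x then 1 else 0) * b)"
    using assms by (simp add: if_distrib[of of_int] if_distrib[of "\<lambda>u. u * _"] sum.delta cong: if_cong)
  then show "x \<in> zspan B" using zspanI[of "\<lambda>b. if b = x then 1 else 0" B] by simp
qed

lemma zspan_least: "is_addgroup Z \<Longrightarrow> B \<subseteq> Z \<Longrightarrow> zspan B \<subseteq> Z"
  by (auto simp: zspan_def intro!: addgroup_sum addgroup_of_int)

lemma addhull_finite: "finite B \<Longrightarrow> addhull B = zspan B"
  by (intro subset_antisym addhull_least addgroup_zspan zspan_superset zspan_least
      addgroup_addhull addhull_superset)

lemma Ints_choice: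
  assumes "\<forall>x\<in>A. f x \<in> \<int>"
  shows "\<exists>z. \<forall>x\<in>A. f x = of_int (z x)"
  using assms by (intro bchoice) (auto elim: Ints_cases)

section \<open>Lattices, integrality and the trace in a number field\<close>

locale num_field =
  fixes K :: "'k::field_char_0 itself"
  assumes number_field: "number_field K"
begin

sublocale rat: vector_space "\<lambda>q (x::'k). of_rat q * x"
  by unfold_locales (auto simp: of_rat_add of_rat_mult algebra_simps)

definition rat_linear :: "('k \<Rightarrow> rat) \<Rightarrow> bool" where
  "rat_linear f \<longleftrightarrow> (\<forall>x y. f (x + y) = f x + f y) \<and> (\<forall>q x. f (of_rat q * x) = q * f x)"

lemma rat_linear_add: "rat_linear f \<Longrightarrow> f (x + y) = f x + f y"
  and rat_linear_scale: "rat_linear f \<Longrightarrow> f (of_rat q * x) = q * f x"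
  by (auto simp: rat_linear_def)

lemma rat_linear_0: "rat_linear f \<Longrightarrow> f 0 = 0"
  using rat_linear_scale[of f 0 0] by simp

lemma rat_linear_of_int: "rat_linear f \<Longrightarrow> f (of_int n * x) = of_int n * f x"
  using rat_linear_scale[of f "of_int n" x] by simp

lemma rat_linear_minus: "rat_linear f \<Longrightarrow> f (- x) = - f x"
  using rat_linear_of_int[of f "-1" x] by simp

lemma rat_linear_diff: "rat_linear f \<Longrightarrow> f (x - y) = f x - f y"
  using rat_linear_add[of f x "- y"] by (simp add: rat_linear_minus)

lemma rat_linear_sum: "rat_linear f \<Longrightarrow> f (sum g A) = (\<Sum>a\<in>A. f (g a))"
  by (induction A rule: infinite_finite_induct) (auto simp: rat_linear_0 rat_linear_add)

lemma rat_linear_addgroup: "rat_linear f \<Longrightarrow> is_addgroup {x. f x \<in> \<int>}"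
  by (auto simp: is_addgroup_def rat_linear_0 rat_linear_diff)

lemma rat_linear_kernel: "rat_linear f \<Longrightarrow> rat.subspace {x. f x = 0}"
  by (auto simp: rat.subspace_def rat_linear_0 rat_linear_add rat_linear_scale)

text \<open>Induction over the separating functionals. The values of \<open>f\<close> on
  \<open>H\<close> are the multiples of a least positive \<open>g\<close>, so an \<open>h0\<close>
  with \<open>f h0 = g\<close> splits off and the kernel of \<open>f\<close> remains.\<close>

lemma zbasis:
  assumes "is_addgroup H" "\<And>f. f \<in> set fs \<Longrightarrow> rat_linear f"
    and "\<And>f h. f \<in> set fs \<Longrightarrow> h \<in> H \<Longrightarrow> f h \<in> \<int>"
    and "\<And>h. h \<in> H \<Longrightarrow> (\<And>f. f \<in> set fs \<Longrightarrow> f h = 0) \<Longrightarrow> h = 0"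
  shows "\<exists>B. finite B \<and> rat.independent B \<and> H = zspan B"
  using assms
proof (induction fs arbitrary: H)
  case Nil
  then have "H = {0}" using addgroup_0 by force
  then show ?case by (intro exI[of _ "{}"]) (simp add: rat.dependent_def zspan_def)
next
  case (Cons f fs)
  note H = Cons.prems(1)
  have f: "rat_linear f" using Cons.prems(2) by simp
  let ?H' = "H \<inter> {x. f x = 0}"
  have "\<exists>B. finite B \<and> rat.independent B \<and> ?H' = zspan B"
  proof (rule Cons.IH)
    show "is_addgroup ?H'" using H f by (auto simp: is_addgroup_def rat_linear_0 rat_linear_diff)
    show "h = 0" if "h \<in> ?H'" "\<And>g. g \<in> set fs \<Longrightarrow> g h = 0" for h
      using that Cons.prems(4)[of h] by auto
  qed (use Cons.prems(2,3) in auto)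
  then obtain B where B: "finite B" "rat.independent B" "?H' = zspan B"
    by auto
  have f_int: "\<exists>z. f h = of_int z" if "h \<in> H" for h
    using Cons.prems(3)[of f h] that by (auto elim: Ints_cases)
  show ?case
  proof (cases "\<forall>h\<in>H. f h = 0")
    case True
    then have "?H' = H" by auto
    with B show ?thesis by auto
  next
    case False
    let ?pos = "\<lambda>n. n > 0 \<and> (\<exists>h\<in>H. f h = of_nat n)"
    obtain h where h: "h \<in> H" "f h \<noteq> 0" using False by blast
    have "\<exists>n. ?pos n"
    proof -
      obtain z where z: "f h = of_int z" using f_int[OF h(1)] by blast
      have "f (if z > 0 then h else - h) = of_nat (nat \<bar>z\<bar>)" "(if z > 0 then h else - h) \<in> H" "nat \<bar>z\<bar> > 0"
        using z h addgroup_minus[OF H] by (auto simp: rat_linear_minus[OF f])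
      then show ?thesis by blast
    qed
    then have "?pos (LEAST n. ?pos n)" by (rule LeastI_ex)
    then obtain g h0 where g: "g = (LEAST n. ?pos n)" "g > 0" "h0 \<in> H" "f h0 = of_nat g" by blast
    have h0: "h0 \<notin> B" "rat.independent (insert h0 B)"
    proof -
      have "B \<subseteq> {x. f x = 0}" using zspan_superset[OF B(1)] B(3) by blast
      then have "rat.span B \<subseteq> {x. f x = 0}" by (rule rat.span_minimal[OF _ rat_linear_kernel[OF f]])
      then have "h0 \<notin> rat.span B" using g by auto
      then show "h0 \<notin> B" "rat.independent (insert h0 B)"
        using B(2) rat.span_base by (auto simp: rat.independent_insert)
    qed
    have "H = zspan (insert h0 B)"
    proof
      show "zspan (insert h0 B) \<subseteq> H"
        by (rule zspan_least[OF H]) (use g zspan_superset[OF B(1)] B(3) in blast)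
      show "H \<subseteq> zspan (insert h0 B)"
      proof
        fix x assume x: "x \<in> H"
        obtain z where z: "f x = of_int z" using f_int[OF x] by blast
        define y where "y = x - of_int (z div int g) * h0"
        have yH: "y \<in> H" unfolding y_def by (intro addgroup_diff[OF H] addgroup_of_int[OF H] x g)
        have "f y = of_int (z - (z div int g) * int g)"
          by (simp add: y_def rat_linear_diff[OF f] rat_linear_of_int[OF f] z g(4))
        then have fy: "f y = of_nat (nat (z mod int g))"
          using g(2) by (simp add: minus_div_mult_eq_mod)
        have "nat (z mod int g) < g" using g(2) by (simp add: nat_less_iff)
        then have "\<not> ?pos (nat (z mod int g))" unfolding g(1) by (rule not_less_Least)
        then have "f y = 0" using fy yH by auto
        then have "y \<in> ?H'" using yH by blast
        then obtain c where c: "y = (\<Sum>b\<in>B. of_int (c b) * b)" unfolding B(3) by (elim zspanE)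
        have "x = of_int (z div int g) * h0 + (\<Sum>b\<in>B. of_int (c b) * b)"
          by (simp add: y_def flip: c)
        also have "(\<Sum>b\<in>B. of_int (c b) * b) = (\<Sum>b\<in>B. of_int ((c(h0 := z div int g)) b) * b)"
          by (rule sum.cong) (use h0(1) in auto)
        finally have "x = (\<Sum>b\<in>insert h0 B. of_int ((c(h0 := z div int g)) b) * b)"
          using B(1) h0(1) by simp
        then show "x \<in> zspan (insert h0 B)" by (simp only: zspanI)
      qed
    qed
    with B(1) h0 show ?thesis by blast
  qed
qed

definition E :: "'k set" where
  "E = (SOME E. finite E \<and> rat.independent E \<and> rat.span E = UNIV)"

lemma E: "finite E" "rat.independent E" "rat.span E = UNIV"
proof -
  obtain B :: "'k set" where B: "finite B" "rat.span B = UNIV"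
    using number_field by (auto simp: number_field_def)
  obtain C where "C \<subseteq> B" "rat.independent C" "B \<subseteq> rat.span C"
    using rat.maximal_independent_subset[of B] by blast
  then have "\<exists>E. finite E \<and> rat.independent E \<and> rat.span E = UNIV"
    using B finite_subset rat.span_mono rat.span_span by (metis top.extremum_uniqueI)
  then have "finite E \<and> rat.independent E \<and> rat.span E = UNIV"
    unfolding E_def by (rule someI_ex)
  then show "finite E" "rat.independent E" "rat.span E = UNIV" by auto
qed

lemma rat_linear_representation:
  assumes "rat.independent B" "rat.span B = UNIV"
  shows "rat_linear (\<lambda>x. rat.representation B (x * a) b)"
  unfolding rat_linear_def
  using rat.representation_add[OF assms(1)] rat.representation_scale[OF assms(1)] assms(2)
  by (auto simp: distrib_right mult.assoc)

lemma rat_representation_sum: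
  assumes "finite B" "rat.independent B" "rat.span B = UNIV"
  shows "(\<Sum>b\<in>B. of_rat (rat.representation B x b) * b) = x"
  using rat.sum_representation_eq[OF assms(2) _ assms(1) order_refl, of x] assms(3) by simp

text \<open>The trace of multiplication by \<open>x\<close>. The basis is a parameter because
  integrality shows in a basis of a lattice stable under \<open>x\<close>, while the trace form is
  used in the fixed basis \<open>E\<close>.\<close>

definition tr :: "'k set \<Rightarrow> 'k \<Rightarrow> rat" where
  "tr B x = (\<Sum>b\<in>B. rat.representation B (x * b) b)"

lemma tr_linear: "rat.independent B \<Longrightarrow> rat.span B = UNIV \<Longrightarrow> rat_linear (\<lambda>x. tr B (x * y))"
  using rat_linear_representation[of B "y * _"]
  by (simp add: tr_def rat_linear_def mult.assoc sum.distrib sum_distrib_left)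

lemma tr_basis:
  assumes B: "finite B" "rat.independent B" "rat.span B = UNIV"
    and D: "finite D" "rat.independent D" "rat.span D = UNIV"
  shows "tr B x = tr D x"
proof -
  let ?b = "rat.representation B" and ?d = "rat.representation D"
  have lin: "rat_linear (\<lambda>x. ?b (x * a) b)" "rat_linear (\<lambda>x. ?d (x * a) b)" for a b
    using rat_linear_representation B D by auto
  have "?b (x * b) b = (\<Sum>d\<in>D. ?d b d * ?b (x * d) b)" for b
  proof -
    have "?b (x * b) b = ?b ((\<Sum>d\<in>D. of_rat (?d b d) * d) * x) b"
      by (simp only: rat_representation_sum[OF D] mult.commute[of x b])
    also have "\<dots> = (\<Sum>d\<in>D. ?b ((of_rat (?d b d) * d) * x) b)"
      by (rule rat_linear_sum[OF lin(1)])
    also have "\<dots> = (\<Sum>d\<in>D. ?d b d * ?b (d * x) b)"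
      by (intro sum.cong refl rat_linear_scale[OF lin(1)])
    finally show ?thesis by (simp add: mult.commute)
  qed
  then have "tr B x = (\<Sum>b\<in>B. \<Sum>d\<in>D. ?d b d * ?b (x * d) b)" by (simp add: tr_def)
  also have "\<dots> = (\<Sum>d\<in>D. \<Sum>b\<in>B. ?d b d * ?b (x * d) b)" by (rule sum.swap)
  also have "\<dots> = (\<Sum>d\<in>D. ?d (x * d) d)"
  proof (rule sum.cong[OF refl])
    fix d
    have "?d (x * d) d = ?d ((\<Sum>b\<in>B. of_rat (?b (x * d) b) * b) * 1) d"
      by (simp add: rat_representation_sum[OF B])
    also have "\<dots> = (\<Sum>b\<in>B. ?d ((of_rat (?b (x * d) b) * b) * 1) d)"
      by (rule rat_linear_sum[OF lin(2)])
    also have "\<dots> = (\<Sum>b\<in>B. ?b (x * d) b * ?d (b * 1) d)"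
      by (intro sum.cong refl rat_linear_scale[OF lin(2)])
    finally show "(\<Sum>b\<in>B. ?d b d * ?b (x * d) b) = ?d (x * d) d" by (simp add: mult.commute)
  qed
  finally show ?thesis by (simp add: tr_def)
qed

lemma common_denominator:
  fixes q :: "'b \<Rightarrow> rat"
  assumes "finite A"
  shows "\<exists>n>0. \<forall>a\<in>A. of_nat n * q a \<in> \<int>"
  using assms
proof (induction A rule: finite_induct)
  case (insert a A)
  then obtain n where n: "n > 0" "\<forall>a\<in>A. of_nat n * q a \<in> \<int>" by blast
  obtain x y where xy: "quotient_of (q a) = (x, y)" by (cases "quotient_of (q a)")
  then have y: "y > 0" "q a = of_int x / of_int y"
    using quotient_of_denom_pos quotient_of_div by auto
  have "of_nat (n * nat y) * q a = of_int (int n * x)"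
    using y by (simp add: of_nat_nat)
  then have "of_nat (n * nat y) * q a \<in> \<int>" by (metis Ints_of_int)
  moreover have "of_nat (n * nat y) * q b \<in> \<int>" if "b \<in> A" for b
  proof -
    have "of_nat (n * nat y) * q b = of_int y * (of_nat n * q b)" using y by simp
    then show ?thesis using n(2) that Ints_mult[OF Ints_of_int] by metis
  qed
  ultimately show ?case
    using n(1) y(1) by (intro exI[of _ "n * nat y"]) (auto simp del: of_nat_mult)
qed (auto intro: exI[of _ 1])

text \<open>These are the coordinates over \<open>E\<close>, multiplied by a common denominator of
  the coordinates of \<open>F\<close>.\<close>

lemma integral_functionals:
  assumes "finite F"
  shows "\<exists>fs. (\<forall>f\<in>set fs. rat_linear f \<and> (\<forall>x\<in>F. f x \<in> \<int>)) \<and> (\<forall>x. (\<forall>f\<in>set fs. f x = 0) \<longrightarrow> x = 0)"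
proof -
  obtain n where n: "n > 0" "\<forall>(x, e)\<in>F \<times> E. of_nat n * rat.representation E x e \<in> \<int>"
    using common_denominator[of "F \<times> E" "\<lambda>(x, e). rat.representation E x e"] assms E(1)
    by (auto simp: case_prod_unfold)
  obtain es where es: "set es = E" using E(1) finite_list by blast
  let ?f = "\<lambda>e x. of_nat n * rat.representation E x e"
  have "rat_linear (?f e)" for e
    using rat_linear_representation[OF E(2,3), of 1 e] by (simp add: rat_linear_def algebra_simps)
  moreover have "x = 0" if "\<forall>e\<in>E. ?f e x = 0" for x
    using rat_representation_sum[OF E, of x] that n(1) by simp
  ultimately show ?thesis
    using n(2) by (intro exI[of _ "map ?f es"]) (auto simp: es)
qed

lemma finitely_generated_subgroup:
  assumes F: "finite F" and H: "is_addgroup H" "H \<subseteq> addhull F"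
  shows "\<exists>B. finite B \<and> rat.independent B \<and> H = zspan B"
proof -
  obtain fs where fs: "\<And>f. f \<in> set fs \<Longrightarrow> rat_linear f" "\<And>f x. f \<in> set fs \<Longrightarrow> x \<in> F \<Longrightarrow> f x \<in> \<int>"
    "\<And>x. (\<And>f. f \<in> set fs \<Longrightarrow> f x = 0) \<Longrightarrow> x = 0"
    using integral_functionals[OF F] by metis
  have "f x \<in> \<int>" if "f \<in> set fs" "x \<in> H" for f x
    using addhull_least[OF rat_linear_addgroup[OF fs(1)[OF that(1)]], of F] fs(2) that H(2) by blast
  then show ?thesis using zbasis[OF H(1) fs(1)] fs(3) by blast
qed

text \<open>The additive group of \<open>\<int>[c]\<close> lies in a finitely generated group, so it
  is itself finitely generated and exhausted by the powers below some \<open>n\<close>. Then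
  \<open>c ^ n\<close> is an integral combination of lower powers.\<close>

lemma algebraic_int_of_bounded_powers:
  assumes F: "finite F" and c: "\<And>k. c ^ k \<in> addhull F"
  shows "algebraic_int (c :: 'k)"
proof -
  define P where "P n = {\<Sum>i<n. of_int (a i) * c ^ i | a. True}" for n
  have mono: "P m \<subseteq> P n" if "m \<le> n" for m n
  proof
    fix x assume "x \<in> P m"
    then obtain a where a: "x = (\<Sum>i<m. of_int (a i) * c ^ i)" by (auto simp: P_def)
    have "x = (\<Sum>i<n. of_int (if i < m then a i else 0) * c ^ i)"
      unfolding a by (rule sum.mono_neutral_cong_left) (use that in auto)
    then show "x \<in> P n" unfolding P_def by (intro CollectI exI[of _ "\<lambda>i. if i < m then a i else 0"]) simp
  qed
  let ?H = "\<Union>n. P n"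
  have "is_addgroup ?H"
  proof (rule addgroupI)
    show "0 \<in> ?H" by (auto simp: P_def intro!: exI[of _ 0])
  next
    fix x y assume "x \<in> ?H" "y \<in> ?H"
    then obtain m n where "x \<in> P m" "y \<in> P n" by blast
    then have "x \<in> P (max m n)" "y \<in> P (max m n)" using mono by (meson max.cobounded1 max.cobounded2 subsetD)+
    then obtain a b where "x = (\<Sum>i<max m n. of_int (a i) * c ^ i)" "y = (\<Sum>i<max m n. of_int (b i) * c ^ i)"
      by (auto simp: P_def)
    then have "x - y = (\<Sum>i<max m n. of_int (a i - b i) * c ^ i)"
      by (simp add: algebra_simps flip: sum_subtractf)
    then have "x - y \<in> P (max m n)" unfolding P_def by (intro CollectI exI[of _ "\<lambda>i. a i - b i"]) simp
    then show "x - y \<in> ?H" by blast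
  qed
  moreover have "?H \<subseteq> addhull F"
    unfolding P_def by (auto intro!: addgroup_sum addgroup_of_int addgroup_addhull c)
  ultimately obtain B where B: "finite B" "?H = zspan B"
    using finitely_generated_subgroup[OF F] by metis
  have "\<exists>n. G \<subseteq> P n" if "finite G" "G \<subseteq> ?H" for G
    using that
  proof (induction G rule: finite_induct)
    case (insert x G)
    then obtain m n where "G \<subseteq> P n" "x \<in> P m" by auto
    then have "insert x G \<subseteq> P (max m n)" using mono[of n "max m n"] mono[of m "max m n"] by auto
    then show ?case by blast
  qed simp
  then obtain n where n: "B \<subseteq> P n" using B(1) zspan_superset[OF B(1)] B(2) by metis
  have "is_addgroup (P n)"
  proof (rule addgroupI)
    show "0 \<in> P n" unfolding P_def by (intro CollectI exI[of _ "\<lambda>_. 0"]) simp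
  next
    fix x y assume "x \<in> P n" "y \<in> P n"
    then obtain a b where "x = (\<Sum>i<n. of_int (a i) * c ^ i)" "y = (\<Sum>i<n. of_int (b i) * c ^ i)"
      by (auto simp: P_def)
    then have "x - y = (\<Sum>i<n. of_int (a i - b i) * c ^ i)"
      by (simp add: algebra_simps flip: sum_subtractf)
    then show "x - y \<in> P n" unfolding P_def by (intro CollectI exI[of _ "\<lambda>i. a i - b i"]) simp
  qed
  then have "?H \<subseteq> P n" unfolding B(2) by (rule zspan_least[OF _ n])
  moreover have "c ^ n \<in> P (Suc n)"
    unfolding P_def by (intro CollectI exI[of _ "\<lambda>i. if i = n then 1 else 0"]) simp
  ultimately have "c ^ n \<in> P n" by blast
  then obtain a where a: "c ^ n = (\<Sum>i<n. of_int (a i) * c ^ i)" by (auto simp: P_def)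
  define p where "p = monom 1 n - (\<Sum>i<n. monom (of_int (a i)) i :: 'k poly)"
  have cf: "coeff p i = (if i = n then 1 else 0) - (if i < n then of_int (a i) else 0)" for i
    by (auto simp: p_def coeff_sum)
  have "degree p = n"
  proof (rule antisym)
    show "degree p \<le> n" by (rule degree_le) (simp add: cf)
    show "n \<le> degree p" by (rule le_degree) (simp add: cf)
  qed
  show ?thesis
  proof (rule algebraic_int.intros)
    show "lead_coeff p = 1" using \<open>degree p = n\<close> by (simp add: cf)
    show "\<forall>i. coeff p i \<in> \<int>" by (simp add: cf)
    show "poly p c = 0" by (simp add: p_def poly_sum poly_monom a)
  qed
qed

lemma algebraic_int_power_relation:
  assumes "algebraic_int (x :: 'k)"
  shows "\<exists>n>0. \<exists>a. x ^ n = (\<Sum>i<n. of_int (a i) * x ^ i)"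
proof -
  obtain p where p: "poly p x = 0" "lead_coeff p = 1" "\<forall>i. coeff p i \<in> \<int>"
    using assms by (auto elim: algebraic_int.cases)
  define n where "n = degree p"
  obtain a where a: "\<And>i. coeff p i = of_int (a i)" using Ints_choice[of UNIV "coeff p"] p(3) by auto
  have "0 = (\<Sum>i\<le>n. coeff p i * x ^ i)" using p(1) by (simp add: poly_altdef n_def)
  also have "\<dots> = (\<Sum>i<n. coeff p i * x ^ i) + x ^ n"
    using p(2) by (simp add: n_def flip: lessThan_Suc_atMost)
  finally have "x ^ n = (\<Sum>i<n. of_int (- a i) * x ^ i)"
    by (simp add: a sum_negf eq_neg_iff_add_eq_0 add.commute)
  then have "\<exists>a. x ^ n = (\<Sum>i<n. of_int (a i) * x ^ i)" by (intro exI[of _ "\<lambda>i. - a i"])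
  moreover have "n > 0"
  proof (rule ccontr)
    assume "\<not> n > 0"
    then have "p = [:1:]" using p(2) by (metis degree_eq_zeroE lead_coeff_pCons(2) n_def not_gr_zero)
    with p(1) show False by simp
  qed
  ultimately show ?thesis by blast
qed

text \<open>The new generators are \<open>x ^ i * f\<close> for \<open>i\<close> below the degree of
  a monic relation of \<open>x\<close>. By the last clause stability under other elements survives,
  which allows integers to be adjoined one after another.\<close>

lemma finitely_generated_adjoin:
  assumes x: "algebraic_int (x :: 'k)" and F: "finite F"
  shows "\<exists>G. finite G \<and> F \<subseteq> G \<and> (\<forall>g\<in>addhull G. x * g \<in> addhull G) \<and>
    (\<forall>y. (\<forall>f\<in>F. y * f \<in> addhull F) \<longrightarrow> (\<forall>g\<in>G. y * g \<in> addhull G))"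
proof -
  obtain n a where n: "n > 0" "x ^ n = (\<Sum>i<n. of_int (a i) * x ^ i)"
    using algebraic_int_power_relation[OF x] by blast
  let ?G = "(\<lambda>(i, f). x ^ i * f) ` ({..<n} \<times> F)"
  have G: "finite ?G" using F by simp
  have FG: "F \<subseteq> ?G" using n(1) by (force intro: image_eqI[of _ _ "(0, _)"])
  have gen: "x ^ i * f \<in> addhull ?G" if "i < n" "f \<in> F" for i f
    using that addhull_superset[of ?G] by force
  have "?G \<subseteq> {g. x * g \<in> addhull ?G}"
  proof clarify
    fix i f assume *: "i < n" "f \<in> F"
    show "x * (x ^ i * f) \<in> addhull ?G"
    proof (cases "Suc i < n")
      case True
      then show ?thesis using gen[OF True *(2)] by (simp add: mult.assoc)
    next
      case False
      then have "x * (x ^ i * f) = x ^ n * f" using * by (metis Suc_lessI mult.assoc power_Suc)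
      also have "\<dots> = (\<Sum>i<n. of_int (a i) * (x ^ i * f))"
        unfolding n(2) by (simp add: sum_distrib_right mult.assoc)
      also have "\<dots> \<in> addhull ?G"
        by (intro addgroup_sum addgroup_of_int addgroup_addhull gen *) auto
      finally show ?thesis .
    qed
  qed
  then have 1: "addhull ?G \<subseteq> {g. x * g \<in> addhull ?G}"
    by (rule addhull_least[OF addgroup_vimage_right[OF addgroup_addhull]])
  have 2: "y * g \<in> addhull ?G" if y: "\<forall>f\<in>F. y * f \<in> addhull F" and g: "g \<in> ?G" for y g
  proof -
    obtain i f where g: "i < n" "f \<in> F" "g = x ^ i * f" using g by auto
    have "addhull F \<subseteq> {z. x ^ i * z \<in> addhull ?G}"
      by (rule addhull_least[OF addgroup_vimage_right[OF addgroup_addhull]]) (use gen g in auto)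
    then have "x ^ i * (y * f) \<in> addhull ?G" using y g by blast
    then show ?thesis by (simp add: g mult.left_commute)
  qed
  show ?thesis using G FG 1 2 by (intro exI[of _ ?G]) blast
qed

lemma algebraic_int_closed:
  assumes "algebraic_int (x :: 'k)" "algebraic_int y"
  shows "algebraic_int (x + y)" "algebraic_int (x * y)"
proof -
  obtain F where F: "finite F" "{1} \<subseteq> F" "\<forall>g\<in>addhull F. x * g \<in> addhull F"
    using finitely_generated_adjoin[OF assms(1), of "{1}"] by auto
  obtain G where G: "finite G" "F \<subseteq> G" "\<forall>g\<in>addhull G. y * g \<in> addhull G"
    "(\<forall>f\<in>F. x * f \<in> addhull F) \<longrightarrow> (\<forall>g\<in>G. x * g \<in> addhull G)"
    using finitely_generated_adjoin[OF assms(2) F(1)] by metis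
  have "\<forall>f\<in>F. x * f \<in> addhull F" using F(3) addhull_superset by blast
  then have "G \<subseteq> {g. x * g \<in> addhull G}" using G(4) by blast
  then have xG: "addhull G \<subseteq> {g. x * g \<in> addhull G}"
    by (rule addhull_least[OF addgroup_vimage_right[OF addgroup_addhull]])
  have one: "1 \<in> addhull G" using F(2) G(2) addhull_superset by blast
  have "(x + y) ^ k \<in> addhull G" for k
  proof (induction k)
    case (Suc k)
    then have "x * (x + y) ^ k + y * (x + y) ^ k \<in> addhull G"
      using xG G(3) by (intro addgroup_add[OF addgroup_addhull]) auto
    then show ?case by (simp add: distrib_right)
  qed (simp add: one)
  then show "algebraic_int (x + y)" by (rule algebraic_int_of_bounded_powers[OF G(1)])
  have "(x * y) ^ k \<in> addhull G" for k
  proof (induction k)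
    case (Suc k)
    then have "x * (y * (x * y) ^ k) \<in> addhull G" using xG G(3) by blast
    then show ?case by (simp add: mult.assoc)
  qed (simp add: one)
  then show "algebraic_int (x * y)" by (rule algebraic_int_of_bounded_powers[OF G(1)])
qed

lemma ring_of_integers_subring: "is_subring (ring_of_integers :: 'k set)"
  unfolding is_subring_def is_addgroup_def ring_of_integers_def
  using algebraic_int_closed(1)[of _ "- _"] algebraic_int_closed(2) by auto

text \<open>If \<open>m\<close> clears the structure constants of the basis \<open>E\<close>, the
  group generated by \<open>m E\<close> is closed under products, so the powers of its elements stay
  in a finitely generated group.\<close>

lemma integral_multiple: "\<exists>n>0. algebraic_int (of_nat n * (x :: 'k))"
proof -
  let ?r = "rat.representation E"
  obtain m where m: "m > 0" "\<forall>(a, b, e)\<in>E \<times> E \<times> E. of_nat m * ?r (a * b) e \<in> \<int>"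
    using common_denominator[of "E \<times> E \<times> E" "\<lambda>(a, b, e). ?r (a * b) e"] E(1)
    by (auto simp: case_prod_unfold)
  let ?F = "insert 1 ((\<lambda>e. of_nat m * e) ` E)"
  have F: "finite ?F" using E(1) by simp
  define L where "L = addhull ((\<lambda>e. of_nat m * e) ` E)"
  have Ladd: "is_addgroup L" unfolding L_def by (rule addgroup_addhull)
  have eL: "of_nat m * e \<in> L" if "e \<in> E" for e using addhull_superset that by (force simp: L_def)
  have LF: "L \<subseteq> addhull ?F" unfolding L_def
    by (rule addhull_least[OF addgroup_addhull]) (use addhull_superset[of ?F] in blast)
  have ab: "(of_nat m * a) * (of_nat m * b) \<in> L" if ab: "a \<in> E" "b \<in> E" for a b
  proof -
    obtain z where z: "\<And>e. e \<in> E \<Longrightarrow> of_nat m * ?r (a * b) e = of_int (z e)"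
    proof -
      have "\<forall>e\<in>E. of_nat m * ?r (a * b) e \<in> \<int>" using m(2) ab by auto
      from Ints_choice[OF this] show thesis using that by blast
    qed
    have "(of_nat m * a) * (of_nat m * b) = of_nat m * of_nat m * (a * b)" by (simp add: mult_ac)
    also have "\<dots> = of_nat m * of_nat m * (\<Sum>e\<in>E. of_rat (?r (a * b) e) * e)"
      by (simp only: rat_representation_sum[OF E])
    also have "\<dots> = (\<Sum>e\<in>E. of_rat (of_nat m * ?r (a * b) e) * (of_nat m * e))"
      by (simp add: sum_distrib_left of_rat_mult mult_ac)
    also have "\<dots> = (\<Sum>e\<in>E. of_int (z e) * (of_nat m * e))"
      by (intro sum.cong refl) (simp add: z del: of_rat_mult)
    also have "\<dots> \<in> L" by (intro addgroup_sum addgroup_of_int Ladd eL)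
    finally show ?thesis .
  qed
  have Lmult: "u * v \<in> L" if u: "u \<in> L" and v: "v \<in> L" for u v
  proof -
    have "addhull ((\<lambda>e. of_nat m * e) ` E) \<subseteq> {u. u * (of_nat m * b) \<in> L}" if "b \<in> E" for b
      by (rule addhull_least[OF addgroup_vimage_left[OF Ladd]]) (use ab that in blast)
    then have "L \<subseteq> {u. u * (of_nat m * b) \<in> L}" if "b \<in> E" for b using that by (simp add: L_def)
    then have 1: "u * (of_nat m * b) \<in> L" if "b \<in> E" for b using u that by blast
    have "addhull ((\<lambda>e. of_nat m * e) ` E) \<subseteq> {v. u * v \<in> L}"
      by (rule addhull_least[OF addgroup_vimage_right[OF Ladd]]) (use 1 in blast)
    then show ?thesis using v by (auto simp: L_def)
  qed
  obtain n where n: "n > 0" "\<forall>e\<in>E. of_nat n * ?r x e \<in> \<int>"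
    using common_denominator[OF E(1), of "?r x"] by blast
  obtain z where z: "\<And>e. e \<in> E \<Longrightarrow> of_nat n * ?r x e = of_int (z e)"
    using Ints_choice[OF n(2)] by blast
  have "of_nat (n * m) * x = of_nat n * of_nat m * (\<Sum>e\<in>E. of_rat (?r x e) * e)"
    by (simp add: rat_representation_sum[OF E])
  also have "\<dots> = (\<Sum>e\<in>E. of_rat (of_nat n * ?r x e) * (of_nat m * e))"
    by (simp add: sum_distrib_left of_rat_mult mult_ac)
  also have "\<dots> = (\<Sum>e\<in>E. of_int (z e) * (of_nat m * e))"
    by (intro sum.cong refl) (simp add: z del: of_rat_mult)
  also have "\<dots> \<in> L" by (intro addgroup_sum addgroup_of_int Ladd eL)
  finally have xL: "of_nat (n * m) * x \<in> L" .
  have "(of_nat (n * m) * x) ^ k \<in> addhull ?F" for k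
  proof (cases k)
    case 0
    then show ?thesis using addhull_superset[of ?F] by auto
  next
    case (Suc j)
    have "(of_nat (n * m) * x) ^ Suc j \<in> L"
      by (induction j) (use xL Lmult in \<open>simp_all only: power_Suc power_0 mult_1_right\<close>)
    then show ?thesis using LF Suc by blast
  qed
  then have "algebraic_int (of_nat (n * m) * x)" by (rule algebraic_int_of_bounded_powers[OF F])
  then show ?thesis using n(1) m(1) by (intro exI[of _ "n * m"]) simp
qed

text \<open>\<open>x\<close> stabilizes a lattice that contains \<open>E\<close>. In a
  \<open>\<int>\<close>-basis of it multiplication by \<open>x\<close> has an integral matrix, and
  the trace does not depend on the basis.\<close>

lemma trace_integral:
  assumes x: "algebraic_int (x :: 'k)"
  shows "tr E x \<in> \<int>"
proof -
  obtain G where G: "finite G" "E \<subseteq> G" "\<forall>g\<in>addhull G. x * g \<in> addhull G"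
    using finitely_generated_adjoin[OF x E(1)] by auto
  obtain B where B: "finite B" "rat.independent B" "addhull G = zspan B"
    using finitely_generated_subgroup[OF G(1) addgroup_addhull order_refl] by blast
  have "addhull G \<subseteq> rat.span B"
  proof
    fix y assume "y \<in> addhull G"
    then obtain c where "y = (\<Sum>b\<in>B. of_int (c b) * b)" unfolding B(3) by (elim zspanE)
    then have "y = (\<Sum>b\<in>B. of_rat (of_int (c b)) * b)" by simp
    then show "y \<in> rat.span B" by (simp only:) (intro rat.span_sum rat.span_scale rat.span_base)
  qed
  then have "E \<subseteq> rat.span B" using G(2) addhull_superset by blast
  then have span: "rat.span B = UNIV" using E(3) by (metis rat.span_minimal rat.subspace_span top.extremum_uniqueI)
  have "rat.representation B (x * b) b \<in> \<int>" if b: "b \<in> B" for b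
  proof -
    have "b \<in> addhull G" using zspan_superset[OF B(1)] B(3) b by blast
    then have "x * b \<in> addhull G" using G(3) by blast
    then obtain c where c: "x * b = (\<Sum>b\<in>B. of_int (c b) * b)" unfolding B(3) by (elim zspanE)
    have "rat.representation B (x * b) = (\<lambda>b. if b \<in> B then of_int (c b) else 0)"
    proof (rule rat.representation_eqI[OF B(2)])
      show "x * b \<in> rat.span B" by (simp add: span)
      show "finite {v. (if v \<in> B then of_int (c v) else 0 :: rat) \<noteq> 0}"
        by (rule finite_subset[OF _ B(1)]) auto
      have "(\<Sum>v | (if v \<in> B then of_int (c v) else 0 :: rat) \<noteq> 0. of_rat (if v \<in> B then of_int (c v) else 0) * v) =
        (\<Sum>v\<in>B. of_int (c v) * v)"
        by (rule sum.mono_neutral_cong_left) (use B(1) in auto)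
      then show "(\<Sum>v | (if v \<in> B then of_int (c v) else 0 :: rat) \<noteq> 0. of_rat (if v \<in> B then of_int (c v) else 0) * v) = x * b"
        by (simp only: c)
    qed (simp split: if_splits)
    then show ?thesis using b by simp
  qed
  then have "tr B x \<in> \<int>" unfolding tr_def by (intro Ints_sum)
  then show ?thesis using tr_basis[OF E B(1,2) span] by simp
qed

text \<open>The trace form embeds the integers into a lattice: the functionals
  \<open>x \<mapsto> tr (x d e)\<close>, for \<open>e\<close> in the basis and a multiple
  \<open>d e\<close> that is integral, take integer values on them. They separate points because the
  trace of 1 is the degree, which is not 0.\<close>

theorem ring_of_integers_finitely_generated:
  "\<exists>B. finite B \<and> (ring_of_integers :: 'k set) = zspan B"
proof -
  obtain d where d: "\<And>e. d e > 0 \<and> algebraic_int (of_nat (d e) * (e :: 'k))"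
    using integral_multiple by metis
  obtain es where es: "set es = E" using E(1) finite_list by blast
  let ?f = "\<lambda>e x. tr E (x * (of_nat (d e) * e))"
  have lin: "rat_linear (?f e)" for e by (rule tr_linear[OF E(2,3)])
  have inj: "x = 0" if "\<And>e. e \<in> E \<Longrightarrow> ?f e x = 0" for x
  proof (rule ccontr)
    assume "x \<noteq> 0"
    have lin': "rat_linear (\<lambda>y. tr E (y * x))" by (rule tr_linear[OF E(2,3)])
    have "tr E (e * x) = 0" if "e \<in> E" for e
    proof -
      have "of_nat (d e) * tr E (e * x) = tr E (of_rat (of_nat (d e)) * e * x)"
        using rat_linear_scale[OF lin', of "of_nat (d e)" e] by simp
      also have "\<dots> = ?f e x" by (simp add: mult_ac)
      finally show ?thesis using \<open>\<And>e. e \<in> E \<Longrightarrow> ?f e x = 0\<close>[OF that] d[of e] by simp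
    qed
    then have "E \<subseteq> {y. tr E (y * x) = 0}" by blast
    then have "rat.span E \<subseteq> {y. tr E (y * x) = 0}" by (rule rat.span_minimal[OF _ rat_linear_kernel[OF lin']])
    then have "tr E (inverse x * x) = 0" using E(3) by blast
    moreover have "tr E 1 = of_nat (card E)"
      by (simp add: tr_def rat.representation_basis[OF E(2)])
    moreover have "E \<noteq> {}" using E(3) rat.span_empty by (metis UNIV_I singletonD zero_neq_one)
    ultimately show False using \<open>x \<noteq> 0\<close> E(1) by simp
  qed
  have "\<exists>B. finite B \<and> rat.independent B \<and> (ring_of_integers :: 'k set) = zspan B"
  proof (rule zbasis[of _ "map ?f es"])
    show "is_addgroup (ring_of_integers :: 'k set)" using ring_of_integers_subring subring_addgroup by blast
    show "f h \<in> \<int>" if f: "f \<in> set (map ?f es)" and h: "h \<in> ring_of_integers" for f h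
    proof -
      obtain e where "f = ?f e" using f by auto
      moreover have "algebraic_int (h * (of_nat (d e) * e))"
        by (rule algebraic_int_closed(2)) (use h d in \<open>simp_all add: ring_of_integers_def\<close>)
      ultimately show ?thesis using trace_integral by blast
    qed
    show "h = 0" if "\<And>f. f \<in> set (map ?f es) \<Longrightarrow> f h = 0" for h
      by (rule inj) (use that es in auto)
    show "rat_linear f" if "f \<in> set (map ?f es)" for f using that lin by auto
  qed
  then show ?thesis by blast
qed

lemma ring_of_integers_finite_quotient:
  assumes "n > 0"
  shows "\<exists>F. finite F \<and> F \<subseteq> (ring_of_integers :: 'k set) \<and>
    (\<forall>x\<in>ring_of_integers. \<exists>f\<in>F. \<exists>y\<in>ring_of_integers. x = f + of_nat n * y)"
proof -
  obtain B where B: "finite B" "(ring_of_integers :: 'k set) = zspan B"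
    using ring_of_integers_finitely_generated by blast
  let ?F = "(\<lambda>c. \<Sum>b\<in>B. of_int (c b) * b) ` (B \<rightarrow>\<^sub>E {0..<int n})"
  have "finite ?F" using B(1) by (intro finite_imageI finite_PiE) auto
  moreover have "?F \<subseteq> ring_of_integers" unfolding B(2) by (auto intro: zspanI)
  moreover have "\<exists>f\<in>?F. \<exists>y\<in>ring_of_integers. x = f + of_nat n * y" if "x \<in> ring_of_integers" for x :: 'k
  proof -
    have "x \<in> zspan B" using that B(2) by simp
    then obtain c where c: "x = (\<Sum>b\<in>B. of_int (c b) * b)" by (rule zspanE)
    let ?r = "\<lambda>b\<in>B. c b mod int n"
    have "?r \<in> B \<rightarrow>\<^sub>E {0..<int n}" using assms by simp
    moreover have "(\<Sum>b\<in>B. of_int (c b div int n) * b) \<in> ring_of_integers" unfolding B(2) by (rule zspanI)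
    moreover have "x = (\<Sum>b\<in>B. of_int (?r b) * b) + of_nat n * (\<Sum>b\<in>B. of_int (c b div int n) * b)"
    proof -
      have q: "of_int (c b) * b = of_int (c b mod int n) * b + of_nat n * (of_int (c b div int n) * b)" for b
      proof -
        have "of_int (c b) = (of_int (c b mod int n) + of_int (int n) * of_int (c b div int n) :: 'k)"
          by (metis mod_mult_div_eq of_int_add of_int_mult)
        then show ?thesis by (simp add: algebra_simps)
      qed
      have "(\<Sum>b\<in>B. of_int (c b) * b) = (\<Sum>b\<in>B. of_int (?r b) * b + of_nat n * (of_int (c b div int n) * b))"
        by (rule sum.cong[OF refl]) (simp only: q restrict_apply')
      then show ?thesis unfolding c by (simp only: sum.distrib sum_distrib_left)
    qed
    ultimately show ?thesis by blast
  qed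
  ultimately show ?thesis by (intro exI[of _ ?F]) blast
qed

lemma addhull_ring_of_integers: "\<exists>B. finite B \<and> (ring_of_integers :: 'k set) = addhull B"
  using ring_of_integers_finitely_generated addhull_finite by metis

text \<open>For maximality: the powers of an element of a bounded overring have a common denominator
  \<open>n\<close>, so they stay in a finitely generated group and the element is integral.\<close>

sublocale integers: maximal_order "ring_of_integers :: 'k set"
proof unfold_locales
  show "is_subring (ring_of_integers :: 'k set)" by (rule ring_of_integers_subring)
  show "\<exists>y::'k. of_nat n * y = 1" if "n > 0" for n using that by (intro exI[of _ "inverse (of_nat n)"]) simp
  show "\<exists>F. finite F \<and> F \<subseteq> (ring_of_integers :: 'k set) \<and>
    (\<forall>x\<in>ring_of_integers. \<exists>f\<in>F. \<exists>y\<in>ring_of_integers. x = f + of_nat n * y)" if "n > 0" for n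
    by (rule ring_of_integers_finite_quotient[OF that])
  show "\<exists>n>0. of_nat n * x \<in> ring_of_integers" for x :: 'k
    using integral_multiple by (simp add: ring_of_integers_def)
next
  fix S :: "'k set" assume S: "is_subring S" "ring_of_integers \<subseteq> S" "is_bounded ring_of_integers S"
  obtain n where n: "n > 0" "\<And>x. x \<in> S \<Longrightarrow> of_nat n * x \<in> ring_of_integers"
    using S(3) by (auto simp: is_bounded_def)
  obtain B where B: "finite B" "(ring_of_integers :: 'k set) = addhull B"
    using addhull_ring_of_integers by blast
  have "x \<in> ring_of_integers" if x: "x \<in> S" for x
    unfolding ring_of_integers_def
  proof (rule CollectI, rule algebraic_int_of_bounded_powers)
    show "finite ((\<lambda>b. b / of_nat n) ` B)" using B(1) by simp
    fix k
    have "addhull B \<subseteq> {z. z / of_nat n \<in> addhull ((\<lambda>b. b / of_nat n) ` B)}"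
    proof (rule addhull_least)
      show "is_addgroup {z. z / of_nat n \<in> addhull ((\<lambda>b. b / of_nat n) ` B)}"
        using addgroup_addhull[of "(\<lambda>b. b / of_nat n) ` B"] by (auto simp: is_addgroup_def diff_divide_distrib)
      show "B \<subseteq> {z. z / of_nat n \<in> addhull ((\<lambda>b. b / of_nat n) ` B)}"
        using addhull_superset[of "(\<lambda>b. b / of_nat n) ` B"] by auto
    qed
    moreover have "of_nat n * x ^ k \<in> addhull B" using n(2)[OF subring_power[OF S(1) x]] B(2) by simp
    ultimately show "x ^ k \<in> addhull ((\<lambda>b. b / of_nat n) ` B)" using n(1) by auto
  qed
  then show "S = ring_of_integers" using S(2) by blast
qed

end

section \<open>Orders in central simple algebras\<close>

lemma a_inv_ring_of_type_algebra:
  "\<ominus>\<^bsub>ring_of_type_algebra\<^esub> x = - (x::'a::ring_1)"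
proof -
  interpret ring "ring_of_type_algebra :: 'a ring" by (rule ring_ring_of_type_algebra)
  have "(- x) \<oplus>\<^bsub>ring_of_type_algebra\<^esub> x = \<zero>\<^bsub>ring_of_type_algebra\<^esub>"
    by (simp add: ring_of_type_algebra_def)
  then show ?thesis by (intro minus_equality) (simp_all add: ring_of_type_algebra_def)
qed

lemma subring_ring_of_type_algebra_iff:
  "subring S ring_of_type_algebra \<longleftrightarrow> is_subring (S :: 'a::ring_1 set)"
proof
  assume S: "subring S ring_of_type_algebra"
  have *: "0 \<in> S" "1 \<in> S" "\<And>x. x \<in> S \<Longrightarrow> - x \<in> S" "\<And>x y. x \<in> S \<Longrightarrow> y \<in> S \<Longrightarrow> x * y \<in> S"
    "\<And>x y. x \<in> S \<Longrightarrow> y \<in> S \<Longrightarrow> x + y \<in> S"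
    using subringE(2,3,5,6,7)[OF S] unfolding a_inv_ring_of_type_algebra
    by (simp_all add: ring_of_type_algebra_def)
  then show "is_subring S"
    by (auto simp: is_subring_def is_addgroup_def intro: *(5)[of _ "- _", simplified])
next
  assume S: "is_subring S"
  show "subring S ring_of_type_algebra"
    by (rule ring.subringI[OF ring_ring_of_type_algebra], unfold a_inv_ring_of_type_algebra)
      (use S in \<open>simp_all add: ring_of_type_algebra_def subring_1 subring_mult
        addgroup_minus addgroup_add subring_addgroup\<close>)
qed

context rational_order
begin

text \<open>The residue of \<open>m * x\<close> in \<open>R\<close> modulo \<open>n * m\<close>
  determines \<open>x\<close> in \<open>S\<close> modulo \<open>n\<close>. For each residue that
  occurs, \<open>g\<close> selects an element of \<open>S\<close> that represents it.\<close>

lemma overorder: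
  assumes S: "is_subring S" "R \<subseteq> S" "is_bounded R S"
  shows "rational_order S"
proof
  obtain m where m: "m > 0" "\<And>x. x \<in> S \<Longrightarrow> of_nat m * x \<in> R" using S(3) by (auto simp: is_bounded_def)
  show "is_subring S" by fact
  show "\<exists>y::'a. of_nat n * y = 1" if "n > 0" for n by (rule unit_of_nat[OF that])
  show "\<exists>n>0. of_nat n * x \<in> S" for x using full[of x] S(2) by blast
  show "\<exists>F. finite F \<and> F \<subseteq> S \<and> (\<forall>x\<in>S. \<exists>f\<in>F. \<exists>y\<in>S. x = f + of_nat n * y)" if n: "n > 0" for n
  proof -
    have "n * m > 0" using n m by simp
    then obtain F where F: "finite F" "F \<subseteq> R" "\<And>x. x \<in> R \<Longrightarrow> \<exists>f\<in>F. \<exists>y\<in>R. x = f + of_nat (n * m) * y"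
      using finite_quotient[of "n * m"] by metis
    define g where "g f = (SOME x. x \<in> S \<and> (\<exists>y\<in>R. of_nat m * x = f + of_nat (n * m) * y))" for f
    let ?P = "\<lambda>f. \<exists>x. x \<in> S \<and> (\<exists>y\<in>R. of_nat m * x = f + of_nat (n * m) * y)"
    have g: "g f \<in> S \<and> (\<exists>y\<in>R. of_nat m * g f = f + of_nat (n * m) * y)" if "?P f" for f
      unfolding g_def by (rule someI_ex[OF that])
    have "\<exists>f\<in>g ` {f \<in> F. ?P f}. \<exists>y\<in>S. x = f + of_nat n * y" if x: "x \<in> S" for x
    proof -
      obtain f y where f: "f \<in> F" "y \<in> R" "of_nat m * x = f + of_nat (n * m) * y"
        using F(3)[OF m(2)[OF x]] by blast
      then have Pf: "?P f" using x by blast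
      then obtain z where z: "z \<in> R" "of_nat m * g f = f + of_nat (n * m) * z" using g by blast
      have "of_nat m * x = of_nat m * (g f + of_nat n * (y - z))"
      proof -
        have "of_nat m * (of_nat n * (y - z)) = of_nat (n * m) * (y - z)"
          by (simp add: mult.assoc mult.commute flip: of_nat_mult mult.assoc)
        then show ?thesis using f(3) z(2) by (simp add: distrib_left right_diff_distrib)
      qed
      then have "x = g f + of_nat n * (y - z)" by (rule of_nat_cancel[OF m(1)])
      moreover have "y - z \<in> S" using addgroup_diff[OF addgroup f(2) z(1)] S(2) by blast
      ultimately show ?thesis using f(1) Pf by blast
    qed
    moreover have "g ` {f \<in> F. ?P f} \<subseteq> S" using g by blast
    ultimately show ?thesis using F(1) by (intro exI[of _ "g ` {f \<in> F. ?P f}"]) simp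
  qed
qed

end

section \<open>Coordinates and the multiplication algebra\<close>

locale csa_number_field = central_simple_algebra scale + num_field "TYPE('k)"
  for scale :: "'k::field_char_0 \<Rightarrow> 'a::ring_1 \<Rightarrow> 'a"
begin

lemma scale_eq_mult: "scale c x = scale c 1 * x"
  using scale_mult_left[of c 1 x] by simp

lemma scale_one_commute: "scale c 1 * x = x * scale c 1"
  by (metis mult.right_neutral mult_1 scale_mult_left scale_mult_right)

lemma scale_of_nat: "scale (of_nat n) x = of_nat n * x"
  by (induction n) (simp_all add: scale_left_distrib algebra_simps)

lemma of_nat_scale: "of_nat n * scale c x = scale (of_nat n * c) x"
  by (simp flip: scale_of_nat)

lemma unit_of_nat_algebra: "n > 0 \<Longrightarrow> \<exists>y::'a. of_nat n * y = 1"
  by (rule exI[of _ "scale (1 / of_nat n) 1"]) (simp flip: scale_of_nat)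

definition BA :: "'a set" where
  "BA = (SOME B. finite B \<and> independent B \<and> span B = UNIV)"

lemma BA: "finite BA" "independent BA" "span BA = UNIV"
proof -
  obtain B where B: "finite B" "span B = UNIV" using finite_dimensional by blast
  obtain C where "C \<subseteq> B" "independent C" "B \<subseteq> span C"
    using maximal_independent_subset[of B] by blast
  then have "\<exists>B. finite B \<and> independent B \<and> span B = UNIV"
    using B finite_subset span_mono span_span by (metis top.extremum_uniqueI)
  then have "finite BA \<and> independent BA \<and> span BA = UNIV" unfolding BA_def by (rule someI_ex)
  then show "finite BA" "independent BA" "span BA = UNIV" by auto
qed

sublocale fd: finite_dimensional_vector_space scale BA
  by unfold_locales (use BA in auto)

abbreviation coord :: "'a \<Rightarrow> 'a \<Rightarrow> 'k" where "coord \<equiv> representation BA"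

lemma coord_sum: "(\<Sum>b\<in>BA. scale (coord x b) b) = x"
  using sum_representation_eq[OF BA(2) _ BA(1) order_refl, of x] BA(3) by simp

lemma coord_scale: "coord (scale c x) b = c * coord x b"
  using representation_scale[OF BA(2)] BA(3) by simp

lemma coord_add: "coord (x + y) b = coord x b + coord y b"
  using representation_add[OF BA(2)] BA(3) by simp

lemma coord_sum_right: "coord (sum f A) b = (\<Sum>a\<in>A. coord (f a) b)"
proof (induction A rule: infinite_finite_induct)
  case empty
  show ?case using coord_scale[of 0 0] by simp
next
  case (infinite A)
  then show ?case using coord_scale[of 0 0] by simp
qed (simp add: coord_add)

text \<open>The image of \<open>A \<otimes> A^op\<close> in the endomorphisms of \<open>A\<close>,
  presented by the maps \<open>a x b\<close> and their sums.\<close>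

inductive_set mult_maps :: "('a \<Rightarrow> 'a) set" where
  mult_map: "(\<lambda>x. a * x * b) \<in> mult_maps"
| mult_maps_add: "f \<in> mult_maps \<Longrightarrow> g \<in> mult_maps \<Longrightarrow> (\<lambda>x. f x + g x) \<in> mult_maps"

lemma mult_maps_sandwich: "f \<in> mult_maps \<Longrightarrow> (\<lambda>x. a * f x * b) \<in> mult_maps"
proof (induction rule: mult_maps.induct)
  case (mult_map c d)
  show ?case using mult_maps.mult_map[of "a * c" "d * b"] by (simp add: mult.assoc)
next
  case (mult_maps_add f g)
  then show ?case using mult_maps.mult_maps_add[OF mult_maps_add.IH] by (simp add: algebra_simps)
qed

lemma mult_maps_diff: "f \<in> mult_maps \<Longrightarrow> g \<in> mult_maps \<Longrightarrow> (\<lambda>x. f x - g x) \<in> mult_maps"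
  using mult_maps_add[of f "\<lambda>x. - 1 * g x * 1"] mult_maps_sandwich[of g "- 1" 1] by simp

lemma mult_maps_sum:
  "(\<And>i. i \<in> I \<Longrightarrow> f i \<in> mult_maps) \<Longrightarrow> (\<lambda>x. \<Sum>i\<in>I. f i x) \<in> mult_maps"
proof (induction I rule: infinite_finite_induct)
  case (insert i I)
  then show ?case using mult_maps_add[of "f i" "\<lambda>x. \<Sum>i\<in>I. f i x"] by simp
qed (use mult_map[of 0 0] in simp_all)

lemma mult_maps_linear:
  assumes "f \<in> mult_maps"
  shows "f (x + y) = f x + f y" "f (scale c x) = scale c (f x)" "f 0 = 0"
  using assms
  by (induction rule: mult_maps.induct)
    (simp_all add: algebra_simps scale_right_distrib flip: scale_mult_left scale_mult_right)

lemma mult_maps_sum_right: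
  assumes "f \<in> mult_maps"
  shows "f (sum g A) = (\<Sum>a\<in>A. f (g a))"
  by (induction A rule: infinite_finite_induct) (simp_all add: mult_maps_linear[OF assms])

text \<open>The values \<open>f y\<close> form a two-sided ideal, which contains \<open>y\<close>;
  simplicity makes it the whole algebra.\<close>

lemma mult_maps_unit:
  assumes "y \<noteq> 0"
  shows "\<exists>f\<in>mult_maps. f y = 1"
proof -
  let ?I = "(\<lambda>f. f y) ` mult_maps"
  have "ideal ?I (ring_of_type_algebra :: 'a ring)"
  proof (rule Ideal.idealI[OF ring_ring_of_type_algebra])
    show "subgroup ?I (add_monoid (ring_of_type_algebra :: 'a ring))"
    proof
      show "inv\<^bsub>add_monoid ring_of_type_algebra\<^esub> x \<in> ?I" if "x \<in> ?I" for x
      proof -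
        obtain f where f: "f \<in> mult_maps" "x = f y" using \<open>x \<in> ?I\<close> by blast
        have "- x \<in> ?I" using imageI[OF mult_maps_sandwich[OF f(1), of "- 1" 1], of "\<lambda>f. f y"] f by simp
        then show ?thesis using a_inv_ring_of_type_algebra[of x] by (simp add: a_inv_def)
      qed
    next
      have "0 \<in> ?I" using imageI[OF mult_map[of 0 0], of "\<lambda>f. f y"] by simp
      then show "\<one>\<^bsub>add_monoid ring_of_type_algebra\<^esub> \<in> ?I" by (simp add: ring_of_type_algebra_def)
    next
      fix u v assume "u \<in> ?I" "v \<in> ?I"
      then obtain f g where "f \<in> mult_maps" "u = f y" "g \<in> mult_maps" "v = g y" by blast
      then have "u + v \<in> ?I" using imageI[OF mult_maps_add[of f g], of "\<lambda>f. f y"] by simp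
      then show "u \<otimes>\<^bsub>add_monoid ring_of_type_algebra\<^esub> v \<in> ?I" by (simp add: ring_of_type_algebra_def)
    qed (simp add: ring_of_type_algebra_def)
  next
    fix u x assume "u \<in> ?I"
    then obtain f where f: "f \<in> mult_maps" "u = f y" by blast
    have "x * u \<in> ?I" "u * x \<in> ?I"
      using imageI[OF mult_maps_sandwich[OF f(1), of x 1], of "\<lambda>f. f y"]
        imageI[OF mult_maps_sandwich[OF f(1), of 1 x], of "\<lambda>f. f y"] f(2) by simp_all
    then show "x \<otimes>\<^bsub>ring_of_type_algebra\<^esub> u \<in> ?I" "u \<otimes>\<^bsub>ring_of_type_algebra\<^esub> x \<in> ?I"
      by (simp_all add: ring_of_type_algebra_def)
  qed
  then consider "?I = {0}" | "?I = UNIV" using simple by blast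
  then show ?thesis
  proof cases
    case 1
    moreover have "y \<in> ?I" using imageI[OF mult_map[of 1 1], of "\<lambda>f. f y"] by simp
    ultimately show ?thesis using assms by simp
  next
    case 2
    then have "1 \<in> ?I" by blast
    then show ?thesis by (metis imageE)
  qed
qed

text \<open>The multiplication algebra contains the dual basis (Artin--Whaples).\<close>

lemma mult_maps_dual:
  assumes "finite F" "independent F"
  shows "\<exists>T. \<forall>e\<in>F. T e \<in> mult_maps \<and> (\<forall>e'\<in>F. T e e' = (if e' = e then 1 else 0))"
  using assms
proof (induction F rule: finite_induct)
  case (insert y F)
  have ind: "independent F" "y \<notin> span F"
    using insert.prems insert.hyps independent_insert[of y F] by auto
  obtain T where T: "\<And>e. e \<in> F \<Longrightarrow> T e \<in> mult_maps"
    "\<And>e e'. e \<in> F \<Longrightarrow> e' \<in> F \<Longrightarrow> T e e' = (if e' = e then 1 else 0)"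
    using insert.IH[OF ind(1)] by blast
  \<comment> \<open>Otherwise the value at \<open>y\<close> of every map in the algebra is
    determined by its values on \<open>F\<close>. Applied to \<open>x \<mapsto> T e x * c\<close>,
    this shows that \<open>T e y\<close> is central, hence a scalar, and the identity map then puts
    \<open>y\<close> into the span of \<open>F\<close>.\<close>
  have "\<exists>f\<in>mult_maps. (\<forall>e\<in>F. f e = 0) \<and> f y \<noteq> 0"
  proof (rule ccontr)
    assume "\<not> ?thesis"
    then have no: "f y = 0" if "f \<in> mult_maps" "\<And>e. e \<in> F \<Longrightarrow> f e = 0" for f using that by blast
    have expand: "f y = (\<Sum>e\<in>F. f e * T e y)" if f: "f \<in> mult_maps" for f
    proof -
      let ?g = "\<lambda>x. f x - (\<Sum>e\<in>F. f e * T e x)"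
      have "(\<lambda>x. f e * T e x) \<in> mult_maps" if "e \<in> F" for e
        using mult_maps_sandwich[OF T(1)[OF that], of "f e" 1] by simp
      then have "?g \<in> mult_maps" by (intro mult_maps_diff f mult_maps_sum)
      moreover have "?g e = 0" if "e \<in> F" for e
      proof -
        have "(\<Sum>e'\<in>F. f e' * T e' e) = (\<Sum>e'\<in>F. if e' = e then f e else 0)"
          by (rule sum.cong) (use T(2)[OF _ that] in auto)
        then show ?thesis using insert.hyps(1) that by simp
      qed
      ultimately have "?g y = 0" by (rule no)
      then show ?thesis by simp
    qed
    have "\<exists>k. T e y = scale k 1" if e: "e \<in> F" for e
    proof -
      have "T e y * c = c * T e y" for c
      proof -
        have "(\<lambda>x. 1 * T e x * c) \<in> mult_maps" by (rule mult_maps_sandwich[OF T(1)[OF e]])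
        then have "T e y * c = (\<Sum>e'\<in>F. 1 * T e e' * c * T e' y)" using expand by force
        also have "\<dots> = (\<Sum>e'\<in>F. if e' = e then c * T e y else 0)"
          by (rule sum.cong) (use T(2)[OF e] in auto)
        finally show ?thesis using insert.hyps(1) e by simp
      qed
      then show ?thesis using central by blast
    qed
    then obtain k where k: "\<And>e. e \<in> F \<Longrightarrow> T e y = scale (k e) 1" by metis
    have "(\<lambda>x. 1 * x * 1) \<in> mult_maps" by (rule mult_map)
    from expand[OF this] have "y = (\<Sum>e\<in>F. e * T e y)" by simp
    also have "\<dots> = (\<Sum>e\<in>F. scale (k e) e)"
      by (rule sum.cong) (simp_all add: k flip: scale_mult_right)
    also have "\<dots> \<in> span F" by (intro span_sum span_scale span_base)
    finally show False using ind(2) by simp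
  qed
  then obtain f where f: "f \<in> mult_maps" "\<And>e. e \<in> F \<Longrightarrow> f e = 0" "f y \<noteq> 0" by blast
  obtain h where h: "h \<in> mult_maps" "h (f y) = 1" using mult_maps_unit[OF f(3)] by blast
  have comp: "(\<lambda>x. h (f x)) \<in> mult_maps" using h(1) f(1)
  proof (induction h rule: mult_maps.induct)
    case (mult_map a b)
    then show ?case by (rule mult_maps_sandwich)
  qed (simp add: mult_maps.mult_maps_add)
  \<comment> \<open>\<open>g\<close> is dual to \<open>y\<close> and vanishes on \<open>F\<close>;
    subtracting \<open>T e y * g\<close> corrects the old dual maps at \<open>y\<close>.\<close>
  define g where "g = (\<lambda>x. h (f x))"
  have g: "g \<in> mult_maps" "g y = 1" "\<And>e. e \<in> F \<Longrightarrow> g e = 0"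
    using comp f(2) h(2) mult_maps_linear(3)[OF h(1)] by (simp_all add: g_def)
  define T' where "T' e = (if e = y then g else (\<lambda>x. T e x - T e y * g x * 1))" for e
  show ?case
  proof (intro exI[of _ T'] ballI conjI)
    fix e assume e: "e \<in> insert y F"
    show "T' e \<in> mult_maps"
    proof (cases "e = y")
      case False
      then have "e \<in> F" using e by simp
      from mult_maps_diff[OF T(1)[OF this] mult_maps_sandwich[OF g(1), of "T e y" 1]]
      show ?thesis using False by (simp add: T'_def)
    qed (simp add: T'_def g(1))
    fix e' assume "e' \<in> insert y F"
    then show "T' e e' = (if e' = e then 1 else 0)"
      using e insert.hyps(2) g T(2) by (auto simp: T'_def)
  qed
qed simp

end

section \<open>Integrality of coordinates in an order\<close>

locale csa_order = csa_number_field scale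
  for scale :: "'k::field_char_0 \<Rightarrow> 'a::ring_1 \<Rightarrow> 'a" +
  fixes R :: "'a set"
  assumes order: "algebra_order scale R"
begin

abbreviation int_K :: "'k set" ("\<O>\<^sub>K") where "\<O>\<^sub>K \<equiv> ring_of_integers"

lemma R_subring: "is_subring R"
  using order by (simp add: algebra_order_def subring_ring_of_type_algebra_iff)

lemmas R_addgroup = subring_addgroup[OF R_subring]

definition gens :: "'a set" where
  "gens = (SOME S. finite S \<and> R = {\<Sum>s\<in>S. scale (c s) s | c. c \<in> S \<rightarrow> \<O>\<^sub>K})"

lemma gens: "finite gens" "R = {\<Sum>s\<in>gens. scale (c s) s | c. c \<in> gens \<rightarrow> \<O>\<^sub>K}"
proof -
  have "\<exists>S. finite S \<and> R = {\<Sum>s\<in>S. scale (c s) s | c. c \<in> S \<rightarrow> \<O>\<^sub>K}"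
    using order by (simp add: algebra_order_def)
  from someI_ex[OF this] show "finite gens" "R = {\<Sum>s\<in>gens. scale (c s) s | c. c \<in> gens \<rightarrow> \<O>\<^sub>K}"
    unfolding gens_def by auto
qed

lemma R_E: "x \<in> R \<Longrightarrow> \<exists>c. x = (\<Sum>s\<in>gens. scale (c s) s) \<and> (\<forall>s\<in>gens. c s \<in> \<O>\<^sub>K)"
  by (subst (asm) gens(2)) auto

lemma R_I: "(\<And>s. s \<in> gens \<Longrightarrow> c s \<in> \<O>\<^sub>K) \<Longrightarrow> (\<Sum>s\<in>gens. scale (c s) s) \<in> R"
  by (subst gens(2)) auto

lemma R_scale:
  assumes "c \<in> \<O>\<^sub>K" "x \<in> R"
  shows "scale c x \<in> R"
proof -
  obtain d where d: "x = (\<Sum>s\<in>gens. scale (d s) s)" "\<And>s. s \<in> gens \<Longrightarrow> d s \<in> \<O>\<^sub>K" using R_E[OF assms(2)] by blast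
  have "scale c x = (\<Sum>s\<in>gens. scale (c * d s) s)" by (simp add: d(1) scale_sum_right)
  then show ?thesis using R_I[of "\<lambda>s. c * d s"] d(2) assms(1) subring_mult[OF ring_of_integers_subring] by simp
qed

lemma R_full: "\<exists>n>0. of_nat n * x \<in> R"
proof -
  have "subspace {x. \<exists>n>0. of_nat n * x \<in> R}"
    unfolding subspace_def
  proof (intro conjI ballI allI CollectI)
    show "\<exists>n>0. of_nat n * 0 \<in> R" using addgroup_0[OF R_addgroup] by (intro exI[of _ 1]) simp
  next
    fix x y assume "x \<in> {x. \<exists>n>0. of_nat n * x \<in> R}" "y \<in> {x. \<exists>n>0. of_nat n * x \<in> R}"
    then obtain m n where mn: "m > 0" "n > 0" "of_nat m * x \<in> R" "of_nat n * y \<in> R" by blast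
    have "of_nat (m * n) * (x + y) = of_nat n * (of_nat m * x) + of_nat m * (of_nat n * y)"
      by (simp add: distrib_left mult.commute flip: mult.assoc of_nat_mult)
    then show "\<exists>n>0. of_nat n * (x + y) \<in> R"
      using mn addgroup_add[OF R_addgroup] addgroup_of_nat[OF R_addgroup]
      by (intro exI[of _ "m * n"]) simp
  next
    fix c x assume "x \<in> {x. \<exists>n>0. of_nat n * x \<in> R}"
    then obtain m where m: "m > 0" "of_nat m * x \<in> R" by blast
    obtain n where n: "n > 0" "of_nat n * c \<in> \<O>\<^sub>K" using integers.full by blast
    have "of_nat (m * n) * scale c x = scale (of_nat n * c) (of_nat m * x)"
      by (simp only: scale_of_nat[symmetric] scale_scale, simp add: mult_ac)
    then show "\<exists>n>0. of_nat n * scale c x \<in> R"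
      using m n R_scale[OF n(2) m(2)] by (intro exI[of _ "m * n"]) simp
  qed
  moreover have "R \<subseteq> {x. \<exists>n>0. of_nat n * x \<in> R}" by (auto intro!: exI[of _ 1])
  ultimately have "span R \<subseteq> {x. \<exists>n>0. of_nat n * x \<in> R}" by (rule span_minimal[rotated])
  moreover have "span R = UNIV" using order by (simp add: algebra_order_def)
  ultimately show ?thesis by auto
qed

sublocale rational_order R
proof
  show "is_subring R" by (rule R_subring)
  show "\<exists>y::'a. of_nat n * y = 1" if "n > 0" for n by (rule unit_of_nat_algebra[OF that])
  show "\<exists>n>0. of_nat n * x \<in> R" for x by (rule R_full)
  show "\<exists>F. finite F \<and> F \<subseteq> R \<and> (\<forall>x\<in>R. \<exists>f\<in>F. \<exists>y\<in>R. x = f + of_nat n * y)" if n: "n > 0" for n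
  proof -
    obtain F where F: "finite F" "F \<subseteq> \<O>\<^sub>K" "\<And>x. x \<in> \<O>\<^sub>K \<Longrightarrow> \<exists>f\<in>F. \<exists>y\<in>\<O>\<^sub>K. x = f + of_nat n * y"
      using integers.finite_quotient[OF n] by blast
    let ?F = "(\<lambda>c. \<Sum>s\<in>gens. scale (c s) s) ` (gens \<rightarrow>\<^sub>E F)"
    have "finite ?F" using F(1) gens(1) by (intro finite_imageI finite_PiE) auto
    moreover have "?F \<subseteq> R" using F(2) by (auto intro!: R_I)
    moreover have "\<exists>f\<in>?F. \<exists>y\<in>R. x = f + of_nat n * y" if "x \<in> R" for x
    proof -
      obtain c where c: "x = (\<Sum>s\<in>gens. scale (c s) s)" "\<And>s. s \<in> gens \<Longrightarrow> c s \<in> \<O>\<^sub>K" using R_E[OF \<open>x \<in> R\<close>] by blast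
      have "\<forall>s\<in>gens. \<exists>f y. f \<in> F \<and> y \<in> \<O>\<^sub>K \<and> c s = f + of_nat n * y" using F(3) c(2) by blast
      then obtain f y where fy: "\<And>s. s \<in> gens \<Longrightarrow> f s \<in> F \<and> y s \<in> \<O>\<^sub>K \<and> c s = f s + of_nat n * y s"
        by metis
      have "x = (\<Sum>s\<in>gens. scale (restrict f gens s) s + of_nat n * scale (y s) s)"
        unfolding c(1) by (rule sum.cong) (use fy in \<open>auto simp: scale_left_distrib simp flip: scale_of_nat\<close>)
      then have "x = (\<Sum>s\<in>gens. scale (restrict f gens s) s) + of_nat n * (\<Sum>s\<in>gens. scale (y s) s)"
        by (simp only: sum.distrib sum_distrib_left)
      moreover have "restrict f gens \<in> gens \<rightarrow>\<^sub>E F" using fy by auto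
      moreover have "(\<Sum>s\<in>gens. scale (y s) s) \<in> R" using fy by (intro R_I) auto
      ultimately show ?thesis by blast
    qed
    ultimately show ?thesis by (intro exI[of _ ?F]) blast
  qed
qed

text \<open>Since \<open>m S \<subseteq> R\<close>, generators of \<open>R\<close> together with
  representatives of \<open>S\<close> modulo \<open>m S\<close> generate \<open>S\<close>.\<close>

lemma overorder_algebra_order:
  assumes S: "is_subring S" "R \<subseteq> S" "is_bounded R S"
  shows "algebra_order scale S"
  unfolding algebra_order_def
proof (intro conjI)
  show "subring S ring_of_type_algebra" using S(1) by (simp add: subring_ring_of_type_algebra_iff)
  have "UNIV \<subseteq> span S" using span_mono[OF S(2)] order by (simp add: algebra_order_def)
  then show "span S = UNIV" by auto
  obtain m where m: "m > 0" "\<And>x. x \<in> S \<Longrightarrow> of_nat m * x \<in> R" using S(3) by (auto simp: is_bounded_def)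
  interpret S: rational_order S by (rule overorder[OF S])
  obtain F where F: "finite F" "F \<subseteq> S" "\<And>x. x \<in> S \<Longrightarrow> \<exists>f\<in>F. \<exists>y\<in>S. x = f + of_nat m * y"
    using S.finite_quotient[OF m(1)] by blast
  have one_K: "1 \<in> \<O>\<^sub>K" "0 \<in> \<O>\<^sub>K"
    using subring_1[OF ring_of_integers_subring] addgroup_0[OF integers.addgroup] by auto
  have S_scale: "scale c x \<in> S" if "c \<in> \<O>\<^sub>K" "x \<in> S" for c x
    using R_scale[OF that(1) subring_1[OF R_subring]] S(2) that(2) subring_mult[OF S(1)]
    by (subst scale_eq_mult) blast
  let ?G = "gens \<union> F"
  have "gens \<subseteq> R"
  proof
    fix g assume g: "g \<in> gens"
    have "(\<Sum>s\<in>gens. scale (if s = g then 1 else 0) s) \<in> R" by (rule R_I) (use one_K in auto)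
    moreover have "(\<Sum>s\<in>gens. scale (if s = g then 1 else 0) s) = (\<Sum>s\<in>gens. if s = g then g else 0)"
      by (rule sum.cong) auto
    ultimately show "g \<in> R" using gens(1) g by simp
  qed
  then have GS: "?G \<subseteq> S" using S(2) F(2) by blast
  have fin: "finite ?G" using gens(1) F(1) by simp
  have "S = {\<Sum>s\<in>?G. scale (c s) s | c. c \<in> ?G \<rightarrow> \<O>\<^sub>K}" (is "S = ?M")
  proof
    show "?M \<subseteq> S" using GS by (auto intro!: addgroup_sum S_scale S.addgroup)
    show "S \<subseteq> ?M"
    proof
      fix x assume "x \<in> S"
      then obtain f y where f: "f \<in> F" "y \<in> S" "x = f + of_nat m * y" using F(3) by blast
      obtain c where c: "of_nat m * y = (\<Sum>s\<in>gens. scale (c s) s)" "\<And>s. s \<in> gens \<Longrightarrow> c s \<in> \<O>\<^sub>K" using R_E[OF m(2)[OF f(2)]] by blast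
      define d where "d s = (if s \<in> gens then c s else 0) + (if s = f then 1 else 0)" for s
      have "d s \<in> \<O>\<^sub>K" for s
        unfolding d_def by (rule addgroup_add[OF integers.addgroup]) (use c(2) one_K in auto)
      moreover have "x = (\<Sum>s\<in>?G. scale (d s) s)"
      proof -
        have "(\<Sum>s\<in>?G. scale (d s) s) = (\<Sum>s\<in>?G. scale (if s \<in> gens then c s else 0) s) +
            (\<Sum>s\<in>?G. scale (if s = f then 1 else 0) s)"
          by (simp add: d_def scale_left_distrib sum.distrib)
        also have "(\<Sum>s\<in>?G. scale (if s \<in> gens then c s else 0) s) = (\<Sum>s\<in>gens. scale (c s) s)"
          by (rule sum.mono_neutral_cong_right) (use fin in auto)
        also have "(\<Sum>s\<in>?G. scale (if s = f then 1 else 0) s) = (\<Sum>s\<in>?G. if s = f then f else 0)"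
          by (rule sum.cong) auto
        finally show ?thesis using fin f c(1) by (simp add: add.commute)
      qed
      ultimately show "x \<in> ?M" by blast
    qed
  qed
  then show "\<exists>G. finite G \<and> S = {\<Sum>s\<in>G. scale (c s) s | c. c \<in> G \<rightarrow> \<O>\<^sub>K}" using fin by blast
qed

text \<open>The scalars in \<open>R\<close> form a ring over \<open>\<O>\<^sub>K\<close>. A
  coordinate in which \<open>1\<close> does not vanish reads them off with bounded denominators, and
  the ring of integers is maximal.\<close>

lemma scalars_integral: "scale c 1 \<in> R \<longleftrightarrow> c \<in> \<O>\<^sub>K"
proof
  show "c \<in> \<O>\<^sub>K \<Longrightarrow> scale c 1 \<in> R" by (rule R_scale[OF _ subring_1[OF subring]])
next
  assume c: "scale c 1 \<in> R"
  let ?S = "{c. scale c 1 \<in> R}"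
  have S: "is_subring ?S"
    unfolding is_subring_def is_addgroup_def
  proof (intro conjI ballI CollectI)
    fix c d assume "c \<in> ?S" "d \<in> ?S"
    then show "scale (c - d) 1 \<in> R" "scale (c * d) 1 \<in> R"
      using addgroup_diff[OF addgroup] subring_mult[OF subring, of "scale c 1" "scale d 1"]
      by (simp_all add: scale_left_diff_distrib scale_eq_mult[of c "scale d 1", symmetric])
  qed (use subring_1[OF subring] addgroup_0[OF addgroup] in simp_all)
  have "\<exists>b. coord 1 b \<noteq> 0"
  proof (rule ccontr)
    assume "\<not> ?thesis"
    then have "(1::'a) = 0" using coord_sum[of 1] by simp
    then show False by simp
  qed
  then obtain b where b: "coord 1 b \<noteq> 0" by blast
  obtain n1 where n1: "n1 > 0" "\<And>s. s \<in> gens \<Longrightarrow> of_nat n1 * coord s b \<in> \<O>\<^sub>K"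
  proof -
    have "\<exists>n>0. \<forall>s\<in>G. of_nat n * coord s b \<in> \<O>\<^sub>K" if "finite G" for G
      using that
    proof (induction G rule: finite_induct)
      case (insert s G)
      then obtain n where n: "n > 0" "\<forall>s\<in>G. of_nat n * coord s b \<in> \<O>\<^sub>K" by blast
      obtain m where m: "m > 0" "of_nat m * coord s b \<in> \<O>\<^sub>K" using integers.full by blast
      have "of_nat (m * n) * coord t b \<in> \<O>\<^sub>K" if "t \<in> insert s G" for t
        using that n m addgroup_of_nat[OF integers.addgroup, of "of_nat n * coord t b" m]
          addgroup_of_nat[OF integers.addgroup, of "of_nat m * coord t b" n]
        by (auto simp: mult_ac)
      then show ?case using m n by (intro exI[of _ "m * n"]) simp
    qed (auto intro: exI[of _ 1])
    then show thesis using that gens(1) by blast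
  qed
  obtain n2 where n2: "n2 > 0" "of_nat n2 * inverse (coord 1 b) \<in> \<O>\<^sub>K" using integers.full by blast
  have "is_bounded \<O>\<^sub>K ?S"
    unfolding is_bounded_def
  proof (intro exI[of _ "n1 * n2"] conjI ballI)
    fix c assume "c \<in> ?S"
    then obtain d where d: "scale c 1 = (\<Sum>s\<in>gens. scale (d s) s)" "\<And>s. s \<in> gens \<Longrightarrow> d s \<in> \<O>\<^sub>K"
      using R_E[of "scale c 1"] by auto
    have "of_nat n1 * (c * coord 1 b) = of_nat n1 * coord (\<Sum>s\<in>gens. scale (d s) s) b"
      by (simp add: coord_scale flip: d(1))
    also have "\<dots> = (\<Sum>s\<in>gens. d s * (of_nat n1 * coord s b))"
      by (simp add: coord_sum_right coord_scale sum_distrib_left mult_ac)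
    also have "\<dots> \<in> \<O>\<^sub>K"
      by (intro addgroup_sum integers.addgroup subring_mult[OF integers.subring] d(2) n1(2))
    finally have "(of_nat n1 * (c * coord 1 b)) * (of_nat n2 * inverse (coord 1 b)) \<in> \<O>\<^sub>K"
      using n2(2) subring_mult[OF integers.subring] by blast
    then show "of_nat (n1 * n2) * c \<in> \<O>\<^sub>K" using b by (simp add: field_simps)
  qed (use n1 n2 in simp)
  moreover have "\<O>\<^sub>K \<subseteq> ?S" using R_scale subring_1[OF subring] by blast
  ultimately have "?S = \<O>\<^sub>K" using integers.maximal[OF S] by blast
  with c show "c \<in> \<O>\<^sub>K" by blast
qed

text \<open>The dual basis lies in the multiplication algebra, so the coordinates of
  \<open>x\<close> arise by multiplying \<open>x\<close> on both sides with fixed elements of the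
  algebra and adding. Clearing the denominators of these elements gives an \<open>m\<close> that
  does not depend on \<open>x\<close>.\<close>

lemma coord_multiple:
  "\<exists>m>0. \<forall>x. \<forall>b\<in>BA. of_nat m * scale (coord x b) 1 \<in> addhull {u * x * v | u v. u \<in> R \<and> v \<in> R}"
proof -
  let ?H = "\<lambda>x. addhull {u * x * v | u v. u \<in> R \<and> v \<in> R}"
  have mm: "\<exists>m>0. \<forall>x. of_nat m * f x \<in> ?H x" if "f \<in> mult_maps" for f
    using that
  proof (induction f rule: mult_maps.induct)
    case (mult_map a b)
    obtain m n where mn: "m > 0" "n > 0" "of_nat m * a \<in> R" "of_nat n * b \<in> R" using full by meson
    have "of_nat (m * n) * (a * x * b) = (of_nat m * a) * x * (of_nat n * b)" for x
      by (metis (no_types, lifting) mult.assoc mult_of_nat_commute of_nat_mult)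
    then have "of_nat (m * n) * (a * x * b) \<in> ?H x" for x
      using mn addhull_superset[of "{u * x * v | u v. u \<in> R \<and> v \<in> R}"] by auto
    then show ?case using mn by (intro exI[of _ "m * n"]) simp
  next
    case (mult_maps_add f g)
    then obtain m n where mn: "m > 0" "n > 0" "\<And>x. of_nat m * f x \<in> ?H x" "\<And>x. of_nat n * g x \<in> ?H x" by blast
    have "of_nat (m * n) * (f x + g x) = of_nat n * (of_nat m * f x) + of_nat m * (of_nat n * g x)" for x
      by (simp add: distrib_left mult.commute flip: mult.assoc of_nat_mult)
    then have "of_nat (m * n) * (f x + g x) \<in> ?H x" for x
      using addgroup_add[OF addgroup_addhull addgroup_of_nat[OF addgroup_addhull mn(3)[of x], of n]
          addgroup_of_nat[OF addgroup_addhull mn(4)[of x], of m]] by (simp only:)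
    then show ?case using mn by (intro exI[of _ "m * n"]) simp
  qed
  obtain T where T: "\<And>e. e \<in> BA \<Longrightarrow> T e \<in> mult_maps"
    "\<And>e e'. e \<in> BA \<Longrightarrow> e' \<in> BA \<Longrightarrow> T e e' = (if e' = e then 1 else 0)"
    using mult_maps_dual[OF BA(1,2)] by blast
  have Tc: "T b x = scale (coord x b) 1" if b: "b \<in> BA" for b x
  proof -
    have "T b x = T b (\<Sum>e\<in>BA. scale (coord x e) e)" by (simp only: coord_sum)
    also have "\<dots> = (\<Sum>e\<in>BA. scale (coord x e) (T b e))"
      by (simp add: mult_maps_sum_right[OF T(1)[OF b]] mult_maps_linear(2)[OF T(1)[OF b]])
    also have "\<dots> = (\<Sum>e\<in>BA. if e = b then scale (coord x b) 1 else 0)"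
      by (rule sum.cong) (use T(2)[OF b] in auto)
    finally show ?thesis using BA(1) b by simp
  qed
  have "\<exists>m>0. \<forall>b\<in>B. \<forall>x. of_nat m * T b x \<in> ?H x" if "finite B" "B \<subseteq> BA" for B
    using that
  proof (induction B rule: finite_induct)
    case (insert b B)
    then obtain n where n: "n > 0" "\<forall>b\<in>B. \<forall>x. of_nat n * T b x \<in> ?H x" by blast
    obtain m where m: "m > 0" "\<forall>x. of_nat m * T b x \<in> ?H x" using mm T(1) insert.prems by blast
    have "of_nat (m * n) * T c x \<in> ?H x" if c: "c \<in> insert b B" for c x
    proof (cases "c = b")
      case True
      have "of_nat (m * n) * T c x = of_nat n * (of_nat m * T c x)"
        by (simp add: mult.commute flip: mult.assoc of_nat_mult)
      then show ?thesis using m(2) True by (simp add: addgroup_of_nat addgroup_addhull)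
    next
      case False
      then have "of_nat n * T c x \<in> ?H x" using c n(2) by blast
      then have "of_nat m * (of_nat n * T c x) \<in> ?H x" by (rule addgroup_of_nat[OF addgroup_addhull])
      then show ?thesis by (simp add: mult.assoc)
    qed
    then show ?case using m n by (intro exI[of _ "m * n"]) simp
  qed (auto intro: exI[of _ 1])
  from this[OF BA(1)] show ?thesis using Tc by auto
qed

lemma integral_coord:
  assumes m: "\<forall>x. \<forall>b\<in>BA. of_nat m * scale (coord x b) 1 \<in> addhull {u * x * v | u v. u \<in> R \<and> v \<in> R}"
    and S: "is_addgroup S" "x \<in> S" "\<And>u v y. u \<in> R \<Longrightarrow> v \<in> R \<Longrightarrow> y \<in> S \<Longrightarrow> u * y * v \<in> S" and b: "b \<in> BA"
  shows "scale (of_nat m * coord x b) 1 \<in> S"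
proof -
  have "addhull {u * x * v | u v. u \<in> R \<and> v \<in> R} \<subseteq> S"
    by (rule addhull_least[OF S(1)]) (use S(2,3) in blast)
  then have "of_nat m * scale (coord x b) 1 \<in> S" using m b by blast
  moreover have "of_nat m * scale (coord x b) 1 = scale (of_nat m * coord x b) 1"
    by (simp flip: scale_of_nat)
  ultimately show ?thesis by (simp only:)
qed

lemma coord_expand:
  assumes "of_nat d * of_nat m * x = z"
  shows "z = (\<Sum>b\<in>BA. scale (of_nat m * coord x b) (of_nat d * b))"
proof -
  have "z = of_nat d * of_nat m * (\<Sum>b\<in>BA. scale (coord x b) b)" using assms by (simp only: coord_sum)
  also have "\<dots> = (\<Sum>b\<in>BA. scale (of_nat m * coord x b) (of_nat d * b))"
    unfolding sum_distrib_left
    by (rule sum.cong[OF refl]) (simp add: mult.assoc scale_mult_right of_nat_scale)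
  finally show ?thesis .
qed

text \<open>For an element of any bounded overring \<open>M\<close>, the coordinates times
  \<open>m\<close> are scalars in \<open>M\<close>, thus integral. So all these overrings have the
  denominator \<open>d * m\<close> in common, and \<open>finite_between\<close> leaves finitely many
  of them.\<close>

theorem contained_in_maximal_order: "\<exists>M. maximal_order M \<and> R \<subseteq> M \<and> is_bounded R M"
proof -
  obtain m where m: "m > 0"
    "\<forall>x. \<forall>b\<in>BA. of_nat m * scale (coord x b) 1 \<in> addhull {u * x * v | u v. u \<in> R \<and> v \<in> R}"
    using coord_multiple by blast
  obtain d where d: "d > 0" "\<forall>b\<in>BA. of_nat d * b \<in> R" using common_denominator_exists[OF BA(1)] by blast
  define \<A> where "\<A> = {M. is_subring M \<and> R \<subseteq> M \<and> is_bounded R M}"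
  have uniform: "of_nat d * of_nat m * x \<in> R" if M: "M \<in> \<A>" and x: "x \<in> M" for M x
  proof -
    have Ms: "is_subring M" "R \<subseteq> M" "is_bounded R M" using M by (auto simp: \<A>_def)
    have K: "c \<in> \<O>\<^sub>K" if "scale c 1 \<in> M" for c
    proof -
      interpret M: csa_order scale M
        by unfold_locales (rule overorder_algebra_order[OF Ms])
      show ?thesis using that M.scalars_integral by blast
    qed
    have "of_nat m * coord x b \<in> \<O>\<^sub>K" if "b \<in> BA" for b
      by (rule K, rule integral_coord[OF m(2) subring_addgroup[OF Ms(1)] x _ that])
        (use Ms(2) subring_mult[OF Ms(1)] in blast)
    then show ?thesis
      unfolding coord_expand[OF refl, of d m x]
      by (intro addgroup_sum addgroup R_scale) (use d in auto)
  qed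
  let ?n = "d * m"
  have n: "?n > 0" using d m by simp
  define \<phi> where "\<phi> M = (\<lambda>x. of_nat ?n * x) ` M" for M :: "'a set"
  have "finite (\<phi> ` \<A>)"
  proof (rule finite_subset[OF _ finite_between[OF n]], clarify, intro conjI ballI)
    fix M assume M: "M \<in> \<A>"
    then have Ms: "is_subring M" "R \<subseteq> M" by (auto simp: \<A>_def)
    have "\<phi> M = {of_nat ?n * y | y. y \<in> M}" by (auto simp: \<phi>_def)
    then show "is_addgroup (\<phi> M)" using addgroup_of_nat_image[OF subring_addgroup[OF Ms(1)], of ?n] by (simp only:)
    show "of_nat ?n * x \<in> \<phi> M" if "x \<in> R" for x using that Ms by (auto simp: \<phi>_def)
    show "\<phi> M \<subseteq> R" using uniform[OF M] by (auto simp: \<phi>_def)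
  qed
  moreover have "inj_on \<phi> \<A>"
  proof -
    have "inj (\<lambda>x::'a. of_nat ?n * x)" using of_nat_cancel[OF n] by (auto simp: inj_def)
    then show ?thesis unfolding \<phi>_def by (simp add: inj_image_eq_iff inj_on_def)
  qed
  ultimately have "finite \<A>" by (rule finite_imageD)
  moreover have "R \<in> \<A>" by (simp add: \<A>_def subring bounded_self)
  ultimately obtain M where M: "M \<in> \<A>" and max: "\<And>S. S \<in> \<A> \<Longrightarrow> M \<subseteq> S \<Longrightarrow> S = M"
    using finite_maximal_set by meson
  have Ms: "is_subring M" "R \<subseteq> M" "is_bounded R M" using M by (auto simp: \<A>_def)
  have "maximal_order M"
  proof (intro maximal_order.intro overorder[OF Ms] maximal_order_axioms.intro)
    fix S assume S: "is_subring S" "M \<subseteq> S" "is_bounded M S"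
    obtain k where k: "k > 0" "\<And>x. x \<in> M \<Longrightarrow> of_nat k * x \<in> R" using Ms(3) by (auto simp: is_bounded_def)
    obtain l where l: "l > 0" "\<And>x. x \<in> S \<Longrightarrow> of_nat l * x \<in> M" using S(3) by (auto simp: is_bounded_def)
    have "of_nat (k * l) * x \<in> R" if "x \<in> S" for x using k(2)[OF l(2)[OF that]] by (simp add: mult.assoc)
    then have "is_bounded R S" unfolding is_bounded_def using k l by (intro exI[of _ "k * l"]) simp
    then show "S = M" using S Ms by (intro max) (auto simp: \<A>_def)
  qed
  with Ms show ?thesis by blast
qed

text \<open>By \<open>coord_multiple\<close> an element \<open>x\<close> of \<open>I\<close> outside
  \<open>P\<close> yields scalars in \<open>I\<close>, its coordinates times \<open>m\<close>. At
  least one of them is, locally at \<open>p\<close>, not in \<open>n p\<close>; then it divides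
  \<open>n\<close> locally, as in a valuation ring. This gives an \<open>s\<close> outside
  \<open>p\<close> with \<open>s n\<close> in \<open>I\<close>.\<close>

theorem ideal_meets_scalars:
  assumes P: "is_prime_ideal R P"
  shows "\<exists>m>0. \<forall>I. is_ideal R I \<longrightarrow> \<not> I \<subseteq> P \<longrightarrow>
    (\<exists>s\<in>(\<lambda>c. scale c 1) ` \<O>\<^sub>K. s \<notin> P \<and> s * of_nat m \<in> I)"
proof -
  obtain m where m: "m > 0"
    "\<forall>x. \<forall>b\<in>BA. of_nat m * scale (coord x b) 1 \<in> addhull {u * x * v | u v. u \<in> R \<and> v \<in> R}"
    using coord_multiple by blast
  obtain d where d: "d > 0" "\<forall>b\<in>BA. of_nat d * b \<in> R" using common_denominator_exists[OF BA(1)] by blast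
  let ?n = "d * m"
  have n: "?n > 0" using d m by simp
  note Pid = prime_ideal[OF P]
  define p where "p = {c \<in> \<O>\<^sub>K. scale c 1 \<in> P}"
  have p_add: "is_addgroup p"
    unfolding p_def using integers.addgroup ideal_addgroup[OF Pid]
    by (auto simp: is_addgroup_def scale_left_diff_distrib)
  have one: "1 \<notin> p" using ideal_one[OF Pid subring] P by (auto simp: p_def is_prime_ideal_def)
  have KR: "scale c 1 \<in> R" if "c \<in> \<O>\<^sub>K" for c using scalars_integral that by blast
  have mult1: "scale c 1 * scale e 1 = scale (c * e) 1" for c e
    by (simp add: scale_eq_mult[symmetric])
  have p_left: "c * e \<in> p" if "c \<in> \<O>\<^sub>K" "e \<in> p" for c e
    using that ideal_left[OF Pid KR[OF that(1)], of "scale e 1"] subring_mult[OF integers.subring]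
    by (auto simp: p_def mult1)
  have p_prime: "c * e \<notin> p" if "c \<in> \<O>\<^sub>K - p" "e \<in> \<O>\<^sub>K - p" for c e
  proof
    assume "c * e \<in> p"
    then have "scale c 1 * scale e 1 \<in> P" by (simp add: p_def mult1)
    then have "scale c 1 \<in> P \<or> scale e 1 \<in> P"
      by (intro prime_ideal_central[OF P] KR scale_one_commute) (use that in auto)
    then show False using that by (auto simp: p_def)
  qed
  have "\<exists>s\<in>\<O>\<^sub>K - p. scale (s * of_nat ?n) 1 \<in> I" if I: "is_ideal R I" "\<not> I \<subseteq> P" for I
  proof -
    obtain x where x: "x \<in> I" "x \<notin> P" using I(2) by blast
    have xR: "x \<in> R" using x ideal_subset[OF I(1)] by blast
    let ?y = "\<lambda>b. of_nat m * coord x b"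
    have yI: "scale (?y b) 1 \<in> I" if "b \<in> BA" for b
      by (rule integral_coord[OF m(2) ideal_addgroup[OF I(1)] x(1) _ that])
        (rule ideal_right[OF I(1) _ ideal_left[OF I(1)]])
    then have yK: "?y b \<in> \<O>\<^sub>K" if "b \<in> BA" for b
      using that ideal_subset[OF I(1)] scalars_integral by blast
    \<comment> \<open>Otherwise the scalars, divided by \<open>?n\<close>, would all lie in
      \<open>p\<close> after multiplication by one \<open>s\<close> outside \<open>p\<close>;
      expanding \<open>x\<close> in the elements \<open>d b\<close> of \<open>R\<close> would put
      \<open>s x\<close>, and hence \<open>x\<close>, into \<open>P\<close>.\<close>
    have "\<exists>b\<in>BA. \<forall>s\<in>\<O>\<^sub>K - p. \<forall>z\<in>p. s * ?y b \<noteq> of_nat ?n * z"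
    proof (rule ccontr)
      assume "\<not> ?thesis"
      then have "\<forall>b\<in>BA. \<exists>s z. s \<in> \<O>\<^sub>K - p \<and> z \<in> p \<and> s * ?y b = of_nat ?n * z" by blast
      then obtain s z where sz: "\<And>b. b \<in> BA \<Longrightarrow> s b \<in> \<O>\<^sub>K - p \<and> z b \<in> p \<and> s b * ?y b = of_nat ?n * z b"
        by metis
      have prod: "prod s B \<in> \<O>\<^sub>K - p" if "B \<subseteq> BA" for B
        using finite_subset[OF that BA(1)] that
      proof (induction B rule: finite_induct)
        case (insert b B)
        then show ?case
          using sz[of b] p_prime subring_mult[OF integers.subring, of "s b" "prod s B"] by auto
      qed (use one subring_1[OF integers.subring] in simp)
      let ?s = "prod s BA"
      have "\<exists>z'\<in>p. ?s * ?y b = of_nat ?n * z'" if b: "b \<in> BA" for b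
      proof (intro bexI[of _ "prod s (BA - {b}) * z b"])
        have "?s = s b * prod s (BA - {b})" using BA(1) b by (simp add: prod.remove)
        then show "?s * ?y b = of_nat ?n * (prod s (BA - {b}) * z b)"
        proof -
          have "?s * ?y b = prod s (BA - {b}) * (s b * ?y b)"
            by (simp only: \<open>?s = s b * prod s (BA - {b})\<close> mult_ac)
          also have "s b * ?y b = of_nat ?n * z b" using sz[OF b] by blast
          finally show ?thesis by (simp only: mult_ac)
        qed
        show "prod s (BA - {b}) * z b \<in> p" using prod[of "BA - {b}"] sz[OF b] by (intro p_left) auto
      qed
      then obtain z' where z': "\<And>b. b \<in> BA \<Longrightarrow> z' b \<in> p \<and> ?s * ?y b = of_nat ?n * z' b" by metis
      have "of_nat ?n * (scale ?s 1 * x) = scale ?s 1 * (of_nat d * of_nat m * x)"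
        by (metis mult.assoc mult_of_nat_commute of_nat_mult)
      also have "\<dots> = (\<Sum>b\<in>BA. scale (?s * ?y b) (of_nat d * b))"
        by (subst coord_expand[OF refl]) (simp add: scale_sum_right flip: scale_eq_mult)
      also have "\<dots> = (\<Sum>b\<in>BA. scale (of_nat ?n * z' b) (of_nat d * b))"
        by (rule sum.cong) (use z' in auto)
      also have "\<dots> = of_nat ?n * (\<Sum>b\<in>BA. scale (z' b) (of_nat d * b))"
        unfolding sum_distrib_left by (intro sum.cong refl) (simp only: scale_of_nat[symmetric] scale_scale, simp only: mult_ac)
      finally have "scale ?s 1 * x = (\<Sum>b\<in>BA. scale (z' b) (of_nat d * b))"
        by (rule of_nat_cancel[OF n])
      also have "\<dots> = (\<Sum>b\<in>BA. scale (z' b) 1 * (of_nat d * b))"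
        by (intro sum.cong refl) (rule scale_eq_mult)
      also have "\<dots> \<in> P"
        by (intro addgroup_sum ideal_addgroup[OF Pid] ideal_right[OF Pid]) (use z' d in \<open>auto simp: p_def\<close>)
      finally have "scale ?s 1 \<in> P \<or> x \<in> P"
        using prod[of BA] by (intro prime_ideal_central[OF P KR xR scale_one_commute]) auto
      then show False using x(2) prod[of BA] by (auto simp: p_def)
    qed
    then obtain b where b: "b \<in> BA" "\<And>s z. s \<in> \<O>\<^sub>K - p \<Longrightarrow> z \<in> p \<Longrightarrow> s * ?y b \<noteq> of_nat ?n * z" by blast
    define y where "y = ?y b"
    have y: "y \<in> \<O>\<^sub>K" "scale y 1 \<in> I" using yK yI b(1) by (auto simp: y_def)
    \<comment> \<open>Invertibility of the ideal \<open>Q\<close> generated by \<open>?n\<close> and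
      \<open>y\<close> replaces the valuation: some \<open>t\<close> in its inverse has
      \<open>t * y\<close> or \<open>t * ?n\<close> outside \<open>p\<close>. That
      \<open>t * y\<close> lies in \<open>p\<close> is then excluded by the choice of
      \<open>b\<close>.\<close>
    define Q where "Q = {of_nat ?n * u + y * v | u v. u \<in> \<O>\<^sub>K \<and> v \<in> \<O>\<^sub>K}"
    have zero: "0 \<in> \<O>\<^sub>K" and oneK: "1 \<in> \<O>\<^sub>K"
      using addgroup_0[OF integers.addgroup] subring_1[OF integers.subring] by auto
    have QI: "of_nat ?n * u + y * v \<in> Q" if "u \<in> \<O>\<^sub>K" "v \<in> \<O>\<^sub>K" for u v
      unfolding Q_def using that by blast
    have nQ: "of_nat ?n \<in> Q" "y \<in> Q" using QI[OF oneK zero] QI[OF zero oneK] by simp_all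
    let ?D = "{t. \<forall>q\<in>Q. t * q \<in> \<O>\<^sub>K}"
    have gen: "?D \<star> Q = \<O>\<^sub>K"
    proof (rule integers.lattice_generates[OF _ _ n nQ(1)])
      show "is_addgroup Q"
      proof (rule addgroupI)
        show "0 \<in> Q" using QI[OF zero zero] by simp
        fix a c assume "a \<in> Q" "c \<in> Q"
        then obtain u v u' v' where *: "a = of_nat ?n * u + y * v" "c = of_nat ?n * u' + y * v'"
          "u \<in> \<O>\<^sub>K" "v \<in> \<O>\<^sub>K" "u' \<in> \<O>\<^sub>K" "v' \<in> \<O>\<^sub>K" unfolding Q_def by blast
        have "a - c = of_nat ?n * (u - u') + y * (v - v')" by (simp add: * algebra_simps)
        then show "a - c \<in> Q" using QI * addgroup_diff[OF integers.addgroup] by metis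
      qed
      have "of_nat ?n * u + y * v \<in> \<O>\<^sub>K" if "u \<in> \<O>\<^sub>K" "v \<in> \<O>\<^sub>K" for u v
        by (intro addgroup_add[OF integers.addgroup] addgroup_of_nat[OF integers.addgroup]
            subring_mult[OF integers.subring] y(1) that)
      then have "Q \<subseteq> \<O>\<^sub>K" unfolding Q_def by blast
      then show "is_bounded \<O>\<^sub>K Q" by (rule bounded_mono[OF bounded_self _ order_refl])
      fix q r assume "q \<in> Q" "r \<in> \<O>\<^sub>K"
      then obtain u v where "q = of_nat ?n * u + y * v" "u \<in> \<O>\<^sub>K" "v \<in> \<O>\<^sub>K" unfolding Q_def by blast
      then show "q * r \<in> Q"
        using QI[of "u * r" "v * r"] subring_mult[OF integers.subring] \<open>r \<in> \<O>\<^sub>K\<close>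
        by (simp add: distrib_right mult.assoc)
    qed
    have "\<exists>t\<in>?D. t * y \<notin> p \<or> t * of_nat ?n \<notin> p"
    proof (rule ccontr)
      assume no: "\<not> ?thesis"
      have "?D \<star> Q \<subseteq> p"
      proof (rule sprod_least[OF p_add])
        fix t q assume t: "t \<in> ?D" and "q \<in> Q"
        then obtain u v where q: "q = of_nat ?n * u + y * v" "u \<in> \<O>\<^sub>K" "v \<in> \<O>\<^sub>K" unfolding Q_def by blast
        have "t * q = u * (t * of_nat ?n) + v * (t * y)" by (simp add: q algebra_simps)
        moreover have "t * y \<in> p" "t * of_nat ?n \<in> p" using no t by blast+
        ultimately show "t * q \<in> p" using addgroup_add[OF p_add p_left[OF q(2)] p_left[OF q(3)]] by simp
      qed
      then show False using gen oneK one by blast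
    qed
    then obtain t where t: "t \<in> ?D" "t * y \<notin> p \<or> t * of_nat ?n \<notin> p" by blast
    have tK: "t * y \<in> \<O>\<^sub>K" "t * of_nat ?n \<in> \<O>\<^sub>K" using t(1) nQ by auto
    show ?thesis
    proof (cases "t * y \<in> p")
      case True
      then have "t * of_nat ?n \<in> \<O>\<^sub>K - p" using t(2) tK by blast
      from b(2)[OF this True] have False by (simp add: y_def[symmetric] mult_ac)
      then show ?thesis ..
    next
      case False
      have "t * y * of_nat ?n = (t * of_nat ?n) * y" by (simp add: mult_ac)
      then have "scale (t * y * of_nat ?n) 1 = scale (t * of_nat ?n) 1 * scale y 1" by (simp only: mult1)
      also have "\<dots> \<in> I" by (rule ideal_left[OF I(1) KR[OF tK(2)] y(2)])
      finally show ?thesis using False tK(1) by blast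
    qed
  qed
  moreover have "scale (s * of_nat ?n) 1 = scale s 1 * of_nat ?n" for s
    by (metis mult.right_neutral mult1 scale_of_nat)
  ultimately show ?thesis using n by (intro exI[of _ ?n]) (auto simp: p_def simp del: of_nat_mult)
qed

text \<open>A nonzero coordinate of \<open>x\<close>, with denominators cleared, would be divisible
  by all powers of \<open>N\<close>.\<close>

lemma separated:
  assumes N: "N \<ge> 2" and x: "\<And>k. \<exists>y\<in>R. x = of_nat (N ^ k) * y"
  shows "x = 0"
proof (rule ccontr)
  assume "x \<noteq> 0"
  then obtain b where b: "coord x b \<noteq> 0" using coord_sum[of x] by (metis (no_types, lifting) scale_zero_left sum.neutral)
  obtain n1 where n1: "n1 > 0" "\<And>y. y \<in> R \<Longrightarrow> of_nat n1 * coord y b \<in> \<O>\<^sub>K"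
  proof -
    have "\<exists>n>0. \<forall>s\<in>G. of_nat n * coord s b \<in> \<O>\<^sub>K" if "finite G" for G
      using that
    proof (induction G rule: finite_induct)
      case (insert s G)
      then obtain n where n: "n > 0" "\<forall>s\<in>G. of_nat n * coord s b \<in> \<O>\<^sub>K" by blast
      obtain m where m: "m > 0" "of_nat m * coord s b \<in> \<O>\<^sub>K" using integers.full by blast
      have "of_nat (m * n) * coord t b \<in> \<O>\<^sub>K" if "t \<in> insert s G" for t
        using that n m addgroup_of_nat[OF integers.addgroup, of "of_nat n * coord t b" m]
          addgroup_of_nat[OF integers.addgroup, of "of_nat m * coord t b" n]
        by (auto simp: mult_ac)
      then show ?case using m n by (intro exI[of _ "m * n"]) simp
    qed (auto intro: exI[of _ 1])
    then obtain n where n: "n > 0" "\<forall>s\<in>gens. of_nat n * coord s b \<in> \<O>\<^sub>K" using gens(1) by blast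
    have "of_nat n * coord y b \<in> \<O>\<^sub>K" if y: "y \<in> R" for y
    proof -
      obtain c where c: "y = (\<Sum>s\<in>gens. scale (c s) s)" "\<And>s. s \<in> gens \<Longrightarrow> c s \<in> \<O>\<^sub>K" using R_E[OF y] by blast
      have "of_nat n * coord y b = (\<Sum>s\<in>gens. c s * (of_nat n * coord s b))"
        by (simp add: c(1) coord_sum_right coord_scale sum_distrib_left mult_ac)
      also have "\<dots> \<in> \<O>\<^sub>K"
        by (intro addgroup_sum integers.addgroup subring_mult[OF integers.subring c(2)]) (use n(2) in auto)
      finally show ?thesis .
    qed
    with n(1) show thesis using that by blast
  qed
  obtain n2 where n2: "n2 > 0" "of_nat n2 * inverse (coord x b) \<in> \<O>\<^sub>K" using integers.full by blast
  \<comment> \<open>The exponent is chosen equal to the denominator: \<open>k / N ^ k\<close>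
    becomes an algebraic integer, hence an integer, although \<open>0 < k < N ^ k\<close>.\<close>
  define k where "k = n1 * n2"
  have "k < N ^ k" using N by (meson less_exp order_less_le_trans power_mono zero_le_numeral)
  obtain y where y: "y \<in> R" "x = of_nat (N ^ k) * y" using x by blast
  have "coord x b = of_nat (N ^ k) * coord y b" by (simp only: y(2) coord_scale flip: scale_of_nat)
  then have "of_nat k / of_nat (N ^ k) = (of_nat n1 * coord y b) * (of_nat n2 * inverse (coord x b))"
    using b N by (simp add: k_def field_simps)
  also have "\<dots> \<in> \<O>\<^sub>K" by (rule subring_mult[OF integers.subring n1(2)[OF y(1)] n2(2)])
  finally have "algebraic_int (of_nat k / of_nat (N ^ k) :: 'k)" by (simp add: ring_of_integers_def)
  moreover have "(of_nat k / of_nat (N ^ k) :: 'k) \<in> \<rat>" by (intro Rats_divide Rats_of_nat)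
  ultimately have "(of_nat k / of_nat (N ^ k) :: 'k) \<in> \<int>" by (rule rational_algebraic_int_is_int)
  then obtain z where "(of_nat k / of_nat (N ^ k) :: 'k) = of_int z" by (elim Ints_cases)
  then have "(of_nat k :: 'k) = of_int (z * int (N ^ k))" using N by (simp add: field_simps)
  then have "int k = z * int (N ^ k)" by (metis of_int_eq_iff of_int_of_nat_eq)
  then have "N ^ k dvd k" by (metis dvd_triv_right int_dvd_int_iff)
  moreover have "k > 0" using n1(1) n2(1) by (simp add: k_def)
  ultimately show False using \<open>k < N ^ k\<close> by (meson dvd_imp_le not_le)
qed

end

section \<open>Symmetric multipliers\<close>

definition exchange_mat :: "nat \<Rightarrow> 'l::field mat" where
  "exchange_mat n = mat n n (\<lambda>(i, j). if j = n - Suc i then 1 else 0)"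

lemma exchange_mat_carrier [simp]: "exchange_mat n \<in> carrier_mat n n"
  by (simp add: exchange_mat_def)

lemma exchange_mat_mult:
  assumes "M \<in> carrier_mat n n"
  shows "exchange_mat n * M = mat n n (\<lambda>(i, j). M $$ (n - Suc i, j))"
proof (rule eq_matI)
  fix i j assume "i < dim_row (mat n n (\<lambda>(i, j). M $$ (n - Suc i, j)))" "j < dim_col (mat n n (\<lambda>(i, j). M $$ (n - Suc i, j)))"
  then have ij: "i < n" "j < n" by auto
  have "(exchange_mat n * M) $$ (i, j) = (\<Sum>k\<in>{0..<n}. (if k = n - Suc i then 1 else 0) * M $$ (k, j))"
    using assms ij by (auto simp: exchange_mat_def scalar_prod_def intro!: sum.cong)
  also have "\<dots> = (\<Sum>k\<in>{0..<n}. if k = n - Suc i then M $$ (n - Suc i, j) else 0)"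
    by (rule sum.cong) auto
  also have "\<dots> = M $$ (n - Suc i, j)" using ij by simp
  finally show "(exchange_mat n * M) $$ (i, j) = mat n n (\<lambda>(i, j). M $$ (n - Suc i, j)) $$ (i, j)"
    using ij by simp
qed (use assms in \<open>auto simp: exchange_mat_def\<close>)

lemma exchange_mat_square: "exchange_mat n * exchange_mat n = 1\<^sub>m n"
  unfolding exchange_mat_mult[OF exchange_mat_carrier]
  by (rule eq_matI) (auto simp: exchange_mat_def)

lemma exchange_mat_symmetric: "transpose_mat (exchange_mat n) = exchange_mat n"
  by (rule eq_matI) (auto simp: exchange_mat_def)

text \<open>Reversing the rows turns a Jordan block into a Hankel matrix, whose entries depend on
  \<open>i + j\<close> only.\<close>

lemma exchange_mat_jordan_block:
  "transpose_mat (exchange_mat n * jordan_block n a) = exchange_mat n * jordan_block n (a :: 'l::field)"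
proof -
  have "exchange_mat n * jordan_block n a = mat n n (\<lambda>(i, j). jordan_block n a $$ (n - Suc i, j))"
    by (rule exchange_mat_mult) (simp add: jordan_block_def)
  then show ?thesis by (auto intro!: eq_matI)
qed

lemma mult_block_diagonal:
  assumes "A \<in> carrier_mat n n" "A' \<in> carrier_mat n n" "D \<in> carrier_mat m m" "D' \<in> carrier_mat m m"
  shows "four_block_mat A (0\<^sub>m n m) (0\<^sub>m m n) D * four_block_mat A' (0\<^sub>m n m) (0\<^sub>m m n) D' =
    four_block_mat (A * A') (0\<^sub>m n m) (0\<^sub>m m n) (D * (D' :: 'l::field mat))"
  using assms by (simp add: mult_four_block_mat[of _ n n _ m _ m _ _ n _ m])

lemma transpose_block_diagonal:
  assumes "A \<in> carrier_mat n n" "D \<in> carrier_mat m m"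
  shows "transpose_mat (four_block_mat A (0\<^sub>m n m) (0\<^sub>m m n) D) =
    four_block_mat (transpose_mat A) (0\<^sub>m n m) (0\<^sub>m m n) (transpose_mat (D :: 'l::field mat))"
  using assms by (simp add: transpose_four_block_mat[of _ n n _ m _ m])

text \<open>The witness is the block diagonal matrix of the exchange matrices that belong to the
  Jordan blocks.\<close>

lemma jordan_matrix_symmetrizer:
  fixes n_as :: "(nat \<times> 'l::field) list"
  defines "N \<equiv> sum_list (map fst n_as)"
  shows "\<exists>Q\<in>carrier_mat N N. Q * Q = 1\<^sub>m N \<and> transpose_mat Q = Q \<and>
    transpose_mat (Q * jordan_matrix n_as) = Q * jordan_matrix n_as"
  unfolding N_def
proof (induction n_as)
  case Nil
  show ?case by (rule bexI[of _ "1\<^sub>m 0"]) (auto simp: jordan_matrix_def intro!: eq_matI)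
next
  case (Cons na n_as)
  obtain n a where na: "na = (n, a)" by (cases na)
  define m where "m = sum_list (map fst n_as)"
  let ?J = "jordan_matrix n_as" and ?E = "exchange_mat n :: 'l mat" and ?B = "jordan_block n a"
  obtain Q where Q: "Q \<in> carrier_mat m m" "Q * Q = 1\<^sub>m m" "transpose_mat Q = Q"
    "transpose_mat (Q * ?J) = Q * ?J"
    using Cons.IH unfolding m_def by blast
  have J: "?J \<in> carrier_mat m m" "?B \<in> carrier_mat n n" unfolding m_def by (simp_all add: jordan_block_def)
  let ?Q = "four_block_mat ?E (0\<^sub>m n m) (0\<^sub>m m n) Q"
  have QJ: "?Q * jordan_matrix (na # n_as) = four_block_mat (?E * ?B) (0\<^sub>m n m) (0\<^sub>m m n) (Q * ?J)"
    unfolding na jordan_matrix_Cons m_def[symmetric]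
    by (rule mult_block_diagonal) (use J(1) Q in auto)
  have "?Q * ?Q = four_block_mat (?E * ?E) (0\<^sub>m n m) (0\<^sub>m m n) (Q * Q)"
    by (rule mult_block_diagonal) (use Q in auto)
  also have "\<dots> = 1\<^sub>m (n + m)" by (simp add: exchange_mat_square Q(2))
  finally have 1: "?Q * ?Q = 1\<^sub>m (n + m)" .
  have 2: "transpose_mat ?Q = ?Q"
    by (simp add: transpose_block_diagonal[OF exchange_mat_carrier Q(1)] exchange_mat_symmetric Q(3))
  have 3: "transpose_mat (?Q * jordan_matrix (na # n_as)) = ?Q * jordan_matrix (na # n_as)"
    unfolding QJ
    by (simp add: transpose_block_diagonal[OF mult_carrier_mat[OF exchange_mat_carrier J(2)]
        mult_carrier_mat[OF Q(1) J(1)]] exchange_mat_jordan_block Q(4))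
  have "?Q \<in> carrier_mat (n + m) (n + m)" using Q(1) by simp
  then have "\<exists>Q\<in>carrier_mat (n + m) (n + m). Q * Q = 1\<^sub>m (n + m) \<and> transpose_mat Q = Q \<and>
      transpose_mat (Q * jordan_matrix (na # n_as)) = Q * jordan_matrix (na # n_as)"
    using 1 2 3 by blast
  then show ?case by (simp add: na m_def)
qed

lemma invertible_with_first_column:
  fixes v :: "'l::field vec"
  assumes v: "v \<in> carrier_vec (Suc n)" "v \<noteq> 0\<^sub>v (Suc n)"
  shows "\<exists>P\<in>carrier_mat (Suc n) (Suc n). det P \<noteq> 0 \<and> col P 0 = v"
proof -
  obtain k where k: "k < Suc n" "v $ k \<noteq> 0"
    using v by (metis carrier_vecD dim_vec eq_vecI index_zero_vec)
  \<comment> \<open>The columns after the first are the unit vectors except the one with index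
    \<open>k\<close>; if \<open>k\<close> is not 0, column \<open>k\<close> carries the unit vector
    of index 0, whose place is taken by \<open>v\<close>.\<close>
  define r where "r j = (if j = k then 0 else j)" for j
  define P where "P = mat (Suc n) (Suc n) (\<lambda>(i, j). if j = 0 then v $ i else if i = r j then 1 else 0)"
  have P: "P \<in> carrier_mat (Suc n) (Suc n)" by (simp add: P_def)
  have "x = 0\<^sub>v (Suc n)" if x: "x \<in> carrier_vec (Suc n)" "P *\<^sub>v x = 0\<^sub>v (Suc n)" for x
  proof -
    have e: "v $ i * x $ 0 + (\<Sum>j = 1..<Suc n. (if i = r j then 1 else 0) * x $ j) = 0" if i: "i < Suc n" for i
    proof -
      have "(P *\<^sub>v x) $ i = (\<Sum>j = 0..<Suc n. (if j = 0 then v $ i else if i = r j then 1 else 0) * x $ j)"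
        using x(1) i by (auto simp: P_def scalar_prod_def intro!: sum.cong)
      also have "\<dots> = v $ i * x $ 0 + (\<Sum>j = 1..<Suc n. (if i = r j then 1 else 0) * x $ j)"
        by (subst sum.atLeast_Suc_lessThan) (auto intro!: sum.cong)
      finally show ?thesis using x(2) i by simp
    qed
    have "(\<Sum>j = 1..<Suc n. (if k = r j then 1 else 0) * x $ j) = 0"
      by (rule sum.neutral) (auto simp: r_def)
    with e[OF k(1)] k(2) have x0: "x $ 0 = 0" by simp
    have "x $ j = 0" if j: "j < Suc n" for j
    proof (cases "j = 0")
      case False
      have rj: "r j < Suc n" using j by (simp add: r_def)
      have "(\<Sum>l = 1..<Suc n. (if r j = r l then 1 else 0) * x $ l) = (\<Sum>l = 1..<Suc n. if l = j then x $ j else 0)"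
        by (rule sum.cong) (use False in \<open>auto simp: r_def split: if_splits\<close>)
      also have "\<dots> = x $ j" using False j by (subst sum.delta) auto
      finally show ?thesis using e[OF rj] x0 by simp
    qed (use x0 in simp)
    with x(1) show ?thesis by (intro eq_vecI) auto
  qed
  then have "det P \<noteq> 0" using det_0_iff_vec_prod_zero_field[OF P] by blast
  moreover have "col P 0 = v" by (rule eq_vecI) (use v in \<open>auto simp: P_def\<close>)
  ultimately show ?thesis using P by blast
qed

text \<open>An eigenvector, completed to a basis, clears the first column, and the lower right block
  is treated by induction. The triangular form is the input to the Jordan normal form.\<close>

lemma triangularizable:
  fixes u :: "'l::alg_closed_field mat"
  assumes "u \<in> carrier_mat n n"
  shows "\<exists>T\<in>carrier_mat n n. upper_triangular T \<and> similar_mat u T"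
  using assms
proof (induction n arbitrary: u)
  case 0
  then show ?case by (intro bexI[of _ u]) (auto simp: similar_mat_refl)
next
  case (Suc n)
  have "degree (char_poly u) > 0" using degree_monic_char_poly[OF Suc.prems] by simp
  then obtain e where "poly (char_poly u) e = 0" using alg_closed_imp_poly_has_root by blast
  then have "eigenvalue u e" using eigenvalue_root_char_poly[OF Suc.prems] by simp
  then obtain v where v: "v \<in> carrier_vec (Suc n)" "v \<noteq> 0\<^sub>v (Suc n)" "u *\<^sub>v v = e \<cdot>\<^sub>v v"
    using Suc.prems by (auto simp: eigenvalue_def eigenvector_def)
  obtain P where P: "P \<in> carrier_mat (Suc n) (Suc n)" "det P \<noteq> 0" "col P 0 = v"
    using invertible_with_first_column[OF v(1,2)] by blast
  obtain Q where Q: "Q \<in> carrier_mat (Suc n) (Suc n)" "Q * P = 1\<^sub>m (Suc n)" "P * Q = 1\<^sub>m (Suc n)"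
    using det_non_zero_imp_unit[OF P(1,2), of "()"] by (auto simp: Units_def ring_mat_def)
  define M where "M = Q * u * P"
  have M: "M \<in> carrier_mat (Suc n) (Suc n)" using P Q Suc.prems by (simp add: M_def)
  have Qv: "Q *\<^sub>v v = unit_vec (Suc n) 0"
  proof -
    have "col (Q * P) 0 = Q *\<^sub>v col P 0" by (rule col_mult2[OF Q(1) P(1)]) simp
    then show ?thesis using P(3) Q(2) by simp
  qed
  have "col M 0 = Q *\<^sub>v (u *\<^sub>v v)"
    using col_mult2[OF mult_carrier_mat[OF Q(1) Suc.prems] P(1), of 0] P(3)
      assoc_mult_mat_vec[OF Q(1) Suc.prems v(1)] by (simp add: M_def)
  also have "\<dots> = e \<cdot>\<^sub>v unit_vec (Suc n) 0"
    unfolding v(3) using Qv Q(1) v(1) by (simp add: mult_mat_vec)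
  finally have col: "col M 0 = e \<cdot>\<^sub>v unit_vec (Suc n) 0" .
  have M0: "M $$ (i, 0) = (if i = 0 then e else 0)" if "i < Suc n" for i
    using arg_cong[OF col, of "\<lambda>w. vec_index w i"] that M by simp
  have uM: "similar_mat u M"
  proof -
    have "P * M * Q = u"
    proof -
      have "P * M * Q = (P * Q) * u * (P * Q)"
        unfolding M_def using P(1) Q(1) Suc.prems by (simp add: assoc_mult_mat[of _ "Suc n" "Suc n" _ "Suc n" _ "Suc n"])
      then show ?thesis using Q(3) Suc.prems by simp
    qed
    then show ?thesis using P Q M Suc.prems unfolding similar_mat_def similar_mat_wit_def Let_def
      by (intro exI[of _ P] exI[of _ Q]) auto
  qed
  obtain A1 A2 A0 A3 where split: "split_block M 1 1 = (A1, A2, A0, A3)" by (metis prod_cases4)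
  have A: "A1 \<in> carrier_mat 1 1" "A2 \<in> carrier_mat 1 n" "A0 \<in> carrier_mat n 1" "A3 \<in> carrier_mat n n"
    "M = four_block_mat A1 A2 A0 A3"
    using split_block[OF split, of n n] M by auto
  have A0: "A0 = 0\<^sub>m n 1"
    using split M by (intro eq_matI) (auto simp: split_block_def Let_def M0)
  obtain T where T: "T \<in> carrier_mat n n" "upper_triangular T" "similar_mat A3 T"
    using Suc.IH[OF A(4)] by blast
  obtain B0 where B0: "B0 \<in> carrier_mat 1 n" "similar_mat M (four_block_mat A1 B0 (0\<^sub>m n 1) T)"
    using similar_mat_four_block_0_ex[OF similar_mat_refl[OF A(1)] T(3) A(2,1,4)] A(5) A0 by auto
  have A1: "upper_triangular A1" using A(1) by auto
  have "upper_triangular (four_block_mat A1 B0 (0\<^sub>m n 1) T)"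
    by (rule upper_triangular_four_block[OF A(1) T(1) A1 T(2)])
  moreover have "four_block_mat A1 B0 (0\<^sub>m n 1) T \<in> carrier_mat (Suc n) (Suc n)"
    using four_block_carrier_mat[OF A(1) T(1)] by simp
  ultimately show ?case using similar_mat_trans[OF uM B0(2)] by blast
qed

text \<open>Frobenius: a matrix is conjugate to its transpose by a symmetric matrix.\<close>

lemma symmetrizer_exists:
  fixes u :: "'l::alg_closed_field mat"
  assumes u: "u \<in> carrier_mat n n"
  shows "\<exists>B\<in>carrier_mat n n. det B \<noteq> 0 \<and> transpose_mat B = B \<and> transpose_mat (B * u) = B * u"
proof -
  obtain T where T: "T \<in> carrier_mat n n" "upper_triangular T" "similar_mat u T"
    using triangularizable[OF u] by blast
  obtain n_as where "jordan_nf u n_as"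
    using triangular_to_jnf_vector[OF T(1,2)] similar_mat_trans[OF T(3)] unfolding jordan_nf_def by blast
  then obtain P Q where "similar_mat_wit u (jordan_matrix n_as) P Q"
    by (auto simp: jordan_nf_def similar_mat_def)
  note w = similar_mat_witD2[OF u this]
  let ?J = "jordan_matrix n_as"
  have n: "sum_list (map fst n_as) = n" using w(5) by (metis carrier_matD(1) jordan_matrix_dim(1))
  obtain S where S: "S \<in> carrier_mat n n" "S * S = 1\<^sub>m n" "transpose_mat S = S"
    "transpose_mat (S * ?J) = S * ?J"
    using jordan_matrix_symmetrizer[of n_as] unfolding n by blast
  \<comment> \<open>The symmetrizer of the Jordan form is transported as a bilinear form, by
    congruence with \<open>Q\<close> and not by conjugation, so that symmetry is preserved.\<close>
  let ?B = "transpose_mat Q * S * Q"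
  have c: "?B \<in> carrier_mat n n" using w S by auto
  have detS: "det S \<noteq> 0" using det_mult[OF S(1) S(1)] S(2) by auto
  have detQ: "det Q \<noteq> 0" using det_mult[OF w(6,7)] w(1) by auto
  have "det ?B = det Q * det S * det Q"
    using w S by (simp add: det_mult[of _ n] det_transpose[of Q n])
  then have "det ?B \<noteq> 0" using detS detQ by simp
  moreover have sym: "transpose_mat (transpose_mat Q * M * Q) = transpose_mat Q * M * Q"
    if "M \<in> carrier_mat n n" "transpose_mat M = M" for M
  proof -
    have "transpose_mat (transpose_mat Q * M * Q) = transpose_mat Q * (transpose_mat M * Q)"
      using w(7) that(1) by (simp add: transpose_mult[of _ n n _ n])
    then show ?thesis using w(7) that by (simp add: assoc_mult_mat[of _ n n _ n _ n])
  qed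
  moreover have "?B * u = transpose_mat Q * (S * ?J) * Q"
  proof -
    have "?B * u = transpose_mat Q * S * (Q * (P * ?J * Q))"
      unfolding w(3) using w S by (simp add: assoc_mult_mat[of _ n n _ n _ n])
    also have "Q * (P * ?J * Q) = (Q * P) * (?J * Q)" using w(5-7) by (simp add: assoc_mult_mat[of _ n n _ n _ n])
    also have "\<dots> = ?J * Q" using left_mult_one_mat[OF mult_carrier_mat[OF w(5,7)]] w(2) by simp
    finally show ?thesis using w S by (simp add: assoc_mult_mat[of _ n n _ n _ n])
  qed
  ultimately show ?thesis using c sym[OF S(1,3)] sym[of "S * ?J"] S w(5) by (intro bexI[of _ ?B]) auto
qed

lemma of_nat_alg_closure_inj: "(of_nat m :: 'k::field_char_0 alg_closure) = of_nat n \<longleftrightarrow> m = n"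
proof -
  have "to_ac x = to_ac y \<longleftrightarrow> x = y" for x y :: 'k
  proof -
    interpret h: field_hom "to_ac :: 'k \<Rightarrow> 'k alg_closure" by unfold_locales simp_all
    show ?thesis by (rule h.eq_iff)
  qed
  then show ?thesis by (metis of_nat_eq_iff to_ac_of_nat)
qed

text \<open>The determinant is a polynomial in the parameter and does not vanish identically, so
  finitely many natural numbers are roots. Natural numbers act on the algebra itself, which is why
  they replace \<open>l\<close>.\<close>

lemma det_specialize:
  fixes M :: "'k::field_char_0 alg_closure mat"
  assumes M: "M \<in> carrier_mat n n" and P: "P \<in> carrier_mat n n" and det: "det (M + l \<cdot>\<^sub>m P) \<noteq> 0"
  shows "\<exists>t::nat. det (M + of_nat t \<cdot>\<^sub>m P) \<noteq> 0"
proof -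
  define W where "W = mat n n (\<lambda>ij. [:M $$ ij, P $$ ij:])"
  define p where "p = det W"
  have p: "poly p x = det (M + x \<cdot>\<^sub>m P)" for x
  proof -
    have "map_mat (\<lambda>p. poly p x) W = M + x \<cdot>\<^sub>m P"
      by (rule eq_matI) (use M P in \<open>auto simp: W_def\<close>)
    then show ?thesis using comm_ring_hom.hom_det[OF poly_hom.comm_ring_hom_axioms, of x W] by (simp add: p_def)
  qed
  then have "p \<noteq> 0" using det by (metis poly_0)
  then have "finite {x. poly p x = 0}" by (rule poly_roots_finite)
  moreover have "infinite (range (of_nat :: nat \<Rightarrow> 'k alg_closure))"
    by (rule range_inj_infinite) (simp add: inj_def of_nat_alg_closure_inj)
  ultimately have "\<not> range (of_nat :: nat \<Rightarrow> 'k alg_closure) \<subseteq> {x. poly p x = 0}"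
    using finite_subset by blast
  then obtain t :: nat where "poly p (of_nat t) \<noteq> 0" by blast
  then show ?thesis using p by auto
qed

section \<open>The adjoint involution and descent from the algebraic closure\<close>

context csa_number_field
begin

text \<open>Left multiplication is linear, so in finite dimension injectivity gives surjectivity;
  the right inverse obtained is a left inverse by cancelling \<open>s\<close>.\<close>

lemma unit_if_left_regular:
  assumes "\<And>y. s * y = 0 \<Longrightarrow> y = 0"
  shows "\<exists>y. s * y = 1 \<and> y * s = (1::'a)"
proof -
  have lin: "Vector_Spaces.linear scale scale (\<lambda>y. s * y)"
    unfolding Vector_Spaces.linear_iff
    using vector_space_axioms by (simp add: distrib_left scale_mult_right)
  have "inj (\<lambda>y. s * y)"
    using assms by (intro injI) (metis eq_iff_diff_eq_0 right_diff_distrib)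
  then have "surj (\<lambda>y. s * y)" by (rule fd.linear_inj_imp_surj[OF lin])
  then obtain y where y: "s * y = 1" by (metis surjD)
  have "s * (y * s - 1) = 0" using y by (simp add: right_diff_distrib flip: mult.assoc)
  then have "y * s - 1 = 0" by (rule assms)
  with y show ?thesis by auto
qed

end

locale split_involution = csa_number_field scale
  for scale :: "'k::field_char_0 \<Rightarrow> 'a::ring_1 \<Rightarrow> 'a" +
  fixes \<sigma> :: "'a \<Rightarrow> 'a" and n :: nat and \<phi> :: "'a \<Rightarrow> 'k alg_closure mat"
    and \<tau> :: "'k alg_closure mat \<Rightarrow> 'k alg_closure mat" and b
  assumes split: "splitting scale n \<phi>"
    and tau_carrier: "\<tau> \<in> carrier_mat n n \<rightarrow> carrier_mat n n"
    and tau_add: "M \<in> carrier_mat n n \<Longrightarrow> N \<in> carrier_mat n n \<Longrightarrow> \<tau> (M + N) = \<tau> M + \<tau> N"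
    and tau_smult: "M \<in> carrier_mat n n \<Longrightarrow> \<tau> (c \<cdot>\<^sub>m M) = c \<cdot>\<^sub>m \<tau> M"
    and tau_phi: "\<tau> (\<phi> x) = \<phi> (\<sigma> x)"
    and form: "bilinear_form n b"
    and form_nonzero: "\<exists>v \<in> carrier_vec n. \<exists>w \<in> carrier_vec n. b v w \<noteq> 0"
    and form_adjoint: "M \<in> carrier_mat n n \<Longrightarrow> v \<in> carrier_vec n \<Longrightarrow> w \<in> carrier_vec n \<Longrightarrow>
      b v (M *\<^sub>v w) = b (\<tau> M *\<^sub>v v) w"
    and form_symmetric: "v \<in> carrier_vec n \<Longrightarrow> w \<in> carrier_vec n \<Longrightarrow> b v w = b w v"
begin

lemma phi_carrier: "\<phi> x \<in> carrier_mat n n"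
  and phi_add: "\<phi> (x + y) = \<phi> x + \<phi> y"
  and phi_mult: "\<phi> (x * y) = \<phi> x * \<phi> y"
  and phi_scale: "\<phi> (scale c x) = to_ac c \<cdot>\<^sub>m \<phi> x"
  using split unfolding splitting_def ring_hom_def
  by (auto simp: ring_of_type_algebra_def ring_mat_simps Pi_def)

lemma phi_dim [simp]: "dim_row (\<phi> x) = n" "dim_col (\<phi> x) = n"
  using phi_carrier[of x] by auto

definition Gram :: "'k alg_closure mat" where
  "Gram = mat n n (\<lambda>(i, j). b (unit_vec n i) (unit_vec n j))"

lemma Gram_carrier: "Gram \<in> carrier_mat n n"
  by (simp add: Gram_def)

lemma form_add_right: "u \<in> carrier_vec n \<Longrightarrow> v \<in> carrier_vec n \<Longrightarrow> w \<in> carrier_vec n \<Longrightarrow> b u (v + w) = b u v + b u w"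
  and form_smult_right: "v \<in> carrier_vec n \<Longrightarrow> w \<in> carrier_vec n \<Longrightarrow> b v (c \<cdot>\<^sub>v w) = c * b v w"
  using form by (auto simp: bilinear_form_def)

lemma form_right_expand:
  assumes v: "v \<in> carrier_vec n" and w: "w \<in> carrier_vec n"
  shows "b v w = (\<Sum>j<n. w $ j * b v (unit_vec n j))"
proof -
  have part: "b v (vec n (\<lambda>j. if j < k then w $ j else 0)) = (\<Sum>j<k. w $ j * b v (unit_vec n j))" if "k \<le> n" for k
    using that
  proof (induction k)
    case 0
    have "b v (0 \<cdot>\<^sub>v vec n (\<lambda>j. 0)) = 0 * b v (vec n (\<lambda>j. 0))" by (rule form_smult_right[OF v]) simp
    moreover have "0 \<cdot>\<^sub>v vec n (\<lambda>j. 0) = vec n (\<lambda>j. 0 :: 'k alg_closure)" by (rule eq_vecI) auto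
    ultimately show ?case by simp
  next
    case (Suc k)
    have "vec n (\<lambda>j. if j < Suc k then w $ j else 0) =
        vec n (\<lambda>j. if j < k then w $ j else 0) + (w $ k) \<cdot>\<^sub>v unit_vec n k"
      by (rule eq_vecI) (auto simp: unit_vec_def less_Suc_eq)
    then show ?case using Suc v by (simp add: form_add_right form_smult_right)
  qed
  have "vec n (\<lambda>j. if j < n then w $ j else 0) = w" by (rule eq_vecI) (use w in auto)
  with part[of n] show ?thesis by simp
qed

lemma form_Gram:
  assumes v: "v \<in> carrier_vec n" and w: "w \<in> carrier_vec n"
  shows "b v w = v \<bullet> (Gram *\<^sub>v w)"
proof -
  have "b v w = (\<Sum>i<n. v $ i * b w (unit_vec n i))"
    using form_right_expand[OF w v] form_symmetric[OF v w] by simp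
  also have "\<dots> = (\<Sum>i<n. v $ i * (\<Sum>j<n. w $ j * b (unit_vec n i) (unit_vec n j)))"
  proof (rule sum.cong[OF refl])
    fix i assume "i \<in> {..<n}"
    then show "v $ i * b w (unit_vec n i) = v $ i * (\<Sum>j<n. w $ j * b (unit_vec n i) (unit_vec n j))"
      using form_right_expand[of "unit_vec n i" w] form_symmetric[OF w, of "unit_vec n i"] w by simp
  qed
  also have "\<dots> = v \<bullet> (Gram *\<^sub>v w)"
    using v w by (auto simp: scalar_prod_def Gram_def mult.commute lessThan_atLeast0 intro!: sum.cong)
  finally show ?thesis .
qed

lemma Gram_symmetric: "transpose_mat Gram = Gram"
  by (rule eq_matI) (auto simp: Gram_def form_symmetric)

lemma Gram_adjoint:
  assumes M: "M \<in> carrier_mat n n"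
  shows "Gram * M = transpose_mat (\<tau> M) * Gram"
proof (rule eq_matI)
  have tM: "\<tau> M \<in> carrier_mat n n" using tau_carrier M by blast
  have entry: "N $$ (i, j) = unit_vec n i \<bullet> (N *\<^sub>v unit_vec n j)"
    if "N \<in> carrier_mat n n" "i < n" "j < n" for N :: "'k alg_closure mat" and i j
    using that by (simp add: scalar_prod_left_unit[of _ n] scalar_prod_right_unit[of _ n])
  fix i j assume "i < dim_row (transpose_mat (\<tau> M) * Gram)" "j < dim_col (transpose_mat (\<tau> M) * Gram)"
  then have ij: "i < n" "j < n" using tM by (auto simp: Gram_def)
  have "(Gram * M) $$ (i, j) = unit_vec n i \<bullet> ((Gram * M) *\<^sub>v unit_vec n j)"
    by (rule entry) (use ij M Gram_carrier in auto)
  also have "\<dots> = b (unit_vec n i) (M *\<^sub>v unit_vec n j)"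
    using M Gram_carrier by (simp add: form_Gram assoc_mult_mat_vec[of _ n n _ n])
  also have "\<dots> = b (\<tau> M *\<^sub>v unit_vec n i) (unit_vec n j)" by (rule form_adjoint[OF M]) simp_all
  also have "\<dots> = (\<tau> M *\<^sub>v unit_vec n i) \<bullet> (Gram *\<^sub>v unit_vec n j)"
    by (rule form_Gram) (use tM in auto)
  also have "\<dots> = unit_vec n i \<bullet> (transpose_mat (\<tau> M) *\<^sub>v (Gram *\<^sub>v unit_vec n j))"
    using tM Gram_carrier
      transpose_vec_mult_scalar[OF transpose_carrier_mat[THEN iffD2, OF tM], of "Gram *\<^sub>v unit_vec n j" "unit_vec n i"]
    by simp
  also have "\<dots> = unit_vec n i \<bullet> ((transpose_mat (\<tau> M) * Gram) *\<^sub>v unit_vec n j)"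
    using tM Gram_carrier by (simp add: assoc_mult_mat_vec[of _ n n _ n])
  also have "\<dots> = (transpose_mat (\<tau> M) * Gram) $$ (i, j)"
    by (rule entry[symmetric]) (use ij tM Gram_carrier in auto)
  finally show "(Gram * M) $$ (i, j) = (transpose_mat (\<tau> M) * Gram) $$ (i, j)" .
qed (use M tau_carrier Gram_carrier in auto)

text \<open>A vector \<open>z \<noteq> 0\<close> in the radical can be moved to any \<open>w\<close>
  by a matrix \<open>M\<close>, and the adjoint identity then gives
  \<open>b v w = b (\<tau> M v) z = 0\<close>. So a nonzero form with adjoints is
  nondegenerate.\<close>

lemma Gram_det: "det Gram \<noteq> 0"
proof
  assume "det Gram = 0"
  then obtain z where z: "z \<in> carrier_vec n" "z \<noteq> 0\<^sub>v n" "Gram *\<^sub>v z = 0\<^sub>v n"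
    using det_0_iff_vec_prod_zero_field[OF Gram_carrier] by blast
  have "\<exists>i<n. z $ i \<noteq> 0"
  proof (rule ccontr)
    assume "\<not> ?thesis"
    then have "z = 0\<^sub>v n" using z(1) by (intro eq_vecI) auto
    with z(2) show False by simp
  qed
  then obtain i where i: "i < n" "z $ i \<noteq> 0" by blast
  have "b v w = 0" if v: "v \<in> carrier_vec n" and w: "w \<in> carrier_vec n" for v w
  proof -
    define M where "M = mat n n (\<lambda>(k, l). if l = i then w $ k / z $ i else 0)"
    have M: "M \<in> carrier_mat n n" by (simp add: M_def)
    have "M *\<^sub>v z = w"
    proof (rule eq_vecI)
      fix k assume "k < dim_vec w"
      then have k: "k < n" using w by simp
      have "(M *\<^sub>v z) $ k = (\<Sum>l\<in>{0..<n}. (if l = i then w $ k / z $ i else 0) * z $ l)"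
        using k z(1) by (simp add: M_def scalar_prod_def)
      also have "\<dots> = (\<Sum>l\<in>{0..<n}. if l = i then w $ k else 0)"
        by (rule sum.cong) (use i in auto)
      finally show "(M *\<^sub>v z) $ k = w $ k" using i by simp
    qed (use w in \<open>simp add: M_def\<close>)
    then have "b v w = b (\<tau> M *\<^sub>v v) z" using form_adjoint[OF M v z(1)] by simp
    also have "\<dots> = (\<tau> M *\<^sub>v v) \<bullet> 0\<^sub>v n"
      using form_Gram[OF mult_mat_vec_carrier[OF funcset_mem[OF tau_carrier M] v] z(1)] z(3) by simp
    also have "\<dots> = 0" by (rule scalar_prod_right_zero[OF mult_mat_vec_carrier[OF funcset_mem[OF tau_carrier M] v]])
    finally show ?thesis .
  qed
  with form_nonzero show False by blast
qed

text \<open>Transposing the adjoint identity gives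
  \<open>transpose_mat (Gram * M) = Gram * \<tau> M\<close>, because \<open>Gram\<close> is
  symmetric; this is where orthogonality is used. Then \<open>Gram\<close> is cancelled.\<close>

lemma fixed_if_symmetric:
  assumes M: "M \<in> carrier_mat n n" and sym: "transpose_mat (Gram * M) = Gram * M"
  shows "\<tau> M = M"
proof -
  have tM: "\<tau> M \<in> carrier_mat n n" using tau_carrier M by blast
  have "transpose_mat (Gram * M) = transpose_mat (transpose_mat (\<tau> M) * Gram)"
    by (simp add: Gram_adjoint[OF M])
  also have "\<dots> = Gram * \<tau> M" using tM Gram_carrier by (simp add: transpose_mult[of _ n n _ n] Gram_symmetric)
  finally have eq: "Gram * \<tau> M = Gram * M" by (simp add: sym)
  obtain G' where G': "G' \<in> carrier_mat n n" "G' * Gram = 1\<^sub>m n"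
    using det_non_zero_imp_unit[OF Gram_carrier Gram_det, of "()"] Gram_carrier
    by (auto simp: Units_def ring_mat_def)
  have "G' * (Gram * \<tau> M) = G' * (Gram * M)" by (simp add: eq)
  then show ?thesis using G' Gram_carrier M tM by (simp flip: assoc_mult_mat[of _ n n _ n _ n])
qed

definition B0 :: "'a set" where
  "B0 = (SOME B. finite B \<and> independent B \<and> span B = UNIV \<and>
    (\<forall>M \<in> carrier_mat n n. \<exists>!c. c \<in> B \<rightarrow>\<^sub>E UNIV \<and> M = mat n n (\<lambda>(i, j). \<Sum>e\<in>B. c e * \<phi> e $$ (i, j))))"

lemma B0: "finite B0" "independent B0" "span B0 = UNIV"
  "M \<in> carrier_mat n n \<Longrightarrow> \<exists>!c. c \<in> B0 \<rightarrow>\<^sub>E UNIV \<and> M = mat n n (\<lambda>(i, j). \<Sum>e\<in>B0. c e * \<phi> e $$ (i, j))"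
proof -
  have "\<exists>B. finite B \<and> independent B \<and> span B = UNIV \<and>
    (\<forall>M \<in> carrier_mat n n. \<exists>!c. c \<in> B \<rightarrow>\<^sub>E UNIV \<and> M = mat n n (\<lambda>(i, j). \<Sum>e\<in>B. c e * \<phi> e $$ (i, j)))"
    using split by (simp add: splitting_def)
  from someI_ex[OF this] show "finite B0" "independent B0" "span B0 = UNIV"
    "M \<in> carrier_mat n n \<Longrightarrow> \<exists>!c. c \<in> B0 \<rightarrow>\<^sub>E UNIV \<and> M = mat n n (\<lambda>(i, j). \<Sum>e\<in>B0. c e * \<phi> e $$ (i, j))"
    unfolding B0_def by auto
qed

abbreviation rep0 :: "'a \<Rightarrow> 'a \<Rightarrow> 'k" where "rep0 \<equiv> representation B0"

lemma rep0_sum: "(\<Sum>e\<in>B0. scale (rep0 x e) e) = x"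
  using sum_representation_eq[OF B0(2) _ B0(1) order_refl, of x] B0(3) by simp

lemma phi_entry_add: "i < n \<Longrightarrow> j < n \<Longrightarrow> \<phi> (x + y) $$ (i, j) = \<phi> x $$ (i, j) + \<phi> y $$ (i, j)"
  and phi_entry_scale: "i < n \<Longrightarrow> j < n \<Longrightarrow> \<phi> (scale c x) $$ (i, j) = to_ac c * \<phi> x $$ (i, j)"
  by (simp_all add: phi_add phi_scale)

lemma phi_entry_sum:
  "i < n \<Longrightarrow> j < n \<Longrightarrow> \<phi> (\<Sum>a\<in>A. scale (f a) (g a)) $$ (i, j) = (\<Sum>a\<in>A. to_ac (f a) * \<phi> (g a) $$ (i, j))"
proof (induction A rule: infinite_finite_induct)
  case (infinite A)
  then show ?case using phi_entry_scale[of i j 0 0] by simp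
next
  case empty
  then show ?case using phi_entry_scale[of i j 0 0] by simp
qed (simp add: phi_entry_add phi_entry_scale)

lemma phi_entry_expand: "i < n \<Longrightarrow> j < n \<Longrightarrow> \<phi> x $$ (i, j) = (\<Sum>e\<in>B0. to_ac (rep0 x e) * \<phi> e $$ (i, j))"
  using phi_entry_sum[of i j "rep0 x" "\<lambda>e. e" B0] by (simp add: rep0_sum)

lemma coefficients_zero:
  assumes "\<And>i j. i < n \<Longrightarrow> j < n \<Longrightarrow> (\<Sum>e\<in>B0. c e * \<phi> e $$ (i, j)) = 0" "e \<in> B0"
  shows "c e = 0"
proof -
  let ?M = "0\<^sub>m n n :: 'k alg_closure mat"
  have "?M = mat n n (\<lambda>(i, j). \<Sum>e\<in>B0. restrict c B0 e * \<phi> e $$ (i, j))"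
    by (rule eq_matI) (simp_all add: assms(1))
  moreover have "?M = mat n n (\<lambda>(i, j). \<Sum>e\<in>B0. restrict (\<lambda>_. 0) B0 e * \<phi> e $$ (i, j))"
    by (rule eq_matI) simp_all
  moreover have "restrict c B0 \<in> B0 \<rightarrow>\<^sub>E UNIV" "restrict (\<lambda>_. 0) B0 \<in> B0 \<rightarrow>\<^sub>E (UNIV :: 'k alg_closure set)"
    by auto
  ultimately have "restrict c B0 = restrict (\<lambda>_. 0) B0" using B0(4)[of ?M] by auto
  then show ?thesis using assms(2) by (metis restrict_apply')
qed

lemma phi_inj: "\<phi> x = 0\<^sub>m n n \<Longrightarrow> x = 0"
proof -
  assume "\<phi> x = 0\<^sub>m n n"
  then have "to_ac (rep0 x e) = 0" if "e \<in> B0" for e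
    using that by (intro coefficients_zero[of "\<lambda>e. to_ac (rep0 x e)"]) (simp_all flip: phi_entry_expand)
  then have "rep0 x e = 0" if "e \<in> B0" for e
    using that by (metis mult_zero_left right_inverse to_ac_1 to_ac_mult zero_neq_one)
  then have "(\<Sum>e\<in>B0. scale (rep0 x e) e) = 0" by (intro sum.neutral) simp
  then show "x = 0" by (simp only: rep0_sum)
qed

sublocale ac: vector_space "\<lambda>k (l :: 'k alg_closure). to_ac k * l"
  by unfold_locales (simp_all add: algebra_simps)

text \<open>The image of the tensor \<open>\<Sum> l \<otimes> f l\<close>. If the \<open>l\<close>
  are independent over \<open>K\<close>, the elements \<open>f l\<close> are determined by it
  (\<open>comb_zero\<close>), so equations between such matrices descend to the algebra.\<close>

definition comb :: "'k alg_closure set \<Rightarrow> ('k alg_closure \<Rightarrow> 'a) \<Rightarrow> 'k alg_closure mat" where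
  "comb A f = mat n n (\<lambda>(i, j). \<Sum>l\<in>A. l * \<phi> (f l) $$ (i, j))"

lemma comb_carrier [simp]: "comb A f \<in> carrier_mat n n"
  by (simp add: comb_def)

lemma comb_insert:
  assumes "finite A" "l \<notin> A"
  shows "comb (insert l A) f = l \<cdot>\<^sub>m \<phi> (f l) + comb A f"
  by (rule eq_matI) (use assms in \<open>auto simp: comb_def\<close>)

text \<open>Expanding every \<open>f l\<close> in the basis \<open>B0\<close> gives coefficients in
  \<open>K\<close>; for each basis element they combine the independent \<open>l\<close> to
  0.\<close>

lemma comb_zero:
  assumes A: "finite A" "ac.independent A" and "comb A f = 0\<^sub>m n n" "l \<in> A"
  shows "f l = 0"
proof -
  have "(\<Sum>l\<in>A. to_ac (rep0 (f l) e) * l) = 0" if "e \<in> B0" for e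
  proof (rule coefficients_zero[OF _ that])
    fix i j assume ij: "i < n" "j < n"
    have "(\<Sum>e\<in>B0. (\<Sum>l\<in>A. to_ac (rep0 (f l) e) * l) * \<phi> e $$ (i, j)) =
        (\<Sum>l\<in>A. \<Sum>e\<in>B0. to_ac (rep0 (f l) e) * l * \<phi> e $$ (i, j))"
      by (simp only: sum_distrib_right) (rule sum.swap)
    also have "\<dots> = (\<Sum>l\<in>A. l * \<phi> (f l) $$ (i, j))"
    proof (rule sum.cong[OF refl])
      fix l
      have "l * \<phi> (f l) $$ (i, j) = (\<Sum>e\<in>B0. l * (to_ac (rep0 (f l) e) * \<phi> e $$ (i, j)))"
        by (subst phi_entry_expand[OF ij]) (rule sum_distrib_left)
      then show "(\<Sum>e\<in>B0. to_ac (rep0 (f l) e) * l * \<phi> e $$ (i, j)) = l * \<phi> (f l) $$ (i, j)"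
        by (simp add: mult_ac)
    qed
    also have "\<dots> = comb A f $$ (i, j)" using ij by (simp add: comb_def)
    finally show "(\<Sum>e\<in>B0. (\<Sum>l\<in>A. to_ac (rep0 (f l) e) * l) * \<phi> e $$ (i, j)) = 0" using assms(3) ij by simp
  qed
  then have "rep0 (f l) e = 0" if "e \<in> B0" for e
    using ac.independentD[OF A(2,1) order_refl _ assms(4), of "\<lambda>l. rep0 (f l) e"] that by simp
  then have "(\<Sum>e\<in>B0. scale (rep0 (f l) e) e) = 0" by (intro sum.neutral) simp
  then show ?thesis by (simp only: rep0_sum)
qed

lemma tau_comb: "finite A \<Longrightarrow> \<tau> (comb A f) = comb A (\<lambda>l. \<sigma> (f l))"
proof (induction A rule: finite_induct)
  case empty
  have 0: "comb {} f = 0 \<cdot>\<^sub>m comb {} f" for f by (rule eq_matI) (auto simp: comb_def)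
  have "\<tau> (0 \<cdot>\<^sub>m comb {} f) = 0 \<cdot>\<^sub>m \<tau> (comb {} f)" by (rule tau_smult) simp
  moreover have "0 \<cdot>\<^sub>m \<tau> (comb {} f) = comb {} (\<lambda>l. \<sigma> (f l))"
    using funcset_mem[OF tau_carrier comb_carrier[of "{}" f]] by (intro eq_matI) (auto simp: comb_def carrier_matD)
  ultimately show ?case using 0[of f] by simp
next
  case (insert l A)
  then show ?case
    by (simp add: comb_insert tau_add tau_smult phi_carrier tau_phi)
qed

lemma comb_mult: "comb A f * \<phi> x = comb A (\<lambda>l. f l * x)"
proof (rule eq_matI)
  fix i j assume "i < dim_row (comb A (\<lambda>l. f l * x))" "j < dim_col (comb A (\<lambda>l. f l * x))"
  then have ij: "i < n" "j < n" by (auto simp: comb_def)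
  have "(comb A f * \<phi> x) $$ (i, j) = (\<Sum>k\<in>{0..<n}. (\<Sum>l\<in>A. l * \<phi> (f l) $$ (i, k)) * \<phi> x $$ (k, j))"
    using ij by (simp add: scalar_prod_def comb_def)
  also have "\<dots> = (\<Sum>k\<in>{0..<n}. \<Sum>l\<in>A. l * (\<phi> (f l) $$ (i, k) * \<phi> x $$ (k, j)))"
    by (simp add: sum_distrib_right mult.assoc)
  also have "\<dots> = (\<Sum>l\<in>A. \<Sum>k\<in>{0..<n}. l * (\<phi> (f l) $$ (i, k) * \<phi> x $$ (k, j)))" by (rule sum.swap)
  also have "\<dots> = (\<Sum>l\<in>A. l * \<phi> (f l * x) $$ (i, j))"
    using ij by (intro sum.cong refl) (simp add: phi_mult scalar_prod_def sum_distrib_left)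
  finally show "(comb A f * \<phi> x) $$ (i, j) = comb A (\<lambda>l. f l * x) $$ (i, j)" using ij by (simp add: comb_def)
qed (auto simp: comb_def)

lemma comb_diff:
  assumes "comb A f = comb A g" "finite A"
  shows "comb A (\<lambda>l. f l - g l) = 0\<^sub>m n n"
proof (rule eq_matI)
  fix i j assume "i < dim_row (0\<^sub>m n n)" "j < dim_col (0\<^sub>m n n)"
  then have ij: "i < n" "j < n" by auto
  have d: "\<phi> (x - y) $$ (i, j) = \<phi> x $$ (i, j) - \<phi> y $$ (i, j)" for x y
    using phi_entry_add[OF ij, of "x - y" y] by simp
  have "comb A (\<lambda>l. f l - g l) $$ (i, j) = comb A f $$ (i, j) - comb A g $$ (i, j)"
    using ij by (simp add: comb_def d right_diff_distrib sum_subtractf)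
  then show "comb A (\<lambda>l. f l - g l) $$ (i, j) = 0\<^sub>m n n $$ (i, j)" using assms(1) ij by simp
qed (auto simp: comb_def)

text \<open>The coefficients \<open>l\<close> are replaced by natural numbers one at a time;
  \<open>M\<close> carries the part that is already specialized.\<close>

lemma comb_specialize:
  assumes "finite A" "M \<in> carrier_mat n n" "det (M + comb A f) \<noteq> 0"
  shows "\<exists>t. det (M + \<phi> (\<Sum>l\<in>A. of_nat (t l) * f l)) \<noteq> 0"
  using assms
proof (induction A arbitrary: M rule: finite_induct)
  case empty
  have "comb {} f = \<phi> 0"
    using phi_entry_scale[of _ _ 0 0] by (intro eq_matI) (auto simp: comb_def)
  with empty show ?case by simp
next
  case (insert l A)
  have "M + comb (insert l A) f = (M + comb A f) + l \<cdot>\<^sub>m \<phi> (f l)"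
    unfolding comb_insert[OF insert.hyps] using insert.prems(1) phi_carrier[of "f l"]
    by (intro eq_matI) (auto simp: comb_def)
  then obtain k :: nat where "det ((M + comb A f) + of_nat k \<cdot>\<^sub>m \<phi> (f l)) \<noteq> 0"
    using det_specialize[of "M + comb A f" n "\<phi> (f l)" l] insert.prems phi_carrier by auto
  moreover have "(M + comb A f) + of_nat k \<cdot>\<^sub>m \<phi> (f l) = (M + of_nat k \<cdot>\<^sub>m \<phi> (f l)) + comb A f"
    using insert.prems(1) phi_carrier[of "f l"] by (intro eq_matI) (auto simp: comb_def)
  ultimately have "\<exists>t. det ((M + of_nat k \<cdot>\<^sub>m \<phi> (f l)) + \<phi> (\<Sum>l\<in>A. of_nat (t l) * f l)) \<noteq> 0"
    using insert.prems(1) phi_carrier by (intro insert.IH) auto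
  then obtain t where t: "det ((M + of_nat k \<cdot>\<^sub>m \<phi> (f l)) + \<phi> (\<Sum>l\<in>A. of_nat (t l) * f l)) \<noteq> 0" by blast
  have "(\<Sum>l'\<in>insert l A. of_nat ((t(l := k)) l') * f l') = of_nat k * f l + (\<Sum>l\<in>A. of_nat (t l) * f l)"
  proof -
    have "(\<Sum>l'\<in>A. of_nat ((t(l := k)) l') * f l') = (\<Sum>l\<in>A. of_nat (t l) * f l)"
      by (rule sum.cong) (use insert.hyps in auto)
    then show ?thesis using insert.hyps by simp
  qed
  moreover have "\<phi> (of_nat k * f l) = of_nat k \<cdot>\<^sub>m \<phi> (f l)"
    using phi_scale[of "of_nat k" "f l"] by (simp add: scale_of_nat)
  ultimately have "M + \<phi> (\<Sum>l'\<in>insert l A. of_nat ((t(l := k)) l') * f l') =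
      (M + of_nat k \<cdot>\<^sub>m \<phi> (f l)) + \<phi> (\<Sum>l\<in>A. of_nat (t l) * f l)"
    using insert.prems(1) phi_carrier by (simp add: phi_add assoc_add_mat[of _ n n])
  with t show ?case by metis
qed

text \<open>If \<open>B\<close> symmetrizes \<open>\<phi> x\<close>, then over the closure
  \<open>S = Gram^-1 B\<close> and \<open>S * \<phi> x\<close> are fixed by \<open>\<tau>\<close>.
  Writing \<open>S\<close> as a tensor with independent coefficients, each component
  \<open>f l\<close> inherits both linear conditions; invertibility is then restored by
  specialization.\<close>

lemma symmetric_multiplier:
  assumes sigma_add: "\<And>x y. \<sigma> (x + y) = \<sigma> x + \<sigma> y"
  shows "\<exists>s s'. \<sigma> s = s \<and> s * s' = 1 \<and> s' * s = 1 \<and> \<sigma> (s * x) = s * x"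
proof -
  obtain B where B: "B \<in> carrier_mat n n" "det B \<noteq> 0" "transpose_mat B = B"
    "transpose_mat (B * \<phi> x) = B * \<phi> x"
    using symmetrizer_exists[OF phi_carrier[of x]] by blast
  obtain G' where G': "G' \<in> carrier_mat n n" "Gram * G' = 1\<^sub>m n" "G' * Gram = 1\<^sub>m n"
    using det_non_zero_imp_unit[OF Gram_carrier Gram_det, of "()"] Gram_carrier
    by (auto simp: Units_def ring_mat_def)
  define S where "S = G' * B"
  have S: "S \<in> carrier_mat n n" using G' B by (simp add: S_def)
  have GS: "Gram * S = B" unfolding S_def using assoc_mult_mat[OF Gram_carrier G'(1) B(1)] G'(2) B(1) by simp
  have GSx: "Gram * (S * \<phi> x) = B * \<phi> x"
    using assoc_mult_mat[OF Gram_carrier S phi_carrier[of x]] GS by simp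
  have fix1: "\<tau> S = S" using B GS by (intro fixed_if_symmetric[OF S]) simp
  have fix2: "\<tau> (S * \<phi> x) = S * \<phi> x"
    by (rule fixed_if_symmetric) (use B GSx S phi_carrier[of x] in auto)
  have detS: "det S \<noteq> 0"
  proof
    assume "det S = 0"
    then have "det (Gram * S) = 0" using det_mult[OF Gram_carrier S] by simp
    with GS B(2) show False by simp
  qed
  obtain c where c: "S = mat n n (\<lambda>(i, j). \<Sum>e\<in>B0. c e * \<phi> e $$ (i, j))" using B0(4)[OF S] by blast
  \<comment> \<open>A basis over \<open>K\<close> of the space spanned by the coefficients
    \<open>c e\<close>.\<close>
  obtain \<Lambda> where L: "\<Lambda> \<subseteq> c ` B0" "ac.independent \<Lambda>" "c ` B0 \<subseteq> ac.span \<Lambda>"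
    using ac.maximal_independent_subset[of "c ` B0"] by blast
  have finL: "finite \<Lambda>" using L(1) B0(1) finite_subset by blast
  define r where "r e l = ac.representation \<Lambda> (c e) l" for e l
  have cr: "c e = (\<Sum>l\<in>\<Lambda>. to_ac (r e l) * l)" if "e \<in> B0" for e
    unfolding r_def using ac.sum_representation_eq[OF L(2) _ finL order_refl, of "c e"] L(3) that by auto
  define f where "f l = (\<Sum>e\<in>B0. scale (r e l) e)" for l
  have Sf: "S = comb \<Lambda> f"
  proof (rule eq_matI)
    fix i j assume "i < dim_row (comb \<Lambda> f)" "j < dim_col (comb \<Lambda> f)"
    then have ij: "i < n" "j < n" by (auto simp: comb_def)
    have "S $$ (i, j) = (\<Sum>e\<in>B0. (\<Sum>l\<in>\<Lambda>. to_ac (r e l) * l) * \<phi> e $$ (i, j))"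
      using ij by (simp add: c cr)
    also have "\<dots> = (\<Sum>l\<in>\<Lambda>. \<Sum>e\<in>B0. to_ac (r e l) * l * \<phi> e $$ (i, j))"
      by (simp only: sum_distrib_right) (rule sum.swap)
    also have "\<dots> = (\<Sum>l\<in>\<Lambda>. l * \<phi> (f l) $$ (i, j))"
      unfolding f_def by (intro sum.cong refl) (simp add: phi_entry_sum[OF ij] sum_distrib_left mult_ac)
    finally show "S $$ (i, j) = comb \<Lambda> f $$ (i, j)" using ij by (simp add: comb_def)
  qed (use S in \<open>auto simp: comb_def\<close>)
  have "comb \<Lambda> (\<lambda>l. \<sigma> (f l)) = comb \<Lambda> f" using fix1 tau_comb[OF finL, of f] Sf by simp
  then have f1: "\<sigma> (f l) = f l" if "l \<in> \<Lambda>" for l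
    using comb_zero[OF finL L(2) comb_diff[OF _ finL] that] by fastforce
  have "comb \<Lambda> (\<lambda>l. \<sigma> (f l * x)) = comb \<Lambda> (\<lambda>l. f l * x)"
    using fix2 tau_comb[OF finL, of "\<lambda>l. f l * x"] by (simp add: Sf comb_mult)
  then have f2: "\<sigma> (f l * x) = f l * x" if "l \<in> \<Lambda>" for l
    using comb_zero[OF finL L(2) comb_diff[OF _ finL] that] by fastforce
  have "det (0\<^sub>m n n + comb \<Lambda> f) \<noteq> 0" using detS Sf by simp
  from comb_specialize[OF finL _ this] obtain t where
    "det (0\<^sub>m n n + \<phi> (\<Sum>l\<in>\<Lambda>. of_nat (t l) * f l)) \<noteq> 0" by auto
  then have t: "det (\<phi> (\<Sum>l\<in>\<Lambda>. of_nat (t l) * f l)) \<noteq> 0" by (simp add: phi_carrier)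
  \<comment> \<open>Every combination of the \<open>f l\<close> with natural coefficients satisfies
    the two conditions; \<open>t\<close> keeps the determinant different from 0.\<close>
  define s where "s = (\<Sum>l\<in>\<Lambda>. of_nat (t l) * f l)"
  have sigma_0: "\<sigma> 0 = 0" using sigma_add[of 0 0] by simp
  have sigma_of_nat: "\<sigma> (of_nat k * y) = of_nat k * \<sigma> y" for k y
    by (induction k) (simp_all add: sigma_0 sigma_add distrib_right)
  have sigma_sum: "\<sigma> (sum g A) = (\<Sum>a\<in>A. \<sigma> (g a))" for g and A :: "'k alg_closure set"
    by (induction A rule: infinite_finite_induct) (simp_all add: sigma_0 sigma_add)
  have "\<sigma> s = s" unfolding s_def by (simp add: sigma_sum sigma_of_nat f1)
  moreover have "\<sigma> (s * x) = s * x"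
    unfolding s_def by (simp add: sum_distrib_right mult.assoc sigma_sum sigma_of_nat f2)
  moreover have "y = 0" if "s * y = 0" for y
  proof -
    obtain W where W: "W \<in> carrier_mat n n" "W * \<phi> s = 1\<^sub>m n"
      using det_non_zero_imp_unit[OF phi_carrier t, of "()"]
      by (auto simp: Units_def ring_mat_def s_def)
    have "\<phi> s * \<phi> y = 0\<^sub>m n n"
    proof -
      have "\<phi> 0 = 0\<^sub>m n n" using phi_entry_scale[of _ _ 0 0] by (intro eq_matI) auto
      then show ?thesis using that by (simp flip: phi_mult)
    qed
    then have "W * (\<phi> s * \<phi> y) = 0\<^sub>m n n" using W by simp
    then have "\<phi> y = 0\<^sub>m n n" using W phi_carrier[of s] phi_carrier[of y] by (simp flip: assoc_mult_mat[of _ n n _ n _ n])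
    then show ?thesis by (rule phi_inj)
  qed
  then obtain s' where "s * s' = 1" "s' * s = 1" using unit_if_left_regular[of s] by blast
  ultimately show ?thesis by blast
qed

end

theorem (in csa_number_field) symmetric_multiplier_exists:
  assumes "orthogonal_involution scale \<sigma>"
  shows "\<exists>s s'. \<sigma> s = s \<and> s * s' = 1 \<and> s' * s = 1 \<and> \<sigma> (s * x) = s * x"
proof -
  obtain n \<phi> \<tau> b where *: "splitting scale n \<phi>"
    "\<tau> \<in> carrier_mat n n \<rightarrow> carrier_mat n n"
    "\<forall>M \<in> carrier_mat n n. \<forall>N \<in> carrier_mat n n. \<tau> (M + N) = \<tau> M + \<tau> N"
    "\<forall>c. \<forall>M \<in> carrier_mat n n. \<tau> (c \<cdot>\<^sub>m M) = c \<cdot>\<^sub>m \<tau> M"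
    "\<forall>x. \<tau> (\<phi> x) = \<phi> (\<sigma> x)" "bilinear_form n b"
    "\<exists>v \<in> carrier_vec n. \<exists>w \<in> carrier_vec n. b v w \<noteq> 0"
    "\<forall>M \<in> carrier_mat n n. \<forall>v \<in> carrier_vec n. \<forall>w \<in> carrier_vec n. b v (M *\<^sub>v w) = b (\<tau> M *\<^sub>v v) w"
    "\<forall>v \<in> carrier_vec n. \<forall>w \<in> carrier_vec n. b v w = b w v"
    using assms unfolding orthogonal_involution_def by blast
  interpret split_involution scale \<sigma> n \<phi> \<tau> b
    by unfold_locales (use * in auto)
  show ?thesis
    by (rule symmetric_multiplier) (use assms in \<open>simp add: orthogonal_involution_def involution_def\<close>)
qed

section \<open>Elementary matrices and strong approximation\<close>

context involution_ring
begin

text \<open>The four entries of the equation \<open>M hat(M) = I\<close> for the matrix \<open>M\<close> with rows \<open>(a, b)\<close> and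
  \<open>(c, d)\<close>.\<close>

definition sl :: "'a \<Rightarrow> 'a \<Rightarrow> 'a \<Rightarrow> 'a \<Rightarrow> bool" where
  "sl a b c d \<longleftrightarrow> a * \<sigma> d - b * \<sigma> c = 1 \<and> a * \<sigma> b = b * \<sigma> a \<and> c * \<sigma> d = d * \<sigma> c \<and> d * \<sigma> a - c * \<sigma> b = 1"

text \<open>The entries, by rows, of a product of unipotent matrices, built by multiplication on the
  right. The set \<open>S\<close> of parameters is variable: all symmetric elements at first, those
  with \<open>N\<close>-power denominators after approximation.\<close>

inductive elementary :: "'a set \<Rightarrow> 'a \<Rightarrow> 'a \<Rightarrow> 'a \<Rightarrow> 'a \<Rightarrow> bool" for S where
  one: "elementary S 1 0 0 1"
| upper: "elementary S a b c d \<Longrightarrow> x \<in> S \<Longrightarrow> elementary S a (a * x + b) c (c * x + d)"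
| lower: "elementary S a b c d \<Longrightarrow> x \<in> S \<Longrightarrow> elementary S (a + b * x) b (c + d * x) d"

definition symmetric_elements :: "'a set" where
  "symmetric_elements = {x. \<sigma> x = x}"

lemma elementary_sl:
  assumes "elementary S a b c d" "S \<subseteq> symmetric_elements"
  shows "sl a b c d"
  using assms(1)
proof induction
  case one
  show ?case by (simp add: sl_def)
next
  case (upper a b c d x)
  then have x: "\<sigma> x = x" using assms(2) by (auto simp: symmetric_elements_def)
  have "a * \<sigma> d = 1 + b * \<sigma> c" "a * \<sigma> b = b * \<sigma> a" "c * \<sigma> d = d * \<sigma> c" "d * \<sigma> a = 1 + c * \<sigma> b"
    using upper.IH by (simp_all add: sl_def diff_eq_eq)
  then show ?case by (simp add: sl_def inv_add inv_mult x algebra_simps)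
next
  case (lower a b c d x)
  then have x: "\<sigma> x = x" using assms(2) by (auto simp: symmetric_elements_def)
  have "a * \<sigma> d = 1 + b * \<sigma> c" "a * \<sigma> b = b * \<sigma> a" "c * \<sigma> d = d * \<sigma> c" "d * \<sigma> a = 1 + c * \<sigma> b"
    using lower.IH by (simp_all add: sl_def diff_eq_eq)
  then show ?case by (simp add: sl_def inv_add inv_mult x algebra_simps)
qed

text \<open>Whitehead's factorization of a diagonal matrix into elementary ones.\<close>

lemma elementary_diagonal:
  assumes el: "elementary S a b c d" and t: "t * t' = 1" "t' * t = 1"
    and S: "t \<in> S" "- t' \<in> S" "1 \<in> S" "- 1 \<in> S"
  shows "elementary S (a * t) (b * t') (c * t) (d * t')"
proof -
  have c: "x * t * t' = x" "x * t' * t = x" for x using t by (simp_all add: mult.assoc)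
  \<comment> \<open>The first three factors multiply to the matrix with rows \<open>(0, t)\<close>
    and \<open>(- t', 0)\<close>, the last three to that with rows \<open>(0, - 1)\<close> and
    \<open>(1, 0)\<close>.\<close>
  note 1 = upper[OF el S(1)]
  note 2 = lower[OF 1 S(2)]
  note 3 = upper[OF 2 S(1)]
  note 4 = upper[OF 3 S(4)]
  note 5 = lower[OF 4 S(3)]
  note 6 = upper[OF 5 S(4)]
  have "elementary S (a * t) (b * t') (c * t) (d * t') = elementary S
    (a + (a * t + b) * - t' + ((a + (a * t + b) * - t') * - 1 + ((a + (a * t + b) * - t') * t + (a * t + b))) * 1)
    ((a + (a * t + b) * - t' + ((a + (a * t + b) * - t') * - 1 + ((a + (a * t + b) * - t') * t + (a * t + b))) * 1) * - 1 +
      ((a + (a * t + b) * - t') * - 1 + ((a + (a * t + b) * - t') * t + (a * t + b))))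
    (c + (c * t + d) * - t' + ((c + (c * t + d) * - t') * - 1 + ((c + (c * t + d) * - t') * t + (c * t + d))) * 1)
    ((c + (c * t + d) * - t' + ((c + (c * t + d) * - t') * - 1 + ((c + (c * t + d) * - t') * t + (c * t + d))) * 1) * - 1 +
      ((c + (c * t + d) * - t') * - 1 + ((c + (c * t + d) * - t') * t + (c * t + d))))"
    by (rule arg_cong4[where f = "elementary S"]) (simp_all add: algebra_simps c flip: mult.assoc)
  with 6 show ?thesis by simp
qed

lemma symmetric_inverse:
  assumes "\<sigma> s = s" "s * s' = 1" "s' * s = 1"
  shows "\<sigma> s' = s'"
proof -
  have "\<sigma> s' * s = 1" using arg_cong[OF assms(2), of \<sigma>] assms(1) by (simp add: inv_mult)
  then have "\<sigma> s' * s * s' = s'" by simp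
  then show ?thesis using assms(2) by (simp add: mult.assoc)
qed

text \<open>As \<open>u = s' * (s * u)\<close> is a product of two symmetric units, Whitehead's
  factorization is applied to the diagonal matrices of \<open>s'\<close> and of
  \<open>s * u\<close>, where all its parameters are symmetric.\<close>

lemma elementary_unit:
  assumes u: "u * u' = 1" "u' * u = 1" and s: "\<sigma> s = s" "s * s' = 1" "s' * s = 1" "\<sigma> (s * u) = s * u"
  shows "\<exists>d. elementary symmetric_elements u 0 0 d"
proof -
  have s': "\<sigma> s' = s'" by (rule symmetric_inverse[OF s(1-3)])
  have t: "(s * u) * (u' * s') = 1" "(u' * s') * (s * u) = 1"
    using u s by (metis mult.assoc mult_1_right)+
  have t': "\<sigma> (u' * s') = u' * s'" by (rule symmetric_inverse[OF s(4) t])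
  have "elementary symmetric_elements (1 * s') (0 * s) (0 * s') (1 * s)"
    by (rule elementary_diagonal[OF one s(3,2)])
      (simp_all add: symmetric_elements_def s s' inv_minus)
  then have "elementary symmetric_elements (1 * s' * (s * u)) (0 * s * (u' * s')) (0 * s' * (s * u)) (1 * s * (u' * s'))"
    by (rule elementary_diagonal[OF _ t])
      (simp_all add: symmetric_elements_def s t' inv_minus)
  moreover have "1 * s' * (s * u) = u" using s(3) by (simp flip: mult.assoc)
  ultimately show ?thesis by auto
qed

end

text \<open>The gcd with \<open>N\<close> is divided out repeatedly; each time one more power of
  \<open>N\<close> is used and \<open>n\<close> decreases.\<close>

lemma coprime_part:
  assumes "n > 0" "N > (0::nat)"
  shows "\<exists>k m. m > 0 \<and> coprime m N \<and> n dvd N ^ k * m"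
  using assms(1)
proof (induction n rule: less_induct)
  case (less n)
  show ?case
  proof (cases "coprime n N")
    case True
    then show ?thesis using less.prems by (intro exI[of _ 0] exI[of _ n]) auto
  next
    case False
    define g where "g = gcd n N"
    have "g \<noteq> 0" "g \<noteq> 1" using False assms(2) by (auto simp: g_def coprime_iff_gcd_eq_1)
    then have g: "g > 1" by linarith
    obtain n' where n': "n = g * n'" unfolding g_def by (meson dvdE gcd_dvd1)
    have "n' < n" "n' > 0" using n' g less.prems by auto
    then obtain k m where km: "m > 0" "coprime m N" "n' dvd N ^ k * m" using less.IH by blast
    have "g * n' dvd N * (N ^ k * m)" by (rule mult_dvd_mono) (use km in \<open>auto simp: g_def\<close>)
    then show ?thesis using km n' by (intro exI[of _ "Suc k"] exI[of _ m]) (simp add: mult.assoc)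
  qed
qed

section \<open>Approximation modulo powers of an integer\<close>

context rational_order
begin

text \<open>Denominators here are prime to \<open>N\<close>, in \<open>inverted\<close> they are
  powers of \<open>N\<close>. The two rings meet in \<open>R\<close>
  (\<open>localized_inverted\<close>): closeness is measured in the first, while the approximating
  entries are kept in the second.\<close>

definition localized :: "nat \<Rightarrow> 'a set" where
  "localized N = {x. \<exists>m>0. coprime m N \<and> of_nat m * x \<in> R}"

definition inverted :: "nat \<Rightarrow> 'a set" where
  "inverted N = {x. \<exists>k. of_nat (N ^ k) * x \<in> R}"

lemma of_nat_mult_mult: "(of_nat (m * n) :: 'a) * (x * y) = (of_nat m * x) * (of_nat n * y)"
proof -
  have "(of_nat m * x) * (of_nat n * y) = of_nat m * (x * of_nat n) * y" by (simp only: mult.assoc)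
  also have "\<dots> = of_nat m * (of_nat n * x) * y" by (simp only: mult_of_nat_commute)
  finally show ?thesis by (simp only: of_nat_assoc mult.assoc)
qed

lemma R_localized: "x \<in> R \<Longrightarrow> x \<in> localized N"
  by (auto simp: localized_def intro!: exI[of _ 1])

lemma R_inverted: "x \<in> R \<Longrightarrow> x \<in> inverted N"
  by (auto simp: inverted_def intro!: exI[of _ 0])

lemma subring_localized: "is_subring (localized N)"
  unfolding is_subring_def
proof (intro conjI ballI)
  show "is_addgroup (localized N)"
  proof (rule addgroupI)
    show "0 \<in> localized N" by (rule R_localized[OF addgroup_0[OF addgroup]])
    fix x y assume "x \<in> localized N" "y \<in> localized N"
    then obtain m n where m: "m > 0" "coprime m N" "of_nat m * x \<in> R" and n: "n > 0" "coprime n N" "of_nat n * y \<in> R"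
      by (auto simp: localized_def)
    have "of_nat (m * n) * (x - y) = of_nat n * (of_nat m * x) - of_nat m * (of_nat n * y)"
      by (simp only: right_diff_distrib of_nat_assoc mult.commute[of n m])
    also have "\<dots> \<in> R" by (intro addgroup_diff[OF addgroup] of_nat_R m n)
    finally show "x - y \<in> localized N" using m n by (auto simp: localized_def intro!: exI[of _ "m * n"])
  qed
  show "1 \<in> localized N" by (rule R_localized[OF subring_1[OF subring]])
  fix x y assume "x \<in> localized N" "y \<in> localized N"
  then obtain m n where m: "m > 0" "coprime m N" "of_nat m * x \<in> R" and n: "n > 0" "coprime n N" "of_nat n * y \<in> R"
    by (auto simp: localized_def)
  have "of_nat (m * n) * (x * y) \<in> R" unfolding of_nat_mult_mult by (rule subring_mult[OF subring m(3) n(3)])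
  then show "x * y \<in> localized N" using m n by (auto simp: localized_def intro!: exI[of _ "m * n"])
qed

lemma inverted_mono: "of_nat (N ^ k) * x \<in> R \<Longrightarrow> of_nat (N ^ (k + l)) * x \<in> R"
  using of_nat_R[of "of_nat (N ^ k) * x" "N ^ l"] by (simp only: power_add of_nat_assoc mult.commute)

lemma subring_inverted: "is_subring (inverted N)"
  unfolding is_subring_def
proof (intro conjI ballI)
  show "is_addgroup (inverted N)"
  proof (rule addgroupI)
    show "0 \<in> inverted N" by (rule R_inverted[OF addgroup_0[OF addgroup]])
    fix x y assume "x \<in> inverted N" "y \<in> inverted N"
    then obtain k l where "of_nat (N ^ k) * x \<in> R" "of_nat (N ^ l) * y \<in> R" by (auto simp: inverted_def)
    then have "of_nat (N ^ (k + l)) * x \<in> R" "of_nat (N ^ (k + l)) * y \<in> R"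
      using inverted_mono[of N k x l] inverted_mono[of N l y k] by (simp_all add: add.commute)
    then have "of_nat (N ^ (k + l)) * (x - y) \<in> R" by (simp only: right_diff_distrib addgroup_diff[OF addgroup])
    then show "x - y \<in> inverted N" unfolding inverted_def by blast
  qed
  show "1 \<in> inverted N" by (rule R_inverted[OF subring_1[OF subring]])
  fix x y assume "x \<in> inverted N" "y \<in> inverted N"
  then obtain k l where "of_nat (N ^ k) * x \<in> R" "of_nat (N ^ l) * y \<in> R" by (auto simp: inverted_def)
  then have "of_nat (N ^ k * N ^ l) * (x * y) \<in> R" unfolding of_nat_mult_mult by (rule subring_mult[OF subring])
  then show "x * y \<in> inverted N" unfolding inverted_def power_add[symmetric] by blast
qed

text \<open>A Bezout relation between the two coprime denominators writes \<open>x\<close> as an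
  integral combination of two multiples that lie in \<open>R\<close>.\<close>

lemma localized_inverted:
  assumes "x \<in> localized N" "x \<in> inverted N"
  shows "x \<in> R"
proof -
  obtain m k where m: "coprime m N" "of_nat m * x \<in> R" and k: "of_nat (N ^ k) * x \<in> R"
    using assms by (auto simp: localized_def inverted_def)
  have "coprime (int m) (int (N ^ k))" using m(1) by simp
  then obtain p q where "p * int m + q * int (N ^ k) = 1" using bezout_int[of "int m" "int (N ^ k)"] by auto
  then have "(of_int (p * int m + q * int (N ^ k)) :: 'a) = 1" by simp
  then have "of_int p * of_nat m + of_int q * of_nat (N ^ k) = (1 :: 'a)"
    by (simp only: of_int_add of_int_mult of_int_of_nat_eq)
  then have "(of_int p * of_nat m + of_int q * of_nat (N ^ k)) * x = x" by simp
  then have "of_int p * (of_nat m * x) + of_int q * (of_nat (N ^ k) * x) = x"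
    by (simp only: distrib_right mult.assoc)
  moreover have "of_int p * (of_nat m * x) + of_int q * (of_nat (N ^ k) * x) \<in> R"
    by (intro addgroup_add[OF addgroup] addgroup_of_int[OF addgroup] m k)
  ultimately show ?thesis by simp
qed

lemma denominator_coprime_part:
  assumes "N > 0"
  shows "\<exists>k m. m > 0 \<and> coprime m N \<and> of_nat (N ^ k * m) * x \<in> R"
proof -
  obtain n where n: "n > 0" "of_nat n * x \<in> R" using full by blast
  obtain k m where km: "m > 0" "coprime m N" "n dvd N ^ k * m" using coprime_part[OF n(1) assms] by blast
  then obtain q where "N ^ k * m = q * n" by (metis dvdE mult.commute)
  then have "of_nat (N ^ k * m) * x = of_nat q * (of_nat n * x)" by (simp only: of_nat_mult mult.assoc)
  then have "of_nat (N ^ k * m) * x \<in> R" using of_nat_R[OF n(2)] by simp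
  with km show ?thesis by blast
qed

text \<open>Congruence modulo \<open>N ^ F\<close> in \<open>localized N\<close>, extended to
  elements outside that ring.\<close>

definition close :: "nat \<Rightarrow> nat \<Rightarrow> 'a \<Rightarrow> 'a \<Rightarrow> bool" where
  "close N F x y \<longleftrightarrow> (\<exists>z\<in>localized N. x - y = of_nat (N ^ F) * z)"

lemma close_refl: "close N F x x"
  using addgroup_0[OF subring_addgroup[OF subring_localized[of N]]] by (auto simp: close_def intro!: bexI[of _ 0])

lemma close_add:
  assumes "close N F x y" "close N F x' y'"
  shows "close N F (x + x') (y + y')"
proof -
  obtain z z' where z: "z \<in> localized N" "x - y = of_nat (N ^ F) * z" "z' \<in> localized N" "x' - y' = of_nat (N ^ F) * z'"
    using assms by (auto simp: close_def)
  have "x + x' - (y + y') = (x - y) + (x' - y')" by simp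
  also have "\<dots> = of_nat (N ^ F) * (z + z')" by (simp only: z distrib_left)
  finally show ?thesis
    using addgroup_add[OF subring_addgroup[OF subring_localized] z(1,3)] unfolding close_def by blast
qed

lemma close_weaken:
  assumes "close N (F + k) x y"
  shows "close N F x y"
proof -
  obtain z where z: "z \<in> localized N" "x - y = of_nat (N ^ (F + k)) * z" using assms by (auto simp: close_def)
  have "x - y = of_nat (N ^ F) * (of_nat (N ^ k) * z)" by (simp only: z(2) power_add of_nat_mult mult.assoc)
  then show ?thesis
    using addgroup_of_nat[OF subring_addgroup[OF subring_localized] z(1)] unfolding close_def by blast
qed

text \<open>A factor with \<open>N ^ k\<close> in its denominator costs \<open>k\<close> digits of
  precision.\<close>

lemma close_mult_right:
  assumes "close N (F + k) x y" "of_nat (N ^ k) * w \<in> localized N"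
  shows "close N F (x * w) (y * w)"
proof -
  obtain z where z: "z \<in> localized N" "x - y = of_nat (N ^ (F + k)) * z" using assms by (auto simp: close_def)
  have "x * w - y * w = of_nat (N ^ F) * (of_nat (N ^ k) * z * w)"
    by (simp only: z(2) power_add of_nat_mult mult.assoc flip: left_diff_distrib)
  also have "of_nat (N ^ k) * z * w = z * (of_nat (N ^ k) * w)"
    using mult_of_nat_commute[of "N ^ k" z] by (simp only: mult.assoc)
  finally show ?thesis using subring_mult[OF subring_localized z(1) assms(2)] unfolding close_def by blast
qed

lemma close_mult_left:
  assumes "close N (F + k) x y" "of_nat (N ^ k) * w \<in> R"
  shows "close N F (w * x) (w * y)"
proof -
  obtain z where z: "z \<in> localized N" "x - y = of_nat (N ^ (F + k)) * z" using assms by (auto simp: close_def)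
  have "w * x - w * y = w * of_nat (N ^ F * N ^ k) * z"
    by (simp only: z(2) power_add mult.assoc flip: right_diff_distrib)
  also have "w * of_nat (N ^ F * N ^ k) = of_nat (N ^ F) * (of_nat (N ^ k) * w)"
    using mult_of_nat_commute[of "N ^ F * N ^ k" w] by (simp only: of_nat_assoc)
  finally have "w * x - w * y = of_nat (N ^ F) * (of_nat (N ^ k) * w * z)" by (simp only: mult.assoc)
  then show ?thesis using subring_mult[OF subring_localized R_localized[OF assms(2)] z(1)] unfolding close_def by blast
qed

end

locale stable_order = rational_order R + involution_ring \<sigma> for R :: "'a::ring_1 set" and \<sigma> :: "'a \<Rightarrow> 'a" +
  assumes stable: "\<sigma> ` R = R"
begin

lemma inv_in_R: "x \<in> R \<Longrightarrow> \<sigma> x \<in> R"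
  using stable by auto

lemma inv_of_nat_mult: "\<sigma> (of_nat n * x) = of_nat n * \<sigma> x"
  by (simp add: inv_mult inv_of_nat mult_of_nat_commute)

lemma inv_localized: "x \<in> localized N \<Longrightarrow> \<sigma> x \<in> localized N"
proof -
  assume "x \<in> localized N"
  then obtain m where m: "m > 0" "coprime m N" "of_nat m * x \<in> R" by (auto simp: localized_def)
  then have "of_nat m * \<sigma> x \<in> R" using inv_in_R[OF m(3)] by (simp only: inv_of_nat_mult)
  with m show ?thesis by (auto simp: localized_def)
qed

text \<open>Multiplication by an integer preserves symmetry. The integer \<open>m * m'\<close>
  removes the denominator \<open>m\<close> prime to \<open>N\<close> and is 1 modulo
  \<open>N ^ (F + k)\<close>, where \<open>k\<close> makes up for the \<open>N\<close>-part of the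
  denominator of \<open>x\<close>.\<close>

lemma symmetric_approximation:
  assumes x: "x \<in> symmetric_elements" and N: "N > 0"
  shows "\<exists>y\<in>symmetric_elements \<inter> inverted N. close N F x y"
proof -
  obtain k m where m: "m > 0" "coprime m N" "of_nat (N ^ k * m) * x \<in> R"
    using denominator_coprime_part[OF N, of x] by blast
  have "coprime m (N ^ (F + k))" using m(2) by simp
  then obtain m' q where pq: "m * m' = N ^ (F + k) * q + 1"
    using bezout_nat[of m "N ^ (F + k)"] m(1) by (auto simp: coprime_iff_gcd_eq_1)
  let ?z = "of_nat q * (of_nat (N ^ k) * x)"
  have "of_nat (N ^ k) * x \<in> localized N"
    using m by (auto simp only: localized_def of_nat_assoc mult.commute[of m] mem_Collect_eq)
  then have "?z \<in> localized N"
    by (rule addgroup_of_nat[OF subring_addgroup[OF subring_localized]])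
  then have z: "- ?z \<in> localized N" by (rule addgroup_minus[OF subring_addgroup[OF subring_localized]])
  have "of_nat (m * m') * x = of_nat (N ^ (F + k) * q) * x + x"
    by (simp only: pq of_nat_add distrib_right of_nat_1 mult_1)
  then have "x - of_nat (m * m') * x = - (of_nat (N ^ (F + k) * q) * x)" by simp
  also have "\<dots> = of_nat (N ^ F) * - ?z"
    by (simp only: power_add of_nat_assoc mult_minus_right mult_ac)
  finally have "close N F x (of_nat (m * m') * x)" using z unfolding close_def by blast
  moreover have "of_nat (N ^ k) * (of_nat (m * m') * x) = of_nat m' * (of_nat (N ^ k * m) * x)"
    by (simp only: of_nat_assoc mult_ac)
  then have "of_nat (m * m') * x \<in> inverted N" using of_nat_R[OF m(3)] unfolding inverted_def by (metis mem_Collect_eq)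
  moreover have "of_nat (m * m') * x \<in> symmetric_elements"
    using x by (simp only: symmetric_elements_def mem_Collect_eq inv_of_nat_mult)
  ultimately show ?thesis by blast
qed

lemma elementary_inverted:
  assumes "elementary (symmetric_elements \<inter> inverted N) a b c d"
  shows "a \<in> inverted N \<and> b \<in> inverted N \<and> c \<in> inverted N \<and> d \<in> inverted N"
  using assms
  by induction (auto intro!: subring_mult[OF subring_inverted] subring_1[OF subring_inverted]
      addgroup_add[OF subring_addgroup[OF subring_inverted]] addgroup_0[OF subring_addgroup[OF subring_inverted]])

text \<open>A weak form of strong approximation, immediate for products of elementary matrices.\<close>

lemma elementary_approximation:
  assumes "elementary symmetric_elements a b c d" and N: "N > 0"
  shows "\<exists>a' b' c' d'. elementary (symmetric_elements \<inter> inverted N) a' b' c' d' \<and>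
    close N F a a' \<and> close N F b b' \<and> close N F c c' \<and> close N F d d'"
  using assms(1)
proof (induction arbitrary: F)
  case one
  show ?case using elementary.one close_refl by blast
next
  case (upper a b c d x)
  obtain k m where m: "m > 0" "coprime m N" "of_nat (N ^ k * m) * x \<in> R"
    using denominator_coprime_part[OF N, of x] by blast
  have kx: "of_nat (N ^ k) * x \<in> localized N"
    using m by (auto simp only: localized_def of_nat_assoc mult.commute[of m] mem_Collect_eq)
  \<comment> \<open>The order of the choices matters: the precision of \<open>a'\<close> and
    \<open>c'\<close> must outweigh the factor \<open>N ^ k\<close> in the denominator of
    \<open>x\<close>; then \<open>y\<close> is chosen, precise enough for the denominators of
    \<open>a'\<close> and \<open>c'\<close>.\<close>
  obtain a' b' c' d' where IH: "elementary (symmetric_elements \<inter> inverted N) a' b' c' d'"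
    "close N (F + k) a a'" "close N (F + k) b b'" "close N (F + k) c c'" "close N (F + k) d d'"
    using upper.IH[of "F + k"] by blast
  obtain i j where ij: "of_nat (N ^ i) * a' \<in> R" "of_nat (N ^ j) * c' \<in> R"
    using elementary_inverted[OF IH(1)] by (auto simp: inverted_def)
  obtain y where y: "y \<in> symmetric_elements \<inter> inverted N" "close N (F + (i + j)) x y"
    using symmetric_approximation[OF upper.hyps(2) N] by blast
  have "close N F (w * x) (w' * y)" if w: "close N (F + k) w w'" "of_nat (N ^ (i + j)) * w' \<in> R" for w w'
  proof -
    obtain z1 where z1: "z1 \<in> localized N" "w * x - w' * x = of_nat (N ^ F) * z1"
      using close_mult_right[OF w(1) kx] by (auto simp: close_def)
    obtain z2 where z2: "z2 \<in> localized N" "w' * x - w' * y = of_nat (N ^ F) * z2"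
      using close_mult_left[OF y(2) w(2)] by (auto simp: close_def)
    have "w * x - w' * y = of_nat (N ^ F) * (z1 + z2)"
      unfolding distrib_left z1(2)[symmetric] z2(2)[symmetric] by simp
    then show ?thesis
      using addgroup_add[OF subring_addgroup[OF subring_localized] z1(1) z2(1)] unfolding close_def by blast
  qed
  note close = this
  have "close N F (a * x + b) (a' * y + b')"
    by (rule close_add[OF close[OF IH(2)] close_weaken[OF IH(3)]]) (rule inverted_mono[OF ij(1)])
  moreover have "close N F (c * x + d) (c' * y + d')"
    by (rule close_add[OF close[OF IH(4)] close_weaken[OF IH(5)]])
      (use inverted_mono[OF ij(2), of i] in \<open>simp only: add.commute\<close>)
  ultimately show ?case
    using elementary.upper[OF IH(1) y(1)] close_weaken[OF IH(2)] close_weaken[OF IH(4)] by blast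
next
  case (lower a b c d x)
  obtain k m where m: "m > 0" "coprime m N" "of_nat (N ^ k * m) * x \<in> R"
    using denominator_coprime_part[OF N, of x] by blast
  have kx: "of_nat (N ^ k) * x \<in> localized N"
    using m by (auto simp only: localized_def of_nat_assoc mult.commute[of m] mem_Collect_eq)
  obtain a' b' c' d' where IH: "elementary (symmetric_elements \<inter> inverted N) a' b' c' d'"
    "close N (F + k) a a'" "close N (F + k) b b'" "close N (F + k) c c'" "close N (F + k) d d'"
    using lower.IH[of "F + k"] by blast
  obtain i j where ij: "of_nat (N ^ i) * b' \<in> R" "of_nat (N ^ j) * d' \<in> R"
    using elementary_inverted[OF IH(1)] by (auto simp: inverted_def)
  obtain y where y: "y \<in> symmetric_elements \<inter> inverted N" "close N (F + (i + j)) x y"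
    using symmetric_approximation[OF lower.hyps(2) N] by blast
  have "close N F (w * x) (w' * y)" if w: "close N (F + k) w w'" "of_nat (N ^ (i + j)) * w' \<in> R" for w w'
  proof -
    obtain z1 where z1: "z1 \<in> localized N" "w * x - w' * x = of_nat (N ^ F) * z1"
      using close_mult_right[OF w(1) kx] by (auto simp: close_def)
    obtain z2 where z2: "z2 \<in> localized N" "w' * x - w' * y = of_nat (N ^ F) * z2"
      using close_mult_left[OF y(2) w(2)] by (auto simp: close_def)
    have "w * x - w' * y = of_nat (N ^ F) * (z1 + z2)"
      unfolding distrib_left z1(2)[symmetric] z2(2)[symmetric] by simp
    then show ?thesis
      using addgroup_add[OF subring_addgroup[OF subring_localized] z1(1) z2(1)] unfolding close_def by blast
  qed
  note close = this
  have "close N F (a + b * x) (a' + b' * y)"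
    by (rule close_add[OF close_weaken[OF IH(2)] close[OF IH(3)]]) (rule inverted_mono[OF ij(1)])
  moreover have "close N F (c + d * x) (c' + d' * y)"
    by (rule close_add[OF close_weaken[OF IH(4)] close[OF IH(5)]])
      (use inverted_mono[OF ij(2), of i] in \<open>simp only: add.commute\<close>)
  ultimately show ?case
    using elementary.lower[OF IH(1) y(1)] close_weaken[OF IH(3)] close_weaken[OF IH(5)] by blast
qed

text \<open>The diagonal matrix of \<open>u\<close> and \<open>d\<close> is a product of elementary
  matrices over the algebra. Its approximation has entries with \<open>N\<close>-power denominators;
  being close to entries in \<open>localized N\<close>, they also have denominators prime to
  \<open>N\<close>, so they lie in \<open>R\<close>.\<close>

theorem unit_approximation:
  assumes N: "N > 0" and u: "u \<in> R" "u * u' = 1" "u' * u = 1" "u' \<in> localized N"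
    and s: "\<sigma> s = s" "s * s' = 1" "s' * s = 1" "\<sigma> (s * u) = s * u"
  shows "\<exists>a\<in>R. \<exists>b\<in>R. \<exists>c\<in>R. \<exists>d\<in>R. sl a b c d \<and> (\<exists>z\<in>R. u - a = of_nat N * z)"
proof -
  obtain d where el: "elementary symmetric_elements u 0 0 d" using elementary_unit[OF u(2,3) s] by blast
  then have "u * \<sigma> d = 1" using elementary_sl[OF el] by (simp add: sl_def)
  then have "\<sigma> d = u'" using u(3) by (metis mult.assoc mult_1 mult_1_right)
  then have d: "d \<in> localized N" using inv_localized[OF u(4)] by (metis inv_inv)
  obtain a' b' c' d' where el': "elementary (symmetric_elements \<inter> inverted N) a' b' c' d'"
    and cl: "close N 1 u a'" "close N 1 0 b'" "close N 1 0 c'" "close N 1 d d'"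
    using elementary_approximation[OF el N, of 1] by blast
  have loc: "y \<in> localized N" if xy: "close N 1 x y" and x: "x \<in> localized N" for x y
  proof -
    obtain z where z: "z \<in> localized N" "x - y = of_nat (N ^ 1) * z" using xy by (auto simp: close_def)
    have "y = x - of_nat (N ^ 1) * z" using z(2) by (simp add: algebra_simps)
    then show ?thesis
      using addgroup_diff[OF subring_addgroup[OF subring_localized] x addgroup_of_nat[OF subring_addgroup[OF subring_localized] z(1)]]
      by simp
  qed
  have 0: "0 \<in> localized N" by (rule addgroup_0[OF subring_addgroup[OF subring_localized]])
  have in_R: "a' \<in> R" "b' \<in> R" "c' \<in> R" "d' \<in> R"
    using elementary_inverted[OF el'] loc[OF cl(1) R_localized[OF u(1)]] loc[OF cl(2) 0] loc[OF cl(3) 0] loc[OF cl(4) d]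
    by (simp_all add: localized_inverted)
  moreover have "sl a' b' c' d'" by (rule elementary_sl[OF el']) simp
  moreover obtain z where z: "z \<in> localized N" "u - a' = of_nat (N ^ 1) * z" using cl(1) by (auto simp: close_def)
  moreover have "z \<in> R"
  proof (rule localized_inverted[OF z(1)])
    have "u - a' \<in> R" using addgroup_diff[OF addgroup u(1) in_R(1)] .
    then show "z \<in> inverted N" using z(2) unfolding inverted_def by (metis mem_Collect_eq)
  qed
  ultimately show ?thesis by (metis power_one_right)
qed

end

section \<open>Generation of the order by matrix entries\<close>

locale maximal_involution_csa = csa_order scale R + involution_ring \<sigma>
  for scale :: "'k::field_char_0 \<Rightarrow> 'a::ring_1 \<Rightarrow> 'a" and R and \<sigma> :: "'a \<Rightarrow> 'a" +
  assumes orthogonal: "orthogonal_involution scale \<sigma>"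
    and maximal: "maximal_involution_order scale \<sigma> R"
begin

lemma sigma_image: "\<sigma> ` R = R"
  using maximal by (simp add: maximal_involution_order_def involution_order_def)

lemma sigma_scale_one: "\<sigma> (scale c 1) = scale c 1"
  using orthogonal by (simp add: orthogonal_involution_def first_kind_def)

sublocale stable_order R \<sigma>
  by unfold_locales (rule sigma_image)

sublocale max_involution_order R \<sigma> "(\<lambda>c. scale c 1) ` \<O>\<^sub>K"
proof
  let ?C = "(\<lambda>c. scale c 1) ` \<O>\<^sub>K"
  show "\<sigma> ` R = R" by (rule sigma_image)
  show "S = R" if S: "is_subring S" "R \<subseteq> S" "is_bounded R S" "\<sigma> ` S = S" for S
  proof (rule ccontr)
    assume "S \<noteq> R"
    with S(2) have "R \<subset> S" by blast
    moreover have "involution_order scale \<sigma> S"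
      using overorder_algebra_order[OF S(1-3)] S(4) by (simp add: involution_order_def)
    ultimately show False using maximal unfolding maximal_involution_order_def by blast
  qed
  show "?C \<subseteq> R" using scalars_integral by auto
  show "c * x = x * c" if "c \<in> ?C" for c x using that scale_one_commute by auto
  show "\<sigma> c = c" if "c \<in> ?C" for c using that sigma_scale_one by auto
  show "1 \<in> ?C" using subring_1[OF ring_of_integers_subring] by (force intro: rev_image_eqI[of 1])
  show "c * d \<in> ?C" if cd: "c \<in> ?C" "d \<in> ?C" for c d
  proof -
    obtain c' d' where "c' \<in> \<O>\<^sub>K" "d' \<in> \<O>\<^sub>K" "c = scale c' 1" "d = scale d' 1" using cd by auto
    moreover have "scale c' 1 * scale d' 1 = scale (c' * d') 1"
      by (metis scale_eq_mult scale_scale)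
    ultimately show ?thesis using subring_mult[OF ring_of_integers_subring] by auto
  qed
  show "\<exists>m>0. \<forall>I. is_ideal R I \<longrightarrow> \<not> I \<subseteq> P \<longrightarrow> (\<exists>s\<in>?C. s \<notin> P \<and> s * of_nat m \<in> I)"
    if "is_prime_ideal R P" for P by (rule ideal_meets_scalars[OF that])
  show "\<exists>M. maximal_order M \<and> R \<subseteq> M \<and> is_bounded R M" by (rule contained_in_maximal_order)
qed

text \<open>With \<open>v * u = 1 - N r'\<close> the geometric series for the inverse converges
  \<open>N\<close>-adically only. Injectivity of multiplication by \<open>u\<close> comes from
  \<open>separated\<close>, so an inverse exists in the algebra; truncating the series then shows
  that the \<open>N\<close>-part of its denominator cancels.\<close>

lemma unit_if_unit_modulo:
  assumes N: "N \<ge> 2" and uv: "u \<in> R" "v \<in> R" "v * u - 1 \<in> {of_nat N * y | y. y \<in> R}"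
  shows "\<exists>u'. u * u' = 1 \<and> u' * u = 1 \<and> u' \<in> localized N"
proof -
  obtain r where r: "r \<in> R" "v * u = 1 + of_nat N * r" using uv(3) by (auto simp: diff_eq_eq add.commute)
  define r' where "r' = - r"
  have r': "r' \<in> R" "r' ^ k \<in> R" for k
    using addgroup_minus[OF addgroup r(1)] subring_power[OF subring] by (auto simp: r'_def)
  have swap: "x * (of_nat m * y) = of_nat m * (x * y)" for x y :: 'a and m
    by (metis mult.assoc mult_of_nat_commute)
  have vu: "w = v * (u * w) + of_nat N * (r' * w)" for w
    using r(2) by (simp add: r'_def distrib_right flip: mult.assoc)
  have regular: "x = 0" if ux: "u * x = 0" for x
  proof -
    obtain m where m: "m > 0" "of_nat m * x \<in> R" using full by blast
    define y where "y = of_nat m * x"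
    have "u * y = 0" using ux by (simp only: y_def swap mult_zero_right)
    then have y: "y = of_nat N * (r' * y)" using vu[of y] by simp
    have "y = of_nat (N ^ k) * (r' ^ k * y)" for k
    proof (induction k)
      case (Suc k)
      have "y = of_nat (N ^ k) * (r' ^ k * (of_nat N * (r' * y)))" using Suc y by simp
      also have "\<dots> = of_nat (N ^ Suc k) * (r' ^ Suc k * y)"
        by (simp only: swap[of "r' ^ k" N] of_nat_assoc power_Suc2 mult.assoc)
      finally show ?case .
    qed simp
    moreover have "r' ^ k * y \<in> R" for k using subring_mult[OF subring r'(2)] m(2) by (simp add: y_def)
    ultimately have "y = 0" by (intro separated[OF N]) blast
    then show ?thesis using of_nat_cancel[OF m(1), of x 0] by (simp add: y_def)
  qed
  obtain u' where u': "u * u' = 1" "u' * u = 1" using unit_if_left_regular[of u] regular by blast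
  \<comment> \<open>\<open>p\<close> is the sum of the first \<open>k\<close> terms of the series,
    the other summand is the remainder.\<close>
  have "\<exists>p\<in>R. u' = p + of_nat (N ^ k) * (r' ^ k * u')" for k
  proof (induction k)
    case 0
    show ?case using addgroup_0[OF addgroup] by force
  next
    case (Suc k)
    then obtain p where p: "p \<in> R" "u' = p + of_nat (N ^ k) * (r' ^ k * u')" by blast
    have "u' = v + of_nat N * (r' * u')" using vu[of u'] u'(1) by simp
    then have "of_nat (N ^ k) * (r' ^ k * u') = of_nat (N ^ k) * (r' ^ k * (v + of_nat N * (r' * u')))" by simp
    also have "\<dots> = of_nat (N ^ k) * (r' ^ k * v) + of_nat (N ^ Suc k) * (r' ^ Suc k * u')"
      by (simp only: distrib_left swap[of "r' ^ k" N] of_nat_assoc power_Suc2 mult.assoc)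
    finally have "u' = (p + of_nat (N ^ k) * (r' ^ k * v)) + of_nat (N ^ Suc k) * (r' ^ Suc k * u')"
      using p(2) by (simp only: add.assoc)
    moreover have "p + of_nat (N ^ k) * (r' ^ k * v) \<in> R"
      by (intro addgroup_add[OF addgroup] p(1) of_nat_R subring_mult[OF subring] r' uv)
    ultimately show ?case by blast
  qed
  note expand = this
  obtain k m where m: "m > 0" "coprime m N" "of_nat (N ^ k * m) * u' \<in> R"
    using denominator_coprime_part[of N u'] N by auto
  obtain p where p: "p \<in> R" "u' = p + of_nat (N ^ k) * (r' ^ k * u')" using expand by blast
  \<comment> \<open>For this \<open>k\<close> the power \<open>N ^ k\<close> in the remainder
    completes the denominator \<open>N ^ k * m\<close> of \<open>u'\<close>, so
    \<open>m * u'\<close> lies in \<open>R\<close>.\<close>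
  have "of_nat m * u' = of_nat m * p + of_nat m * (of_nat (N ^ k) * (r' ^ k * u'))"
    using arg_cong[OF p(2), of "\<lambda>w. of_nat m * w"] by (simp only: distrib_left)
  also have "of_nat m * (of_nat (N ^ k) * (r' ^ k * u')) = r' ^ k * (of_nat (N ^ k * m) * u')"
    by (simp only: swap[of "r' ^ k" "N ^ k * m"] of_nat_assoc mult.commute[of m])
  also have "of_nat m * p + r' ^ k * (of_nat (N ^ k * m) * u') \<in> R"
    by (intro addgroup_add[OF addgroup] of_nat_R p(1) subring_mult[OF subring] r' m)
  finally have "u' \<in> localized N" using m by (auto simp: localized_def)
  with u' show ?thesis by blast
qed

theorem entries_generate:
  assumes S: "is_subring S"
    and entries: "\<And>a b c d. a \<in> R \<Longrightarrow> b \<in> R \<Longrightarrow> c \<in> R \<Longrightarrow> d \<in> R \<Longrightarrow> sl a b c d \<Longrightarrow> a \<in> S \<and> b \<in> S"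
  shows "R \<subseteq> S"
proof -
  note Sadd = subring_addgroup[OF S]
  have R01: "0 \<in> R" "1 \<in> R" using addgroup_0[OF addgroup] subring_1[OF subring] by auto
  have symmetric: "x \<in> S" if "x \<in> R" "\<sigma> x = x" for x
    using entries[OF R01(2) that(1) R01] that(2) inv_1 by (simp add: sl_def)
  \<comment> \<open>The factor \<open>n\<close> may depend on \<open>g\<close>, which later runs
    over the finitely many generators of \<open>R\<close>, but not on \<open>c\<close>. The scalar
    is put into the factor \<open>s'\<close>, which stays symmetric because \<open>\<sigma>\<close>
    fixes scalars.\<close>
  have "\<exists>n>0. \<forall>c\<in>\<O>\<^sub>K. of_nat n * scale c g \<in> S" for g
  proof -
    obtain s s' where s: "\<sigma> s = s" "s * s' = 1" "s' * s = 1" "\<sigma> (s * g) = s * g"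
      using symmetric_multiplier_exists[OF orthogonal, of g] by blast
    have s': "\<sigma> s' = s'" by (rule symmetric_inverse[OF s(1-3)])
    obtain n where n: "n > 0" "of_nat n * s' \<in> R" using full by blast
    obtain m where m: "m > 0" "of_nat m * (s * g) \<in> R" using full by blast
    have "of_nat (n * m) * scale c g \<in> S" if c: "c \<in> \<O>\<^sub>K" for c
    proof -
      have "\<sigma> (scale c (of_nat n * s')) = scale c (of_nat n * s')"
        using scale_eq_mult[of c "of_nat n * s'"] scale_one_commute[of c "of_nat n * s'"]
        by (metis inv_mult inv_of_nat_mult s' sigma_scale_one)
      then have 1: "scale c (of_nat n * s') \<in> S" by (rule symmetric[OF R_scale[OF c n(2)]])
      have 2: "of_nat m * (s * g) \<in> S" by (rule symmetric[OF m(2)]) (simp only: inv_of_nat_mult s(4))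
      have "scale c (of_nat n * s') * (of_nat m * (s * g)) = scale c ((of_nat n * s') * (of_nat m * (s * g)))"
        by (simp only: scale_mult_left)
      also have "(of_nat n * s') * (of_nat m * (s * g)) = of_nat (n * m) * (s' * (s * g))"
        by (simp only: of_nat_mult_mult)
      also have "s' * (s * g) = g" using s(3) by (simp flip: mult.assoc)
      also have "scale c (of_nat (n * m) * g) = of_nat (n * m) * scale c g" by (simp only: scale_mult_right)
      finally show ?thesis using subring_mult[OF S 1 2] by simp
    qed
    then show ?thesis using n m by (intro exI[of _ "n * m"]) simp
  qed
  then obtain n where n: "\<And>g. n g > 0" "\<And>g c. c \<in> \<O>\<^sub>K \<Longrightarrow> of_nat (n g) * scale c g \<in> S" by metis
  \<comment> \<open>The factor 2 ensures \<open>N \<ge> 2\<close>, without which divisibility by all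
    powers of \<open>N\<close> says nothing.\<close>
  define N where "N = 2 * (\<Prod>g\<in>gens. n g)"
  have "(\<Prod>g\<in>gens. n g) > 0" using n(1) by (simp add: prod_pos)
  then have N: "N \<ge> 2" "N > 0" by (auto simp: N_def)
  have multiples: "of_nat N * x \<in> S" if x: "x \<in> R" for x
  proof -
    obtain c where c: "x = (\<Sum>s\<in>gens. scale (c s) s)" "\<forall>s\<in>gens. c s \<in> \<O>\<^sub>K" using R_E[OF x] by blast
    have "of_nat N * scale (c s) s \<in> S" if s: "s \<in> gens" for s
    proof -
      have "N = (2 * (\<Prod>g\<in>gens - {s}. n g)) * n s"
        unfolding N_def using prod.remove[OF gens(1) s, of n] by simp
      then have "of_nat N * scale (c s) s = of_nat (2 * (\<Prod>g\<in>gens - {s}. n g)) * (of_nat (n s) * scale (c s) s)"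
        by (simp only: of_nat_assoc)
      moreover have "of_nat (n s) * scale (c s) s \<in> S" by (rule n(2)) (use c(2) s in blast)
      ultimately show ?thesis by (simp only: addgroup_of_nat[OF Sadd])
    qed
    then show ?thesis unfolding c(1) sum_distrib_left by (rule addgroup_sum[OF Sadd])
  qed
  show ?thesis
  proof (rule generated_by_units_and_symmetric[OF N(2) S multiples symmetric])
    fix u v assume uv: "u \<in> R" "v \<in> R" "v * u - 1 \<in> {of_nat N * y | y. y \<in> R}"
    obtain u' where u': "u * u' = 1" "u' * u = 1" "u' \<in> localized N"
      using unit_if_unit_modulo[OF N(1) uv] by blast
    obtain s s' where s: "\<sigma> s = s" "s * s' = 1" "s' * s = 1" "\<sigma> (s * u) = s * u"
      using symmetric_multiplier_exists[OF orthogonal, of u] by blast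
    obtain a b c d z where abcd: "a \<in> R" "b \<in> R" "c \<in> R" "d \<in> R" "sl a b c d" "z \<in> R" "u - a = of_nat N * z"
      using unit_approximation[OF N(2) uv(1) u' s] by blast
    have "u = of_nat N * z + a" using abcd(7) by (simp add: algebra_simps)
    then show "u \<in> S" using addgroup_add[OF Sadd multiples[OF abcd(6)]] entries[OF abcd(1-5)] by simp
  qed
qed

end

section \<open>Embeddings into matrix algebras\<close>

definition mat2 :: "'a \<Rightarrow> 'a \<Rightarrow> 'a \<Rightarrow> 'a \<Rightarrow> 'a mat" where
  "mat2 a b c d = mat_of_rows_list 2 [[a, b], [c, d]]"

lemma mat2_carrier [simp]: "mat2 a b c d \<in> carrier_mat 2 2"
  by (simp add: mat2_def mat_of_rows_list_def numeral_2_eq_2)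

lemma mat2_dim [simp]: "dim_row (mat2 a b c d) = 2" "dim_col (mat2 a b c d) = 2"
  by (simp_all add: carrier_matD[OF mat2_carrier])

lemma mat2_index [simp]:
  "mat2 a b c d $$ (0, 0) = a" "mat2 a b c d $$ (0, Suc 0) = b"
  "mat2 a b c d $$ (Suc 0, 0) = c" "mat2 a b c d $$ (Suc 0, Suc 0) = d"
  by (simp_all add: mat2_def mat_of_rows_list_def)

lemma mat2_inject [simp]: "mat2 a b c d = mat2 a' b' c' d' \<longleftrightarrow> a = a' \<and> b = b' \<and> c = c' \<and> d = d'"
  by (metis mat2_index)

lemma mat2_eqI:
  assumes "M \<in> carrier_mat 2 2" "M $$ (0, 0) = a" "M $$ (0, 1) = b" "M $$ (1, 0) = c" "M $$ (1, 1) = d"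
  shows "M = mat2 a b c d"
proof (rule eq_matI)
  fix i j assume "i < dim_row (mat2 a b c d)" "j < dim_col (mat2 a b c d)"
  then have "i < 2" "j < 2" using mat2_carrier[of a b c d] by auto
  then show "M $$ (i, j) = mat2 a b c d $$ (i, j)" using assms by (auto simp: less_2_cases_iff)
qed (use assms(1) in auto)

lemma mat2_cases:
  assumes "M \<in> carrier_mat 2 2"
  obtains a b c d where "M = mat2 a b c d"
  by (rule that[OF mat2_eqI[OF assms refl refl refl refl]])

lemma mat2_mult:
  "mat2 a b c d * mat2 a' b' c' d' =
    mat2 (a * a' + b * c') (a * b' + b * d') (c * a' + d * c') (c * b' + d * (d' :: 'a::semiring_0))"
proof (rule mat2_eqI)
  have s: "{0..<2} = {0, Suc 0}" by auto
  show "(mat2 a b c d * mat2 a' b' c' d') $$ (0, 0) = a * a' + b * c'"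
    "(mat2 a b c d * mat2 a' b' c' d') $$ (0, 1) = a * b' + b * d'"
    "(mat2 a b c d * mat2 a' b' c' d') $$ (1, 0) = c * a' + d * c'"
    "(mat2 a b c d * mat2 a' b' c' d') $$ (1, 1) = c * b' + d * d'"
    by (simp_all add: scalar_prod_def s)
qed (rule mult_carrier_mat[OF mat2_carrier mat2_carrier])

lemma mat2_one: "1\<^sub>m 2 = mat2 1 0 0 1"
  by (rule mat2_eqI) auto

lemma mat2_add: "mat2 a b c d + mat2 a' b' c' d' = mat2 (a + a') (b + b') (c + c') (d + d')"
  by (intro mat2_eqI) simp_all

lemma mat2_map: "map_mat f (mat2 a b c d) = mat2 (f a) (f b) (f c) (f d)"
  by (intro mat2_eqI) simp_all

lemma hat_mat2: "hat \<sigma> (mat2 a b c d) = mat2 (\<sigma> d) (- \<sigma> b) (- \<sigma> c) (\<sigma> a)"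
  by (simp add: hat_def mat2_def[symmetric])

lemma elements_mat2: "elements_mat (mat2 a b c d) = {a, b, c, d}"
  by (simp add: elements_mat_def numeral_2_eq_2)

lemma (in involution_ring) SL2_mat2:
  "mat2 a b c d \<in> SL2 \<sigma> S \<longleftrightarrow> a \<in> S \<and> b \<in> S \<and> c \<in> S \<and> d \<in> S \<and> sl a b c d"
  by (auto simp: SL2_def elements_mat2 hat_mat2 mat2_mult mat2_one sl_def algebra_simps)

lemma SL2_cases:
  assumes "M \<in> SL2 \<sigma> S"
  obtains a b c d where "M = mat2 a b c d"
  using assms mat2_cases unfolding SL2_def by blast

text \<open>Elements with the same residue lie in one coset of \<open>J\<close>, so there are at
  most as many cosets as values of \<open>f\<close>, which is an arbitrary function here.\<close>

lemma (in group) finite_rcosets_if_residues: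
  assumes J: "subgroup J G" "J \<subseteq> H" and H: "H \<subseteq> carrier G" and fin: "finite (f ` H)"
    and f: "\<And>g h. g \<in> H \<Longrightarrow> h \<in> H \<Longrightarrow> f g = f h \<Longrightarrow> g \<otimes> inv h \<in> J"
  shows "finite (rcosets\<^bsub>G\<lparr>carrier := H\<rparr>\<^esub> J)"
proof -
  have coset: "J #> g = J #> h" if gh: "g \<in> H" "h \<in> H" "f g = f h" for g h
  proof -
    have c: "g \<in> carrier G" "h \<in> carrier G" using gh H by auto
    have "g = (g \<otimes> inv h) \<otimes> h" using c by (simp add: m_assoc)
    then have "g \<in> J #> h" using f[OF gh] unfolding r_coset_def by blast
    then show ?thesis using repr_independence[OF _ c(2) J(1)] by simp
  qed
  have "rcosets\<^bsub>G\<lparr>carrier := H\<rparr>\<^esub> J = (\<lambda>g. J #> g) ` H"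
    by (auto simp: RCOSETS_def r_coset_def)
  also have "\<dots> \<subseteq> (\<lambda>v. J #> (SOME g. g \<in> H \<and> f g = v)) ` (f ` H)"
  proof (rule image_subsetI)
    fix g assume g: "g \<in> H"
    have "(SOME h. h \<in> H \<and> f h = f g) \<in> H \<and> f (SOME h. h \<in> H \<and> f h = f g) = f g"
      by (rule someI[of _ g]) (use g in simp)
    then have "J #> g = J #> (SOME h. h \<in> H \<and> f h = f g)" by (intro coset g) auto
    then show "J #> g \<in> (\<lambda>v. J #> (SOME g. g \<in> H \<and> f g = v)) ` (f ` H)" using g by blast
  qed
  finally show ?thesis using fin finite_surj by blast
qed

section \<open>Denominators of matrices under an embedding\<close>

context csa_number_field
begin

definition integral_mat :: "nat \<Rightarrow> nat \<Rightarrow> 'k mat \<Rightarrow> bool" where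
  "integral_mat N n A \<longleftrightarrow> (\<forall>i<N. \<forall>j<N. of_nat n * A $$ (i, j) \<in> ring_of_integers)"

lemma integral_mat_elements:
  assumes "A \<in> carrier_mat N N"
  shows "integral_mat N 1 A \<longleftrightarrow> elements_mat A \<subseteq> ring_of_integers"
  using assms by (fastforce simp: integral_mat_def elements_mat_def)

lemma integral_mat_exists: "\<exists>n>0. integral_mat N n A"
  using integers.common_denominator_exists[of "(\<lambda>(i, j). A $$ (i, j)) ` ({..<N} \<times> {..<N})"]
  by (fastforce simp: integral_mat_def)

lemma integral_mat_dvd: "integral_mat N n A \<Longrightarrow> integral_mat N (m * n) A"
  unfolding integral_mat_def integers.of_nat_assoc[symmetric] by (blast intro: integers.of_nat_R)

lemma integral_mat_mult:
  assumes A: "integral_mat N m A" "A \<in> carrier_mat N N" and B: "integral_mat N n B" "B \<in> carrier_mat N N"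
  shows "integral_mat N (m * n) (A * B)"
  unfolding integral_mat_def
proof (intro allI impI)
  fix i j assume ij: "i < N" "j < N"
  have "of_nat (m * n) * (A * B) $$ (i, j) = (\<Sum>k\<in>{0..<N}. (of_nat m * A $$ (i, k)) * (of_nat n * B $$ (k, j)))"
    using A(2) B(2) ij by (simp add: scalar_prod_def sum_distrib_left mult_ac)
  also have "\<dots> \<in> ring_of_integers"
    by (rule addgroup_sum[OF integers.addgroup], rule subring_mult[OF integers.subring])
      (use A(1) B(1) ij in \<open>auto simp: integral_mat_def\<close>)
  finally show "of_nat (m * n) * (A * B) $$ (i, j) \<in> ring_of_integers" .
qed

lemma integral_mat_add:
  assumes "integral_mat N n A" "integral_mat N n B" "A \<in> carrier_mat N N" "B \<in> carrier_mat N N"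
  shows "integral_mat N n (A + B)"
  using assms addgroup_add[OF integers.addgroup] by (auto simp: integral_mat_def distrib_left)

end

locale algebra_embedding = csa_number_field scale
  for scale :: "'k::field_char_0 \<Rightarrow> 'a::ring_1 \<Rightarrow> 'a" +
  fixes N :: nat and \<rho> :: "'a mat \<Rightarrow> 'k mat"
  assumes embedding: "matrix_embedding scale N \<rho>"
begin

lemma rho_carrier: "\<rho> (mat2 a b c d) \<in> carrier_mat N N"
  and rho_mult: "\<rho> (mat2 a b c d * mat2 a' b' c' d') = \<rho> (mat2 a b c d) * \<rho> (mat2 a' b' c' d')"
  and rho_add: "\<rho> (mat2 a b c d + mat2 a' b' c' d') = \<rho> (mat2 a b c d) + \<rho> (mat2 a' b' c' d')"
  and rho_one: "\<rho> (1\<^sub>m 2) = 1\<^sub>m N"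
  using embedding unfolding matrix_embedding_def ring_hom_def by (auto simp: ring_mat_simps)

lemma rho_scale: "\<rho> (mat2 (scale e a) (scale e b) (scale e c) (scale e d)) = e \<cdot>\<^sub>m \<rho> (mat2 a b c d)"
  using embedding unfolding matrix_embedding_def by (auto simp flip: mat2_map)

lemma rho_inject: "\<rho> (mat2 a b c d) = \<rho> (mat2 a' b' c' d') \<Longrightarrow> mat2 a b c d = mat2 a' b' c' d'"
  using embedding unfolding matrix_embedding_def by (auto dest!: inj_onD)

lemma rho_dim [simp]: "dim_row (\<rho> (mat2 a b c d)) = N" "dim_col (\<rho> (mat2 a b c d)) = N"
  using rho_carrier[of a b c d] by auto

text \<open>\<open>\<rho>\<close> carries the question to square matrices over a field, where
  one-sided inverses are two-sided.\<close>

lemma right_inverse_left: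
  assumes "mat2 a b c d * mat2 a' b' c' d' = 1\<^sub>m 2"
  shows "mat2 a' b' c' d' * mat2 a b c d = (1\<^sub>m 2 :: 'a mat)"
proof -
  have "\<rho> (mat2 a b c d) * \<rho> (mat2 a' b' c' d') = 1\<^sub>m N" using assms rho_mult[of a b c d a' b' c' d'] rho_one by simp
  then have "\<rho> (mat2 a' b' c' d') * \<rho> (mat2 a b c d) = 1\<^sub>m N"
    by (rule mat_mult_left_right_inverse[OF rho_carrier rho_carrier])
  then have "\<rho> (mat2 a' b' c' d' * mat2 a b c d) = \<rho> (mat2 1 0 0 1)" using rho_mult rho_one by (simp add: mat2_one)
  then show ?thesis unfolding mat2_mult mat2_one by (rule rho_inject)
qed

text \<open>The linear injection \<open>x \<mapsto> \<rho> (mat2 x 0 0 0)\<close> has a linear left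
  inverse \<open>g\<close>, and \<open>n\<close> clears the denominators of its values on the matrix
  units. Matrices become functions that vanish outside the index range, since these form a vector
  space as a type.\<close>

lemma corner_denominators:
  assumes R: "csa_order scale R"
  shows "\<exists>n>0. \<forall>x. integral_mat N m (\<rho> (mat2 x 0 0 0)) \<longrightarrow> of_nat (n * m) * x \<in> R"
proof -
  interpret csa_order scale R by (rule R)
  define f where "f x = (\<lambda>(r, s). if r < N \<and> s < N then \<rho> (mat2 x 0 0 0) $$ (r, s) else 0)" for x
  let ?s = "\<lambda>c f (rs :: nat \<times> nat). c * f rs :: 'k"
  interpret fn: vector_space ?s
    by unfold_locales (auto simp: algebra_simps fun_eq_iff plus_fun_def)
  interpret vector_space_pair scale ?s ..
  have "f (x + y) = f x + f y" for x y
    using rho_add[of x 0 0 0 y 0 0 0] by (auto simp: f_def fun_eq_iff mat2_add plus_fun_def)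
  moreover have "f (scale c x) = (\<lambda>rs. c * f x rs)" for c x
    using rho_scale[of c x 0 0 0] by (auto simp: f_def fun_eq_iff)
  ultimately have lin: "Vector_Spaces.linear scale ?s f"
    unfolding Vector_Spaces.linear_iff using vector_space_axioms fn.vector_space_axioms by blast
  have "inj f"
  proof (rule injI)
    fix x y assume eq: "f x = f y"
    have "\<rho> (mat2 x 0 0 0) = \<rho> (mat2 y 0 0 0)"
    proof (rule eq_matI)
      fix i j assume "i < dim_row (\<rho> (mat2 y 0 0 0))" "j < dim_col (\<rho> (mat2 y 0 0 0))"
      then show "\<rho> (mat2 x 0 0 0) $$ (i, j) = \<rho> (mat2 y 0 0 0) $$ (i, j)"
        using fun_cong[OF eq, of "(i, j)"] by (simp add: f_def)
    qed simp_all
    then show "x = y" using rho_inject by fastforce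
  qed
  then obtain g where g: "Vector_Spaces.linear ?s scale g" "g \<circ> f = id"
    using linear_injective_left_inverse[OF lin] by blast
  interpret g: Vector_Spaces.linear ?s scale g by (rule g(1))
  let ?I = "{..<N} \<times> {..<N}"
  define \<delta> where "\<delta> i = (\<lambda>j. if j = i then 1 else (0 :: 'k))" for i :: "nat \<times> nat"
  obtain n where n: "n > 0" "\<And>i. i \<in> ?I \<Longrightarrow> of_nat n * g (\<delta> i) \<in> R"
    using common_denominator_exists[of "(\<lambda>i. g (\<delta> i)) ` ?I"] by auto
  have "of_nat (n * m) * x \<in> R" if x: "integral_mat N m (\<rho> (mat2 x 0 0 0))" for x
  proof -
    have sum_fun: "(\<Sum>i\<in>A. h i) y = (\<Sum>i\<in>A. h i y)" for h :: "nat \<times> nat \<Rightarrow> nat \<times> nat \<Rightarrow> 'k" and A y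
      by (induction A rule: infinite_finite_induct) (simp_all add: plus_fun_def zero_fun_def)
    have "f x = (\<Sum>i\<in>?I. ?s (f x i) (\<delta> i))"
    proof
      fix y
      have "(\<Sum>i\<in>?I. ?s (f x i) (\<delta> i)) y = (\<Sum>i\<in>?I. if i = y then f x y else 0)"
        unfolding sum_fun by (rule sum.cong) (auto simp: \<delta>_def)
      also have "\<dots> = f x y" by (auto simp: f_def split: prod.splits)
      finally show "f x y = (\<Sum>i\<in>?I. ?s (f x i) (\<delta> i)) y" by simp
    qed
    then have "x = g (\<Sum>i\<in>?I. ?s (f x i) (\<delta> i))" using fun_cong[OF g(2), of x] by simp
    also have "\<dots> = (\<Sum>i\<in>?I. scale (f x i) (g (\<delta> i)))"
      by (simp only: g.sum g.scale)
    finally have "of_nat (n * m) * x = of_nat (n * m) * (\<Sum>i\<in>?I. scale (f x i) (g (\<delta> i)))"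
      by (rule arg_cong)
    also have "\<dots> = (\<Sum>i\<in>?I. of_nat (n * m) * scale (f x i) (g (\<delta> i)))" by (rule sum_distrib_left)
    also have "\<dots> = (\<Sum>i\<in>?I. scale (of_nat m * f x i) (of_nat n * g (\<delta> i)))"
      by (intro sum.cong refl) (simp only: of_nat_mult mult.assoc of_nat_scale scale_mult_right)
    also have "\<dots> \<in> R"
      by (intro addgroup_sum[OF addgroup] R_scale n(2)) (use x in \<open>auto simp: f_def integral_mat_def\<close>)
    finally show ?thesis .
  qed
  with n(1) show ?thesis by blast
qed

text \<open>Matrix units on both sides move each entry into the corner; the factor
  \<open>m * m\<close> pays for their own denominators under \<open>\<rho>\<close>.\<close>

lemma embedding_denominators:
  assumes R: "csa_order scale R"
  shows "\<exists>n>0. \<forall>a b c d. integral_mat N 1 (\<rho> (mat2 a b c d)) \<longrightarrow>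
    of_nat n * a \<in> R \<and> of_nat n * b \<in> R \<and> of_nat n * c \<in> R \<and> of_nat n * d \<in> R"
proof -
  interpret csa_order scale R by (rule R)
  obtain m1 where m1: "m1 > 0" "integral_mat N m1 (\<rho> (mat2 1 0 0 0))" using integral_mat_exists by blast
  obtain m2 where m2: "m2 > 0" "integral_mat N m2 (\<rho> (mat2 0 1 0 0))" using integral_mat_exists by blast
  obtain m3 where m3: "m3 > 0" "integral_mat N m3 (\<rho> (mat2 0 0 1 0))" using integral_mat_exists by blast
  define m where "m = m1 * m2 * m3"
  have E: "integral_mat N m (\<rho> (mat2 1 0 0 0))" "integral_mat N m (\<rho> (mat2 0 1 0 0))" "integral_mat N m (\<rho> (mat2 0 0 1 0))"
    using integral_mat_dvd[OF m1(2), of "m2 * m3"] integral_mat_dvd[OF m2(2), of "m1 * m3"]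
      integral_mat_dvd[OF m3(2), of "m1 * m2"] by (simp_all add: m_def mult_ac)
  obtain n where n: "n > 0" "\<And>x. integral_mat N (m * m) (\<rho> (mat2 x 0 0 0)) \<Longrightarrow> of_nat (n * (m * m)) * x \<in> R"
    using corner_denominators[OF R, of "m * m"] by blast
  have "of_nat (n * (m * m)) * a \<in> R \<and> of_nat (n * (m * m)) * b \<in> R \<and> of_nat (n * (m * m)) * c \<in> R \<and> of_nat (n * (m * m)) * d \<in> R"
    if M: "integral_mat N 1 (\<rho> (mat2 a b c d))" for a b c d
  proof -
    have sandwich: "integral_mat N (m * m) (\<rho> (mat2 x 0 0 0))"
      if eq: "mat2 x 0 0 0 = mat2 p q r s * mat2 a b c d * mat2 p' q' r' s'"
        and L: "integral_mat N m (\<rho> (mat2 p q r s))" and L': "integral_mat N m (\<rho> (mat2 p' q' r' s'))"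
      for x p q r s p' q' r' s'
    proof -
      have "\<rho> (mat2 x 0 0 0) = \<rho> (mat2 p q r s * mat2 a b c d) * \<rho> (mat2 p' q' r' s')"
        unfolding eq mat2_mult[of p] rho_mult ..
      then show ?thesis
        using integral_mat_mult[OF integral_mat_mult[OF L rho_carrier M rho_carrier] _ L' rho_carrier]
        by (simp add: rho_mult mult_carrier_mat[OF rho_carrier rho_carrier])
    qed
    show ?thesis
      using sandwich[of a 1 0 0 0 1 0 0 0] sandwich[of b 1 0 0 0 0 0 1 0]
        sandwich[of c 0 1 0 0 1 0 0 0] sandwich[of d 0 1 0 0 0 0 1 0] E n(2)
      by (auto simp: mat2_mult)
  qed
  moreover have "n * (m * m) > 0" using n(1) m1(1) m2(1) m3(1) by (simp add: m_def)
  ultimately show ?thesis by blast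
qed

end

section \<open>The regular representation\<close>

context csa_number_field
begin

definition basis_list :: "'a list" where
  "basis_list = (SOME es. set es = BA \<and> distinct es)"

lemma basis_list: "set basis_list = BA" "distinct basis_list"
proof -
  have "\<exists>es. set es = BA \<and> distinct es" using finite_distinct_list[OF BA(1)] .
  from someI_ex[OF this] show "set basis_list = BA" "distinct basis_list" by (simp_all add: basis_list_def)
qed

abbreviation dimA :: nat where "dimA \<equiv> length basis_list"

lemma sum_basis_list: "(\<Sum>k<dimA. h (basis_list ! k)) = sum h BA"
  using sum.reindex_bij_betw[OF bij_betw_nth[OF basis_list(2) refl basis_list(1)[symmetric]], of h] by simp

lemma basis_list_nth: "i < dimA \<Longrightarrow> basis_list ! i \<in> BA"
  using nth_mem basis_list(1) by blast

definition left_mat :: "'a \<Rightarrow> 'k mat" where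
  "left_mat x = mat dimA dimA (\<lambda>(i, j). coord (x * basis_list ! j) (basis_list ! i))"

lemma left_mat_carrier [simp]: "left_mat x \<in> carrier_mat dimA dimA"
  by (simp add: left_mat_def)

lemma left_mat_dim [simp]: "dim_row (left_mat x) = dimA" "dim_col (left_mat x) = dimA"
  by (simp_all add: left_mat_def)

lemma left_mat_add: "left_mat (x + y) = left_mat x + left_mat y"
  by (rule eq_matI) (simp_all add: left_mat_def distrib_right coord_add)

lemma left_mat_scale: "left_mat (scale c x) = c \<cdot>\<^sub>m left_mat x"
  by (rule eq_matI) (simp_all add: left_mat_def coord_scale flip: scale_mult_left)

lemma left_mat_one: "left_mat 1 = 1\<^sub>m dimA"
  by (rule eq_matI)
    (auto simp: left_mat_def representation_basis[OF BA(2) basis_list_nth] nth_eq_iff_index_eq[OF basis_list(2)])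

lemma left_mat_mult: "left_mat (x * y) = left_mat x * left_mat y"
proof (rule eq_matI)
  fix i j assume "i < dim_row (left_mat x * left_mat y)" "j < dim_col (left_mat x * left_mat y)"
  then have ij: "i < dimA" "j < dimA" by (simp_all add: left_mat_def)
  let ?e = basis_list
  have "x * (y * ?e ! j) = x * (\<Sum>b\<in>BA. scale (coord (y * ?e ! j) b) b)" by (simp only: coord_sum)
  also have "\<dots> = (\<Sum>b\<in>BA. scale (coord (y * ?e ! j) b) (x * b))" by (simp only: sum_distrib_left scale_mult_right)
  finally have "coord (x * y * ?e ! j) (?e ! i) = (\<Sum>b\<in>BA. coord (y * ?e ! j) b * coord (x * b) (?e ! i))"
    by (simp only: mult.assoc coord_sum_right coord_scale)
  also have "\<dots> = (\<Sum>k<dimA. coord (x * ?e ! k) (?e ! i) * coord (y * ?e ! j) (?e ! k))"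
    unfolding sum_basis_list[symmetric] by (simp only: mult.commute)
  finally show "left_mat (x * y) $$ (i, j) = (left_mat x * left_mat y) $$ (i, j)"
    using ij by (simp add: left_mat_def scalar_prod_def lessThan_atLeast0)
qed (simp_all add: left_mat_def)

lemma left_mat_inject:
  assumes "left_mat x = left_mat y"
  shows "x = y"
proof -
  have "coord (x * e) b = coord (y * e) b" if eb: "e \<in> BA" "b \<in> BA" for e b
  proof -
    obtain i where i: "i < dimA" "basis_list ! i = b" using eb(2) basis_list(1) by (metis in_set_conv_nth)
    obtain j where j: "j < dimA" "basis_list ! j = e" using eb(1) basis_list(1) by (metis in_set_conv_nth)
    have "left_mat x $$ (i, j) = left_mat y $$ (i, j)" by (simp only: assms)
    then show ?thesis using i j by (simp add: left_mat_def)
  qed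
  then have e: "x * e = y * e" if "e \<in> BA" for e
    using coord_sum[of "x * e"] coord_sum[of "y * e"] that by (metis (no_types, lifting) sum.cong)
  have "x * (\<Sum>e\<in>BA. scale (coord 1 e) e) = y * (\<Sum>e\<in>BA. scale (coord 1 e) e)"
    unfolding sum_distrib_left by (rule sum.cong) (simp_all add: e flip: scale_mult_right)
  then show ?thesis by (simp only: coord_sum mult_1_right)
qed

text \<open>A witness that matrix embeddings exist: matrices with two rows act from the left on two
  copies of the algebra.\<close>

definition regular :: "'a mat \<Rightarrow> 'k mat" where
  "regular M = four_block_mat (left_mat (M $$ (0, 0))) (left_mat (M $$ (0, 1)))
    (left_mat (M $$ (1, 0))) (left_mat (M $$ (1, 1)))"

lemma regular_mat2: "regular (mat2 a b c d) = four_block_mat (left_mat a) (left_mat b) (left_mat c) (left_mat d)"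
  by (simp add: regular_def)

lemma regular_index:
  assumes "i < dimA + dimA" "j < dimA + dimA"
  shows "regular (mat2 a b c d) $$ (i, j) = left_mat
    (if i < dimA then (if j < dimA then a else b) else (if j < dimA then c else d))
    $$ (if i < dimA then i else i - dimA, if j < dimA then j else j - dimA)"
  using assms by (simp add: regular_mat2 left_mat_def)

lemma left_mat_zero: "left_mat 0 = 0\<^sub>m dimA dimA"
  by (rule eq_matI) (simp_all add: left_mat_def representation_zero)

lemma regular_carrier: "regular M \<in> carrier_mat (dimA + dimA) (dimA + dimA)"
  unfolding regular_def by (rule four_block_carrier_mat) simp_all

lemma regular_mult: "regular (mat2 a b c d * mat2 a' b' c' d') = regular (mat2 a b c d) * regular (mat2 a' b' c' d')"
  unfolding mat2_mult regular_mat2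
  by (subst mult_four_block_mat[of _ dimA dimA _ dimA _ dimA _ _ dimA _ dimA])
    (simp_all add: left_mat_add left_mat_mult)

lemma regular_add: "regular (mat2 a b c d + mat2 a' b' c' d') = regular (mat2 a b c d) + regular (mat2 a' b' c' d')"
  unfolding mat2_add regular_mat2
  by (subst add_four_block_mat[of _ dimA dimA _ dimA _ dimA]) (simp_all add: left_mat_add)

lemma regular_scale: "regular (mat2 (scale e a) (scale e b) (scale e c) (scale e d)) = e \<cdot>\<^sub>m regular (mat2 a b c d)"
  unfolding regular_mat2
  by (subst smult_four_block_mat[of _ dimA dimA _ dimA _ dimA]) (simp_all add: left_mat_scale)

lemma regular_inject:
  assumes eq: "regular (mat2 a b c d) = regular (mat2 a' b' c' d')"
  shows "mat2 a b c d = mat2 a' b' c' d'"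
proof -
  have "left_mat a = left_mat a'"
  proof (rule eq_matI)
    fix i j assume "i < dim_row (left_mat a')" "j < dim_col (left_mat a')"
    then show "left_mat a $$ (i, j) = left_mat a' $$ (i, j)"
      using arg_cong[OF eq, of "\<lambda>A. A $$ (i, j)"] by (simp add: regular_index)
  qed (simp_all add: left_mat_def)
  moreover have "left_mat b = left_mat b'"
  proof (rule eq_matI)
    fix i j assume "i < dim_row (left_mat b')" "j < dim_col (left_mat b')"
    then show "left_mat b $$ (i, j) = left_mat b' $$ (i, j)"
      using arg_cong[OF eq, of "\<lambda>A. A $$ (i, j + dimA)"] by (simp add: regular_index)
  qed (simp_all add: left_mat_def)
  moreover have "left_mat c = left_mat c'"
  proof (rule eq_matI)
    fix i j assume "i < dim_row (left_mat c')" "j < dim_col (left_mat c')"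
    then show "left_mat c $$ (i, j) = left_mat c' $$ (i, j)"
      using arg_cong[OF eq, of "\<lambda>A. A $$ (i + dimA, j)"] by (simp add: regular_index)
  qed (simp_all add: left_mat_def)
  moreover have "left_mat d = left_mat d'"
  proof (rule eq_matI)
    fix i j assume "i < dim_row (left_mat d')" "j < dim_col (left_mat d')"
    then show "left_mat d $$ (i, j) = left_mat d' $$ (i, j)"
      using arg_cong[OF eq, of "\<lambda>A. A $$ (i + dimA, j + dimA)"] by (simp add: regular_index)
  qed (simp_all add: left_mat_def)
  ultimately show ?thesis using left_mat_inject by simp
qed

lemma regular_embedding: "matrix_embedding scale (dimA + dimA) regular"
  unfolding matrix_embedding_def
proof (intro conjI allI ballI)
  show "regular \<in> ring_hom (ring_mat TYPE('a) 2 ()) (ring_mat TYPE('k) (dimA + dimA) ())"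
  proof (rule ring_hom_memI, unfold ring_mat_simps)
    show "regular M \<in> carrier_mat (dimA + dimA) (dimA + dimA)" for M by (rule regular_carrier)
    show "regular (M * M') = regular M * regular M'" "regular (M + M') = regular M + regular M'"
      if "M \<in> carrier_mat 2 2" "M' \<in> carrier_mat 2 2" for M M'
      using that by (auto elim!: mat2_cases simp: regular_mult regular_add)
    show "regular (1\<^sub>m 2) = 1\<^sub>m (dimA + dimA)"
      unfolding mat2_one regular_mat2 left_mat_one left_mat_zero by (rule four_block_one_mat)
  qed
  show "regular (map_mat (scale e) M) = e \<cdot>\<^sub>m regular M" if "M \<in> carrier_mat 2 2" for e M
    using that by (auto elim!: mat2_cases simp: mat2_map regular_scale)
  show "inj_on regular (carrier_mat 2 2)"
    by (rule inj_onI) (metis mat2_cases regular_inject)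
qed

sublocale reg: algebra_embedding scale "dimA + dimA" regular
  by unfold_locales (rule regular_embedding)

lemma integral_regular:
  assumes "\<And>x. x \<in> {a, b, c, d} \<Longrightarrow> integral_mat dimA 1 (left_mat x)"
  shows "integral_mat (dimA + dimA) 1 (regular (mat2 a b c d))"
  unfolding integral_mat_def
proof (intro allI impI)
  fix i j assume "i < dimA + dimA" "j < dimA + dimA"
  then show "of_nat 1 * regular (mat2 a b c d) $$ (i, j) \<in> ring_of_integers"
    using assms by (auto simp: regular_index integral_mat_def)
qed

end

context csa_order
begin

text \<open>The entries are coordinates of products \<open>x * e\<close>, for which
  \<open>coord_multiple\<close> gives one factor \<open>m\<close> valid for all \<open>x\<close> in
  \<open>R\<close>; \<open>d\<close> brings the basis elements into \<open>R\<close>.\<close>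

lemma left_mat_denominator: "\<exists>n>0. \<forall>x\<in>R. integral_mat dimA n (left_mat x)"
proof -
  obtain m where m: "m > 0"
    "\<forall>x. \<forall>b\<in>BA. of_nat m * scale (coord x b) 1 \<in> addhull {u * x * v | u v. u \<in> R \<and> v \<in> R}"
    using coord_multiple by blast
  obtain d where d: "d > 0" "\<forall>b\<in>BA. of_nat d * b \<in> R" using common_denominator_exists[OF BA(1)] by blast
  have "of_nat (m * d) * coord (x * e) b \<in> \<O>\<^sub>K" if x: "x \<in> R" and e: "e \<in> BA" and b: "b \<in> BA" for x e b
  proof -
    have "x * (of_nat d * e) \<in> R" using subring_mult[OF subring x] d(2) e by blast
    from integral_coord[OF m(2) addgroup this _ b]
    have "scale (of_nat m * coord (x * (of_nat d * e)) b) 1 \<in> R"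
      using subring_mult[OF subring] by blast
    moreover have "x * (of_nat d * e) = scale (of_nat d) (x * e)"
      by (simp only: scale_of_nat scale_mult_right flip: scale_of_nat)
    ultimately show ?thesis by (simp add: coord_scale scalars_integral mult.assoc)
  qed
  then have "integral_mat dimA (m * d) (left_mat x)" if "x \<in> R" for x
    unfolding integral_mat_def left_mat_def using that by (simp add: basis_list_nth del: of_nat_mult)
  then show ?thesis using m(1) d(1) by (intro exI[of _ "m * d"]) simp
qed

end

lemma (in rational_order) residue_map:
  assumes "n > 0"
  shows "\<exists>r :: 'a \<Rightarrow> 'a. finite (r ` R) \<and> (\<forall>x\<in>R. \<forall>y\<in>R. r x = r y \<longrightarrow> (\<exists>z\<in>R. x - y = of_nat n * (z :: 'a)))"
proof -
  obtain F where F: "finite F" "F \<subseteq> R" "\<And>x. x \<in> R \<Longrightarrow> \<exists>f\<in>F. \<exists>y\<in>R. x = f + of_nat n * y"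
    using finite_quotient[OF assms] by blast
  then obtain r where r: "\<And>x. x \<in> R \<Longrightarrow> r x \<in> F \<and> (\<exists>y\<in>R. x = r x + of_nat n * y)" by metis
  have "\<exists>z\<in>R. x - y = of_nat n * z" if xy: "x \<in> R" "y \<in> R" "r x = r y" for x y
  proof -
    obtain x' y' where x': "x' \<in> R" "y' \<in> R" "x = r x + of_nat n * x'" "y = r x + of_nat n * y'"
      using r[OF xy(1)] r[OF xy(2)] xy(3) by metis
    have "x - y = of_nat n * (x' - y')" using x'(3,4) by (metis add_diff_cancel_left right_diff_distrib)
    then show ?thesis using addgroup_diff[OF addgroup x'(1,2)] by blast
  qed
  moreover have "finite (r ` R)" using r F(1) by (metis finite_subset image_subsetI)
  ultimately show ?thesis by (intro exI[of _ r]) blast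
qed

section \<open>Group structure and integral points\<close>

context involution_ring
begin

lemma sl_iff: "sl a b c d \<longleftrightarrow> mat2 a b c d * hat \<sigma> (mat2 a b c d) = 1\<^sub>m 2"
  by (auto simp: hat_mat2 mat2_mult mat2_one sl_def algebra_simps)

lemma hat_mult:
  "hat \<sigma> (mat2 a b c d * mat2 a' b' c' d') = hat \<sigma> (mat2 a' b' c' d') * hat \<sigma> (mat2 a b c d)"
  by (simp add: mat2_mult hat_mat2 inv_add inv_mult)

lemma hat_hat: "hat \<sigma> (hat \<sigma> (mat2 a b c d)) = mat2 a b c d"
  by (simp add: hat_mat2 inv_minus)

lemma SL2_mult:
  assumes S: "is_subring S" and M: "M \<in> SL2 \<sigma> S" "M' \<in> SL2 \<sigma> S"
  shows "M * M' \<in> SL2 \<sigma> S"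
proof -
  obtain a b c d where abcd: "M = mat2 a b c d" using M(1) by (rule SL2_cases)
  obtain a' b' c' d' where abcd': "M' = mat2 a' b' c' d'" using M(2) by (rule SL2_cases)
  have car: "M \<in> carrier_mat 2 2" "M' \<in> carrier_mat 2 2" "hat \<sigma> M \<in> carrier_mat 2 2" "hat \<sigma> M' \<in> carrier_mat 2 2"
    by (simp_all add: abcd abcd' hat_mat2)
  have one: "M * hat \<sigma> M = 1\<^sub>m 2" "M' * hat \<sigma> M' = 1\<^sub>m 2" using M by (auto simp: SL2_def)
  have "(M * M') * hat \<sigma> (M * M') = (M * M') * (hat \<sigma> M' * hat \<sigma> M)"
    unfolding abcd abcd' hat_mult ..
  also have "\<dots> = M * ((M' * hat \<sigma> M') * hat \<sigma> M)"
    using car by (simp add: assoc_mult_mat[of _ 2 2 _ 2 _ 2] mult_carrier_mat[of _ 2 2 _ 2])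
  also have "\<dots> = 1\<^sub>m 2" using car one by simp
  finally have "(M * M') * hat \<sigma> (M * M') = 1\<^sub>m 2" .
  then show ?thesis
    using M S unfolding abcd abcd' mat2_mult SL2_mat2 sl_iff
    by (auto intro!: addgroup_add subring_addgroup subring_mult)
qed

end

context maximal_involution_csa
begin

abbreviation "G \<equiv> SL2_group \<sigma>"

lemma SL2_group_simps: "carrier G = SL2 \<sigma> UNIV" "M \<otimes>\<^bsub>G\<^esub> M' = M * M'" "\<one>\<^bsub>G\<^esub> = 1\<^sub>m 2"
  by (simp_all add: SL2_group_def)

lemma hat_left:
  assumes "M \<in> SL2 \<sigma> UNIV"
  shows "hat \<sigma> M * M = 1\<^sub>m 2"
proof -
  obtain a b c d where abcd: "M = mat2 a b c d" using assms by (rule SL2_cases)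
  have "mat2 a b c d * mat2 (\<sigma> d) (- \<sigma> b) (- \<sigma> c) (\<sigma> a) = 1\<^sub>m 2"
    using assms by (simp add: abcd SL2_def hat_mat2)
  from reg.right_inverse_left[OF this] show ?thesis by (simp add: abcd hat_mat2)
qed

lemma hat_SL2:
  assumes S: "is_subring S" "\<sigma> ` S \<subseteq> S" and M: "M \<in> SL2 \<sigma> S"
  shows "hat \<sigma> M \<in> SL2 \<sigma> S"
proof -
  obtain a b c d where abcd: "M = mat2 a b c d" using M by (rule SL2_cases)
  have "M \<in> SL2 \<sigma> UNIV" using M by (auto simp: SL2_def)
  from hat_left[OF this] have "hat \<sigma> M * hat \<sigma> (hat \<sigma> M) = 1\<^sub>m 2" by (simp add: abcd hat_hat)
  then show ?thesis
    using M S(2) addgroup_minus[OF subring_addgroup[OF S(1)]]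
    unfolding abcd hat_mat2 SL2_mat2 sl_iff by auto
qed

lemma subring_UNIV: "is_subring (UNIV :: 'a set)"
  by (simp add: is_subring_def is_addgroup_def)

lemma one_SL2:
  assumes "is_subring S"
  shows "1\<^sub>m 2 \<in> SL2 \<sigma> S"
  using subring_1[OF assms] addgroup_0[OF subring_addgroup[OF assms]] inv_1
  by (simp add: mat2_one SL2_mat2 sl_def)

lemma SL2_carrier_mat: "M \<in> SL2 \<sigma> S \<Longrightarrow> M \<in> carrier_mat 2 2"
  by (simp add: SL2_def)

lemma group_SL2: "group G"
proof (rule groupI, unfold SL2_group_simps)
  show "M * M' \<in> SL2 \<sigma> UNIV" if "M \<in> SL2 \<sigma> UNIV" "M' \<in> SL2 \<sigma> UNIV" for M M'
    using SL2_mult[OF subring_UNIV that] .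
  show "1\<^sub>m 2 \<in> SL2 \<sigma> UNIV" by (rule one_SL2[OF subring_UNIV])
  show "M * M' * M'' = M * (M' * M'')"
    if "M \<in> SL2 \<sigma> UNIV" "M' \<in> SL2 \<sigma> UNIV" "M'' \<in> SL2 \<sigma> UNIV" for M M' M''
    using that by (intro assoc_mult_mat[of _ 2 2 _ 2 _ 2]) (auto dest: SL2_carrier_mat)
  show "1\<^sub>m 2 * M = M" if "M \<in> SL2 \<sigma> UNIV" for M using SL2_carrier_mat[OF that] by simp
  show "\<exists>M'\<in>SL2 \<sigma> UNIV. M' * M = 1\<^sub>m 2" if "M \<in> SL2 \<sigma> UNIV" for M
    using hat_left[OF that] hat_SL2[OF subring_UNIV _ that] by auto
qed

sublocale G: group G by (rule group_SL2)

lemma inv_SL2: "M \<in> SL2 \<sigma> UNIV \<Longrightarrow> inv\<^bsub>G\<^esub> M = hat \<sigma> M"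
  using hat_left hat_SL2[OF subring_UNIV, of M]
  by (intro G.inv_equality) (auto simp: SL2_group_simps)

lemma SL2_mono: "M \<in> SL2 \<sigma> S \<Longrightarrow> M \<in> SL2 \<sigma> UNIV"
  by (auto simp: SL2_def)

lemma subgroup_SL2:
  assumes "is_subring S" "\<sigma> ` S \<subseteq> S"
  shows "subgroup (SL2 \<sigma> S) G"
proof (rule G.subgroupI, unfold SL2_group_simps)
  show "SL2 \<sigma> S \<subseteq> SL2 \<sigma> UNIV" using SL2_mono by blast
  show "SL2 \<sigma> S \<noteq> {}" using one_SL2[OF assms(1)] by blast
  show "inv\<^bsub>G\<^esub> M \<in> SL2 \<sigma> S" if "M \<in> SL2 \<sigma> S" for M
    using inv_SL2[OF SL2_mono[OF that]] hat_SL2[OF assms that] by simp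
  show "M * M' \<in> SL2 \<sigma> S" if "M \<in> SL2 \<sigma> S" "M' \<in> SL2 \<sigma> S" for M M'
    using SL2_mult[OF assms(1) that] .
qed

definition integral_points :: "nat \<Rightarrow> ('a mat \<Rightarrow> 'k mat) \<Rightarrow> 'a mat set" where
  "integral_points N \<rho> = {M \<in> SL2 \<sigma> UNIV. \<rho> M \<in> GL_integers N}"

text \<open>The inverse of \<open>\<rho> M\<close> is \<open>\<rho> (hat \<sigma> M)\<close>, so the
  integral inverse demanded in \<open>GL_integers\<close> becomes a condition on that
  matrix.\<close>

lemma integral_points_iff:
  assumes "algebra_embedding scale N \<rho>"
  shows "M \<in> integral_points N \<rho> \<longleftrightarrow>
    M \<in> SL2 \<sigma> UNIV \<and> integral_mat N 1 (\<rho> M) \<and> integral_mat N 1 (\<rho> (hat \<sigma> M))"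
proof -
  interpret algebra_embedding scale N \<rho> by (rule assms)
  have "\<rho> M \<in> GL_integers N \<longleftrightarrow> integral_mat N 1 (\<rho> M) \<and> integral_mat N 1 (\<rho> (hat \<sigma> M))" if M: "M \<in> SL2 \<sigma> UNIV"
  proof -
    obtain a b c d where abcd: "M = mat2 a b c d" using M by (rule SL2_cases)
    have car: "\<rho> M \<in> carrier_mat N N" "\<rho> (hat \<sigma> M) \<in> carrier_mat N N"
      by (simp_all add: abcd hat_mat2 rho_carrier)
    have one: "M * hat \<sigma> M = 1\<^sub>m 2" using M by (simp add: SL2_def)
    have 1: "\<rho> M * \<rho> (hat \<sigma> M) = 1\<^sub>m N" "\<rho> (hat \<sigma> M) * \<rho> M = 1\<^sub>m N"
      using one hat_left[OF M] rho_one unfolding abcd hat_mat2 by (simp_all flip: rho_mult)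
    have unique: "B = \<rho> (hat \<sigma> M)" if B: "B \<in> carrier_mat N N" "B * \<rho> M = 1\<^sub>m N" for B
      using assoc_mult_mat[OF B(1) car] B car 1(1) by simp
    show ?thesis
    proof
      assume "\<rho> M \<in> GL_integers N"
      then obtain B where B: "B \<in> carrier_mat N N" "elements_mat B \<subseteq> ring_of_integers" "B * \<rho> M = 1\<^sub>m N"
        "elements_mat (\<rho> M) \<subseteq> ring_of_integers" by (auto simp: GL_integers_def)
      have "elements_mat (\<rho> (hat \<sigma> M)) \<subseteq> ring_of_integers" using B(2) unique[OF B(1,3)] by simp
      then show "integral_mat N 1 (\<rho> M) \<and> integral_mat N 1 (\<rho> (hat \<sigma> M))"
        using B(4) by (intro conjI iffD2[OF integral_mat_elements[OF car(1)]] iffD2[OF integral_mat_elements[OF car(2)]])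
    next
      assume "integral_mat N 1 (\<rho> M) \<and> integral_mat N 1 (\<rho> (hat \<sigma> M))"
      with 1 car show "\<rho> M \<in> GL_integers N"
        unfolding integral_mat_elements[OF car(1)] integral_mat_elements[OF car(2)] GL_integers_def by blast
    qed
  qed
  then show ?thesis by (auto simp: integral_points_def)
qed

lemma subgroup_integral_points:
  assumes "algebra_embedding scale N \<rho>"
  shows "subgroup (integral_points N \<rho>) G"
proof -
  interpret algebra_embedding scale N \<rho> by (rule assms)
  note iff = integral_points_iff[OF assms]
  have mult: "integral_mat N 1 (\<rho> (mat2 a b c d * mat2 a' b' c' d'))"
    if "integral_mat N 1 (\<rho> (mat2 a b c d))" "integral_mat N 1 (\<rho> (mat2 a' b' c' d'))" for a b c d a' b' c' d'
    using integral_mat_mult[OF that(1) rho_carrier that(2) rho_carrier] by (simp add: rho_mult)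
  show ?thesis
  proof (rule G.subgroupI, unfold SL2_group_simps)
    show "integral_points N \<rho> \<subseteq> SL2 \<sigma> UNIV" by (auto simp: integral_points_def)
    have "integral_mat N 1 (1\<^sub>m N)"
      using subring_1[OF ring_of_integers_subring] addgroup_0[OF integers.addgroup] by (simp add: integral_mat_def)
    moreover have "hat \<sigma> (1\<^sub>m 2) = 1\<^sub>m 2" by (simp add: mat2_one hat_mat2 inv_1)
    ultimately have "1\<^sub>m 2 \<in> integral_points N \<rho>" using one_SL2[OF subring_UNIV] by (simp add: iff rho_one)
    then show "integral_points N \<rho> \<noteq> {}" by blast
    show "inv\<^bsub>G\<^esub> M \<in> integral_points N \<rho>" if M: "M \<in> integral_points N \<rho>" for M
    proof -
      have M': "M \<in> SL2 \<sigma> UNIV" using M by (simp add: integral_points_def)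
      obtain a b c d where abcd: "M = mat2 a b c d" using M' by (rule SL2_cases)
      show ?thesis
        using M hat_SL2[OF subring_UNIV _ M'] unfolding inv_SL2[OF M'] iff by (simp add: abcd hat_hat)
    qed
    show "M * M' \<in> integral_points N \<rho>" if M: "M \<in> integral_points N \<rho>" "M' \<in> integral_points N \<rho>" for M M'
    proof -
      have M': "M \<in> SL2 \<sigma> UNIV" "M' \<in> SL2 \<sigma> UNIV" using M by (simp_all add: integral_points_def)
      obtain a b c d where abcd: "M = mat2 a b c d" using M'(1) by (rule SL2_cases)
      obtain a' b' c' d' where abcd': "M' = mat2 a' b' c' d'" using M'(2) by (rule SL2_cases)
      have "integral_mat N 1 (\<rho> (M * M'))" using M mult unfolding iff abcd abcd' by blast
      moreover have "integral_mat N 1 (\<rho> (hat \<sigma> (M * M')))"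
        using M mult unfolding iff abcd abcd' hat_mult hat_mat2 by blast
      ultimately show ?thesis using SL2_mult[OF subring_UNIV M'] by (simp add: iff)
    qed
  qed
qed

end

section \<open>Arithmetic subgroups\<close>

context maximal_involution_csa
begin

lemma R_stable: "\<sigma> ` R \<subseteq> R"
  using stable by simp

text \<open>This is \<open>g h^-1 = 1 + (g - h) h^-1\<close>, where \<open>hat \<sigma>\<close>
  inverts the second matrix.\<close>

lemma SL2_cong_one:
  assumes abcd: "a \<in> R" "b \<in> R" "c \<in> R" "d \<in> R" and abcd': "a' \<in> R" "b' \<in> R" "c' \<in> R" "d' \<in> R"
    and w: "w1 \<in> R" "w2 \<in> R" "w3 \<in> R" "w4 \<in> R"
      "a - a' = of_nat n * w1" "b - b' = of_nat n * w2" "c - c' = of_nat n * w3" "d - d' = of_nat n * w4"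
    and sl: "sl a' b' c' d'"
  shows "\<exists>p q r s. p \<in> R \<and> q \<in> R \<and> r \<in> R \<and> s \<in> R \<and> mat2 a b c d * hat \<sigma> (mat2 a' b' c' d') =
    mat2 (1 + of_nat n * p) (of_nat n * q) (of_nat n * r) (1 + of_nat n * s)"
proof -
  note closed = addgroup_diff[OF addgroup] subring_mult[OF subring] inv_in_R
  have e: "x = x' + of_nat n * w" if "x - x' = of_nat n * w" for x x' w :: 'a using that by (simp add: algebra_simps)
  have rel: "a' * \<sigma> d' = 1 + b' * \<sigma> c'" "a' * \<sigma> b' = b' * \<sigma> a'" "c' * \<sigma> d' = d' * \<sigma> c'" "d' * \<sigma> a' = 1 + c' * \<sigma> b'"
    using sl by (simp_all add: sl_def diff_eq_eq)
  have "mat2 a b c d * hat \<sigma> (mat2 a' b' c' d') =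
    mat2 (1 + of_nat n * (w1 * \<sigma> d' - w2 * \<sigma> c')) (of_nat n * (w2 * \<sigma> a' - w1 * \<sigma> b'))
      (of_nat n * (w3 * \<sigma> d' - w4 * \<sigma> c')) (1 + of_nat n * (w4 * \<sigma> a' - w3 * \<sigma> b'))"
    unfolding e[OF w(5)] e[OF w(6)] e[OF w(7)] e[OF w(8)] hat_mat2 mat2_mult
    by (simp add: algebra_simps rel)
  moreover have "w1 * \<sigma> d' - w2 * \<sigma> c' \<in> R" "w2 * \<sigma> a' - w1 * \<sigma> b' \<in> R"
    "w3 * \<sigma> d' - w4 * \<sigma> c' \<in> R" "w4 * \<sigma> a' - w3 * \<sigma> b' \<in> R"
    by (intro closed w abcd')+
  ultimately show ?thesis by blast
qed

lemma congruence_integral: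
  assumes n: "\<And>x. x \<in> R \<Longrightarrow> integral_mat dimA n (left_mat x)"
    and pqrs: "p \<in> R" "q \<in> R" "r \<in> R" "s \<in> R"
  shows "integral_mat (dimA + dimA) 1 (regular (mat2 (1 + of_nat n * p) (of_nat n * q) (of_nat n * r) (1 + of_nat n * s)))"
proof -
  have 1: "integral_mat dimA 1 (left_mat (of_nat n * x))" if "x \<in> R" for x
    using n[OF that] by (simp add: integral_mat_def left_mat_scale flip: scale_of_nat)
  have "integral_mat dimA 1 (left_mat 1)"
    using subring_1[OF ring_of_integers_subring] addgroup_0[OF integers.addgroup]
    by (simp add: integral_mat_def left_mat_one)
  then have "integral_mat dimA 1 (left_mat (1 + of_nat n * x))" if "x \<in> R" for x
    using integral_mat_add[OF _ 1[OF that]] by (simp add: left_mat_add)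
  with 1 show ?thesis using pqrs by (intro integral_regular) auto
qed

abbreviation "arithmetic_points \<equiv> integral_points (dimA + dimA) regular"

text \<open>Residues of the entries modulo \<open>n\<close> separate cosets: matrices with equal
  residues have a quotient that is 1 modulo \<open>n\<close>, and \<open>n\<close> clears the
  denominators of the regular representation on \<open>R\<close>.\<close>

lemma finite_index_in_SL2:
  "finite (rcosets\<^bsub>G\<lparr>carrier := SL2 \<sigma> R\<rparr>\<^esub> (SL2 \<sigma> R \<inter> arithmetic_points))"
proof -
  obtain n where n: "n > 0" "\<And>x. x \<in> R \<Longrightarrow> integral_mat dimA n (left_mat x)" using left_mat_denominator by blast
  obtain res :: "'a \<Rightarrow> 'a" where res: "finite (res ` R)"
    "\<And>x y. x \<in> R \<Longrightarrow> y \<in> R \<Longrightarrow> res x = res y \<Longrightarrow> \<exists>z\<in>R. x - y = of_nat n * z"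
    using residue_map[OF n(1)] by blast
  let ?f = "\<lambda>M. (res (M $$ (0, 0)), res (M $$ (0, 1)), res (M $$ (1, 0)), res (M $$ (1, 1)))"
  have S: "subgroup (SL2 \<sigma> R) G" by (rule subgroup_SL2[OF subring R_stable])
  show ?thesis
  proof (rule G.finite_rcosets_if_residues)
    show "subgroup (SL2 \<sigma> R \<inter> arithmetic_points) G"
      by (rule G.subgroups_Inter_pair[OF S subgroup_integral_points[OF reg.algebra_embedding_axioms]])
    show "SL2 \<sigma> R \<subseteq> carrier G" by (rule subgroup.subset[OF S])
    have "?f ` SL2 \<sigma> R \<subseteq> res ` R \<times> res ` R \<times> res ` R \<times> res ` R"
    proof (rule image_subsetI)
      fix M assume M: "M \<in> SL2 \<sigma> R"
      then obtain a b c d where "M = mat2 a b c d" by (rule SL2_cases)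
      then show "?f M \<in> res ` R \<times> res ` R \<times> res ` R \<times> res ` R" using M by (simp add: SL2_mat2)
    qed
    then show "finite (?f ` SL2 \<sigma> R)" by (rule finite_subset) (intro finite_cartesian_product res)
    fix g h assume g: "g \<in> SL2 \<sigma> R" and h: "h \<in> SL2 \<sigma> R" and eq: "?f g = ?f h"
    have inv: "g \<otimes>\<^bsub>G\<^esub> inv\<^bsub>G\<^esub> h = g * hat \<sigma> h" using inv_SL2[OF SL2_mono[OF h]] by (simp add: SL2_group_simps)
    obtain a b c d where abcd: "g = mat2 a b c d" using g by (rule SL2_cases)
    obtain a' b' c' d' where abcd': "h = mat2 a' b' c' d'" using h by (rule SL2_cases)
    have gR: "a \<in> R" "b \<in> R" "c \<in> R" "d \<in> R" using g by (simp_all add: abcd SL2_mat2)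
    have hR: "a' \<in> R" "b' \<in> R" "c' \<in> R" "d' \<in> R" and sl: "sl a' b' c' d'" using h by (simp_all add: abcd' SL2_mat2)
    have eqs: "res a = res a'" "res b = res b'" "res c = res c'" "res d = res d'" using eq by (simp_all add: abcd abcd')
    obtain w1 w2 w3 w4 where w: "w1 \<in> R" "w2 \<in> R" "w3 \<in> R" "w4 \<in> R"
      "a - a' = of_nat n * w1" "b - b' = of_nat n * w2" "c - c' = of_nat n * w3" "d - d' = of_nat n * w4"
      using res(2)[OF gR(1) hR(1) eqs(1)] res(2)[OF gR(2) hR(2) eqs(2)]
        res(2)[OF gR(3) hR(3) eqs(3)] res(2)[OF gR(4) hR(4) eqs(4)] by blast
    obtain p q r s where pqrs: "p \<in> R" "q \<in> R" "r \<in> R" "s \<in> R"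
      "g * hat \<sigma> h = mat2 (1 + of_nat n * p) (of_nat n * q) (of_nat n * r) (1 + of_nat n * s)"
      using SL2_cong_one[OF gR hR w sl] unfolding abcd abcd' by blast
    have gh: "g * hat \<sigma> h \<in> SL2 \<sigma> R" by (rule SL2_mult[OF subring g hat_SL2[OF subring R_stable h]])
    have "hat \<sigma> (g * hat \<sigma> h) = mat2 (1 + of_nat n * \<sigma> s) (of_nat n * - \<sigma> q) (of_nat n * - \<sigma> r) (1 + of_nat n * \<sigma> p)"
      unfolding pqrs(5) hat_mat2 by (simp add: inv_add inv_1 inv_of_nat_mult)
    then have "g * hat \<sigma> h \<in> arithmetic_points"
      unfolding integral_points_iff[OF reg.algebra_embedding_axioms] pqrs(5)
      using gh SL2_mono pqrs(1-4) congruence_integral[OF n(2)] inv_in_R addgroup_minus[OF addgroup]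
      by (metis pqrs(5))
    then show "g \<otimes>\<^bsub>G\<^esub> inv\<^bsub>G\<^esub> h \<in> SL2 \<sigma> R \<inter> arithmetic_points" using gh inv by simp
  qed simp
qed

text \<open>The same count in the other direction, with residues of the entries of the regular
  matrices in \<open>\<O>\<^sub>K\<close>; now \<open>n\<close> brings the entries of matrices with
  integral image into \<open>R\<close>.\<close>

lemma finite_index_in_arithmetic_points:
  "finite (rcosets\<^bsub>G\<lparr>carrier := arithmetic_points\<rparr>\<^esub> (SL2 \<sigma> R \<inter> arithmetic_points))"
proof -
  let ?N = "dimA + dimA"
  obtain n where n: "n > 0" "\<And>a b c d. integral_mat ?N 1 (regular (mat2 a b c d)) \<Longrightarrow>
    of_nat n * a \<in> R \<and> of_nat n * b \<in> R \<and> of_nat n * c \<in> R \<and> of_nat n * d \<in> R"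
    using reg.embedding_denominators[OF csa_order_axioms] by blast
  obtain res :: "'k \<Rightarrow> 'k" where res: "finite (res ` \<O>\<^sub>K)"
    "\<And>x y. x \<in> \<O>\<^sub>K \<Longrightarrow> y \<in> \<O>\<^sub>K \<Longrightarrow> res x = res y \<Longrightarrow> \<exists>z\<in>\<O>\<^sub>K. x - y = of_nat n * z"
    using integers.residue_map[OF n(1)] by blast
  let ?I = "{..<?N} \<times> {..<?N}"
  let ?f = "\<lambda>M. restrict (\<lambda>ij. res (regular M $$ ij)) ?I"
  note sub = subgroup_integral_points[OF reg.algebra_embedding_axioms]
  note iff = integral_points_iff[OF reg.algebra_embedding_axioms]
  show ?thesis
  proof (rule G.finite_rcosets_if_residues)
    show "subgroup (SL2 \<sigma> R \<inter> arithmetic_points) G"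
      by (rule G.subgroups_Inter_pair[OF subgroup_SL2[OF subring R_stable] sub])
    show "arithmetic_points \<subseteq> carrier G" by (rule subgroup.subset[OF sub])
    have "?f ` arithmetic_points \<subseteq> (?I \<rightarrow>\<^sub>E res ` \<O>\<^sub>K)"
    proof (rule image_subsetI)
      fix M assume "M \<in> arithmetic_points"
      then have "regular M $$ ij \<in> \<O>\<^sub>K" if "ij \<in> ?I" for ij
        using that by (auto simp: iff integral_mat_def)
      then show "?f M \<in> ?I \<rightarrow>\<^sub>E res ` \<O>\<^sub>K" unfolding restrict_PiE_iff by blast
    qed
    then show "finite (?f ` arithmetic_points)"
      by (rule finite_subset) (intro finite_PiE res, simp)
    fix g h assume g: "g \<in> arithmetic_points" and h: "h \<in> arithmetic_points" and eq: "?f g = ?f h"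
    have gS: "g \<in> SL2 \<sigma> UNIV" and hS: "h \<in> SL2 \<sigma> UNIV" using g h by (simp_all add: iff)
    have inv: "g \<otimes>\<^bsub>G\<^esub> inv\<^bsub>G\<^esub> h = g * hat \<sigma> h" using inv_SL2[OF hS] by (simp add: SL2_group_simps)
    have gh: "g * hat \<sigma> h \<in> arithmetic_points"
      using subgroup.m_closed[OF sub g subgroup.m_inv_closed[OF sub h]] inv by simp
    obtain a b c d where abcd: "g = mat2 a b c d" using gS by (rule SL2_cases)
    obtain a' b' c' d' where abcd': "h = mat2 a' b' c' d'" using hS by (rule SL2_cases)
    have "g * hat \<sigma> h \<in> SL2 \<sigma> UNIV" using gh by (simp add: iff)
    then obtain p q r s where pqrs: "g * hat \<sigma> h = mat2 p q r s" by (rule SL2_cases)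
    have one: "h * hat \<sigma> h = 1\<^sub>m 2" using hS by (simp add: SL2_def)
    have mult: "regular (M * hat \<sigma> h) $$ (i, j) = (\<Sum>k\<in>{0..<?N}. regular M $$ (i, k) * regular (hat \<sigma> h) $$ (k, j))"
      if M: "M = g \<or> M = h" and ij: "i < ?N" "j < ?N" for M i j
    proof -
      obtain x y z w where M': "M = mat2 x y z w" using M abcd abcd' by blast
      have "regular (M * hat \<sigma> h) = regular M * regular (hat \<sigma> h)"
        unfolding M' abcd' hat_mat2 by (rule regular_mult)
      then show ?thesis using ij regular_carrier[of M] regular_carrier[of "hat \<sigma> h"] by (simp add: scalar_prod_def)
    qed
    have diff: "\<exists>z\<in>\<O>\<^sub>K. regular g $$ ij - regular h $$ ij = of_nat n * z" if ij: "ij \<in> ?I" for ij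
    proof -
      have "res (regular g $$ ij) = res (regular h $$ ij)" using fun_cong[OF eq, of ij] ij by simp
      moreover have "regular g $$ ij \<in> \<O>\<^sub>K" "regular h $$ ij \<in> \<O>\<^sub>K"
        using g h ij by (auto simp: iff integral_mat_def)
      ultimately show ?thesis using res(2) by blast
    qed
    have "p - 1 \<in> R \<and> q \<in> R \<and> r \<in> R \<and> s - 1 \<in> R"
    proof -
      \<comment> \<open>Division by \<open>n\<close> inside the algebra:
        \<open>(g h^-1 - 1) / n\<close> has integral image under \<open>regular\<close>, so
        \<open>n\<close> times its entries, that is \<open>p - 1\<close>, \<open>q\<close>,
        \<open>r\<close> and \<open>s - 1\<close>, lie in \<open>R\<close>.\<close>
      define t where "t = 1 / (of_nat n :: 'k)"
      have nt: "of_nat n * scale t x = x" for x using n(1) by (simp add: t_def of_nat_scale)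
      have add: "regular (mat2 p q r s) = regular (mat2 (p - 1) q r (s - 1)) + regular (mat2 1 0 0 1)"
        using regular_add[of "p - 1" q r "s - 1" 1 0 0 1] by (simp add: mat2_add)
      have "integral_mat ?N 1 (regular (mat2 (scale t (p - 1)) (scale t q) (scale t r) (scale t (s - 1))))"
        unfolding integral_mat_def
      proof (intro allI impI)
        fix i j assume ij: "i < ?N" "j < ?N"
        have "regular (mat2 (p - 1) q r (s - 1)) $$ (i, j) = regular (mat2 p q r s) $$ (i, j) - regular (mat2 1 0 0 1) $$ (i, j)"
          unfolding add using ij regular_carrier by (simp del: of_nat_add)
        also have "\<dots> = regular (g * hat \<sigma> h) $$ (i, j) - regular (h * hat \<sigma> h) $$ (i, j)"
          by (simp only: pqrs one mat2_one)
        also have "\<dots> = (\<Sum>k\<in>{0..<?N}. (regular g $$ (i, k) - regular h $$ (i, k)) * regular (hat \<sigma> h) $$ (k, j))"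
          using mult[OF _ ij] by (simp add: sum_subtractf left_diff_distrib)
        finally have "t * regular (mat2 (p - 1) q r (s - 1)) $$ (i, j) =
            (\<Sum>k\<in>{0..<?N}. t * (regular g $$ (i, k) - regular h $$ (i, k)) * regular (hat \<sigma> h) $$ (k, j))"
          by (simp only: sum_distrib_left mult.assoc)
        also have "\<dots> \<in> \<O>\<^sub>K"
        proof (rule addgroup_sum[OF integers.addgroup], rule subring_mult[OF integers.subring])
          fix k assume k: "k \<in> {0..<?N}"
          then obtain z where "z \<in> \<O>\<^sub>K" "regular g $$ (i, k) - regular h $$ (i, k) = of_nat n * z"
            using diff[of "(i, k)"] ij by auto
          then show "t * (regular g $$ (i, k) - regular h $$ (i, k)) \<in> \<O>\<^sub>K" using n(1) by (simp add: t_def)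
          show "regular (hat \<sigma> h) $$ (k, j) \<in> \<O>\<^sub>K" using h k ij by (simp add: iff integral_mat_def)
        qed
        finally show "of_nat 1 * regular (mat2 (scale t (p - 1)) (scale t q) (scale t r) (scale t (s - 1))) $$ (i, j) \<in> \<O>\<^sub>K"
          unfolding regular_scale using ij carrier_matD[OF regular_carrier[of "mat2 (p - 1) q r (s - 1)"]] by simp
      qed
      from n(2)[OF this] show ?thesis by (simp only: nt)
    qed
    then have "p \<in> R" "q \<in> R" "r \<in> R" "s \<in> R"
      using addgroup_add[OF addgroup _ subring_1[OF subring]] by (metis diff_add_cancel)+
    moreover have "sl p q r s" using gh unfolding pqrs iff by (simp add: SL2_mat2)
    ultimately have "g * hat \<sigma> h \<in> SL2 \<sigma> R" unfolding pqrs SL2_mat2 by blast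
    then show "g \<otimes>\<^bsub>G\<^esub> inv\<^bsub>G\<^esub> h \<in> SL2 \<sigma> R \<inter> arithmetic_points" using gh inv by simp
  qed simp
qed

theorem arithmetic_SL2: "arithmetic_subgroup scale \<sigma> (SL2 \<sigma> R)"
  unfolding arithmetic_subgroup_def commensurable_def
  using subgroup_SL2[OF subring R_stable] regular_embedding finite_index_in_SL2 finite_index_in_arithmetic_points
  unfolding integral_points_def by blast

text \<open>\<open>\<Gamma>\<close> is a finite union of cosets \<open>J t\<close>. The entries of
  \<open>J\<close> have a common denominator through the embedding, and the finitely many
  \<open>t\<close> have one as well.\<close>

lemma arithmetic_bounded:
  assumes "arithmetic_subgroup scale \<sigma> \<Gamma>"
  shows "\<exists>n>0. \<forall>M\<in>\<Gamma>. of_nat n * M $$ (0, 0) \<in> R"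
proof -
  obtain N \<rho> where \<Gamma>: "subgroup \<Gamma> G" and emb: "matrix_embedding scale N \<rho>"
    and comm: "commensurable G \<Gamma> (integral_points N \<rho>)"
    using assms unfolding arithmetic_subgroup_def integral_points_def by blast
  interpret algebra_embedding scale N \<rho> by unfold_locales (rule emb)
  define J where "J = \<Gamma> \<inter> integral_points N \<rho>"
  \<comment> \<open>One representative for each coset; the \<open>t\<close> further down is defined
    by the same choice, so that it lies in \<open>T\<close>.\<close>
  define T where "T = (\<lambda>C. SOME t. t \<in> \<Gamma> \<and> C = J #>\<^bsub>G\<^esub> t) ` (rcosets\<^bsub>G\<lparr>carrier := \<Gamma>\<rparr>\<^esub> J)"
  have cosets: "rcosets\<^bsub>G\<lparr>carrier := \<Gamma>\<rparr>\<^esub> J = (\<lambda>t. J #>\<^bsub>G\<^esub> t) ` \<Gamma>"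
    by (auto simp: RCOSETS_def r_coset_def)
  have finT: "finite T" using comm by (simp add: T_def J_def commensurable_def)
  obtain m where m: "m > 0" "\<And>t. t \<in> T \<Longrightarrow> of_nat m * t $$ (0, 0) \<in> R \<and> of_nat m * t $$ (1, 0) \<in> R"
  proof -
    have "finite ((\<lambda>t. t $$ (0, 0)) ` T \<union> (\<lambda>t. t $$ (1, 0)) ` T)" using finT by simp
    from common_denominator_exists[OF this] show ?thesis using that by blast
  qed
  obtain n where n: "n > 0" "\<And>a b c d. integral_mat N 1 (\<rho> (mat2 a b c d)) \<Longrightarrow>
    of_nat n * a \<in> R \<and> of_nat n * b \<in> R \<and> of_nat n * c \<in> R \<and> of_nat n * d \<in> R"
    using embedding_denominators[OF csa_order_axioms] by blast
  have "of_nat (n * m) * M $$ (0, 0) \<in> R" if M: "M \<in> \<Gamma>" for M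
  proof -
    have "M = 1\<^sub>m 2 * M"
      using M subgroup.subset[OF \<Gamma>] by (auto simp: SL2_group_simps dest!: SL2_carrier_mat subsetD)
    moreover have "1\<^sub>m 2 \<in> J"
      using subgroup.one_closed[OF \<Gamma>] subgroup.one_closed[OF subgroup_integral_points[OF algebra_embedding_axioms]]
      by (simp add: J_def SL2_group_simps)
    ultimately have MJ: "M \<in> J #>\<^bsub>G\<^esub> M" unfolding r_coset_def SL2_group_simps by blast
    define t where "t = (SOME t. t \<in> \<Gamma> \<and> J #>\<^bsub>G\<^esub> M = J #>\<^bsub>G\<^esub> t)"
    have t: "t \<in> \<Gamma> \<and> J #>\<^bsub>G\<^esub> M = J #>\<^bsub>G\<^esub> t" unfolding t_def by (rule someI[of _ M]) (use M in simp)
    have tT: "t \<in> T" unfolding T_def t_def cosets using M by blast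
    obtain j where j: "j \<in> J" "M = j * t" using MJ t unfolding r_coset_def SL2_group_simps by auto
    have "t \<in> SL2 \<sigma> UNIV" "j \<in> SL2 \<sigma> UNIV"
      using t subgroup.subset[OF \<Gamma>] j(1) by (auto simp: SL2_group_simps J_def integral_points_def)
    then obtain a b c d a' b' c' d' where t': "t = mat2 a b c d" and j': "j = mat2 a' b' c' d'"
      using SL2_cases by metis
    have "of_nat n * a' \<in> R" "of_nat n * b' \<in> R"
      using n(2)[of a' b' c' d'] j(1) integral_points_iff[OF algebra_embedding_axioms, of j] by (simp_all add: J_def j')
    moreover have "of_nat m * a \<in> R" "of_nat m * c \<in> R" using m(2)[OF tT] by (simp_all add: t')
    moreover have "of_nat (n * m) * M $$ (0, 0) = (of_nat n * a') * (of_nat m * a) + (of_nat n * b') * (of_nat m * c)"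
      by (simp only: j(2) j' t' mat2_mult mat2_index distrib_left of_nat_mult_mult)
    ultimately show ?thesis by (simp only: addgroup_add[OF addgroup] subring_mult[OF subring])
  qed
  then show ?thesis using n(1) m(1) by (intro exI[of _ "n * m"]) simp
qed

lemma arithmetic_overgroup:
  assumes \<Gamma>: "arithmetic_subgroup scale \<sigma> \<Gamma>" and sub: "SL2 \<sigma> R \<subseteq> \<Gamma>"
  shows "\<Gamma> \<subseteq> SL2 \<sigma> R"
proof -
  have grp: "subgroup \<Gamma> G" using \<Gamma> by (simp add: arithmetic_subgroup_def)
  have mult: "M * M' \<in> \<Gamma>" if "M \<in> \<Gamma>" "M' \<in> \<Gamma>" for M M'
    using subgroup.m_closed[OF grp that] by (simp add: SL2_group_simps)
  have \<Gamma>_SL2: "M \<in> SL2 \<sigma> UNIV" if "M \<in> \<Gamma>" for M using subgroup.subset[OF grp] that by (auto simp: SL2_group_simps)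
  have hat: "hat \<sigma> M \<in> \<Gamma>" if "M \<in> \<Gamma>" for M
    using subgroup.m_inv_closed[OF grp that] inv_SL2[OF \<Gamma>_SL2[OF that]] by simp
  have R01: "0 \<in> R" "1 \<in> R" "- 1 \<in> R"
    using addgroup_0[OF addgroup] subring_1[OF subring] addgroup_minus[OF addgroup] by auto
  \<comment> \<open>The monomial matrices move any entry into the upper left corner up to sign, and
    the negative of the identity takes care of the sign.\<close>
  have w: "mat2 0 1 (- 1) 0 \<in> \<Gamma>" "mat2 0 (- 1) 1 0 \<in> \<Gamma>" "mat2 (- 1) 0 0 (- 1) \<in> \<Gamma>" "mat2 1 1 0 1 \<in> \<Gamma>"
    using sub R01 by (auto intro!: subsetD[OF sub] simp: SL2_mat2 sl_def inv_1 inv_minus)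
  define E where "E = (\<lambda>M. M $$ (0, 0)) ` \<Gamma>"
  have E: "a \<in> E" "- a \<in> E" "b \<in> E" "c \<in> E" "d \<in> E" if M: "mat2 a b c d \<in> \<Gamma>" for a b c d
  proof -
    have E': "x \<in> E" if "mat2 x y z u \<in> \<Gamma>" for x y z u using that by (force simp: E_def)
    show "a \<in> E" by (rule E'[OF M])
    show "- a \<in> E" using mult[OF w(3) M] by (intro E'[of _ "- b" "- c" "- d"]) (simp add: mat2_mult)
    show "b \<in> E" using mult[OF M w(2)] by (intro E'[of _ "- a" d "- c"]) (simp add: mat2_mult)
    show "c \<in> E" using mult[OF w(1) M] by (intro E'[of _ d "- a" "- b"]) (simp add: mat2_mult)
    show "d \<in> E" using mult[OF mult[OF w(1) M] w(2)] by (intro E'[of _ "- c" "- b" a]) (simp add: mat2_mult)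
  qed
  define S where "S = addhull E"
  note Sadd = addgroup_addhull[of E, folded S_def]
  have ES: "x \<in> S" if "x \<in> E" for x using that addhull_superset[of E] by (auto simp: S_def)
  have prod: "x * y \<in> S" if xy: "x \<in> E" "y \<in> E" for x y
  proof -
    obtain M M' where M: "M \<in> \<Gamma>" "x = M $$ (0, 0)" and M': "M' \<in> \<Gamma>" "y = M' $$ (0, 0)" using xy by (auto simp: E_def)
    obtain a b c d where abcd: "M = mat2 a b c d" using \<Gamma>_SL2[OF M(1)] by (rule SL2_cases)
    obtain a' b' c' d' where abcd': "M' = mat2 a' b' c' d'" using \<Gamma>_SL2[OF M'(1)] by (rule SL2_cases)
    \<comment> \<open>The monomial factor puts \<open>a'\<close> into the lower left corner, where
      the unipotent matrix picks it up; the two products then differ by \<open>a * a'\<close> in the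
      upper left entry.\<close>
    let ?M' = "mat2 0 (- 1) 1 0 * M'"
    have M'': "?M' \<in> \<Gamma>" by (rule mult[OF w(2) M'(1)])
    have "M * ?M' \<in> \<Gamma>" "M * mat2 1 1 0 1 * ?M' \<in> \<Gamma>" using mult M(1) M'' w(4) by blast+
    then have "- (a * c') + b * a' \<in> E" "- (a * c') + (a + b) * a' \<in> E"
      unfolding abcd abcd' mat2_mult by (auto dest!: E(1))
    then have "(- (a * c') + (a + b) * a') - (- (a * c') + b * a') \<in> S" using addgroup_diff[OF Sadd] ES by blast
    moreover have "(- (a * c') + (a + b) * a') - (- (a * c') + b * a') = x * y"
      by (simp add: M(2) M'(2) abcd abcd' algebra_simps)
    ultimately show ?thesis by simp
  qed
  have S_mult: "x * y \<in> S" if xy: "x \<in> S" "y \<in> S" for x y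
  proof -
    have "E \<subseteq> {u. u * v \<in> S}" if v: "v \<in> E" for v using prod v by blast
    then have *: "u * v \<in> S" if "u \<in> S" "v \<in> E" for u v
      using that addhull_least[OF addgroup_vimage_left[OF Sadd]] unfolding S_def by blast
    have "E \<subseteq> {v. x * v \<in> S}" using * xy(1) by blast
    then show ?thesis using xy(2) addhull_least[OF addgroup_vimage_right[OF Sadd]] unfolding S_def by blast
  qed
  have "1 \<in> E" using E(3)[OF w(1)] .
  then have S: "is_subring S" using Sadd S_mult ES by (simp add: is_subring_def)
  have RS: "R \<subseteq> S"
  proof (rule entries_generate[OF S])
    fix a b c d assume "a \<in> R" "b \<in> R" "c \<in> R" "d \<in> R" "sl a b c d"
    then have "mat2 a b c d \<in> \<Gamma>" using sub by (auto simp: SL2_mat2)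
    then show "a \<in> S \<and> b \<in> S" using ES[OF E(1)] ES[OF E(3)] by blast
  qed
  have bounded: "is_bounded R S"
  proof -
    obtain n where n: "n > 0" "\<And>M. M \<in> \<Gamma> \<Longrightarrow> of_nat n * M $$ (0, 0) \<in> R" using arithmetic_bounded[OF \<Gamma>] by blast
    have "E \<subseteq> {x. of_nat n * x \<in> R}" using n(2) by (auto simp: E_def)
    then have "S \<subseteq> {x. of_nat n * x \<in> R}"
      unfolding S_def by (rule addhull_least[OF addgroup_vimage_right[OF addgroup]])
    then show ?thesis using n(1) unfolding is_bounded_def by blast
  qed
  have "\<sigma> x \<in> S" if x: "x \<in> S" for x
  proof -
    have "is_addgroup {x. \<sigma> x \<in> S}" using Sadd by (auto simp: is_addgroup_def inv_diff)
    moreover have "E \<subseteq> {x. \<sigma> x \<in> S}"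
    proof
      fix x assume "x \<in> E"
      then obtain M where M: "M \<in> \<Gamma>" "x = M $$ (0, 0)" by (auto simp: E_def)
      obtain a b c d where abcd: "M = mat2 a b c d" using \<Gamma>_SL2[OF M(1)] by (rule SL2_cases)
      have "\<sigma> a \<in> E" using hat[OF M(1)] E(5) unfolding abcd hat_mat2 by blast
      then show "x \<in> {x. \<sigma> x \<in> S}" using ES M(2) by (simp add: abcd)
    qed
    ultimately show ?thesis using x addhull_least unfolding S_def by blast
  qed
  then have "\<sigma> ` S = S" by (metis image_subsetI inv_inv rev_image_eqI subsetI subset_antisym)
  then have "S = R" by (rule max_inv[OF S RS bounded])
  show ?thesis
  proof
    fix M assume M: "M \<in> \<Gamma>"
    obtain a b c d where abcd: "M = mat2 a b c d" using \<Gamma>_SL2[OF M] by (rule SL2_cases)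
    have "a \<in> R" "b \<in> R" "c \<in> R" "d \<in> R" using E[OF M[unfolded abcd]] ES \<open>S = R\<close> by auto
    then show "M \<in> SL2 \<sigma> R" using \<Gamma>_SL2[OF M] by (simp add: abcd SL2_mat2)
  qed
qed

end

theorem theorem4p10:
  fixes scale :: "'k::field_char_0 \<Rightarrow> 'a::ring_1 \<Rightarrow> 'a"
    and \<sigma> :: "'a \<Rightarrow> 'a" and \<O> :: "'a set"
  assumes "number_field TYPE('k)"
    and "central_simple_algebra scale"
    and "orthogonal_involution scale \<sigma>"
    and "maximal_involution_order scale \<sigma> \<O>"
  shows "maximal_arithmetic_subgroup scale \<sigma> (SL2 \<sigma> \<O>)"
proof -
  interpret central_simple_algebra scale by (rule assms(2))
  interpret maximal_involution_csa scale \<O> \<sigma>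
    using assms by unfold_locales
      (auto simp: maximal_involution_order_def involution_order_def orthogonal_involution_def)
  show ?thesis
    unfolding maximal_arithmetic_subgroup_def using arithmetic_SL2 arithmetic_overgroup by blast
qed

end
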